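(* For every integer $d > 2$, letting $C = \{-d, \dots, -1, 1, \dots, d\}$, there exists a constant $\delta > 0$ (depending only on $d$) and a randomized algorithm that solves Subset Balancing on coefficient set $C$ with high probability in time $O^*\left(|C|^{(1/2 - \delta)n}\right)$.
   Context: Subset Balancing on a fixed finite coefficient set $C \subseteq \mathbb{Z}$: given $\vec{x} \in \mathbb{Z}^n$, find a nonzero vector $\vec{c} \in C^n \setminus \{\vec{0}\}$ with $\vec{c}\cdot\vec{x} = 0$, or report that none exists. Input integers are assumed to have absolute value at most $2^{n^{O(1)}}$, and arithmetic operations on input integers take unit time. $O^*$ suppresses factors polynomial in $n$. "With high probability" means the algorithm never outputs an invalid solution and, whenever a solution exists, outputs one with probability at least $1 - 2^{-\Omega(n)}$. *)

theory Defs
  imports "HOL-Probability.Probability" "HOL-Library.Landau_Symbols"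
begin

section \<open>Subset Balancing\<close>

definition balancing_solution :: "int set \<Rightarrow> int list \<Rightarrow> int list \<Rightarrow> bool" where
  "balancing_solution C x c \<longleftrightarrow>
     length c = length x \<and> set c \<subseteq> C \<and> (\<exists>i<length c. c ! i \<noteq> 0) \<and>
     (\<Sum>i<length x. c ! i * x ! i) = 0"

text \<open>The size assumption on inputs: absolute value at most two to the power \<open>n ^ k\<close>, where
  \<open>k\<close> is the constant hidden in the exponent.\<close>

definition bounded_input :: "nat \<Rightarrow> int list \<Rightarrow> bool" where
  "bounded_input k x \<longleftrightarrow> (\<forall>y\<in>set x. \<bar>y\<bar> \<le> 2 ^ (length x ^ k))"


section \<open>A randomized random access machine with bounded words\<close>

text \<open>Algorithms are programs of a structured language with integer variables and integer
  arrays (random access, all cells initially 0). Every command takes unit time, but only on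
  words: a word of length \<open>w\<close> is an integer of absolute value at most \<open>2 ^ w\<close>. An operation
  with an operand or result that is not a word gets stuck, so the program does not halt. Without
  such a bound, unit-cost arithmetic on huge integers would be unrealistically powerful.\<close>

type_synonym vname = string

record state =
  vars :: "vname \<Rightarrow> int"
  arrs :: "vname \<Rightarrow> int \<Rightarrow> int"

datatype binop = Add | Sub | Mul | Div | Mod

datatype aexp = Const int | Var vname | Arr vname aexp | Op binop aexp aexp

datatype bexp = Less aexp aexp | Eq aexp aexp | Not bexp | And bexp bexp

datatype com =
    Skip
  | Assign vname aexp
  | Store vname aexp aexp    \<comment> \<open>array, index, value\<close>
  | Rand vname aexp          \<comment> \<open>uniform number in \<open>{0..<m}\<close> for the value \<open>m\<close> of the expression\<close>
  | Seq com com
  | Cond bexp com com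
  | While bexp com

primrec opval :: "binop \<Rightarrow> int \<Rightarrow> int \<Rightarrow> int" where
  "opval Add i j = i + j"
| "opval Sub i j = i - j"
| "opval Mul i j = i * j"
| "opval Div i j = i div j"
| "opval Mod i j = i mod j"

primrec aval :: "aexp \<Rightarrow> state \<Rightarrow> int" where
  "aval (Const i) s = i"
| "aval (Var v) s = vars s v"
| "aval (Arr a e) s = arrs s a (aval e s)"
| "aval (Op f e1 e2) s = opval f (aval e1 s) (aval e2 s)"

primrec bval :: "bexp \<Rightarrow> state \<Rightarrow> bool" where
  "bval (Less e1 e2) s \<longleftrightarrow> aval e1 s < aval e2 s"
| "bval (Eq e1 e2) s \<longleftrightarrow> aval e1 s = aval e2 s"
| "bval (Not b) s \<longleftrightarrow> \<not> bval b s"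
| "bval (And b1 b2) s \<longleftrightarrow> bval b1 s \<and> bval b2 s"

definition is_word :: "nat \<Rightarrow> int \<Rightarrow> bool" where
  "is_word w i \<longleftrightarrow> \<bar>i\<bar> \<le> 2 ^ w"

text \<open>All values occurring in the evaluation of an expression are words.\<close>

primrec asafe :: "nat \<Rightarrow> aexp \<Rightarrow> state \<Rightarrow> bool" where
  "asafe w (Const i) s \<longleftrightarrow> is_word w i"
| "asafe w (Var v) s \<longleftrightarrow> is_word w (vars s v)"
| "asafe w (Arr a e) s \<longleftrightarrow> asafe w e s \<and> is_word w (arrs s a (aval e s))"
| "asafe w (Op f e1 e2) s \<longleftrightarrow>
     asafe w e1 s \<and> asafe w e2 s \<and> is_word w (opval f (aval e1 s) (aval e2 s))"

primrec bsafe :: "nat \<Rightarrow> bexp \<Rightarrow> state \<Rightarrow> bool" where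
  "bsafe w (Less e1 e2) s \<longleftrightarrow> asafe w e1 s \<and> asafe w e2 s"
| "bsafe w (Eq e1 e2) s \<longleftrightarrow> asafe w e1 s \<and> asafe w e2 s"
| "bsafe w (Not b) s \<longleftrightarrow> bsafe w b s"
| "bsafe w (And b1 b2) s \<longleftrightarrow> bsafe w b1 s \<and> bsafe w b2 s"

text \<open>One unit of time. The number of operations inside the expressions of a fixed program is a
  constant, so counting commands determines the running time up to a constant factor. A halted
  program has become \<^const>\<open>Skip\<close>; a stuck program steps to itself forever.\<close>

primrec step :: "nat \<Rightarrow> com \<Rightarrow> state \<Rightarrow> (com \<times> state) pmf" where
  "step w Skip s = return_pmf (Skip, s)"
| "step w (Assign v e) s =
     (if asafe w e s
      then return_pmf (Skip, s\<lparr>vars := (vars s)(v := aval e s)\<rparr>)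
      else return_pmf (Assign v e, s))"
| "step w (Store a e1 e2) s =
     (if asafe w e1 s \<and> asafe w e2 s
      then return_pmf
        (Skip, s\<lparr>arrs := (arrs s)(a := (arrs s a)(aval e1 s := aval e2 s))\<rparr>)
      else return_pmf (Store a e1 e2, s))"
| "step w (Rand v e) s =
     (if asafe w e s \<and> 0 < aval e s
      then map_pmf (\<lambda>i. (Skip, s\<lparr>vars := (vars s)(v := i)\<rparr>)) (pmf_of_set {0..<aval e s})
      else return_pmf (Rand v e, s))"
| "step w (Seq c1 c2) s =
     (if c1 = Skip then return_pmf (c2, s)
      else map_pmf (\<lambda>(c1', s'). (Seq c1' c2, s')) (step w c1 s))"
| "step w (Cond b c1 c2) s =
     (if bsafe w b s then return_pmf (if bval b s then c1 else c2, s)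
      else return_pmf (Cond b c1 c2, s))"
| "step w (While b c) s =
     (if bsafe w b s then return_pmf (if bval b s then Seq c (While b c) else Skip, s)
      else return_pmf (While b c, s))"

text \<open>The distribution of the configuration after \<open>t\<close> units of time.\<close>

primrec run :: "nat \<Rightarrow> nat \<Rightarrow> com \<times> state \<Rightarrow> (com \<times> state) pmf" where
  "run w 0 cs = return_pmf cs"
| "run w (Suc t) cs = bind_pmf (step w (fst cs) (snd cs)) (run w t)"


section \<open>Randomized algorithms for Subset Balancing\<close>

text \<open>The dimension is passed in variable \<open>n\<close> and the vector in cells \<open>0, \<dots>, n - 1\<close> of array
  \<open>x\<close>; everything else is 0.\<close>

definition input_state :: "int list \<Rightarrow> state" where
  "input_state x =
     \<lparr>vars = (\<lambda>_. 0)(''n'' := int (length x)),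
      arrs = (\<lambda>_ _. 0)(''x'' := (\<lambda>i. if 0 \<le> i \<and> i < int (length x) then x ! nat i else 0))\<rparr>"

text \<open>\<^term>\<open>None\<close> is the report that no solution exists.\<close>

definition result :: "nat \<Rightarrow> state \<Rightarrow> int list option" where
  "result n s =
     (if vars s ''found'' = 1 then Some (map (\<lambda>i. arrs s ''c'' (int i)) [0..<n]) else None)"

definition bigo_star :: "(nat \<Rightarrow> real) \<Rightarrow> (nat \<Rightarrow> real) set" where
  "bigo_star f = {g. \<exists>a::nat. g \<in> O(\<lambda>n. real n ^ a * f n)}"

text \<open>One program handles all input magnitudes; only the constants hidden in the asymptotic
  bounds may depend on \<open>k\<close>. The time bound \<open>T\<close> is worst-case over inputs and random choices, and
  the word length \<open>w\<close> is polynomial in \<open>n\<close>, as is the length of the input integers.\<close>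

definition solves_balancing_whp :: "int set \<Rightarrow> com \<Rightarrow> (nat \<Rightarrow> real) \<Rightarrow> bool" where
  "solves_balancing_whp C P f \<longleftrightarrow>
     (\<forall>k. \<exists>(T :: nat \<Rightarrow> nat) (w :: nat \<Rightarrow> nat) (g :: nat \<Rightarrow> real).
        (\<lambda>n. real (T n)) \<in> bigo_star f \<and>
        (\<lambda>n. real (w n)) \<in> bigo_star (\<lambda>_. 1) \<and>
        g \<in> \<Omega>(\<lambda>n. real n) \<and> (\<forall>\<^sub>F n in sequentially. 0 \<le> g n) \<and>
        (\<forall>x. bounded_input k x \<longrightarrow>
          (let n = length x; D = run (w n) (T n) (P, input_state x) in
            (\<forall>(c, s)\<in>set_pmf D. c = Skip \<and>
               (\<forall>v. result n s = Some v \<longrightarrow> balancing_solution C x v)) \<and>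
            ((\<exists>v. balancing_solution C x v) \<longrightarrow>
               measure_pmf.prob D {(c, s). \<exists>v. result n s = Some v \<and> balancing_solution C x v}
                 \<ge> 1 - 2 powr (- g n)))))"

end

theory Submission
  imports Defs
begin

text \<open>Write \<open>C = A - B\<close> with \<open>A = {-(d - 1)..-1} \<union> {2..d}\<close> and \<open>B = {0, 1}\<close>. A coefficient other than \<open>\<plusminus>1\<close>
  and \<open>\<plusminus>d\<close> is a difference in two ways. A solution \<open>c\<close> with a fraction less than \<open>\<theta>\<close> of extreme
  coefficients therefore splits as \<open>u - v\<close> with equal sums \<open>u \<bullet> x = v \<bullet> x\<close> in exponentially many ways, and
  it suffices to search among the \<open>u\<close> and \<open>v\<close> that pass a random filter. The filter accepts \<open>y\<close> if
  \<open>(\<alpha> y + \<beta>) mod P W < W\<close>; this is nearly pairwise independent without any prime modulus, and as the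
  key \<open>y\<close> is additive, the accepted vectors are found by sorting one half into \<open>P\<close> buckets and
  probing two buckets for every other half. A second moment bound shows that a representation
  survives with constant probability.

  A solution with at least \<open>\<theta> n\<close> extreme coefficients is found deterministically. If extreme
  coefficients weigh \<open>s + 1\<close> and others \<open>s\<close>, it has an unusually large weight, and it is cut into a
  prefix and a suffix each of weight at least \<open>Q ^ k / N\<close>, where \<open>k\<close> is its length and \<open>Q\<close> the total
  weight of \<open>C\<close>. As in Kraft's inequality, there are at most \<open>N\<close> such paths of each length. For
  suitable \<open>\<theta>\<close> and \<open>s\<close> both searches take time \<open>(2 d) ^ ((1 / 2 - \<delta>) n)\<close>.\<close>

text \<open>What shapes the proof is that nothing is known about how often the sums of the R
  representations \<open>u\<close> of a solution \<open>c\<close> coincide. If they are mostly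
  distinct, filtering by the sum keeps one of them. If they collide, the colliding ones survive or
  die together, but then there is a new source of matches: whenever \<open>u\<close> and
  \<open>u'\<close> have equal sums, so do \<open>u\<close> and \<open>u' - c\<close>, and their
  difference is again a solution, as every difference of elements of \<open>A\<close> and
  \<open>B\<close> lies in \<open>C\<close>. So \<open>u\<close> and \<open>v\<close> need not
  represent the same solution. Such a pair survives two independent filters with probability
  \<open>1 / P^2\<close>, hence about \<open>P^2\<close> pairs are needed. Both cases are covered if
  \<open>P^3 <= R^2\<close>, and this is why \<open>P\<close> is only the power 2/3 of R.

  Since \<open>u\<close> and \<open>v\<close> run through about
  \<open>(4 * (d - 1)) ^ (n / 2)\<close> vectors, of which a fraction \<open>1 / P\<close> is
  visited, \<open>P\<close> has to outweigh the ratio of \<open>4 * (d - 1)\<close> to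
  \<open>2 * d\<close>. R is exponential in the number of coefficients that are not extreme, so this
  fails if almost all of them are extreme. That is the reason for the second search.\<close>

section \<open>Halting and sequential composition\<close>

lemma run_Skip: "run w t (Skip, s) = return_pmf (Skip, s)"
  by (induction t) (simp_all add: bind_return_pmf)

lemma run_add: "run w (t1 + t2) cs = bind_pmf (run w t1 cs) (run w t2)"
proof (induction t1 arbitrary: cs)
  case (Suc t1)
  then have "run w (t1 + t2) = (\<lambda>cs. bind_pmf (run w t1 cs) (run w t2))" by blast
  then show ?case by (simp add: bind_assoc_pmf)
qed (simp add: bind_return_pmf)

text \<open>The number \<open>t\<close> is an upper bound on the running time, since a halted
  program steps to itself. The point mass makes the final state deterministic; \<open>halted\<close>
  is the counterpart for random outcomes.\<close>

definition exec :: "nat \<Rightarrow> com \<Rightarrow> state \<Rightarrow> nat \<Rightarrow> state \<Rightarrow> bool" where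
  "exec w c s t s' \<longleftrightarrow> run w t (c, s) = return_pmf (Skip, s')"

definition halted :: "nat \<Rightarrow> nat \<Rightarrow> com \<times> state \<Rightarrow> bool" where
  "halted w t cs \<longleftrightarrow> (\<forall>cs'\<in>set_pmf (run w t cs). fst cs' = Skip)"

lemma halted_run_add: "halted w t cs \<Longrightarrow> run w (t + k) cs = run w t cs"
proof -
  assume h: "halted w t cs"
  have "run w (t + k) cs = bind_pmf (run w t cs) (run w k)" by (rule run_add)
  also have "\<dots> = bind_pmf (run w t cs) return_pmf"
  proof (rule bind_pmf_cong[OF refl])
    fix cs' assume "cs' \<in> set_pmf (run w t cs)"
    with h have "fst cs' = Skip" by (auto simp: halted_def)
    then show "run w k cs' = return_pmf cs'" by (cases cs') (simp add: run_Skip)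
  qed
  finally show ?thesis by (simp add: bind_return_pmf')
qed

lemma exec_halted: "exec w c s t s' \<Longrightarrow> halted w t (c, s)"
  by (simp add: exec_def halted_def)

lemma exec_mono: "exec w c s t s' \<Longrightarrow> t \<le> t' \<Longrightarrow> exec w c s t' s'"
  using halted_run_add[OF exec_halted, of w c s t s' "t' - t"] by (simp add: exec_def)

lemma bind_eq_return_pmf:
  assumes "bind_pmf K f = return_pmf y" "x \<in> set_pmf K"
  shows "f x = return_pmf y"
proof -
  have "set_pmf (bind_pmf K f) = {y}" using assms(1) by simp
  then have "set_pmf (f x) \<subseteq> {y}" using assms(2) by (auto simp: set_bind_pmf)
  then show ?thesis by (simp add: set_pmf_subset_singleton)
qed

text \<open>The first command ends deterministically while the second may be random, which is the
  situation of a deterministic precomputation followed by \<open>Rand\<close>. Time left over by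
  \<open>c1\<close> is harmless because \<open>c2\<close> has halted after \<open>t2\<close> steps
  anyway.\<close>

lemma run_Seq:
  assumes "exec w c1 s t1 s1" "halted w t2 (c2, s1)"
  shows "run w (t1 + t2 + 1) (Seq c1 c2, s) = run w t2 (c2, s1)"
  using assms(1)
proof (induction t1 arbitrary: c1 s)
  case 0
  then have "c1 = Skip" "s = s1" by (auto simp: exec_def)
  then show ?case by (simp add: bind_return_pmf)
next
  case (Suc t1)
  show ?case
  proof (cases "c1 = Skip")
    case True
    then have "s = s1" using Suc.prems by (simp add: exec_def run_Skip del: run.simps)
    moreover have "run w (Suc t1 + t2) (c2, s1) = run w t2 (c2, s1)"
      using halted_run_add[OF assms(2), of "Suc t1"] by (simp add: add.commute del: run.simps)
    ultimately show ?thesis using True by (simp add: bind_return_pmf)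
  next
    case False
    have r: "bind_pmf (step w c1 s) (run w t1) = return_pmf (Skip, s1)"
      using Suc.prems by (simp add: exec_def)
    have "run w (Suc t1 + t2 + 1) (Seq c1 c2, s) =
       bind_pmf (step w c1 s) (\<lambda>cs. run w (t1 + t2 + 1) (Seq (fst cs) c2, snd cs))"
    proof -
      have e: "Suc t1 + t2 + 1 = Suc (t1 + t2 + 1)" by simp
      show ?thesis unfolding e run.simps(2) using False
        by (simp add: bind_map_pmf case_prod_beta del: run.simps)
    qed
    also have "\<dots> = bind_pmf (step w c1 s) (\<lambda>cs. run w t2 (c2, s1))"
    proof (rule bind_pmf_cong[OF refl])
      fix cs assume "cs \<in> set_pmf (step w c1 s)"
      from bind_eq_return_pmf[OF r this] have "exec w (fst cs) (snd cs) t1 s1"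
        by (simp add: exec_def)
      from Suc.IH[OF this] show "run w (t1 + t2 + 1) (Seq (fst cs) c2, snd cs) = run w t2 (c2, s1)" .
    qed
    finally show ?thesis by simp
  qed
qed

lemma exec_Seq:
  "exec w c1 s t1 s1 \<Longrightarrow> exec w c2 s1 t2 s2 \<Longrightarrow> exec w (Seq c1 c2) s (t1 + t2 + 1) s2"
  using run_Seq[OF _ exec_halted] by (fastforce simp: exec_def)

lemma exec_Skip: "exec w Skip s 0 s"
  by (simp add: exec_def)

lemma exec_Cond:
  assumes "bsafe w b s" "exec w (if bval b s then c1 else c2) s t s'"
  shows "exec w (Cond b c1 c2) s (t + 1) s'"
  using assms by (simp add: exec_def bind_return_pmf)

section \<open>Frames: the names that a command may write\<close>

primrec wv :: "com \<Rightarrow> vname set" where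
  "wv Skip = {}"
| "wv (Assign v e) = {v}"
| "wv (Store a e1 e2) = {}"
| "wv (Rand v e) = {v}"
| "wv (Seq c1 c2) = wv c1 \<union> wv c2"
| "wv (Cond b c1 c2) = wv c1 \<union> wv c2"
| "wv (While b c) = wv c"

primrec wa :: "com \<Rightarrow> vname set" where
  "wa Skip = {}"
| "wa (Assign v e) = {}"
| "wa (Store a e1 e2) = {a}"
| "wa (Rand v e) = {}"
| "wa (Seq c1 c2) = wa c1 \<union> wa c2"
| "wa (Cond b c1 c2) = wa c1 \<union> wa c2"
| "wa (While b c) = wa c"

definition agree :: "com \<Rightarrow> state \<Rightarrow> state \<Rightarrow> bool" where
  "agree c s s' \<longleftrightarrow> (\<forall>v. v \<notin> wv c \<longrightarrow> vars s' v = vars s v) \<and> (\<forall>a. a \<notin> wa c \<longrightarrow> arrs s' a = arrs s a)"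

lemma agree_refl: "agree c s s" by (simp add: agree_def)
lemma agree_trans: "agree c s s' \<Longrightarrow> agree c s' s'' \<Longrightarrow> agree c s s''" by (simp add: agree_def)

text \<open>Unfolding a loop introduces no new written names, so the frame of the initial command
  covers every configuration reached from it.\<close>

lemma step_agree:
  "(c', s') \<in> set_pmf (step w c s) \<Longrightarrow> wv c' \<subseteq> wv c \<and> wa c' \<subseteq> wa c \<and> agree c s s'"
proof (induction c arbitrary: s c' s')
  case (Seq c1 c2)
  show ?case
  proof (cases "c1 = Skip")
    case True then show ?thesis using Seq.prems by (auto simp: agree_def)
  next
    case False
    then obtain c1' where c1: "(c1', s') \<in> set_pmf (step w c1 s)" "c' = Seq c1' c2"
      using Seq.prems by auto
    from Seq.IH(1)[OF c1(1)] c1(2) show ?thesis by (auto simp: agree_def)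
  qed
qed (auto simp: agree_def split: if_splits)

lemma run_agree: "(c', s') \<in> set_pmf (run w t (c, s)) \<Longrightarrow> agree c s s'"
proof (induction t arbitrary: c s)
  case 0 then show ?case by (simp add: agree_refl)
next
  case (Suc t)
  then obtain c1 s1 where 1: "(c1, s1) \<in> set_pmf (step w c s)" "(c', s') \<in> set_pmf (run w t (c1, s1))"
    by auto
  from step_agree[OF 1(1)] Suc.IH[OF 1(2)] show ?case by (auto simp: agree_def)
qed

lemma exec_agree: "exec w c s t s' \<Longrightarrow> agree c s s'"
  using run_agree[of Skip s' w t c s] by (simp add: exec_def)

section \<open>Bounded states\<close>

text \<open>If all words of the state are at most \<open>B\<close> in absolute value, an expression with \<open>k\<close> leaves
  evaluates within \<open>B ^ k\<close>. So it suffices to bound the assigned values.\<close>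

primrec esz :: "aexp \<Rightarrow> nat" where
  "esz (Const i) = 1"
| "esz (Var v) = 1"
| "esz (Arr a e) = esz e"
| "esz (Op f e1 e2) = esz e1 + esz e2"

primrec cok :: "int \<Rightarrow> aexp \<Rightarrow> bool" where
  "cok B (Const i) \<longleftrightarrow> \<bar>i\<bar> \<le> B"
| "cok B (Var v) \<longleftrightarrow> True"
| "cok B (Arr a e) \<longleftrightarrow> cok B e"
| "cok B (Op f e1 e2) \<longleftrightarrow> cok B e1 \<and> cok B e2"

text \<open>The number 12 exceeds the leaf count of every expression in the program. Together with
  \<open>B ^ 12 <= 2 ^ w\<close> it keeps all intermediate values within words.\<close>

definition eok :: "int \<Rightarrow> aexp \<Rightarrow> bool" where
  "eok B e \<longleftrightarrow> cok B e \<and> esz e \<le> 12"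

primrec bok :: "int \<Rightarrow> bexp \<Rightarrow> bool" where
  "bok B (Less e1 e2) \<longleftrightarrow> eok B e1 \<and> eok B e2"
| "bok B (Eq e1 e2) \<longleftrightarrow> eok B e1 \<and> eok B e2"
| "bok B (Not b) \<longleftrightarrow> bok B b"
| "bok B (And b1 b2) \<longleftrightarrow> bok B b1 \<and> bok B b2"

definition bnd :: "int \<Rightarrow> state \<Rightarrow> bool" where
  "bnd B s \<longleftrightarrow> (\<forall>v. \<bar>vars s v\<bar> \<le> B) \<and> (\<forall>a i. \<bar>arrs s a i\<bar> \<le> B)"

lemma esz_pos: "1 \<le> esz e" by (induction e) auto

lemma power_ge_self: "2 \<le> (B::int) \<Longrightarrow> 1 \<le> k \<Longrightarrow> B \<le> B ^ k"
  using self_le_power[of B k] by simp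

lemma abs_div_le: "\<bar>i div j\<bar> \<le> \<bar>i::int\<bar>"
proof -
  have pos: "\<bar>i div j\<bar> \<le> \<bar>i\<bar>" if "0 < j" for i j :: int
  proof (cases "i \<ge> 0")
    case True
    then show ?thesis using zdiv_mono2[of i 1 j] that by (simp add: pos_imp_zdiv_nonneg_iff)
  next
    case False
    have "i \<le> i div j" using zdiv_mono2_neg[of i 1 j] that False by simp
    moreover have "i div j < 0" using that False by (simp add: pos_imp_zdiv_neg_iff)
    ultimately show ?thesis by simp
  qed
  consider "j = 0" | "0 < j" | "0 < - j" by linarith
  then show ?thesis
  proof cases
    case 3
    have "i div j = (- i) div (- j)" by simp
    then show ?thesis using pos[OF 3, of "- i"] by simp
  qed (use pos in auto)
qed

lemma abs_mod_le: "\<bar>i mod j\<bar> \<le> max \<bar>i\<bar> \<bar>j::int\<bar>"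
  by (smt (verit) max_def mod_by_0 neg_mod_bound neg_mod_sign pos_mod_bound pos_mod_sign)

text \<open>Multiplication is the worst operation: two numbers that are at least 2 have a product at
  least as large as their sum, so \<open>B ^ k + B ^ l\<close> stays below
  \<open>B ^ (k + l)\<close>.\<close>

lemma opval_bound:
  assumes "2 \<le> B" "\<bar>i\<bar> \<le> B ^ k" "\<bar>j\<bar> \<le> B ^ l" "1 \<le> k" "1 \<le> l"
  shows "\<bar>opval f i j\<bar> \<le> B ^ (k + l)"
proof -
  have k2: "2 \<le> B ^ k" "2 \<le> B ^ l" using power_ge_self[of B k] power_ge_self[of B l] assms by linarith+
  then have m: "B ^ k + B ^ l \<le> B ^ (k + l)"
  proof -
    have "0 \<le> (B ^ k - 1) * (B ^ l - 1) - 1" using k2 mult_mono[of 1 "B^k - 1" 1 "B^l-1"] by simp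
    then show ?thesis by (simp add: algebra_simps power_add)
  qed
  show ?thesis
  proof (cases f)
    case Mul
    then show ?thesis using assms(2,3) by (simp add: abs_mult power_add mult_mono)
  next
    case Div
    then show ?thesis using abs_div_le[of i j] m k2 assms(2,3) by simp
  next
    case Mod
    then show ?thesis using abs_mod_le[of i j] m k2 assms(2,3) by simp
  qed (use m assms(2,3) in auto)
qed

lemma aval_bound:
  assumes "2 \<le> B" "bnd B s" "cok B e"
  shows "\<bar>aval e s\<bar> \<le> B ^ esz e"
  using assms(3)
proof (induction e)
  case (Arr a e)
  have "B \<le> B ^ esz e" using power_ge_self[OF assms(1) esz_pos] .
  moreover have "\<bar>arrs s a (aval e s)\<bar> \<le> B" using assms(2) by (simp add: bnd_def)
  ultimately show ?case by simp
next
  case (Op f e1 e2)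
  then show ?case using opval_bound[OF assms(1) _ _ esz_pos esz_pos] by simp
qed (use assms in \<open>auto simp: bnd_def\<close>)

lemma asafe_bnd:
  assumes "2 \<le> B" "bnd B s" "cok B e" "B ^ esz e \<le> 2 ^ w"
  shows "asafe w e s"
  using assms(3,4)
proof (induction e)
  case (Const i)
  then show ?case by (simp add: is_word_def)
next
  case (Var v)
  have "\<bar>vars s v\<bar> \<le> B" using assms(2) by (simp add: bnd_def)
  then show ?case using Var by (simp add: is_word_def)
next
  case (Arr a e)
  have "B \<le> B ^ esz e" using power_ge_self[OF assms(1) esz_pos] .
  moreover have "\<bar>arrs s a (aval e s)\<bar> \<le> B" using assms(2) by (simp add: bnd_def)
  ultimately have "is_word w (arrs s a (aval e s))" using Arr.prems unfolding is_word_def by simp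
  then show ?case using Arr by simp
next
  case (Op f e1 e2)
  have "B ^ esz e1 \<le> B ^ esz (Op f e1 e2)" "B ^ esz e2 \<le> B ^ esz (Op f e1 e2)"
    using assms(1) by (auto intro!: power_increasing)
  moreover have "\<bar>aval (Op f e1 e2) s\<bar> \<le> B ^ esz (Op f e1 e2)"
    using aval_bound[OF assms(1,2)] Op.prems by blast
  ultimately show ?case using Op by (auto simp: is_word_def)
qed

locale machine =
  fixes B :: int and w :: nat
  assumes B2: "2 \<le> B" and Bw: "B ^ 12 \<le> 2 ^ w"
begin

lemma eok_asafe: "bnd B s \<Longrightarrow> eok B e \<Longrightarrow> asafe w e s"
  using asafe_bnd[OF B2, of s e w] order_trans[OF power_increasing[of "esz e" 12 B] Bw] B2
  by (simp add: eok_def)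

lemma bok_bsafe: "bnd B s \<Longrightarrow> bok B b \<Longrightarrow> bsafe w b s"
  by (induction b) (auto simp: eok_asafe)

end

section \<open>Symbolic execution of loop-free code and loop rules\<close>

text \<open>The state transformer of deterministic loop-free code. The clauses for
  \<open>Rand\<close> and \<open>While\<close> are dummy values, which \<open>sok\<close>
  excludes.\<close>

primrec sx :: "com \<Rightarrow> state \<Rightarrow> state" where
  "sx Skip s = s"
| "sx (Assign v e) s = s\<lparr>vars := (vars s)(v := aval e s)\<rparr>"
| "sx (Store a e1 e2) s = s\<lparr>arrs := (arrs s)(a := (arrs s a)(aval e1 s := aval e2 s))\<rparr>"
| "sx (Rand v e) s = s"
| "sx (Seq c1 c2) s = sx c2 (sx c1 s)"
| "sx (Cond b c1 c2) s = (if bval b s then sx c1 s else sx c2 s)"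
| "sx (While b c) s = s"

text \<open>Only what is written has to stay within \<open>B\<close>, so that \<open>bnd\<close> is
  preserved. The index of a \<open>Store\<close> may exceed \<open>B\<close>; \<open>eok\<close>
  keeps it within \<open>B ^ 12\<close>.\<close>

primrec sok :: "int \<Rightarrow> com \<Rightarrow> state \<Rightarrow> bool" where
  "sok B Skip s \<longleftrightarrow> True"
| "sok B (Assign v e) s \<longleftrightarrow> \<bar>aval e s\<bar> \<le> B"
| "sok B (Store a e1 e2) s \<longleftrightarrow> \<bar>aval e2 s\<bar> \<le> B"
| "sok B (Rand v e) s \<longleftrightarrow> False"
| "sok B (Seq c1 c2) s \<longleftrightarrow> sok B c1 s \<and> sok B c2 (sx c1 s)"
| "sok B (Cond b c1 c2) s \<longleftrightarrow> (if bval b s then sok B c1 s else sok B c2 s)"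
| "sok B (While b c) s \<longleftrightarrow> False"

primrec cwf :: "int \<Rightarrow> com \<Rightarrow> bool" where
  "cwf B Skip \<longleftrightarrow> True"
| "cwf B (Assign v e) \<longleftrightarrow> eok B e"
| "cwf B (Store a e1 e2) \<longleftrightarrow> eok B e1 \<and> eok B e2"
| "cwf B (Rand v e) \<longleftrightarrow> eok B e"
| "cwf B (Seq c1 c2) \<longleftrightarrow> cwf B c1 \<and> cwf B c2"
| "cwf B (Cond b c1 c2) \<longleftrightarrow> bok B b \<and> cwf B c1 \<and> cwf B c2"
| "cwf B (While b c) \<longleftrightarrow> bok B b \<and> cwf B c"

text \<open>A bound independent of the state, hence both branches of a conditional are
  added.\<close>

primrec ctime :: "com \<Rightarrow> nat" where
  "ctime Skip = 0"
| "ctime (Assign v e) = 1"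
| "ctime (Store a e1 e2) = 1"
| "ctime (Rand v e) = 1"
| "ctime (Seq c1 c2) = ctime c1 + ctime c2 + 1"
| "ctime (Cond b c1 c2) = ctime c1 + ctime c2 + 1"
| "ctime (While b c) = 0"

context machine begin

lemma exec_sx:
  assumes "bnd B s" "cwf B c" "sok B c s"
  shows "exec w c s (ctime c) (sx c s) \<and> bnd B (sx c s)"
  using assms
proof (induction c arbitrary: s)
  case Skip then show ?case by (simp add: exec_Skip)
next
  case (Assign v e)
  then show ?case by (auto simp: exec_def eok_asafe bind_return_pmf bnd_def)
next
  case (Store a e1 e2)
  then show ?case by (auto simp: exec_def eok_asafe bind_return_pmf bnd_def)
next
  case (Seq c1 c2)
  then show ?case using exec_Seq by fastforce
next
  case (Cond b c1 c2)
  have "exec w (if bval b s then c1 else c2) s (ctime c1 + ctime c2) (sx (Cond b c1 c2) s)"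
    using Cond exec_mono[of w c1 s "ctime c1" _ "ctime c1 + ctime c2"]
      exec_mono[of w c2 s "ctime c2" _ "ctime c1 + ctime c2"] by simp
  then have "exec w (Cond b c1 c2) s (ctime (Cond b c1 c2)) (sx (Cond b c1 c2) s)"
    using exec_Cond bok_bsafe Cond.prems by auto
  then show ?case using Cond by auto
qed auto

lemma exec_While_False:
  "bnd B s \<Longrightarrow> bok B b \<Longrightarrow> \<not> bval b s \<Longrightarrow> exec w (While b c) s 1 s"
  by (simp add: exec_def bok_bsafe bind_return_pmf)

lemma exec_While_True:
  assumes "bnd B s" "bok B b" "bval b s" "exec w c s t1 s1" "exec w (While b c) s1 t2 s2"
  shows "exec w (While b c) s (t1 + t2 + 2) s2"
  using assms exec_Seq[OF assms(4,5)] by (simp add: exec_def bok_bsafe bind_return_pmf)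

text \<open>Each pass costs two steps besides the body, one for unfolding the loop and one for
  dropping the \<open>Skip\<close> left by the body. The step case may use
  \<open>agree c s0 s\<close>, so that \<open>I\<close> needs to mention only what the body
  changes.\<close>

lemma while_rule:
  fixes \<mu> :: "state \<Rightarrow> nat"
  assumes b: "bok B b"
    and step: "\<And>s. bnd B s \<Longrightarrow> I s \<Longrightarrow> agree c s0 s \<Longrightarrow> bval b s \<Longrightarrow>
      \<exists>s'. exec w c s tb s' \<and> bnd B s' \<and> I s' \<and> \<mu> s' < \<mu> s"
    and s0: "bnd B s0" "I s0" "\<mu> s0 \<le> m"
  shows "\<exists>s'. exec w (While b c) s0 (m * (tb + 2) + 1) s' \<and> bnd B s' \<and> I s' \<and> agree c s0 s' \<and> \<not> bval b s'"
proof -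
  have "\<exists>s'. exec w (While b c) s (\<mu> s * (tb + 2) + 1) s' \<and> bnd B s' \<and> I s' \<and> agree c s0 s' \<and> \<not> bval b s'"
    if "bnd B s" "I s" "agree c s0 s" for s
    using that
  proof (induction "\<mu> s" arbitrary: s rule: less_induct)
    case less
    show ?case
    proof (cases "bval b s")
      case False
      have "exec w (While b c) s (\<mu> s * (tb + 2) + 1) s"
        by (rule exec_mono[OF exec_While_False]) (use less False b in auto)
      then show ?thesis using less False by blast
    next
      case True
      from step[OF less.prems True] obtain s1 where
        s1: "exec w c s tb s1" "bnd B s1" "I s1" "\<mu> s1 < \<mu> s" by blast
      have a1: "agree c s0 s1" using agree_trans[OF less.prems(3) exec_agree[OF s1(1)]] .
      from less.hyps[OF s1(4) s1(2,3) a1] obtain s' where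
        s': "exec w (While b c) s1 (\<mu> s1 * (tb + 2) + 1) s'" "bnd B s'" "I s'" "agree c s0 s'" "\<not> bval b s'"
        by blast
      have "exec w (While b c) s (\<mu> s * (tb + 2) + 1) s'"
      proof (rule exec_mono[OF exec_While_True[OF less.prems(1) b True s1(1) s'(1)]])
        have "Suc (\<mu> s1) * (tb + 2) \<le> \<mu> s * (tb + 2)" using s1(4) by (intro mult_le_mono1) simp
        then show "tb + (\<mu> s1 * (tb + 2) + 1) + 2 \<le> \<mu> s * (tb + 2) + 1" by simp
      qed
      then show ?thesis using s' by blast
    qed
  qed
  from this[OF s0(1,2) agree_refl] obtain s' where
    "exec w (While b c) s0 (\<mu> s0 * (tb + 2) + 1) s'" "bnd B s'" "I s'" "agree c s0 s'" "\<not> bval b s'" by blast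
  moreover have "\<mu> s0 * (tb + 2) + 1 \<le> m * (tb + 2) + 1" using s0(3) by (intro add_mono mult_le_mono1) auto
  ultimately show ?thesis using exec_mono by blast
qed

lemma while_sx:
  fixes \<mu> :: "state \<Rightarrow> nat"
  assumes b: "bok B b" "cwf B c"
    and step: "\<And>s. bnd B s \<Longrightarrow> I s \<Longrightarrow> agree c s0 s \<Longrightarrow> bval b s \<Longrightarrow>
      sok B c s \<and> I (sx c s) \<and> \<mu> (sx c s) < \<mu> s"
    and s0: "bnd B s0" "I s0" "\<mu> s0 \<le> m"
  shows "\<exists>s'. exec w (While b c) s0 (m * (ctime c + 2) + 1) s' \<and> bnd B s' \<and> I s' \<and> agree c s0 s' \<and> \<not> bval b s'"
  by (rule while_rule[where I = I and \<mu> = \<mu>]) (use assms exec_sx in blast)+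

end

abbreviation Seq_syn (infixr ";;" 60) where "c1 ;; c2 \<equiv> Seq c1 c2"
abbreviation Assign_syn (infix "::=" 61) where "v ::= e \<equiv> Assign v e"
abbreviation add_syn (infixl "[+]" 65) where "a [+] b \<equiv> Op Add a b"
abbreviation sub_syn (infixl "[-]" 65) where "a [-] b \<equiv> Op Sub a b"
abbreviation mul_syn (infixl "[*]" 70) where "a [*] b \<equiv> Op Mul a b"
abbreviation div_syn (infixl "[div]" 70) where "a [div] b \<equiv> Op Div a b"
abbreviation mod_syn (infixl "[mod]" 70) where "a [mod] b \<equiv> Op Mod a b"
abbreviation "V \<equiv> Var"
abbreviation "K \<equiv> Const"

section \<open>Breadth-first enumeration of weighted paths\<close>

text \<open>Straight-line code whose length depends on the coefficient list alone. Each tree has its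
  own arrays, distinguished by prefixing one character to its name.\<close>

primrec tabs :: "vname \<Rightarrow> nat \<Rightarrow> (int \<times> int) list \<Rightarrow> com" where
  "tabs nm i [] = Skip"
| "tabs nm i (p # ps) = Store (CHR ''v'' # nm) (K (int i)) (K (fst p)) ;;
     Store (CHR ''w'' # nm) (K (int i)) (K (snd p)) ;; tabs nm (Suc i) ps"

lemma tabs_frame:
  "vars (sx (tabs nm i ps) s) = vars s"
  "a \<noteq> CHR ''v'' # nm \<Longrightarrow> a \<noteq> CHR ''w'' # nm \<Longrightarrow> arrs (sx (tabs nm i ps) s) a = arrs s a"
  by (induction ps arbitrary: i s) auto

lemma tabs_below:
  "j < int i \<Longrightarrow> arrs (sx (tabs nm i ps) s) (CHR ''v'' # nm) j = arrs s (CHR ''v'' # nm) j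
    \<and> arrs (sx (tabs nm i ps) s) (CHR ''w'' # nm) j = arrs s (CHR ''w'' # nm) j"
  by (induction ps arbitrary: i s) auto

lemma tabs_val:
  "j < length ps \<Longrightarrow> arrs (sx (tabs nm i ps) s) (CHR ''v'' # nm) (int (i + j)) = fst (ps ! j)
    \<and> arrs (sx (tabs nm i ps) s) (CHR ''w'' # nm) (int (i + j)) = snd (ps ! j)"
proof (induction ps arbitrary: i s j)
  case (Cons p ps)
  show ?case
  proof (cases j)
    case 0
    then show ?thesis by (simp add: tabs_below)
  next
    case (Suc j')
    have "arrs (sx (tabs nm (Suc i) ps) s') (CHR ''v'' # nm) (int (Suc i + j')) = fst (ps ! j')
      \<and> arrs (sx (tabs nm (Suc i) ps) s') (CHR ''w'' # nm) (int (Suc i + j')) = snd (ps ! j')" for s'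
      using Cons.IH[of j' "Suc i" s'] Cons.prems Suc by (simp add: ac_simps)
    then show ?thesis using Suc by (simp add: ac_simps)
  qed
qed simp

text \<open>A path is a queue entry: \<open>S\<close> and \<open>V\<close> hold its sums against \<open>x\<close> and \<open>e\<close>, \<open>l\<close> its length, and
  \<open>N / D\<close> its budget divided by the weights spent so far. A single counter \<open>r = j * q + g\<close> pairs
  the entry \<open>j\<close> with its extension by the coefficient number \<open>g\<close>.\<close>

definition enum_body :: "vname \<Rightarrow> nat \<Rightarrow> int \<Rightarrow> vname \<Rightarrow> vname \<Rightarrow> int \<Rightarrow> com" where
  "enum_body nm q Q hv ov sg =
     ''j'' ::= V ''r'' [div] K (int q) ;;
     ''g'' ::= V ''r'' [mod] K (int q) ;;
     ''k'' ::= Arr (CHR ''l'' # nm) (V ''j'') ;;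
     ''a'' ::= Arr (CHR ''N'' # nm) (V ''j'') [*] Arr (CHR ''w'' # nm) (V ''g'') ;;
     ''b'' ::= Arr (CHR ''D'' # nm) (V ''j'') [*] K Q ;;
     Cond (And (Less (V ''k'') (V hv)) (Not (Less (V ''a'') (V ''b''))))
       (Store (CHR ''S'' # nm) (V ''t'') (Arr (CHR ''S'' # nm) (V ''j'') [+]
          Arr (CHR ''v'' # nm) (V ''g'') [*] Arr ''x'' (V ov [+] K sg [*] V ''k'')) ;;
        Store (CHR ''V'' # nm) (V ''t'') (Arr (CHR ''V'' # nm) (V ''j'') [+]
          Arr (CHR ''v'' # nm) (V ''g'') [*] Arr ''e'' (V ov [+] K sg [*] V ''k'')) ;;
        Store (CHR ''l'' # nm) (V ''t'') (V ''k'' [+] K 1) ;;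
        Store (CHR ''N'' # nm) (V ''t'') (V ''a'') ;;
        Store (CHR ''D'' # nm) (V ''t'') (V ''b'') ;;
        ''t'' ::= V ''t'' [+] K 1)
       Skip ;;
     ''r'' ::= V ''r'' [+] K 1"

definition enum_init :: "vname \<Rightarrow> int \<Rightarrow> (int \<times> int) list \<Rightarrow> com" where
  "enum_init nm D0 vs =
     tabs nm 0 vs ;;
     ''r'' ::= K 0 ;; ''t'' ::= K 1 ;;
     Store (CHR ''S'' # nm) (K 0) (K 0) ;; Store (CHR ''V'' # nm) (K 0) (K 0) ;;
     Store (CHR ''l'' # nm) (K 0) (K 0) ;; Store (CHR ''N'' # nm) (K 0) (V ''N'') ;;
     Store (CHR ''D'' # nm) (K 0) (K D0)"

definition enum_loop where
  "enum_loop nm q Q hv ov sg =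
    While (Less (V ''r'') (V ''t'' [*] K (int q))) (enum_body nm q Q hv ov sg)"

definition enum :: "vname \<Rightarrow> (int \<times> int) list \<Rightarrow> int \<Rightarrow> int \<Rightarrow> vname \<Rightarrow> vname \<Rightarrow> int \<Rightarrow> com" where
  "enum nm vs Q D0 hv ov sg =
     enum_init nm D0 vs ;; enum_loop nm (length vs) Q hv ov sg ;; (CHR ''t'' # nm) ::= V ''t''"

definition psum :: "(int \<Rightarrow> int) \<Rightarrow> int \<Rightarrow> int \<Rightarrow> (int \<times> int) list \<Rightarrow> int" where
  "psum X o' sg p = (\<Sum>i<length p. fst (p ! i) * X (o' + sg * int i))"

definition pnum :: "int \<Rightarrow> (int \<times> int) list \<Rightarrow> int" where
  "pnum N p = N * (\<Prod>v\<leftarrow>p. snd v)"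

definition pden :: "int \<Rightarrow> int \<Rightarrow> (int \<times> int) list \<Rightarrow> int" where
  "pden D0 Q p = D0 * Q ^ length p"

lemma psum_snoc: "psum X o' sg (p @ [v]) = psum X o' sg p + fst v * X (o' + sg * int (length p))"
  by (simp add: psum_def nth_append)

lemma pnum_snoc: "pnum N (p @ [v]) = pnum N p * snd v" by (simp add: pnum_def)
lemma pden_snoc: "pden D0 Q (p @ [v]) = pden D0 Q p * Q" by (simp add: pden_def)

text \<open>The budget is checked on every prefix, which makes the set closed under prefixes and
  hence reachable by extending queue entries one coefficient at a time. The empty path is exempt, so
  the queue always has a root.\<close>

definition paths :: "(int \<times> int) set \<Rightarrow> int \<Rightarrow> int \<Rightarrow> int \<Rightarrow> nat \<Rightarrow> (int \<times> int) list set" where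
  "paths vs Q D0 N H = {p. set p \<subseteq> vs \<and> length p \<le> H \<and>
     (\<forall>k\<le>length p. 0 < k \<longrightarrow> pden D0 Q (take k p) \<le> pnum N (take k p))}"

lemma paths_Nil: "[] \<in> paths vs Q D0 N H" by (simp add: paths_def)

lemma paths_snoc:
  "p @ [v] \<in> paths vs Q D0 N H \<longleftrightarrow> p \<in> paths vs Q D0 N H \<and> v \<in> vs \<and> length p < H \<and>
     pden D0 Q p * Q \<le> pnum N p * snd v"
proof -
  have "(\<forall>k\<le>length (p @ [v]). 0 < k \<longrightarrow> pden D0 Q (take k (p @ [v])) \<le> pnum N (take k (p @ [v]))) \<longleftrightarrow>
    (\<forall>k\<le>length p. 0 < k \<longrightarrow> pden D0 Q (take k p) \<le> pnum N (take k p)) \<and>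
    pden D0 Q (p @ [v]) \<le> pnum N (p @ [v])"
    by (auto simp: le_Suc_eq)
  then show ?thesis by (auto simp: paths_def pden_snoc pnum_snoc)
qed

text \<open>The list \<open>L\<close> is the queue and \<open>r\<close> the number of processed
  pairs of an entry and a coefficient. The last two clauses say that the queue consists of exactly
  the admissible results of these pairs: one gives completeness at the end, the other the absence of
  duplicates.\<close>

definition qinv :: "(int \<times> int) list \<Rightarrow> (int \<times> int) list set \<Rightarrow> (int \<times> int) list list \<Rightarrow> nat \<Rightarrow> bool" where
  "qinv vs PS L r \<longleftrightarrow> L \<noteq> [] \<and> L ! 0 = [] \<and> distinct L \<and> set L \<subseteq> PS \<and> r \<le> length L * length vs \<and>
     (\<forall>i<r. L ! (i div length vs) @ [vs ! (i mod length vs)] \<in> PS \<longrightarrow>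
        L ! (i div length vs) @ [vs ! (i mod length vs)] \<in> set L) \<and>
     (\<forall>j<length L. 0 < j \<longrightarrow> (\<exists>i<r. L ! j = L ! (i div length vs) @ [vs ! (i mod length vs)]))"

lemma qinv_step:
  assumes q: "qinv vs PS L r" and r: "r < length L * length vs" and d: "distinct vs"
    and c: "c = L ! (r div length vs) @ [vs ! (r mod length vs)]"
  shows "c \<in> PS \<Longrightarrow> qinv vs PS (L @ [c]) (Suc r)" and "c \<notin> PS \<Longrightarrow> qinv vs PS L (Suc r)"
proof -
  let ?q = "length vs"
  have q0: "0 < ?q" using r by (cases "?q = 0") auto
  have lt: "i div ?q < length L" if "i \<le> r" for i
    using that r q0 by (simp add: div_less_iff_less_mult)
  have lm: "i mod ?q < ?q" for i using q0 by simp
  \<comment> \<open>A path determines its parent and its last coefficient, hence the counter value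
    that produces it, and that value is reached only once.\<close>
  have new: "c \<notin> set L"
  proof
    assume "c \<in> set L"
    then obtain j where j: "j < length L" "L ! j = c" by (auto simp: in_set_conv_nth)
    have "j \<noteq> 0"
    proof
      assume "j = 0"
      then show False using j c q by (simp add: qinv_def)
    qed
    then obtain i where i: "i < r" "L ! j = L ! (i div ?q) @ [vs ! (i mod ?q)]"
      using q j by (auto simp: qinv_def)
    then have e: "L ! (i div ?q) = L ! (r div ?q)" "vs ! (i mod ?q) = vs ! (r mod ?q)"
      using j c by auto
    have "i div ?q = r div ?q" using e(1) q lt[of i] lt[of r] i(1) by (auto simp: qinv_def nth_eq_iff_index_eq)
    moreover have "i mod ?q = r mod ?q" using e(2) d lm nth_eq_iff_index_eq[OF d] by blast
    ultimately show False using i(1) by (metis div_mult_mod_eq less_irrefl)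
  qed
  have n1: "(L @ [c]) ! (i div ?q) = L ! (i div ?q)" if "i \<le> r" for i
    using lt[OF that] by (simp add: nth_append)
  show "qinv vs PS (L @ [c]) (Suc r)" if "c \<in> PS"
    unfolding qinv_def
  proof (intro conjI allI impI)
    show "(L @ [c]) ! 0 = []" using q by (auto simp: qinv_def nth_append)
    show "distinct (L @ [c])" using q new by (auto simp: qinv_def)
    show "set (L @ [c]) \<subseteq> PS" using q that by (auto simp: qinv_def)
    show "Suc r \<le> length (L @ [c]) * ?q" using r by simp
  next
    fix i assume i: "i < Suc r" "(L @ [c]) ! (i div ?q) @ [vs ! (i mod ?q)] \<in> PS"
    show "(L @ [c]) ! (i div ?q) @ [vs ! (i mod ?q)] \<in> set (L @ [c])"
    proof (cases "i = r")
      case True then show ?thesis using c n1 by auto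
    next
      case False
      then have "i < r" using i(1) by simp
      then show ?thesis using i q n1[of i] by (auto simp: qinv_def)
    qed
  next
    fix j assume j: "j < length (L @ [c])" "0 < j"
    show "\<exists>i<Suc r. (L @ [c]) ! j = (L @ [c]) ! (i div ?q) @ [vs ! (i mod ?q)]"
    proof (cases "j = length L")
      case True
      then have "(L @ [c]) ! j = (L @ [c]) ! (r div ?q) @ [vs ! (r mod ?q)]" using c n1[of r] by simp
      then show ?thesis by blast
    next
      case False
      then have "j < length L" using j by simp
      then obtain i where i: "i < r" "L ! j = L ! (i div ?q) @ [vs ! (i mod ?q)]"
        using q j by (auto simp: qinv_def)
      then have "(L @ [c]) ! j = (L @ [c]) ! (i div ?q) @ [vs ! (i mod ?q)]"
        using n1[of i] \<open>j < length L\<close> by (simp add: nth_append)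
      then show ?thesis using i(1) by (intro exI[of _ i]) auto
    qed
  qed simp
  show "qinv vs PS L (Suc r)" if "c \<notin> PS"
    using q r that c unfolding qinv_def by (auto simp: less_Suc_eq)
qed

text \<open>Once the counter has caught up with the queue, each path is present by induction on its
  length: its parent is some entry \<open>j\<close>, and the pair of \<open>j\<close> with the last
  coefficient has a number below \<open>r\<close>.\<close>

lemma qinv_final:
  assumes q: "qinv vs (paths (set vs) Q D0 N H) L r" and r: "r = length L * length vs"
  shows "set L = paths (set vs) Q D0 N H"
proof
  show "set L \<subseteq> paths (set vs) Q D0 N H" using q by (auto simp: qinv_def)
  have "p \<in> paths (set vs) Q D0 N H \<Longrightarrow> p \<in> set L" for p
  proof (induction p rule: rev_induct)
    case Nil
    then show ?case using q by (metis qinv_def length_greater_0_conv nth_mem)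
  next
    case (snoc v p)
    then have p: "p \<in> set L" "v \<in> set vs" by (auto simp: paths_snoc)
    then obtain j g where jg: "j < length L" "L ! j = p" "g < length vs" "vs ! g = v"
      by (metis in_set_conv_nth)
    define i where "i = j * length vs + g"
    have "i < Suc j * length vs" using jg(3) by (simp add: i_def)
    also have "\<dots> \<le> r" unfolding r using jg(1) by (intro mult_le_mono1) simp
    finally have "i < r" .
    moreover have "i div length vs = j" "i mod length vs = g"
      using jg(3) by (auto simp: i_def intro!: div_nat_eqI)
    ultimately show ?case using q jg snoc.prems by (auto simp: qinv_def)
  qed
  then show "paths (set vs) Q D0 N H \<subseteq> set L" by blast
qed

lemma finite_paths: "finite vs \<Longrightarrow> finite (paths vs Q D0 N H)"
  by (rule finite_subset[OF _ finite_lists_length_le[of vs H]]) (auto simp: paths_def)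

definition tree_rep :: "vname \<Rightarrow> (int \<Rightarrow> int) \<Rightarrow> (int \<Rightarrow> int) \<Rightarrow> int \<Rightarrow> int \<Rightarrow> (int \<times> int) list list \<Rightarrow> state \<Rightarrow> bool" where
  "tree_rep nm X E o' sg L s \<longleftrightarrow> (\<forall>i<length L.
     arrs s (CHR ''l'' # nm) (int i) = int (length (L ! i)) \<and>
     arrs s (CHR ''S'' # nm) (int i) = psum X o' sg (L ! i) \<and>
     arrs s (CHR ''V'' # nm) (int i) = psum E o' sg (L ! i))"

definition num_rep :: "vname \<Rightarrow> int \<Rightarrow> int \<Rightarrow> int \<Rightarrow> (int \<times> int) list list \<Rightarrow> state \<Rightarrow> bool" where
  "num_rep nm N Q D0 L s \<longleftrightarrow> (\<forall>i<length L.
     arrs s (CHR ''N'' # nm) (int i) = pnum N (L ! i) \<and>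
     arrs s (CHR ''D'' # nm) (int i) = pden D0 Q (L ! i))"

context machine begin

lemma enum_loop_exec:
  fixes vs :: "(int \<times> int) list" and H :: nat and N Q D0 sg :: int
  defines "PS \<equiv> paths (set vs) Q D0 N H"
  assumes s0: "bnd B s0" "vars s0 hv = int H" "vars s0 ov = o'"
      "vars s0 ''r'' = 0" "vars s0 ''t'' = 1"
      "arrs s0 ''x'' = X" "arrs s0 ''e'' = E"
      "\<And>i. i < length vs \<Longrightarrow> arrs s0 (CHR ''v'' # nm) (int i) = fst (vs ! i) \<and> arrs s0 (CHR ''w'' # nm) (int i) = snd (vs ! i)"
      "tree_rep nm X E o' sg [[]] s0" "num_rep nm N Q D0 [[]] s0"
    and nms: "hv \<notin> {''j'',''g'',''k'',''a'',''b'',''t'',''r''}" "ov \<notin> {''j'',''g'',''k'',''a'',''b'',''t'',''r''}" "nm \<noteq> ''''"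
    and vs: "distinct vs"
    and bq: "card PS \<le> m" "int m * int (length vs) \<le> B" "int (length vs) \<le> B" "int m \<le> B" "int H \<le> B" "\<bar>Q\<bar> \<le> B" "\<bar>sg\<bar> \<le> B"
    and bp: "\<And>p. set p \<subseteq> set vs \<Longrightarrow> length p \<le> Suc H \<Longrightarrow> \<bar>psum X o' sg p\<bar> \<le> B \<and> \<bar>psum E o' sg p\<bar> \<le> B \<and> \<bar>pnum N p\<bar> \<le> B \<and> \<bar>pden D0 Q p\<bar> \<le> B"
  shows "\<exists>s'. exec w (enum_loop nm (length vs) Q hv ov sg) s0 (m * length vs * 50 + 1) s' \<and> bnd B s' \<and>
     (\<exists>L. distinct L \<and> set L = PS \<and> vars s' ''t'' = int (length L) \<and> tree_rep nm X E o' sg L s')"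
proof -
  let ?q = "length vs"
  define I where "I s \<longleftrightarrow> (\<exists>L r. vars s ''r'' = int r \<and> vars s ''t'' = int (length L) \<and> qinv vs PS L r \<and>
     tree_rep nm X E o' sg L s \<and> num_rep nm N Q D0 L s)" for s
  define \<mu> where "\<mu> s = m * ?q - nat (vars s ''r'')" for s :: state
  have fin: "finite PS" by (simp add: PS_def finite_paths)
  \<comment> \<open>The loop bound \<open>t\<close> grows during the loop. Termination and time come
    from this a priori bound on a duplicate-free queue.\<close>
  have Lm: "length L \<le> m" if "qinv vs PS L r" for L r
  proof -
    have "length L = card (set L)" using that by (simp add: qinv_def distinct_card)
    also have "\<dots> \<le> card PS" using that fin by (intro card_mono) (auto simp: qinv_def)
    finally show ?thesis using bq(1) by simp
  qed
  let ?b = "Less (V ''r'') (V ''t'' [*] K (int ?q))"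
  let ?c = "enum_body nm ?q Q hv ov sg"
  have "\<exists>s'. exec w (While ?b ?c) s0 (m * ?q * (ctime ?c + 2) + 1) s' \<and> bnd B s' \<and> I s' \<and> agree ?c s0 s' \<and> \<not> bval ?b s'"
  proof (rule while_sx[where I = I and \<mu> = \<mu>])
    show "bok B ?b" using bq by (simp add: eok_def)
    show "cwf B ?c" using bq B2 by (simp add: enum_body_def eok_def)
    show "bnd B s0" by fact
    have "qinv vs PS [[]] 0" by (simp add: qinv_def PS_def paths_Nil)
    then show "I s0" using s0 unfolding I_def by (intro exI[of _ "[[]]"] exI[of _ 0]) simp
    show "\<mu> s0 \<le> m * ?q" by (simp add: \<mu>_def)
  next
    fix s assume s: "bnd B s" "I s" "agree ?c s0 s" "bval ?b s"
    from s(2) obtain L r where L: "vars s ''r'' = int r" "vars s ''t'' = int (length L)" "qinv vs PS L r"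
      "tree_rep nm X E o' sg L s" "num_rep nm N Q D0 L s" by (auto simp: I_def)
    have fr: "vars s hv = int H" "vars s ov = o'" "arrs s ''x'' = X" "arrs s ''e'' = E"
      "arrs s (CHR ''v'' # nm) = arrs s0 (CHR ''v'' # nm)" "arrs s (CHR ''w'' # nm) = arrs s0 (CHR ''w'' # nm)"
      using s(3) s0 nms by (auto simp: agree_def enum_body_def)
    have "int r < int (length L * ?q)" using s(4) L by simp
    then have r: "r < length L * ?q" by linarith
    then have q0: "0 < ?q" by (cases "?q = 0") auto
    define j g where "j = r div ?q" and "g = r mod ?q"
    have j: "j < length L" using r q0 by (simp add: j_def div_less_iff_less_mult)
    have g: "g < ?q" using q0 by (simp add: g_def)
    have jg: "int r div int ?q = int j" "int r mod int ?q = int g" by (simp_all add: j_def g_def zdiv_int zmod_int)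
    define p v where "p = L ! j" and "v = vs ! g"
    have pPS: "p \<in> PS" using L(3) j by (auto simp: qinv_def p_def)
    have vv: "v \<in> set vs" using g by (simp add: v_def)
    \<comment> \<open>Length \<open>H + 1\<close> does occur: the numerator and denominator of an
      extension are computed before the length test.\<close>
    have pv: "set (p @ [v]) \<subseteq> set vs" "length (p @ [v]) \<le> Suc H" using pPS vv by (auto simp: PS_def paths_def)
    have bnds: "\<bar>psum X o' sg (p @ [v])\<bar> \<le> B" "\<bar>psum E o' sg (p @ [v])\<bar> \<le> B" "\<bar>pnum N (p @ [v])\<bar> \<le> B" "\<bar>pden D0 Q (p @ [v])\<bar> \<le> B"
      using bp[OF pv] by auto
    have arr: "arrs s (CHR ''l'' # nm) (int j) = int (length p)" "arrs s (CHR ''S'' # nm) (int j) = psum X o' sg p"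
      "arrs s (CHR ''V'' # nm) (int j) = psum E o' sg p" "arrs s (CHR ''N'' # nm) (int j) = pnum N p"
      "arrs s (CHR ''D'' # nm) (int j) = pden D0 Q p"
      "arrs s (CHR ''v'' # nm) (int g) = fst v" "arrs s (CHR ''w'' # nm) (int g) = snd v"
      using L(4,5) j fr(5,6) s0(8)[OF g] by (auto simp: tree_rep_def num_rep_def p_def v_def)
    have lenp: "length p \<le> H" using pPS by (simp add: PS_def paths_def)
    have smallb: "int r < B" "int (length L) \<le> B"
    proof -
      have "length L * ?q \<le> m * ?q" using Lm[OF L(3)] by (intro mult_le_mono1)
      then have "r < m * ?q" using r by (rule less_le_trans[rotated])
      then have "int r < int m * int ?q" by (simp only: of_nat_mult[symmetric] of_nat_less_iff)
      then show "int r < B" using bq(2) by simp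
      show "int (length L) \<le> B" using Lm[OF L(3)] bq(4) by simp
    qed
    have jB: "int j \<le> B" "int g \<le> B" using j smallb(2) g bq(3) by linarith+
    have child: "p @ [v] \<in> PS \<longleftrightarrow> length p < H \<and> \<not> pnum N p * snd v < pden D0 Q p * Q"
      using pPS vv by (auto simp: PS_def paths_snoc)
    have rm: "r < m * ?q" by (rule less_le_trans[OF r]) (use Lm[OF L(3)] in simp)
    show "sok B ?c s \<and> I (sx ?c s) \<and> \<mu> (sx ?c s) < \<mu> s"
    proof (cases "p @ [v] \<in> PS")
      case True
      note q1 = qinv_step(1)[OF L(3) r vs refl, folded j_def g_def, folded p_def v_def, OF True]
      have Lm1: "int (length L) + 1 \<le> B" using Lm[OF q1] bq(4) by simp
      have len1: "int (length p) + 1 \<le> B" using True child bq(5) by linarith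
      have "sok B ?c s"
        using nms arr fr L(1,2) jg True child bnds smallb jB lenp bq Lm1 len1
        by (simp add: enum_body_def psum_snoc pnum_snoc pden_snoc)
      moreover have "I (sx ?c s)"
        unfolding I_def
        apply (rule exI[of _ "L @ [p @ [v]]"], rule exI[of _ "Suc r"])
        using nms arr fr L jg True child q1
        by (auto simp add: enum_body_def psum_snoc pnum_snoc pden_snoc tree_rep_def num_rep_def nth_append)
      moreover have "\<mu> (sx ?c s) < \<mu> s"
        using nms arr fr L(1,2) jg True child rm by (simp add: enum_body_def \<mu>_def nat_add_distrib)
      ultimately show ?thesis by blast
    next
      case False
      note q1 = qinv_step(2)[OF L(3) r vs refl, folded j_def g_def, folded p_def v_def, OF False]
      have nb: "\<not> (length p < H \<and> \<not> pnum N p * snd v < pden D0 Q p * Q)" using False child by blast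
      have "sok B ?c s"
        using nms arr fr L(1,2) jg nb bnds smallb jB lenp bq
        by (auto simp add: enum_body_def pnum_snoc pden_snoc)
      moreover have "I (sx ?c s)"
        unfolding I_def
        apply (rule exI[of _ L], rule exI[of _ "Suc r"])
        using nms arr fr L jg nb q1
        by (auto simp add: enum_body_def tree_rep_def num_rep_def)
      moreover have "\<mu> (sx ?c s) < \<mu> s"
        using nms arr fr L(1,2) jg nb rm by (auto simp add: enum_body_def \<mu>_def nat_add_distrib)
      ultimately show ?thesis by blast
    qed
  qed
  then obtain s' where s': "exec w (While ?b ?c) s0 (m * ?q * (ctime ?c + 2) + 1) s'" "bnd B s'" "I s'" "\<not> bval ?b s'" by blast
  from s'(3) obtain L r where L: "vars s' ''r'' = int r" "vars s' ''t'' = int (length L)" "qinv vs PS L r"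
      "tree_rep nm X E o' sg L s'" by (auto simp: I_def)
  have "\<not> int r < int (length L * ?q)" using s'(4) L by simp
  then have "\<not> r < length L * ?q" by (simp only: of_nat_less_iff not_False_eq_True)
  then have "r = length L * ?q" using L(3) by (simp add: qinv_def)
  then have "set L = PS" using qinv_final L(3) unfolding PS_def by blast
  moreover have "exec w (enum_loop nm ?q Q hv ov sg) s0 (m * ?q * 50 + 1) s'"
    unfolding enum_loop_def by (rule exec_mono[OF s'(1)]) (simp add: enum_body_def)
  ultimately show ?thesis using s' L by (auto simp: qinv_def)
qed

lemma sok_tabs:
  assumes "\<And>v. v \<in> set vs \<Longrightarrow> \<bar>fst v\<bar> \<le> B \<and> \<bar>snd v\<bar> \<le> B" "int (i + length vs) \<le> B"
  shows "cwf B (tabs nm i vs) \<and> sok B (tabs nm i vs) s"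
  using assms by (induction vs arbitrary: i s) (auto simp: eok_def)

lemma ctime_tabs: "ctime (tabs nm i vs) = 4 * length vs"
  by (induction vs arbitrary: i) auto

lemma enum_exec:
  fixes vs :: "(int \<times> int) list" and H :: nat and N Q D0 sg :: int
  defines "PS \<equiv> paths (set vs) Q D0 N H"
  assumes s0: "bnd B s0" "vars s0 hv = int H" "vars s0 ov = o'" "vars s0 ''N'' = N"
      "arrs s0 ''x'' = X" "arrs s0 ''e'' = E"
    and nms: "hv \<notin> {''j'',''g'',''k'',''a'',''b'',''t'',''r''}" "ov \<notin> {''j'',''g'',''k'',''a'',''b'',''t'',''r''}" "nm \<noteq> ''''"
    and vs: "distinct vs" "\<And>v. v \<in> set vs \<Longrightarrow> \<bar>fst v\<bar> \<le> B \<and> \<bar>snd v\<bar> \<le> B"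
    and bq: "card PS \<le> m" "int m * int (length vs) \<le> B" "int (length vs) \<le> B" "int m \<le> B" "int H \<le> B" "\<bar>Q\<bar> \<le> B" "\<bar>sg\<bar> \<le> B" "\<bar>D0\<bar> \<le> B"
    and bp: "\<And>p. set p \<subseteq> set vs \<Longrightarrow> length p \<le> Suc H \<Longrightarrow> \<bar>psum X o' sg p\<bar> \<le> B \<and> \<bar>psum E o' sg p\<bar> \<le> B \<and> \<bar>pnum N p\<bar> \<le> B \<and> \<bar>pden D0 Q p\<bar> \<le> B"
  shows "\<exists>s'. exec w (enum nm vs Q D0 hv ov sg) s0 (4 * length vs + m * length vs * 50 + 30) s' \<and> bnd B s' \<and>
     (\<exists>L. distinct L \<and> set L = PS \<and> vars s' (CHR ''t'' # nm) = int (length L) \<and> tree_rep nm X E o' sg L s')"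
proof -
  define s1 where "s1 = sx (enum_init nm D0 vs) s0"
  have B1: "1 \<le> B" using B2 by simp
  have Nb: "\<bar>N\<bar> \<le> B" using s0(1,4) by (auto simp: bnd_def)
  have c1: "cwf B (enum_init nm D0 vs)" "sok B (enum_init nm D0 vs) s0"
    using sok_tabs[OF vs(2), where i = 0 and nm = nm and vs = vs] bq B1 Nb s0(4)
    by (auto simp: enum_init_def eok_def tabs_frame)
  have e1: "exec w (enum_init nm D0 vs) s0 (ctime (enum_init nm D0 vs)) s1" and b1: "bnd B s1"
    using exec_sx[OF s0(1) c1] by (auto simp: s1_def)
  have ct: "ctime (enum_init nm D0 vs) \<le> 4 * length vs + 20" by (simp add: enum_init_def ctime_tabs)
  have v1: "vars s1 = (vars s0)(''r'' := 0, ''t'' := 1)"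
    by (simp add: s1_def enum_init_def tabs_frame)
  have "\<exists>s'. exec w (enum_loop nm (length vs) Q hv ov sg) s1 (m * length vs * 50 + 1) s' \<and> bnd B s' \<and>
     (\<exists>L. distinct L \<and> set L = PS \<and> vars s' ''t'' = int (length L) \<and> tree_rep nm X E o' sg L s')"
    unfolding PS_def
  proof (rule enum_loop_exec[OF b1])
    show "vars s1 hv = int H" "vars s1 ov = o'" "vars s1 ''r'' = 0" "vars s1 ''t'' = 1"
      using nms s0 by (auto simp: v1)
    show "arrs s1 ''x'' = X" "arrs s1 ''e'' = E"
      using nms s0 by (auto simp: s1_def enum_init_def tabs_frame)
    show "arrs s1 (CHR ''v'' # nm) (int i) = fst (vs ! i) \<and> arrs s1 (CHR ''w'' # nm) (int i) = snd (vs ! i)"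
      if "i < length vs" for i
      using tabs_val[OF that, of nm 0 s0] by (simp add: s1_def enum_init_def)
    show "tree_rep nm X E o' sg [[]] s1"
      by (simp add: s1_def enum_init_def tabs_frame tree_rep_def psum_def)
    show "num_rep nm N Q D0 [[]] s1"
      by (simp add: s1_def enum_init_def tabs_frame num_rep_def pnum_def pden_def s0(4))
  qed (use assms in auto)
  then obtain s2 L where s2: "exec w (enum_loop nm (length vs) Q hv ov sg) s1 (m * length vs * 50 + 1) s2"
    "bnd B s2" "distinct L" "set L = PS" "vars s2 ''t'' = int (length L)" "tree_rep nm X E o' sg L s2" by blast
  let ?c = "(CHR ''t'' # nm) ::= V ''t''"
  have "cwf B ?c" "sok B ?c s2" using s2(2) by (auto simp: eok_def bnd_def)
  from exec_sx[OF s2(2) this] have e3: "exec w ?c s2 1 (sx ?c s2)" "bnd B (sx ?c s2)" by auto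
  have "exec w (enum nm vs Q D0 hv ov sg) s0 (4 * length vs + m * length vs * 50 + 30) (sx ?c s2)"
    unfolding enum_def by (rule exec_mono[OF exec_Seq[OF e1 exec_Seq[OF s2(1) e3(1)]]]) (use ct in simp)
  moreover have "tree_rep nm X E o' sg L (sx ?c s2)" using s2(6) by (simp add: tree_rep_def)
  ultimately show ?thesis using e3(2) s2(3-5) by (intro exI[of _ "sx ?c s2"]) auto
qed

end

section \<open>Matching through tables\<close>

text \<open>Arrays indexed by arbitrary integers serve as dictionaries: \<open>F\<close> flags a key
  and \<open>T\<close> holds the code last stored under it. Each item is looked up in the table of
  the other side and then entered in its own table. A hit leaves in \<open>Z\<close> the code of a
  candidate solution.\<close>

definition proc :: "vname \<Rightarrow> vname \<Rightarrow> int \<Rightarrow> com" where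
  "proc own oth sg =
     Cond (Eq (Arr (CHR ''F'' # oth) (V ''y'')) (K 1))
       (''ok'' ::= K 1 ;; ''Z'' ::= K sg [*] (V ''v'' [-] Arr (CHR ''T'' # oth) (V ''y''))) Skip ;;
     Store (CHR ''F'' # own) (V ''y'') (K 1) ;; Store (CHR ''T'' # own) (V ''y'') (V ''v'')"

lemma proc_vars:
  "vars (sx (proc own oth sg) s) u =
     (if arrs s (CHR ''F'' # oth) (vars s ''y'') = 1 then
        if u = ''ok'' then 1
        else if u = ''Z'' then sg * (vars s ''v'' - arrs s (CHR ''T'' # oth) (vars s ''y''))
        else vars s u
      else vars s u)"
  by (simp add: proc_def)

lemma proc_arrs:
  "arrs (sx (proc own oth sg) s) a =
     (if a = CHR ''F'' # own then (arrs s a)(vars s ''y'' := 1)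
      else if a = CHR ''T'' # own then (arrs s a)(vars s ''y'' := vars s ''v'')
      else arrs s a)"
  by (simp add: proc_def)

lemma proc_agree: "wv (proc own oth sg) = {''ok'', ''Z''}" "wa (proc own oth sg) = {CHR ''F'' # own, CHR ''T'' # own}"
  by (auto simp: proc_def)

text \<open>The relation \<open>G\<close> describes which codes may stand under a key. Overwriting
  an entry is harmless, since any code related to the key serves equally well.\<close>

definition tabinv :: "vname \<Rightarrow> (int \<Rightarrow> int \<Rightarrow> bool) \<Rightarrow> state \<Rightarrow> bool" where
  "tabinv own G s \<longleftrightarrow> (\<forall>y. arrs s (CHR ''F'' # own) y = 1 \<longrightarrow> G y (arrs s (CHR ''T'' # own) y))"

definition okinv :: "(int \<Rightarrow> bool) \<Rightarrow> state \<Rightarrow> bool" where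
  "okinv Zg s \<longleftrightarrow> (vars s ''ok'' = 1 \<longrightarrow> Zg (vars s ''Z''))"

text \<open>This condition turns a hit into a solution. Codes of one fixed side are always
  subtracted from those of the other, and the sign \<open>sg\<close> compensates for the side on
  which the hit is noticed.\<close>

definition compat :: "int \<Rightarrow> (int \<Rightarrow> int \<Rightarrow> bool) \<Rightarrow> (int \<Rightarrow> int \<Rightarrow> bool) \<Rightarrow> int \<Rightarrow> (int \<Rightarrow> bool) \<Rightarrow> bool" where
  "compat B Gown Goth sg Zg \<longleftrightarrow> (\<forall>y a b. Gown y a \<longrightarrow> Goth y b \<longrightarrow> Zg (sg * (a - b)) \<and> \<bar>sg * (a - b)\<bar> \<le> B)"

lemma proc_inv:
  assumes "compat B Gown Goth sg Zg" "Gown (vars s ''y'') (vars s ''v'')" "own \<noteq> oth"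
    "tabinv own Gown s" "tabinv oth Goth s" "okinv Zg s" "\<bar>vars s ''v''\<bar> \<le> B" "1 \<le> B"
  shows "sok B (proc own oth sg) s" "tabinv own Gown (sx (proc own oth sg) s)"
    "tabinv oth Goth (sx (proc own oth sg) s)" "okinv Zg (sx (proc own oth sg) s)"
proof -
  have hit: "Zg (sg * (vars s ''v'' - arrs s (CHR ''T'' # oth) (vars s ''y'')))
     \<and> \<bar>sg * (vars s ''v'' - arrs s (CHR ''T'' # oth) (vars s ''y''))\<bar> \<le> B"
    if "arrs s (CHR ''F'' # oth) (vars s ''y'') = 1"
    using assms(1,2,5) that unfolding compat_def tabinv_def by blast
  show "sok B (proc own oth sg) s" using hit assms(7,8) by (simp add: proc_def)
  show "tabinv own Gown (sx (proc own oth sg) s)" using assms by (simp add: tabinv_def proc_arrs)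
  show "tabinv oth Goth (sx (proc own oth sg) s)" using assms by (simp add: tabinv_def proc_arrs)
  show "okinv Zg (sx (proc own oth sg) s)" using assms hit by (simp add: okinv_def proc_vars)
qed

definition look_body where
  "look_body own oth sg ye ve =
     ''y'' ::= ye ;; ''v'' ::= ve ;; proc own oth sg ;; ''j'' ::= V ''j'' [+] K 1"

definition look :: "vname \<Rightarrow> vname \<Rightarrow> vname \<Rightarrow> int \<Rightarrow> aexp \<Rightarrow> aexp \<Rightarrow> com" where
  "look nm own oth sg ye ve =
     ''j'' ::= K 0 ;;
     While (Less (V ''j'') (V (CHR ''t'' # nm))) (look_body own oth sg ye ve)"

lemma proc_cwf: "1 \<le> B \<Longrightarrow> \<bar>sg\<bar> \<le> B \<Longrightarrow> cwf B (proc own oth sg)"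
  by (simp add: proc_def eok_def)

lemma proc_ctime: "ctime (proc own oth sg) = 8"
  by (simp add: proc_def)

context machine begin

text \<open>Soundness is expressed by the three invariants, completeness by the last line. The
  values of \<open>ye\<close> and \<open>ve\<close> are prescribed in all states within the frame,
  since tables and hits change during the sweep but the tree does not.\<close>

lemma look_exec:
  assumes s0: "bnd B s0" "vars s0 (CHR ''t'' # nm) = int T" and nm: "nm \<noteq> ''''" "own \<noteq> oth"
    and e: "eok B ye" "eok B ve" "\<bar>sg\<bar> \<le> B"
    and val: "\<And>s j. agree (look_body own oth sg ye ve) s0 s \<Longrightarrow> vars s ''j'' = int j \<Longrightarrow> j < T \<Longrightarrow> aval ye s = fy j"
      "\<And>s j. agree (look_body own oth sg ye ve) s0 s \<Longrightarrow> vars s ''j'' = int j \<Longrightarrow> j < T \<Longrightarrow> aval ve (s\<lparr>vars := (vars s)(''y'' := fy j)\<rparr>) = fv j"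
    and G: "\<And>j. j < T \<Longrightarrow> Gown (fy j) (fv j) \<and> \<bar>fy j\<bar> \<le> B \<and> \<bar>fv j\<bar> \<le> B"
    and inv: "tabinv own Gown s0" "tabinv oth Goth s0" "okinv Zg s0" "compat B Gown Goth sg Zg"
  shows "\<exists>s'. exec w (look nm own oth sg ye ve) s0 (T * 20 + 10) s' \<and> bnd B s' \<and>
     tabinv own Gown s' \<and> tabinv oth Goth s' \<and> okinv Zg s' \<and> (vars s0 ''ok'' = 1 \<longrightarrow> vars s' ''ok'' = 1) \<and>
     (\<forall>j<T. arrs s' (CHR ''F'' # own) (fy j) = 1 \<and> (arrs s0 (CHR ''F'' # oth) (fy j) = 1 \<longrightarrow> vars s' ''ok'' = 1))"
proof -
  let ?a = "''j'' ::= K 0" and ?b = "Less (V ''j'') (V (CHR ''t'' # nm))" and ?c = "look_body own oth sg ye ve"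
  have TB: "int T \<le> B" using s0 by (auto simp: bnd_def dest: spec[of _ "CHR ''t'' # nm"])
  have B1: "1 \<le> B" using B2 by simp
  define s1 where "s1 = sx ?a s0"
  have e1: "exec w ?a s0 1 s1" "bnd B s1" using exec_sx[OF s0(1), of ?a] B2 by (auto simp: s1_def eok_def)
  have ag1: "agree ?c s0 s1" by (simp add: s1_def agree_def look_body_def)
  define I where "I s \<longleftrightarrow> (\<exists>j\<le>T. vars s ''j'' = int j \<and> tabinv own Gown s \<and> tabinv oth Goth s \<and> okinv Zg s \<and>
     (vars s0 ''ok'' = 1 \<longrightarrow> vars s ''ok'' = 1) \<and>
     (\<forall>i<j. arrs s (CHR ''F'' # own) (fy i) = 1 \<and> (arrs s0 (CHR ''F'' # oth) (fy i) = 1 \<longrightarrow> vars s ''ok'' = 1)))" for s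
  define \<mu> where "\<mu> s = T - nat (vars s ''j'')" for s :: state
  have "\<exists>s'. exec w (While ?b ?c) s1 (T * (ctime ?c + 2) + 1) s' \<and> bnd B s' \<and> I s' \<and> agree ?c s1 s' \<and> \<not> bval ?b s'"
  proof (rule while_sx[where I = I and \<mu> = \<mu>])
    show "bok B ?b" by (simp add: eok_def)
    show "cwf B ?c" using e B1 by (simp add: look_body_def proc_cwf eok_def)
    show "bnd B s1" by fact
    show "I s1" unfolding I_def using inv by (intro exI[of _ 0]) (simp add: s1_def tabinv_def okinv_def)
    show "\<mu> s1 \<le> T" by (simp add: \<mu>_def)
  next
    fix s assume s: "bnd B s" "I s" "agree ?c s1 s" "bval ?b s"
    from s(2) obtain j where j: "j \<le> T" "vars s ''j'' = int j" "tabinv own Gown s" "tabinv oth Goth s" "okinv Zg s"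
      "vars s0 ''ok'' = 1 \<longrightarrow> vars s ''ok'' = 1"
      "\<And>i. i < j \<Longrightarrow> arrs s (CHR ''F'' # own) (fy i) = 1 \<and> (arrs s0 (CHR ''F'' # oth) (fy i) = 1 \<longrightarrow> vars s ''ok'' = 1)"
      unfolding I_def by blast
    have ag: "agree ?c s0 s" using agree_trans[OF ag1 s(3)] .
    have t: "vars s (CHR ''t'' # nm) = int T" "arrs s (CHR ''F'' # oth) = arrs s0 (CHR ''F'' # oth)"
      using ag s0(2) nm by (auto simp: agree_def look_body_def proc_agree)
    have jT: "j < T" using s(4) j t by simp
    define s2 where "s2 = s\<lparr>vars := (vars s)(''y'' := fy j, ''v'' := fv j)\<rparr>"
    have s2: "sx ?c s = sx (''j'' ::= V ''j'' [+] K 1) (sx (proc own oth sg) s2)"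
      using val(1)[OF ag j(2) jT] val(2)[OF ag j(2) jT] by (simp add: look_body_def s2_def)
    have v2: "vars s2 ''y'' = fy j" "vars s2 ''v'' = fv j" "vars s2 ''j'' = int j" "vars s2 ''ok'' = vars s ''ok''"
      "arrs s2 = arrs s" using j by (auto simp: s2_def)
    have pi: "tabinv own Gown s2" "tabinv oth Goth s2" "okinv Zg s2"
      using j by (auto simp: tabinv_def okinv_def s2_def)
    have G2: "Gown (vars s2 ''y'') (vars s2 ''v'')" "\<bar>vars s2 ''v''\<bar> \<le> B" using G[OF jT] v2 by auto
    note P = proc_inv[OF inv(4) G2(1) nm(2) pi G2(2) B1]
    have "sok B ?c s"
      using val(1)[OF ag j(2) jT] val(2)[OF ag j(2) jT] G[OF jT] P(1) j(2) jT TB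
      by (simp add: look_body_def proc_vars s2_def)
    moreover have "I (sx ?c s)"
      unfolding I_def s2
    proof (intro exI[of _ "Suc j"] conjI allI impI)
      show "Suc j \<le> T" using jT by simp
      let ?s = "sx (''j'' ::= V ''j'' [+] K 1) (sx (proc own oth sg) s2)"
      show "vars ?s ''j'' = int (Suc j)" using v2 by (simp add: proc_vars)
      show "tabinv own Gown ?s" "tabinv oth Goth ?s" "okinv Zg ?s" using P by (auto simp: tabinv_def okinv_def)
      show "vars ?s ''ok'' = 1" if "vars s0 ''ok'' = 1" using j(6) that v2 by (simp add: proc_vars)
      fix i assume i: "i < Suc j"
      show "arrs ?s (CHR ''F'' # own) (fy i) = 1" using i j(7)[of i] v2 by (auto simp: proc_arrs less_Suc_eq)
      show "vars ?s ''ok'' = 1" if "arrs s0 (CHR ''F'' # oth) (fy i) = 1"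
        using i j(7)[of i] v2 t that by (auto simp: proc_vars less_Suc_eq)
    qed
    moreover have "\<mu> (sx ?c s) < \<mu> s" unfolding s2 using v2 jT j(2) by (simp add: \<mu>_def proc_vars nat_add_distrib)
    ultimately show "sok B ?c s \<and> I (sx ?c s) \<and> \<mu> (sx ?c s) < \<mu> s" by blast
  qed
  then obtain s' where s': "exec w (While ?b ?c) s1 (T * (ctime ?c + 2) + 1) s'" "bnd B s'" "I s'"
    "agree ?c s1 s'" "\<not> bval ?b s'" by blast
  have "exec w (look nm own oth sg ye ve) s0 (T * 20 + 10) s'"
    unfolding look_def by (rule exec_mono[OF exec_Seq[OF e1(1) s'(1)]]) (simp add: look_body_def proc_ctime)
  moreover from s'(3) obtain j where j: "j \<le> T" "vars s' ''j'' = int j" "tabinv own Gown s'" "tabinv oth Goth s'" "okinv Zg s'"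
      "vars s0 ''ok'' = 1 \<longrightarrow> vars s' ''ok'' = 1"
      "\<And>i. i < j \<Longrightarrow> arrs s' (CHR ''F'' # own) (fy i) = 1 \<and> (arrs s0 (CHR ''F'' # oth) (fy i) = 1 \<longrightarrow> vars s' ''ok'' = 1)"
      unfolding I_def by blast
  moreover have "vars s' (CHR ''t'' # nm) = int T"
    using agree_trans[OF ag1 s'(4)] s0(2) nm by (auto simp: agree_def look_body_def proc_agree)
  then have "j = T" using s'(5) j by simp
  ultimately show ?thesis using s'(2) by blast
qed

end

section \<open>Enumerating the vectors in a window by buckets\<close>

definition bkt_body :: "vname \<Rightarrow> vname \<Rightarrow> vname \<Rightarrow> vname \<Rightarrow> vname \<Rightarrow> com" where
  "bkt_body nm hv av bv bn =
     Cond (Eq (Arr (CHR ''l'' # nm) (V ''j'')) (V hv))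
       (''k'' ::= (V av [*] (V ''md'' [*] Arr (CHR ''V'' # nm) (V ''j'') [+]
            (K 1 [-] V ''md'') [*] Arr (CHR ''S'' # nm) (V ''j'')) [+] V bv) [mod] V ''M'' ;;
        ''b'' ::= V ''rb'' [+] V ''k'' [div] V ''W'' ;;
        Store (CHR ''B'' # bn) (V ''b'' [*] V (CHR ''t'' # nm) [+] Arr (CHR ''C'' # bn) (V ''b'')) (V ''j'') ;;
        Store (CHR ''C'' # bn) (V ''b'') (Arr (CHR ''C'' # bn) (V ''b'') [+] K 1))
       Skip ;;
     ''j'' ::= V ''j'' [+] K 1"

definition bkt :: "vname \<Rightarrow> vname \<Rightarrow> vname \<Rightarrow> vname \<Rightarrow> vname \<Rightarrow> com" where
  "bkt nm hv av bv bn =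
     ''j'' ::= K 0 ;;
     While (Less (V ''j'') (V (CHR ''t'' # nm))) (bkt_body nm hv av bv bn)"

text \<open>Every bucket owns \<open>T\<close> consecutive cells, enough for the whole queue, so
  buckets cannot overlap. The sparse layout costs no time. Only the first \<open>C\<close> cells of
  a bucket are ever read, hence just the counters have to be fresh.\<close>

definition buckets :: "vname \<Rightarrow> int \<Rightarrow> nat \<Rightarrow> int \<Rightarrow> (int \<Rightarrow> nat list) \<Rightarrow> state \<Rightarrow> bool" where
  "buckets bn rb T P xs s \<longleftrightarrow> (\<forall>b. 0 \<le> b \<longrightarrow> b < P \<longrightarrow>
     arrs s (CHR ''C'' # bn) (rb + b) = int (length (xs b)) \<and>
     (\<forall>i<length (xs b). arrs s (CHR ''B'' # bn) ((rb + b) * int T + int i) = int (xs b ! i)))"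

lemma div_less_mult_int:
  fixes m W P :: int
  assumes "0 < W" "m < P * W"
  shows "m div W < P"
proof (rule ccontr)
  assume "\<not> m div W < P"
  then have "P * W \<le> m div W * W" using assms(1) by (intro mult_right_mono) auto
  also have "\<dots> \<le> m" using div_mult_mod_eq[of m W] pos_mod_sign[OF assms(1), of m] by linarith
  finally show False using assms(2) by simp
qed

lemma index_inj:
  fixes c c' :: int and i l T :: nat
  assumes "c * int T + int i = c' * int T + int l" "i < T" "l < T"
  shows "c = c' \<and> i = l"
proof -
  have "(c * int T + int i) div int T = c" "(c' * int T + int l) div int T = c'"
    using assms(2,3) by (auto intro!: int_div_pos_eq simp: mult.commute)
  then show ?thesis using assms(1) by auto
qed

definition bfilter :: "(nat \<Rightarrow> bool) \<Rightarrow> (nat \<Rightarrow> int) \<Rightarrow> nat \<Rightarrow> int \<Rightarrow> nat list" where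
  "bfilter leaf bk n b = filter (\<lambda>i. leaf i \<and> bk i = b) [0..<n]"

lemma bfilter_Suc:
  "bfilter leaf bk (Suc n) b = bfilter leaf bk n b @ (if leaf n \<and> bk n = b then [n] else [])"
  by (simp add: bfilter_def)

lemma bfilter_length: "length (bfilter leaf bk n b) \<le> n"
  using length_filter_le[of "\<lambda>i. leaf i \<and> bk i = b" "[0..<n]"] by (simp add: bfilter_def)

text \<open>A selection by arithmetic for \<open>md\<close> in \<open>{0, 1}\<close>. Being linear,
  it is additive over the two halves of a vector, as the bucket search requires.\<close>

definition lkey :: "int \<Rightarrow> int \<Rightarrow> int \<Rightarrow> int" where
  "lkey md S V' = md * V' + (1 - md) * S"

context machine begin

lemma bkt_exec:
  fixes nm bn hv av bv :: vname
  assumes s0: "bnd B s0" "vars s0 (CHR ''t'' # nm) = int T" "vars s0 hv = H" "vars s0 av = al" "vars s0 bv = be"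
      "vars s0 ''md'' = md" "vars s0 ''M'' = P * W" "vars s0 ''W'' = W" "vars s0 ''rb'' = rb"
    and pos: "0 < P" "0 < W" "0 \<le> rb" "rb + P \<le> B"
    and nms: "nm \<noteq> ''''" "bn \<noteq> ''''" "hv \<notin> {''j'', ''k'', ''b''}" "av \<notin> {''j'', ''k'', ''b''}" "bv \<notin> {''j'', ''k'', ''b''}"
    and C0: "\<And>b. 0 \<le> b \<Longrightarrow> b < P \<Longrightarrow> arrs s0 (CHR ''C'' # bn) (rb + b) = 0"
    and leaf: "\<And>j. leaf j \<longleftrightarrow> arrs s0 (CHR ''l'' # nm) (int j) = H"
    and bk: "\<And>j. bk j = ((al * lkey md (arrs s0 (CHR ''S'' # nm) (int j)) (arrs s0 (CHR ''V'' # nm) (int j)) + be) mod (P * W)) div W"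
  shows "\<exists>s'. exec w (bkt nm hv av bv bn) s0 (T * 20 + 10) s' \<and> bnd B s' \<and>
     buckets bn rb T P (bfilter leaf bk T) s' \<and>
     (\<forall>b. b \<notin> {rb..<rb + P} \<longrightarrow> arrs s' (CHR ''C'' # bn) b = arrs s0 (CHR ''C'' # bn) b)"
proof -
  let ?a = "''j'' ::= K 0" and ?b = "Less (V ''j'') (V (CHR ''t'' # nm))" and ?c = "bkt_body nm hv av bv bn"
  have TB: "int T \<le> B" "P * W \<le> B" using s0 by (auto simp: bnd_def dest: spec[of _ "CHR ''t'' # nm"] spec[of _ "''M''"])
  have B1: "1 \<le> B" using B2 by simp
  have bkr: "0 \<le> bk j \<and> bk j < P" for j
  proof -
    let ?m = "(al * lkey md (arrs s0 (CHR ''S'' # nm) (int j)) (arrs s0 (CHR ''V'' # nm) (int j)) + be) mod (P * W)"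
    have "0 \<le> ?m" "?m < P * W" using pos by (simp_all add: pos_mod_bound)
    then show ?thesis using pos div_less_mult_int[of W ?m P] by (simp add: bk pos_imp_zdiv_nonneg_iff)
  qed
  define s1 where "s1 = sx ?a s0"
  have e1: "exec w ?a s0 1 s1" "bnd B s1" using exec_sx[OF s0(1), of ?a] B2 by (auto simp: s1_def eok_def)
  have ag1: "agree ?c s0 s1" by (simp add: s1_def agree_def bkt_body_def)
  define I where "I s \<longleftrightarrow> (\<exists>j\<le>T. vars s ''j'' = int j \<and> buckets bn rb T P (bfilter leaf bk j) s \<and>
     (\<forall>b. b \<notin> {rb..<rb + P} \<longrightarrow> arrs s (CHR ''C'' # bn) b = arrs s0 (CHR ''C'' # bn) b))" for s
  define \<mu> where "\<mu> s = T - nat (vars s ''j'')" for s :: state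
  have "\<exists>s'. exec w (While ?b ?c) s1 (T * (ctime ?c + 2) + 1) s' \<and> bnd B s' \<and> I s' \<and> agree ?c s1 s' \<and> \<not> bval ?b s'"
  proof (rule while_sx[where I = I and \<mu> = \<mu>])
    show "bok B ?b" by (simp add: eok_def)
    show "cwf B ?c" using B1 by (simp add: bkt_body_def eok_def)
    show "bnd B s1" by fact
    show "I s1" unfolding I_def using C0 by (intro exI[of _ 0]) (simp add: s1_def buckets_def bfilter_def)
    show "\<mu> s1 \<le> T" by (simp add: \<mu>_def)
  next
    fix s assume s: "bnd B s" "I s" "agree ?c s1 s" "bval ?b s"
    from s(2) obtain j where j: "j \<le> T" "vars s ''j'' = int j" "buckets bn rb T P (bfilter leaf bk j) s"
      "\<And>b. b \<notin> {rb..<rb + P} \<Longrightarrow> arrs s (CHR ''C'' # bn) b = arrs s0 (CHR ''C'' # bn) b"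
      unfolding I_def by blast
    have ag: "agree ?c s0 s" using agree_trans[OF ag1 s(3)] .
    have t: "vars s (CHR ''t'' # nm) = int T" "vars s hv = H" "vars s av = al" "vars s bv = be" "vars s ''md'' = md"
      "vars s ''M'' = P * W" "vars s ''W'' = W" "vars s ''rb'' = rb"
      "arrs s (CHR ''l'' # nm) = arrs s0 (CHR ''l'' # nm)" "arrs s (CHR ''S'' # nm) = arrs s0 (CHR ''S'' # nm)"
      "arrs s (CHR ''V'' # nm) = arrs s0 (CHR ''V'' # nm)"
      using ag s0 nms by (auto simp: agree_def bkt_body_def)
    have jT: "j < T" using s(4) j t by simp
    show "sok B ?c s \<and> I (sx ?c s) \<and> \<mu> (sx ?c s) < \<mu> s"
    proof (cases "leaf j")
      case False
      have l: "arrs s0 (CHR ''l'' # nm) (int j) \<noteq> H" using False leaf by simp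
      have "I (sx ?c s)" unfolding I_def
        using j False jT t l by (intro exI[of _ "Suc j"]) (simp add: bkt_body_def bfilter_Suc buckets_def)
      then show ?thesis using l t j jT TB by (simp add: bkt_body_def \<mu>_def nat_add_distrib)
    next
      case True
      have l: "arrs s0 (CHR ''l'' # nm) (int j) = H" using True leaf by simp
      define k where "k = (al * (md * arrs s0 (CHR ''V'' # nm) (int j) + (1 - md) * arrs s0 (CHR ''S'' # nm) (int j)) + be) mod (P * W)"
      have kb: "k div W = bk j" by (simp add: bk k_def lkey_def)
      have kr: "0 \<le> k" "k < P * W" using pos by (simp_all add: k_def pos_mod_bound)
      let ?xs = "bfilter leaf bk j" and ?b = "bk j"
      have C: "arrs s (CHR ''C'' # bn) (rb + ?b) = int (length (?xs ?b))"
        using j(3) bkr[of j] by (simp add: buckets_def)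
      have lenj: "length (?xs b) \<le> j" for b by (rule bfilter_length)
      define s' where "s' = sx ?c s"
      have s'v: "vars s' ''j'' = int (Suc j)"
        using l t j kb by (simp add: s'_def bkt_body_def)
      have s'C: "arrs s' (CHR ''C'' # bn) = (arrs s (CHR ''C'' # bn))(rb + ?b := int (length (?xs ?b)) + 1)"
        using l t j kb C nms by (simp add: s'_def bkt_body_def flip: k_def)
      have s'B: "arrs s' (CHR ''B'' # bn) = (arrs s (CHR ''B'' # bn))((rb + ?b) * int T + int (length (?xs ?b)) := int j)"
        using l t j kb C nms by (simp add: s'_def bkt_body_def flip: k_def)
      have "sok B ?c s"
        using l t j kb C nms TB kr bkr[of j] pos jT lenj[of ?b] B1
        by (simp add: bkt_body_def flip: k_def)
      moreover have "I s'"
        unfolding I_def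
      proof (intro exI[of _ "Suc j"] conjI allI impI)
        show "Suc j \<le> T" using jT by simp
        show "vars s' ''j'' = int (Suc j)" by fact
        show "arrs s' (CHR ''C'' # bn) b = arrs s0 (CHR ''C'' # bn) b" if "b \<notin> {rb..<rb + P}" for b
          using that j(4)[OF that] bkr[of j] by (auto simp: s'C)
        show "buckets bn rb T P (bfilter leaf bk (Suc j)) s'"
          unfolding buckets_def
        proof (intro allI impI conjI)
          fix b assume b: "0 \<le> b" "b < P"
          show "arrs s' (CHR ''C'' # bn) (rb + b) = int (length (bfilter leaf bk (Suc j) b))"
            using True j(3) b by (auto simp: s'C bfilter_Suc buckets_def)
          fix i assume i: "i < length (bfilter leaf bk (Suc j) b)"
          show "arrs s' (CHR ''B'' # bn) ((rb + b) * int T + int i) = int (bfilter leaf bk (Suc j) b ! i)"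
          proof (cases "b = ?b \<and> i = length (?xs ?b)")
            case True2: True
            then show ?thesis using True by (simp add: s'B bfilter_Suc nth_append)
          next
            case F: False
            have il: "i < length (?xs b)" using i F True by (auto simp: bfilter_Suc split: if_splits)
            \<comment> \<open>The slot just written differs from all slots in use, because quotient
              and remainder by \<open>T\<close> identify the bucket and the position in it.\<close>
            have "\<not> ((rb + b) * int T + int i = (rb + ?b) * int T + int (length (?xs ?b)))"
            proof
              assume "(rb + b) * int T + int i = (rb + ?b) * int T + int (length (?xs ?b))"
              from index_inj[OF this] have "b = ?b \<and> i = length (?xs ?b)"
                using il lenj[of b] lenj[of ?b] jT by auto
              then show False using F by blast
            qed
            then have "arrs s' (CHR ''B'' # bn) ((rb + b) * int T + int i) = arrs s (CHR ''B'' # bn) ((rb + b) * int T + int i)"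
              by (simp add: s'B)
            also have "\<dots> = int (?xs b ! i)" using j(3) b il by (simp add: buckets_def)
            finally show ?thesis using il by (simp add: bfilter_Suc nth_append)
          qed
        qed
      qed
      moreover have "\<mu> s' < \<mu> s" using s'v j(2) jT by (simp add: \<mu>_def)
      ultimately show ?thesis by (simp add: s'_def)
    qed
  qed
  then obtain s' where s': "exec w (While ?b ?c) s1 (T * (ctime ?c + 2) + 1) s'" "bnd B s'" "I s'"
    "agree ?c s1 s'" "\<not> bval ?b s'" by blast
  have "exec w (bkt nm hv av bv bn) s0 (T * 20 + 10) s'"
    unfolding bkt_def by (rule exec_mono[OF exec_Seq[OF e1(1) s'(1)]]) (simp add: bkt_body_def)
  moreover from s'(3) obtain j where j: "j \<le> T" "vars s' ''j'' = int j" "buckets bn rb T P (bfilter leaf bk j) s'"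
      "\<And>b. b \<notin> {rb..<rb + P} \<Longrightarrow> arrs s' (CHR ''C'' # bn) b = arrs s0 (CHR ''C'' # bn) b"
      unfolding I_def by blast
  moreover have "vars s' (CHR ''t'' # nm) = int T"
    using agree_trans[OF ag1 s'(4)] s0(2) nms by (auto simp: agree_def bkt_body_def)
  then have "j = T" using s'(5) j by simp
  ultimately show ?thesis using s'(2) by blast
qed

end

text \<open>The counter \<open>p = 2 * j + q\<close> stands for probe \<open>q\<close> of entry
  \<open>j\<close>. The shift of the hash function is used by the first half of a vector only, so
  the bucket to be probed depends on the multiplier but not on the shift.\<close>

definition match_pre :: "vname \<Rightarrow> vname \<Rightarrow> com" where
  "match_pre nm2 av =
     ''j'' ::= V ''p'' [div] K 2 ;;
     ''k'' ::= (V av [*] (V ''md'' [*] Arr (CHR ''V'' # nm2) (V ''j'') [+]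
            (K 1 [-] V ''md'') [*] Arr (CHR ''S'' # nm2) (V ''j''))) [mod] V ''M'' ;;
     ''b'' ::= V ''rb'' [+] (K 2 [*] V ''P'' [-] V ''k'' [div] V ''W'' [-] V ''p'' [mod] K 2) [mod] V ''P''"

definition match_hit :: "vname \<Rightarrow> vname \<Rightarrow> vname \<Rightarrow> com" where
  "match_hit nm1 nm2 bn =
       ''g'' ::= Arr (CHR ''B'' # bn) (V ''b'' [*] V (CHR ''t'' # nm1) [+] V ''i'') ;;
        ''y'' ::= Arr (CHR ''S'' # nm1) (V ''g'') [+] Arr (CHR ''S'' # nm2) (V ''j'') ;;
        ''v'' ::= Arr (CHR ''V'' # nm1) (V ''g'') [+] Arr (CHR ''V'' # nm2) (V ''j'')"

text \<open>A nested iteration over probes and bucket contents in a single loop: each pass handles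
  one hit or moves to the next probe. The variable \<open>f\<close> is fuel, of which each hit
  consumes one unit.\<close>

definition match_body :: "vname \<Rightarrow> vname \<Rightarrow> vname \<Rightarrow> vname \<Rightarrow> vname \<Rightarrow> vname \<Rightarrow> vname \<Rightarrow> int \<Rightarrow> com" where
  "match_body nm1 nm2 hv av bn own oth sg =
     match_pre nm2 av ;;
     Cond (And (Eq (Arr (CHR ''l'' # nm2) (V ''j'')) (V hv)) (Less (V ''i'') (Arr (CHR ''C'' # bn) (V ''b''))))
       (match_hit nm1 nm2 bn ;; proc own oth sg ;;
        (''i'' ::= V ''i'' [+] K 1 ;; ''f'' ::= V ''f'' [-] K 1))
       (''p'' ::= V ''p'' [+] K 1 ;; ''i'' ::= K 0)"

definition match :: "vname \<Rightarrow> vname \<Rightarrow> vname \<Rightarrow> vname \<Rightarrow> vname \<Rightarrow> vname \<Rightarrow> vname \<Rightarrow> int \<Rightarrow> com" where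
  "match nm1 nm2 hv av bn own oth sg =
     (''p'' ::= K 0 ;; ''i'' ::= K 0 ;; ''f'' ::= V ''N'') ;;
     While (And (Less (V ''p'') (K 2 [*] V (CHR ''t'' # nm2))) (Less (K 0) (V ''f'')))
       (match_body nm1 nm2 hv av bn own oth sg)"

context machine begin

text \<open>The fuel gives a worst-case time bound, even for an unlucky hash function with crowded
  buckets. Soundness holds in any case; completeness is claimed only if the number of hits is below
  \<open>N\<close>.\<close>

lemma match_exec:
  fixes nm1 nm2 bn hv av own oth :: vname and N :: nat and sg :: int
  defines "c \<equiv> match_body nm1 nm2 hv av bn own oth sg"
  assumes s0: "bnd B s0" "vars s0 (CHR ''t'' # nm1) = int T1" "vars s0 (CHR ''t'' # nm2) = int T2"
      "vars s0 hv = H" "vars s0 av = al" "vars s0 ''N'' = int N" "vars s0 ''P'' = P"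
      "vars s0 ''md'' = md" "vars s0 ''M'' = P * W" "vars s0 ''W'' = W" "vars s0 ''rb'' = rb"
    and pos: "0 < P" "0 < W" "0 \<le> rb" "rb + P \<le> B" "2 * int T2 \<le> B" "\<bar>sg\<bar> \<le> B"
    and nms: "nm1 \<noteq> ''''" "nm2 \<noteq> ''''" "bn \<noteq> ''''" "own \<noteq> oth"
      "hv \<notin> {''j'', ''k'', ''b'', ''g'', ''y'', ''v'', ''i'', ''f'', ''p'', ''ok'', ''Z''}"
      "av \<notin> {''j'', ''k'', ''b'', ''g'', ''y'', ''v'', ''i'', ''f'', ''p'', ''ok'', ''Z''}"
    and bu: "buckets bn rb T1 P xs s0" "\<And>b. length (xs b) \<le> T1"
    and SV: "\<And>x. S1 x = arrs s0 (CHR ''S'' # nm1) (int x)" "\<And>x. V1 x = arrs s0 (CHR ''V'' # nm1) (int x)"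
      "\<And>x. S2 x = arrs s0 (CHR ''S'' # nm2) (int x)" "\<And>x. V2 x = arrs s0 (CHR ''V'' # nm2) (int x)"
    and items: "\<And>p. items p = (if arrs s0 (CHR ''l'' # nm2) (int (p div 2)) = H then
        xs ((2 * P - ((al * lkey md (S2 (p div 2)) (V2 (p div 2))) mod (P * W)) div W - int (p mod 2)) mod P) else [])"
    and G: "\<And>p x. p < 2 * T2 \<Longrightarrow> x \<in> set (items p) \<Longrightarrow> Gown (S1 x + S2 (p div 2)) (V1 x + V2 (p div 2)) \<and>
       \<bar>S1 x + S2 (p div 2)\<bar> \<le> B \<and> \<bar>V1 x + V2 (p div 2)\<bar> \<le> B"
    and inv: "tabinv own Gown s0" "tabinv oth Goth s0" "okinv Zg s0" "compat B Gown Goth sg Zg"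
  shows "\<exists>s'. exec w (match nm1 nm2 hv av bn own oth sg) s0 ((2 * T2 + N) * 40 + 10) s' \<and> bnd B s' \<and>
     tabinv own Gown s' \<and> tabinv oth Goth s' \<and> okinv Zg s' \<and> (vars s0 ''ok'' = 1 \<longrightarrow> vars s' ''ok'' = 1) \<and>
     ((\<Sum>p<2 * T2. length (items p)) < N \<longrightarrow>
       (\<forall>p<2 * T2. \<forall>x\<in>set (items p). arrs s' (CHR ''F'' # own) (S1 x + S2 (p div 2)) = 1 \<and>
          (arrs s0 (CHR ''F'' # oth) (S1 x + S2 (p div 2)) = 1 \<longrightarrow> vars s' ''ok'' = 1)))"
proof -
  let ?a = "''p'' ::= K 0 ;; ''i'' ::= K 0 ;; ''f'' ::= V ''N''"
  let ?b = "And (Less (V ''p'') (K 2 [*] V (CHR ''t'' # nm2))) (Less (K 0) (V ''f''))"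
  let ?L = "\<lambda>p. length (items p)"
  define tgt where "tgt p = (2 * P - ((al * lkey md (S2 (p div 2)) (V2 (p div 2))) mod (P * W)) div W - int (p mod 2)) mod P" for p
  have items': "items p = (if arrs s0 (CHR ''l'' # nm2) (int (p div 2)) = H then xs (tgt p) else [])" for p
    by (simp add: items tgt_def)
  have tgtr: "0 \<le> tgt p" "tgt p < P" for p using pos by (simp_all add: tgt_def pos_mod_bound)
  have TB: "int T1 \<le> B" "P * W \<le> B" "int N \<le> B" using s0 by (auto simp: bnd_def dest: spec[of _ "CHR ''t'' # nm1"] spec[of _ "''M''"] spec[of _ "''N''"])
  have B1: "1 \<le> B" using B2 by simp
  define s1 where "s1 = sx ?a s0"
  have e1: "exec w ?a s0 (ctime ?a) s1" "bnd B s1" using exec_sx[OF s0(1), of ?a] B2 s0(6) TB by (auto simp: s1_def eok_def)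
  have ag1: "agree c s0 s1" by (simp add: s1_def agree_def c_def match_body_def match_pre_def match_hit_def)
  define D where "D s p x \<longleftrightarrow> arrs s (CHR ''F'' # own) (S1 x + S2 (p div 2)) = 1 \<and>
     (arrs s0 (CHR ''F'' # oth) (S1 x + S2 (p div 2)) = 1 \<longrightarrow> vars s ''ok'' = 1)" for s :: state and p x
  define I where "I s \<longleftrightarrow> (\<exists>p i. vars s ''p'' = int p \<and> vars s ''i'' = int i \<and> p \<le> 2 * T2 \<and> (p < 2 * T2 \<longrightarrow> i \<le> ?L p) \<and>
     (p = 2 * T2 \<longrightarrow> i = 0) \<and> vars s ''f'' = int N - int ((\<Sum>q<p. ?L q) + i) \<and> 0 \<le> vars s ''f'' \<and>
     tabinv own Gown s \<and> tabinv oth Goth s \<and> okinv Zg s \<and>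
     (vars s0 ''ok'' = 1 \<longrightarrow> vars s ''ok'' = 1) \<and>
     (\<forall>q<p. \<forall>x\<in>set (items q). D s q x) \<and> (\<forall>i'<i. D s p (items p ! i')))" for s
  \<comment> \<open>Each pass uses up a probe or a unit of fuel.\<close>
  define \<mu> where "\<mu> s = (2 * T2 - nat (vars s ''p'')) + nat (vars s ''f'')" for s :: state
  have "\<exists>s'. exec w (While ?b c) s1 ((2 * T2 + N) * (ctime c + 2) + 1) s' \<and> bnd B s' \<and> I s' \<and> agree c s1 s' \<and> \<not> bval ?b s'"
  proof (rule while_sx[where I = I and \<mu> = \<mu>])
    show "bok B ?b" using B2 by (simp add: eok_def)
    show "cwf B c" using B2 pos by (simp add: c_def match_body_def match_pre_def match_hit_def eok_def proc_cwf)
    show "bnd B s1" by fact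
    show "I s1" unfolding I_def using inv s0(6) by (intro exI[of _ 0]) (simp add: s1_def tabinv_def okinv_def)
    show "\<mu> s1 \<le> 2 * T2 + N" by (simp add: \<mu>_def s1_def s0)
  next
    fix s assume s: "bnd B s" "I s" "agree c s1 s" "bval ?b s"
    from s(2) obtain p i where I: "vars s ''p'' = int p" "vars s ''i'' = int i" "p \<le> 2 * T2"
     "p < 2 * T2 \<Longrightarrow> i \<le> ?L p" "vars s ''f'' = int N - int ((\<Sum>q<p. ?L q) + i)"
     "tabinv own Gown s" "tabinv oth Goth s" "okinv Zg s" "vars s0 ''ok'' = 1 \<Longrightarrow> vars s ''ok'' = 1"
     "\<And>q x. q < p \<Longrightarrow> x \<in> set (items q) \<Longrightarrow> D s q x" "\<And>i'. i' < i \<Longrightarrow> D s p (items p ! i')"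
      unfolding I_def by blast
    have ag: "agree c s0 s" using agree_trans[OF ag1 s(3)] .
    have t: "vars s (CHR ''t'' # nm1) = int T1" "vars s (CHR ''t'' # nm2) = int T2" "vars s hv = H" "vars s av = al" "vars s ''md'' = md"
      "vars s ''M'' = P * W" "vars s ''W'' = W" "vars s ''rb'' = rb" "vars s ''P'' = P"
      using ag s0 nms unfolding agree_def c_def match_body_def match_pre_def match_hit_def by (auto simp: proc_agree)
    have ta:  "arrs s (CHR ''S'' # n) = arrs s0 (CHR ''S'' # n)" "arrs s (CHR ''V'' # n) = arrs s0 (CHR ''V'' # n)"
      "arrs s (CHR ''l'' # n) = arrs s0 (CHR ''l'' # n)"
      "arrs s (CHR ''B'' # n) = arrs s0 (CHR ''B'' # n)" "arrs s (CHR ''C'' # n) = arrs s0 (CHR ''C'' # n)"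
      "arrs s (CHR ''F'' # oth) = arrs s0 (CHR ''F'' # oth)" for n
      using ag nms unfolding agree_def c_def match_body_def match_pre_def match_hit_def by (auto simp: proc_agree)
    have pT: "p < 2 * T2" and f0: "0 < vars s ''f''" using s(4) I t by auto
    note iL = I(4)[OF pT]
    let ?j = "p div 2"
    define k where "k = (al * (md * V2 ?j + (1 - md) * S2 ?j)) mod (P * W)"
    have kr: "0 \<le> k" "k < P * W" using pos by (simp_all add: k_def pos_mod_bound)
    have pj: "int p div 2 = int ?j" "int p mod 2 = int (p mod 2)" by (simp_all add: zdiv_int zmod_int)
    have kt: "(2 * P - k div W - int (p mod 2)) mod P = tgt p" by (simp add: tgt_def k_def lkey_def)
    define s2 where "s2 = s\<lparr>vars := (vars s)(''j'' := int ?j, ''k'' := k, ''b'' := rb + tgt p)\<rparr>"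
    let ?g = "And (Eq (Arr (CHR ''l'' # nm2) (V ''j'')) (V hv)) (Less (V ''i'') (Arr (CHR ''C'' # bn) (V ''b'')))"
    have C: "arrs s0 (CHR ''C'' # bn) (rb + tgt p) = int (length (xs (tgt p)))"
      "\<And>i. i < length (xs (tgt p)) \<Longrightarrow> arrs s0 (CHR ''B'' # bn) ((rb + tgt p) * int T1 + int i) = int (xs (tgt p) ! i)"
      using bu tgtr by (simp_all add: buckets_def)
    have gv: "bval ?g s2 \<longleftrightarrow> i < ?L p"
      using t ta nms I C by (auto simp: s2_def items')
    have pre: "sx (match_pre nm2 av) s = s2"
      using t ta nms I pj by (simp add: s2_def SV match_pre_def flip: k_def[unfolded SV] add: kt)
    have jb: "int ?j \<le> B" "rb + tgt p \<le> B" "k \<le> B" "0 \<le> rb + tgt p" "2 * int T2 \<le> B" "int p < 2 * int T2"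
      using pT pos tgtr[of p] kr TB by linarith+
    have sokA: "sok B (match_pre nm2 av) s"
      using t ta nms I pj jb kr by (simp add: SV match_pre_def flip: k_def[unfolded SV] add: kt)
    show "sok B c s \<and> I (sx c s) \<and> \<mu> (sx c s) < \<mu> s"
    proof (cases "i < ?L p")
      case False
      have ng: "\<not> bval ?g s2" using False gv by blast
      let ?s = "s2\<lparr>vars := (vars s2)(''p'' := int p + 1, ''i'' := 0)\<rparr>"
      have sc: "sx c s = ?s"
        unfolding c_def match_body_def by (simp only: sx.simps pre ng if_False) (simp add: s2_def I)
      have "sok B c s"
        unfolding c_def match_body_def
        using I(1) jb B1 sokA by (simp only: sok.simps sx.simps pre ng if_False) (simp add: s2_def)
      moreover have "I ?s"
        unfolding I_def
      proof (rule exI[of _ "Suc p"], rule exI[of _ 0], intro conjI allI impI ballI)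
        show "Suc p \<le> 2 * T2" using pT by simp
        have "i = ?L p" using False iL by simp
        then show "vars ?s ''f'' = int N - int ((\<Sum>q<Suc p. ?L q) + 0)" using I(5) by (simp add: s2_def)
        show "0 \<le> vars ?s ''f''" using f0 by (simp add: s2_def)
        show "tabinv own Gown ?s" "tabinv oth Goth ?s" "okinv Zg ?s"
          using I by (auto simp: tabinv_def okinv_def s2_def)
        show "vars ?s ''ok'' = 1" if "vars s0 ''ok'' = 1" using I(9)[OF that] by (simp add: s2_def)
        fix q x assume q: "q < Suc p" "x \<in> set (items q)"
        have "D s q x"
        proof (cases "q = p")
          case True
          then show ?thesis using q(2) I(11) \<open>i = ?L p\<close> by (auto simp: in_set_conv_nth)
        next
          case False then show ?thesis using q I(10) by simp
        qed
        then show "D ?s q x" by (simp add: D_def s2_def)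
      qed (simp_all add: s2_def)
      moreover have "\<mu> ?s < \<mu> s" using I(1) pT by (simp add: \<mu>_def s2_def nat_add_distrib)
      ultimately show ?thesis unfolding sc by blast
    next
      case True
      define x where "x = items p ! i"
      have x: "x \<in> set (items p)" using True by (simp add: x_def)
      note Gx = G[OF pT x]
      have lf: "arrs s0 (CHR ''l'' # nm2) (int ?j) = H" "i < length (xs (tgt p))" "x = xs (tgt p) ! i"
        using True by (auto simp: items' x_def split: if_splits)
      have xb: "arrs s0 (CHR ''B'' # bn) ((rb + tgt p) * int T1 + int i) = int x"
        using C(2)[OF lf(2)] lf(3) by simp
      have xB: "\<bar>int x\<bar> \<le> B" using s0(1) xb unfolding bnd_def by metis
      define s3 where "s3 = s2\<lparr>vars := (vars s2)(''g'' := int x, ''y'' := S1 x + S2 ?j, ''v'' := V1 x + V2 ?j)\<rparr>"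
      have hit: "sx (match_hit nm1 nm2 bn) s2 = s3" and sokh: "sok B (match_hit nm1 nm2 bn) s2"
        using t ta nms I xb xB Gx by (simp_all add: match_hit_def s2_def s3_def SV)
      have v3: "vars s3 ''y'' = S1 x + S2 ?j" "vars s3 ''v'' = V1 x + V2 ?j" "vars s3 ''i'' = int i"
        "vars s3 ''f'' = vars s ''f''" "vars s3 ''p'' = int p" "vars s3 ''ok'' = vars s ''ok''" "arrs s3 = arrs s"
        using I by (simp_all add: s3_def s2_def)
      have pi: "tabinv own Gown s3" "tabinv oth Goth s3" "okinv Zg s3"
        using I by (auto simp: tabinv_def okinv_def s3_def s2_def)
      have G3: "Gown (vars s3 ''y'') (vars s3 ''v'')" "\<bar>vars s3 ''v''\<bar> \<le> B" using Gx v3 by auto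
      note PI = proc_inv[OF inv(4) G3(1) nms(4) pi G3(2) B1]
      let ?h = "''i'' ::= V ''i'' [+] K 1 ;; ''f'' ::= V ''f'' [-] K 1"
      let ?s = "sx ?h (sx (proc own oth sg) s3)"
      have sc: "sx c s = ?s"
        unfolding c_def match_body_def by (simp only: sx.simps pre gv True hit if_True)
      have iB: "int i + 1 \<le> B" using lf(2) bu(2)[of "tgt p"] TB by linarith
      have fB: "vars s ''f'' \<le> B" using I(5) TB by linarith
      have "sok B c s"
        unfolding c_def match_body_def
        using v3 iB f0 fB sokA sokh PI(1)
        by (simp only: sok.simps sx.simps pre gv True hit if_True) (simp add: proc_vars)
      moreover have "I ?s"
        unfolding I_def
      proof (rule exI[of _ p], rule exI[of _ "Suc i"], intro conjI allI impI ballI)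
        show "vars ?s ''p'' = int p" "vars ?s ''i'' = int (Suc i)" using v3 by (simp_all add: proc_vars)
        show "p \<le> 2 * T2" by fact
        show "Suc i \<le> ?L p" using True by simp
        show "Suc i = 0" if "p = 2 * T2" using that pT by simp
        show "vars ?s ''f'' = int N - int ((\<Sum>q<p. ?L q) + Suc i)" using I(5) v3 by (simp add: proc_vars)
        show "0 \<le> vars ?s ''f''" using f0 v3 by (simp add: proc_vars)
        show "tabinv own Gown ?s" "tabinv oth Goth ?s" "okinv Zg ?s"
          using PI by (auto simp: tabinv_def okinv_def)
        show "vars ?s ''ok'' = 1" if "vars s0 ''ok'' = 1" using I(9)[OF that] v3 by (simp add: proc_vars)
        have mono: "D s q x' \<Longrightarrow> D ?s q x'" for q x'
          using v3 by (simp add: D_def proc_vars proc_arrs)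
        show "D ?s q x'" if "q < p" "x' \<in> set (items q)" for q x' using mono[OF I(10)[OF that]] .
        show "D ?s p (items p ! i')" if "i' < Suc i" for i'
        proof (cases "i' = i")
          case False then show ?thesis using mono[OF I(11)] that by simp
        next
          case i': True
          have "D ?s p x" using v3 ta(6) by (simp add: D_def proc_vars proc_arrs)
          then show ?thesis by (simp add: i' x_def)
        qed
      qed
      moreover have "\<mu> ?s < \<mu> s" using I(1) v3 f0 by (simp add: \<mu>_def proc_vars)
      ultimately show ?thesis unfolding sc by blast
    qed
  qed
  then obtain s' where s': "exec w (While ?b c) s1 ((2 * T2 + N) * (ctime c + 2) + 1) s'" "bnd B s'" "I s'"
    "agree c s1 s'" "\<not> bval ?b s'" by blast
  have ct: "ctime c \<le> 36" by (simp add: c_def match_body_def match_pre_def match_hit_def proc_ctime)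
  have ex: "exec w (match nm1 nm2 hv av bn own oth sg) s0 ((2 * T2 + N) * 40 + 10) s'"
    unfolding match_def
  proof (rule exec_mono[OF exec_Seq[OF e1(1) s'(1)[unfolded c_def]]])
    have "(2 * T2 + N) * (ctime c + 2) \<le> (2 * T2 + N) * 40" using ct by (intro mult_le_mono2) simp
    then show "ctime (?a) + ((2 * T2 + N) * (ctime (match_body nm1 nm2 hv av bn own oth sg) + 2) + 1) + 1 \<le> (2 * T2 + N) * 40 + 10"
      unfolding c_def by simp
  qed
  from s'(3) obtain p i where I: "vars s' ''p'' = int p" "p \<le> 2 * T2" "vars s' ''f'' = int N - int ((\<Sum>q<p. ?L q) + i)"
     "p < 2 * T2 \<Longrightarrow> i \<le> ?L p" "p = 2 * T2 \<Longrightarrow> i = 0"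
     "tabinv own Gown s'" "tabinv oth Goth s'" "okinv Zg s'" "vars s0 ''ok'' = 1 \<Longrightarrow> vars s' ''ok'' = 1"
     "\<And>q x. q < p \<Longrightarrow> x \<in> set (items q) \<Longrightarrow> D s' q x"
      unfolding I_def by blast
  have t2: "vars s' (CHR ''t'' # nm2) = int T2"
    using agree_trans[OF ag1 s'(4)] s0 nms unfolding agree_def c_def match_body_def match_pre_def match_hit_def by (auto simp: proc_agree)
  have "D s' q x" if Y: "(\<Sum>p<2 * T2. ?L p) < N" and q: "q < 2 * T2" "x \<in> set (items q)" for q x
  proof -
    \<comment> \<open>With fewer than \<open>N\<close> hits the fuel is still positive at the end,
      so the loop must have stopped for lack of probes.\<close>
    have "p = 2 * T2"
    proof (rule ccontr)
      assume "p \<noteq> 2 * T2"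
      then have p: "p < 2 * T2" using I(2) by simp
      have "(\<Sum>q<p. ?L q) + i \<le> (\<Sum>q<Suc p. ?L q)" using I(4)[OF p] by simp
      also have "\<dots> \<le> (\<Sum>q<2 * T2. ?L q)" using p by (intro sum_mono2) auto
      finally have "(\<Sum>q<p. ?L q) + i < N" using Y by simp
      then have "0 < vars s' ''f''" unfolding I(3) by (simp only: of_nat_less_iff diff_gt_0_iff_gt)
      then show False using s'(5) I(1) t2 p by simp
    qed
    then show ?thesis using I(10) q by blast
  qed
  then show ?thesis using ex s'(2) I(6-9) unfolding D_def by blast
qed

end

section \<open>A hash family without primes\<close>

lemma card_mod_shift:
  fixes c M :: int
  assumes "S \<subseteq> {0..<M}"
  shows "card {\<beta>\<in>{0..<M}. (c + \<beta>) mod M \<in> S} = card S"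
proof -
  have inj: "inj_on (\<lambda>\<beta>. (c + \<beta>) mod M) {0..<M}"
  proof (rule inj_onI)
    fix x y assume xy: "x \<in> {0..<M}" "y \<in> {0..<M}" "(c + x) mod M = (c + y) mod M"
    then have "x mod M = y mod M" by (metis add_diff_cancel_left' mod_diff_left_eq)
    then show "x = y" using xy by simp
  qed
  have "(\<lambda>\<beta>. (c + \<beta>) mod M) ` {0..<M} = {0..<M}"
    by (rule endo_inj_surj[OF _ _ inj]) (auto simp: pos_mod_bound)
  then have ex: "\<exists>\<beta>\<in>{0..<M}. t = (c + \<beta>) mod M" if "t \<in> S" for t
    using that assms by blast
  have "(\<lambda>\<beta>. (c + \<beta>) mod M) ` {\<beta>\<in>{0..<M}. (c + \<beta>) mod M \<in> S} = S"
  proof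
    show "S \<subseteq> (\<lambda>\<beta>. (c + \<beta>) mod M) ` {\<beta>\<in>{0..<M}. (c + \<beta>) mod M \<in> S}"
    proof
      fix t assume "t \<in> S"
      with ex[OF this] show "t \<in> (\<lambda>\<beta>. (c + \<beta>) mod M) ` {\<beta>\<in>{0..<M}. (c + \<beta>) mod M \<in> S}" by blast
    qed
  qed blast
  moreover have "inj_on (\<lambda>\<beta>. (c + \<beta>) mod M) {\<beta>\<in>{0..<M}. (c + \<beta>) mod M \<in> S}"
    by (rule inj_on_subset[OF inj]) auto
  ultimately show ?thesis using card_image[of "\<lambda>\<beta>. (c + \<beta>) mod M" "{\<beta>\<in>{0..<M}. (c + \<beta>) mod M \<in> S}"] by (simp only:)
qed

lemma card_multiples:
  fixes a \<delta> W :: int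
  assumes "0 < \<delta>" "0 \<le> W"
  shows "finite {\<alpha>. a \<le> \<alpha> * \<delta> \<and> \<alpha> * \<delta> < a + W}" "int (card {\<alpha>. a \<le> \<alpha> * \<delta> \<and> \<alpha> * \<delta> < a + W}) \<le> W div \<delta> + 1"
proof -
  define c where "c = - ((- a) div \<delta>)"
  have c: "a \<le> c * \<delta>" "c * \<delta> < a + \<delta>"
    using div_mult_mod_eq[of "- a" \<delta>] pos_mod_sign[OF assms(1), of "- a"] pos_mod_bound[OF assms(1), of "- a"]
    by (simp_all add: c_def, linarith+)
  have sub: "{\<alpha>. a \<le> \<alpha> * \<delta> \<and> \<alpha> * \<delta> < a + W} \<subseteq> {c..c + W div \<delta>}"
  proof
    fix \<alpha> assume "\<alpha> \<in> {\<alpha>. a \<le> \<alpha> * \<delta> \<and> \<alpha> * \<delta> < a + W}"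
    then have \<alpha>: "a \<le> \<alpha> * \<delta>" "\<alpha> * \<delta> < a + W" by auto
    have "(c - 1) * \<delta> < \<alpha> * \<delta>" using c(2) \<alpha>(1) by (simp add: algebra_simps)
    then have "c \<le> \<alpha>" using assms(1) by (simp add: mult_less_cancel_right)
    moreover have "(\<alpha> - c) * \<delta> \<le> W" using c(1) \<alpha>(2) by (simp add: algebra_simps)
    then have "\<alpha> - c \<le> W div \<delta>" using zdiv_mono1[of "(\<alpha> - c) * \<delta>" W \<delta>] assms(1) by simp
    ultimately show "\<alpha> \<in> {c..c + W div \<delta>}" by simp
  qed
  show "finite {\<alpha>. a \<le> \<alpha> * \<delta> \<and> \<alpha> * \<delta> < a + W}" using sub finite_subset by blast
  have "card {\<alpha>. a \<le> \<alpha> * \<delta> \<and> \<alpha> * \<delta> < a + W} \<le> card {c..c + W div \<delta>}" using sub by (intro card_mono) auto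
  moreover have "0 \<le> W div \<delta>" using assms by (simp add: pos_imp_zdiv_nonneg_iff)
  ultimately show "int (card {\<alpha>. a \<le> \<alpha> * \<delta> \<and> \<alpha> * \<delta> < a + W}) \<le> W div \<delta> + 1" by simp
qed

text \<open>No inverse modulo \<open>P * W\<close> is needed. As \<open>\<alpha>\<close> runs
  through the residues, \<open>\<alpha> * \<delta>\<close> runs through \<open>\<delta>\<close>
  blocks of length \<open>P * W\<close>; in each it can lie near the two ends, in windows of width
  \<open>W\<close> that contain at most \<open>W div \<delta> + 1\<close> multiples of
  \<open>\<delta>\<close> each. The total is at most \<open>2 * (W + \<delta>)\<close>. This is
  where \<open>W\<close> must be at least the distance of the keys.\<close>

lemma card_near_multiples:
  fixes \<delta> W P :: int
  assumes "0 < \<delta>" "\<delta> \<le> W" "0 < P"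
  shows "int (card {\<alpha>\<in>{0..<P * W}. (\<alpha> * \<delta>) mod (P * W) < W \<or> P * W - W < (\<alpha> * \<delta>) mod (P * W)}) \<le> 4 * W"
proof -
  define M where "M = P * W"
  have W: "0 < W" using assms by simp
  have M: "0 < M" using assms W by (simp add: M_def)
  let ?A = "\<lambda>a. {\<alpha>. a \<le> \<alpha> * \<delta> \<and> \<alpha> * \<delta> < a + W}"
  let ?T = "{\<alpha>\<in>{0..<M}. (\<alpha> * \<delta>) mod M < W \<or> M - W < (\<alpha> * \<delta>) mod M}"
  have sub: "?T \<subseteq> (\<Union>j\<in>{0..<\<delta>}. ?A (j * M) \<union> ?A (j * M + M - W))"
  proof
    fix \<alpha> assume \<alpha>: "\<alpha> \<in> ?T"
    define j where "j = (\<alpha> * \<delta>) div M"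
    have e: "\<alpha> * \<delta> = j * M + (\<alpha> * \<delta>) mod M" by (simp add: j_def)
    have "\<alpha> * \<delta> < \<delta> * M" using \<alpha> assms(1) by (simp add: mult.commute)
    then have "j < \<delta>"
      using M by (metis j_def div_less_mult_int)
    moreover have "0 \<le> j" using \<alpha> assms(1) M by (simp add: j_def pos_imp_zdiv_nonneg_iff)
    moreover have "\<alpha> \<in> ?A (j * M) \<union> ?A (j * M + M - W)"
    proof -
      define m where "m = (\<alpha> * \<delta>) mod M"
      have "m < M" "0 \<le> m" "m < W \<or> M - W < m" using \<alpha> M by (simp_all add: m_def pos_mod_bound)
      then show ?thesis using e[folded m_def] by (simp only: Un_iff mem_Collect_eq) linarith
    qed
    ultimately show "\<alpha> \<in> (\<Union>j\<in>{0..<\<delta>}. ?A (j * M) \<union> ?A (j * M + M - W))" by auto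
  qed
  have fin: "finite (?A a)" for a using card_multiples(1)[OF assms(1)] W by simp
  have "card ?T \<le> card (\<Union>j\<in>{0..<\<delta>}. ?A (j * M) \<union> ?A (j * M + M - W))"
    by (rule card_mono[OF _ sub]) (use fin in blast)
  also have "\<dots> \<le> (\<Sum>j\<in>{0..<\<delta>}. card (?A (j * M) \<union> ?A (j * M + M - W)))" by (rule card_UN_le) simp
  also have "\<dots> \<le> (\<Sum>j\<in>{0..<\<delta>}. card (?A (j * M)) + card (?A (j * M + M - W)))" by (intro sum_mono card_Un_le)
  finally have "int (card ?T) \<le> int (\<Sum>j\<in>{0..<\<delta>}. card (?A (j * M)) + card (?A (j * M + M - W)))" by (simp only: of_nat_le_iff)
  also have "\<dots> = (\<Sum>j\<in>{0..<\<delta>}. int (card (?A (j * M))) + int (card (?A (j * M + M - W))))" by (simp only: of_nat_sum of_nat_add)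
  also have "\<dots> \<le> (\<Sum>j\<in>{0..<\<delta>}. (W div \<delta> + 1) + (W div \<delta> + 1))"
    by (intro sum_mono add_mono card_multiples(2)[OF assms(1)]) (use W in auto)
  also have "\<dots> = 2 * (\<delta> * (W div \<delta>)) + 2 * \<delta>" using assms(1) by (simp add: algebra_simps)
  also have "\<dots> \<le> 4 * W"
  proof -
    have "\<delta> * (W div \<delta>) \<le> W" using mult_div_mod_eq[of \<delta> W] pos_mod_sign[OF assms(1), of W] by linarith
    then show ?thesis using assms(2) by linarith
  qed
  finally show ?thesis by (simp add: M_def)
qed

definition passes :: "int \<Rightarrow> int \<Rightarrow> int \<times> int \<Rightarrow> int \<Rightarrow> bool" where
  "passes P W ab y \<longleftrightarrow> (fst ab * y + snd ab) mod (P * W) < W"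

definition hashes :: "int \<Rightarrow> int \<Rightarrow> (int \<times> int) set" where
  "hashes P W = {0..<P * W} \<times> {0..<P * W}"

lemma finite_hashes: "finite (hashes P W)" by (simp add: hashes_def)

lemma card_hashes: "0 < P \<Longrightarrow> 0 < W \<Longrightarrow> real (card (hashes P W)) = real_of_int (P * W) ^ 2"
  by (simp add: hashes_def card_cartesian_product power2_eq_square)

lemma Collect_Times_Sigma: "{ab \<in> A \<times> A'. Q (fst ab) (snd ab)} = (SIGMA a:A. {b\<in>A'. Q a b})"
  by auto

lemma card_Sigma_filter:
  "finite A \<Longrightarrow> finite A' \<Longrightarrow> card (SIGMA a:A. {b\<in>A'. Q a b}) = (\<Sum>a\<in>A. card {b\<in>A'. Q a b})"
  by (rule card_SigmaI) auto

lemma card_pass_shift: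
  assumes "0 < P" "0 < W"
  shows "card {\<beta>\<in>{0..<P * W}. (c + \<beta>) mod (P * W) < W} = nat W"
proof -
  have "{\<beta>\<in>{0..<P * W}. (c + \<beta>) mod (P * W) < W} = {\<beta>\<in>{0..<P * W}. (c + \<beta>) mod (P * W) \<in> {0..<W}}"
    using assms by auto
  moreover have "1 * W \<le> P * W" using assms by (intro mult_right_mono) auto
  ultimately show ?thesis using card_mod_shift[of "{0..<W}" "P * W" c] by simp
qed

text \<open>A fixed key passes with probability exactly \<open>1 / P\<close>: for each multiplier,
  \<open>W\<close> of the \<open>P * W\<close> shifts succeed.\<close>

lemma card_passes:
  assumes "0 < P" "0 < W"
  shows "real (card {ab\<in>hashes P W. passes P W ab y}) = real_of_int (P * W) * real_of_int W"
proof -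
  have "{ab\<in>hashes P W. passes P W ab y} = (SIGMA \<alpha>:{0..<P * W}. {\<beta>\<in>{0..<P * W}. (\<alpha> * y + \<beta>) mod (P * W) < W})"
    unfolding hashes_def passes_def by (rule Collect_Times_Sigma)
  then have "card {ab\<in>hashes P W. passes P W ab y} =
      (\<Sum>\<alpha>\<in>{0..<P * W}. card {\<beta>\<in>{0..<P * W}. (\<alpha> * y + \<beta>) mod (P * W) < W})"
    by (simp only:) (rule card_Sigma_filter; rule finite_atLeastLessThan_int)
  also have "\<dots> = (\<Sum>\<alpha>\<in>{0..<P * W}. nat W)" by (simp only: card_pass_shift[OF assms])
  also have "\<dots> = nat (P * W) * nat W" by simp
  finally have "real (card {ab\<in>hashes P W. passes P W ab y}) = real (nat (P * W)) * real (nat W)"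
    by (simp only: of_nat_mult)
  moreover have "real (nat (P * W)) = real_of_int (P * W)" "real (nat W) = real_of_int W" using assms by simp_all
  ultimately show ?thesis by (simp only:)
qed

text \<open>Two keys that pass have hash values less than \<open>W\<close> apart, so the multiple of
  their difference is near 0 modulo \<open>P * W\<close>, which leaves at most \<open>4 * W\<close>
  multipliers. Each of them admits \<open>W\<close> shifts. The joint probability is thus at most
  \<open>4 / P^2\<close>.\<close>

lemma card_passes2:
  assumes PW: "0 < P" "0 < W" and y: "y \<noteq> y'" "\<bar>y - y'\<bar> \<le> W"
  shows "real (card {ab\<in>hashes P W. passes P W ab y \<and> passes P W ab y'}) \<le> 4 * real_of_int W ^ 2"
proof -
  let ?M = "P * W"
  have main: "real (card {ab\<in>hashes P W. passes P W ab y \<and> passes P W ab y'}) \<le> 4 * real_of_int W ^ 2"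
    if d: "y' < y" "y - y' \<le> W" for y y'
  proof -
    define A where "A = {\<alpha>\<in>{0..<?M}. (\<alpha> * (y - y')) mod ?M < W \<or> ?M - W < (\<alpha> * (y - y')) mod ?M}"
    have M: "0 < ?M" using PW by simp
    have finA: "finite A" unfolding A_def by (rule finite_subset[OF Collect_restrict finite_atLeastLessThan_int])
    have "{ab\<in>hashes P W. passes P W ab y \<and> passes P W ab y'} \<subseteq>
       (SIGMA \<alpha>:A. {\<beta>\<in>{0..<?M}. (\<alpha> * y + \<beta>) mod ?M < W})"
    proof
      fix ab assume ab: "ab \<in> {ab\<in>hashes P W. passes P W ab y \<and> passes P W ab y'}"
      obtain \<alpha> \<beta> where e: "ab = (\<alpha>, \<beta>)" by (cases ab)
      define r r' where "r = (\<alpha> * y + \<beta>) mod ?M" and "r' = (\<alpha> * y' + \<beta>) mod ?M"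
      have r: "0 \<le> r" "r < W" "0 \<le> r'" "r' < W" using ab M by (auto simp: e r_def r'_def passes_def)
      have "(\<alpha> * (y - y')) mod ?M = (r - r') mod ?M"
        unfolding r_def r'_def mod_diff_eq by (simp add: right_diff_distrib)
      moreover have "(r - r') mod ?M = (if r' \<le> r then r - r' else ?M + (r - r'))"
      proof -
        have WM: "1 * W \<le> ?M" using PW by (intro mult_right_mono) auto
        show ?thesis
        proof (cases "r' \<le> r")
          case True
          have "(r - r') mod ?M = r - r'" by (rule mod_pos_pos_trivial) (use r True WM in linarith)+
          then show ?thesis using True by simp
        next
          case False
          have "(r - r') mod ?M = (r - r' + ?M) mod ?M" by simp
          also have "\<dots> = r - r' + ?M" by (rule mod_pos_pos_trivial) (use r False WM in linarith)+
          finally show ?thesis using False by simp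
        qed
      qed
      ultimately have "\<alpha> \<in> A" using ab r by (auto simp: A_def e hashes_def)
      then show "ab \<in> (SIGMA \<alpha>:A. {\<beta>\<in>{0..<?M}. (\<alpha> * y + \<beta>) mod ?M < W})"
        using ab by (auto simp: e hashes_def passes_def)
    qed
    then have "card {ab\<in>hashes P W. passes P W ab y \<and> passes P W ab y'} \<le>
       card (SIGMA \<alpha>:A. {\<beta>\<in>{0..<?M}. (\<alpha> * y + \<beta>) mod ?M < W})"
      by (rule card_mono[rotated], intro finite_SigmaI finite_subset[OF Collect_restrict finite_atLeastLessThan_int])
        (rule finA)
    also have "\<dots> = (\<Sum>\<alpha>\<in>A. card {\<beta>\<in>{0..<?M}. (\<alpha> * y + \<beta>) mod ?M < W})"
      by (rule card_Sigma_filter) (rule finA, rule finite_atLeastLessThan_int)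
    also have "\<dots> = card A * nat W" by (simp only: card_pass_shift[OF PW] sum_constant of_nat_id)
    finally have "real (card {ab\<in>hashes P W. passes P W ab y \<and> passes P W ab y'}) \<le> real (card A) * real_of_int W"
      using PW by (metis (mono_tags, lifting) of_nat_le_iff of_nat_mult of_nat_nat order_less_imp_le of_int_of_nat_eq)
    also have "real (card A) \<le> 4 * real_of_int W"
      using card_near_multiples[of "y - y'" W P] d PW unfolding A_def by linarith
    finally show ?thesis using PW by (simp add: power2_eq_square)
  qed
  show ?thesis
  proof (cases "y' < y")
    case True then show ?thesis using main y by simp
  next
    case False
    then show ?thesis using main[of y y'] y by (simp add: conj_commute)
  qed
qed

section \<open>Second moments\<close>

text \<open>Cauchy-Schwarz for the number of events that occur, summed over the union of the
  events.\<close>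

lemma second_moment:
  fixes Z :: "'e \<Rightarrow> 'w set"
  assumes fin: "finite E" "finite \<Omega>" "\<And>e. e \<in> E \<Longrightarrow> Z e \<subseteq> \<Omega>"
  shows "(\<Sum>e\<in>E. real (card (Z e)))\<^sup>2 \<le> real (card (\<Union>e\<in>E. Z e)) * (\<Sum>e\<in>E. \<Sum>e'\<in>E. real (card (Z e \<inter> Z e')))"
proof -
  define X where "X \<omega> = (\<Sum>e\<in>E. indicator (Z e) \<omega> :: real)" for \<omega>
  let ?U = "\<Union>e\<in>E. Z e"
  have finU: "finite ?U" using fin by (meson UN_least finite_subset)
  have ind: "(\<Sum>\<omega>\<in>?U. indicator A \<omega> :: real) = real (card A)" if "A \<subseteq> ?U" for A
    using that finU by (simp add: indicator_def of_bool_def sum.If_cases Int_absorb1)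
  have "(\<Sum>\<omega>\<in>?U. X \<omega>) = (\<Sum>e\<in>E. \<Sum>\<omega>\<in>?U. indicator (Z e) \<omega>)"
    unfolding X_def by (rule sum.swap)
  also have "\<dots> = (\<Sum>e\<in>E. real (card (Z e)))" by (intro sum.cong refl ind) auto
  finally have 1: "(\<Sum>\<omega>\<in>?U. X \<omega>) = (\<Sum>e\<in>E. real (card (Z e)))" .
  have "(\<Sum>\<omega>\<in>?U. (X \<omega>)\<^sup>2) = (\<Sum>\<omega>\<in>?U. \<Sum>e\<in>E. \<Sum>e'\<in>E. indicator (Z e \<inter> Z e') \<omega>)"
    by (simp add: X_def power2_eq_square sum_product indicator_inter_arith)
  also have "\<dots> = (\<Sum>e\<in>E. \<Sum>\<omega>\<in>?U. \<Sum>e'\<in>E. indicator (Z e \<inter> Z e') \<omega>)" by (rule sum.swap)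
  also have "\<dots> = (\<Sum>e\<in>E. \<Sum>e'\<in>E. \<Sum>\<omega>\<in>?U. indicator (Z e \<inter> Z e') \<omega>)" by (intro sum.cong refl sum.swap)
  also have "\<dots> = (\<Sum>e\<in>E. \<Sum>e'\<in>E. real (card (Z e \<inter> Z e')))" by (intro sum.cong refl ind) auto
  finally have 2: "(\<Sum>\<omega>\<in>?U. (X \<omega>)\<^sup>2) = (\<Sum>e\<in>E. \<Sum>e'\<in>E. real (card (Z e \<inter> Z e')))" .
  have "(\<Sum>\<omega>\<in>?U. 1 * X \<omega>)\<^sup>2 \<le> (\<Sum>\<omega>\<in>?U. 1\<^sup>2) * (\<Sum>\<omega>\<in>?U. (X \<omega>)\<^sup>2)" by (rule Cauchy_Schwarz_ineq_sum)
  then show ?thesis by (simp add: 1 2)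
qed

text \<open>In the second moment, pairs with equal keys pass jointly with probability
  \<open>1 / P\<close> and contribute at most 1 by the collision bound, pairs with distinct keys at
  most 4, relative to the square of the mean. Hence the constant 5.\<close>

lemma many_hashes_same:
  fixes y :: "'u \<Rightarrow> int"
  assumes U: "finite U" "U \<noteq> {}" and PW: "0 < P" "0 < W"
    and y: "\<And>u u'. u \<in> U \<Longrightarrow> u' \<in> U \<Longrightarrow> \<bar>y u - y u'\<bar> \<le> W"
    and S2: "real (card {(u, u'). u \<in> U \<and> u' \<in> U \<and> y u = y u'}) * real_of_int P \<le> (real (card U))\<^sup>2"
  shows "real_of_int (P * W) ^ 2 \<le> 5 * real (card {ab\<in>hashes P W. \<exists>u\<in>U. passes P W ab (y u)})"
proof -
  define Z where "Z u = {ab\<in>hashes P W. passes P W ab (y u)}" for u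
  let ?P = "real_of_int P" and ?W = "real_of_int W" and ?R = "real (card U)"
  let ?G = "{ab\<in>hashes P W. \<exists>u\<in>U. passes P W ab (y u)}"
  have pos: "0 < ?P" "0 < ?W" "0 < ?R" using PW U by (simp_all add: card_gt_0_iff)
  have G: "(\<Union>u\<in>U. Z u) = ?G" by (auto simp: Z_def)
  have cZ: "real (card (Z u)) = ?P * ?W * ?W" for u
    using card_passes[OF PW] by (simp add: Z_def)
  have cZ2: "real (card (Z u \<inter> Z u')) \<le> (if y u = y u' then ?P * ?W\<^sup>2 else 0) + 4 * ?W\<^sup>2"
    if "u \<in> U" "u' \<in> U" for u u'
  proof -
    have "Z u \<inter> Z u' = {ab\<in>hashes P W. passes P W ab (y u) \<and> passes P W ab (y u')}" by (auto simp: Z_def)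
    then show ?thesis
      using card_passes2[OF PW _ y[OF that]] cZ[of u] by (cases "y u = y u'") (auto simp: power2_eq_square Z_def)
  qed
  have "(\<Sum>u\<in>U. \<Sum>u'\<in>U. (if y u = y u' then ?P * ?W\<^sup>2 else 0)) =
      (\<Sum>uu\<in>U \<times> U. (if y (fst uu) = y (snd uu) then ?P * ?W\<^sup>2 else 0))"
    by (simp add: sum.cartesian_product case_prod_beta)
  also have "\<dots> = (\<Sum>uu\<in>{(u, u'). u \<in> U \<and> u' \<in> U \<and> y u = y u'}. ?P * ?W\<^sup>2)"
    using U by (intro sum.mono_neutral_cong_right) auto
  finally have s2: "(\<Sum>u\<in>U. \<Sum>u'\<in>U. (if y u = y u' then ?P * ?W\<^sup>2 else 0)) =
     real (card {(u, u'). u \<in> U \<and> u' \<in> U \<and> y u = y u'}) * ?P * ?W\<^sup>2" by simp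
  have "(\<Sum>u\<in>U. \<Sum>u'\<in>U. real (card (Z u \<inter> Z u'))) \<le>
     (\<Sum>u\<in>U. \<Sum>u'\<in>U. (if y u = y u' then ?P * ?W\<^sup>2 else 0) + 4 * ?W\<^sup>2)"
    by (intro sum_mono cZ2)
  also have "\<dots> = real (card {(u, u'). u \<in> U \<and> u' \<in> U \<and> y u = y u'}) * ?P * ?W\<^sup>2 + ?R\<^sup>2 * (4 * ?W\<^sup>2)"
    by (simp add: sum.distrib s2 power2_eq_square)
  also have "\<dots> \<le> ?R\<^sup>2 * ?W\<^sup>2 + ?R\<^sup>2 * (4 * ?W\<^sup>2)" using S2 by (intro add_mono mult_right_mono) auto
  finally have le: "(\<Sum>u\<in>U. \<Sum>u'\<in>U. real (card (Z u \<inter> Z u'))) \<le> 5 * (?R\<^sup>2 * ?W\<^sup>2)" by (simp add: mult.commute)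
  have "(?R * (?P * ?W * ?W))\<^sup>2 = (\<Sum>u\<in>U. real (card (Z u)))\<^sup>2" by (simp add: cZ)
  also have "\<dots> \<le> real (card (\<Union>u\<in>U. Z u)) * (\<Sum>u\<in>U. \<Sum>u'\<in>U. real (card (Z u \<inter> Z u')))"
    by (rule second_moment[OF U(1) finite_hashes]) (auto simp: Z_def)
  also have "\<dots> \<le> real (card ?G) * (5 * (?R\<^sup>2 * ?W\<^sup>2))" unfolding G by (intro mult_left_mono le) simp
  finally have "(?R\<^sup>2 * ?W\<^sup>2) * (?P * ?W)\<^sup>2 \<le> (?R\<^sup>2 * ?W\<^sup>2) * (5 * real (card ?G))"
    by (simp add: power_mult_distrib mult_ac)
  then have "(?P * ?W)\<^sup>2 \<le> 5 * real (card ?G)" using pos by (simp add: mult_le_cancel_left)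
  then show ?thesis by simp
qed

text \<open>The event of an edge is the product of two events, one for each end. Relative to the
  square of the mean, the diagonal contributes at most 1, pairs sharing one end 4 for each side by
  the degree bound, and all pairs together 16. This adds up to 25.\<close>

lemma many_hashes_independent:
  fixes y :: "'u \<Rightarrow> int" and y' :: "'v \<Rightarrow> int" and P :: nat
  assumes E: "finite E" "P ^ 2 \<le> card E" and PW: "0 < P" "0 < W"
    and deg: "\<And>u. card {e\<in>E. fst e = u} \<le> P" "\<And>v. card {e\<in>E. snd e = v} \<le> P"
    and y: "\<And>u u'. u \<in> fst ` E \<Longrightarrow> u' \<in> fst ` E \<Longrightarrow> u \<noteq> u' \<Longrightarrow> y u \<noteq> y u' \<and> \<bar>y u - y u'\<bar> \<le> W"
    and y': "\<And>v v'. v \<in> snd ` E \<Longrightarrow> v' \<in> snd ` E \<Longrightarrow> v \<noteq> v' \<Longrightarrow> y' v \<noteq> y' v' \<and> \<bar>y' v - y' v'\<bar> \<le> W"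
  shows "real_of_int (int P * W) ^ 4 \<le> 25 * real (card {ab\<in>hashes P W \<times> hashes P W.
     \<exists>(u, v)\<in>E. passes P W (fst ab) (y u) \<and> passes P W (snd ab) (y' v)})"
proof -
  define Zu where "Zu u = {ab\<in>hashes P W. passes P W ab (y u)}" for u
  define Zv where "Zv v = {ab\<in>hashes P W. passes P W ab (y' v)}" for v
  define Z where "Z e = Zu (fst e) \<times> Zv (snd e)" for e
  let ?P = "real P" and ?W = "real_of_int W" and ?m = "real (card E)"
  let ?G = "{ab\<in>hashes P W \<times> hashes P W. \<exists>(u, v)\<in>E. passes P W (fst ab) (y u) \<and> passes P W (snd ab) (y' v)}"
  have PW': "0 < int P" using PW by simp
  have pos: "0 < ?P" "0 < ?W" using PW by simp_all
  have "0 < P ^ 2" using PW by simp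
  then have m0: "0 < card E" using E(2) by linarith
  have mP: "?P ^ 2 \<le> ?m" using E(2) by (metis of_nat_le_iff of_nat_power)
  have G: "(\<Union>e\<in>E. Z e) = ?G" by (fastforce simp: Z_def Zu_def Zv_def)
  have cu: "real (card (Zu u)) = ?P * ?W\<^sup>2" "real (card (Zv v)) = ?P * ?W\<^sup>2" for u v
    using card_passes[OF PW' PW(2)] by (simp_all add: Zu_def Zv_def power2_eq_square)
  have c2u: "real (card (Zu u \<inter> Zu u')) \<le> (if u = u' then ?P * ?W\<^sup>2 else 0) + 4 * ?W\<^sup>2"
    if "u \<in> fst ` E" "u' \<in> fst ` E" for u u'
  proof (cases "u = u'")
    case True then show ?thesis using cu(1)[of u] by simp
  next
    case False
    have "Zu u \<inter> Zu u' = {ab\<in>hashes P W. passes P W ab (y u) \<and> passes P W ab (y u')}" by (auto simp: Zu_def)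
    then show ?thesis using False card_passes2[OF PW' PW(2)] y[OF that False] by simp
  qed
  have c2v: "real (card (Zv v \<inter> Zv v')) \<le> (if v = v' then ?P * ?W\<^sup>2 else 0) + 4 * ?W\<^sup>2"
    if "v \<in> snd ` E" "v' \<in> snd ` E" for v v'
  proof (cases "v = v'")
    case True then show ?thesis using cu(2)[of v] by simp
  next
    case False
    have "Zv v \<inter> Zv v' = {ab\<in>hashes P W. passes P W ab (y' v) \<and> passes P W ab (y' v')}" by (auto simp: Zv_def)
    then show ?thesis using False card_passes2[OF PW' PW(2)] y'[OF that False] by simp
  qed
  let ?c = "?P * ?W\<^sup>2" and ?a = "4 * ?W\<^sup>2"
  have c2: "real (card (Z e \<inter> Z e')) \<le> (if e' = e then ?c\<^sup>2 else 0) +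
      ?a * ?c * ((if fst e' = fst e then 1 else 0) + (if snd e' = snd e then 1 else 0)) + ?a\<^sup>2"
    if "e \<in> E" "e' \<in> E" for e e'
  proof -
    have "Z e \<inter> Z e' = (Zu (fst e) \<inter> Zu (fst e')) \<times> (Zv (snd e) \<inter> Zv (snd e'))" by (auto simp: Z_def)
    then have "real (card (Z e \<inter> Z e')) = real (card (Zu (fst e) \<inter> Zu (fst e'))) * real (card (Zv (snd e) \<inter> Zv (snd e')))"
      by (simp add: card_cartesian_product)
    also have "\<dots> \<le> ((if fst e = fst e' then ?c else 0) + ?a) * ((if snd e = snd e' then ?c else 0) + ?a)"
      using that pos by (intro mult_mono c2u c2v) auto
    also have "\<dots> = (if e' = e then ?c\<^sup>2 else 0) +
      ?a * ?c * ((if fst e' = fst e then 1 else 0) + (if snd e' = snd e then 1 else 0)) + ?a\<^sup>2"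
      by (auto simp: prod_eq_iff power2_eq_square algebra_simps)
    finally show ?thesis .
  qed
  have d1: "(\<Sum>e'\<in>E. (if fst e' = fst e then 1 else 0 :: real)) \<le> ?P" for e
    using deg(1)[of "fst e"] E(1) by (simp add: sum.If_cases Int_def)
  have d2: "(\<Sum>e'\<in>E. (if snd e' = snd e then 1 else 0 :: real)) \<le> ?P" for e
    using deg(2)[of "snd e"] E(1) by (simp add: sum.If_cases Int_def)
  have "(\<Sum>e\<in>E. \<Sum>e'\<in>E. real (card (Z e \<inter> Z e'))) \<le> (\<Sum>e\<in>E. ?c\<^sup>2 + ?a * ?c * (?P + ?P) + ?a\<^sup>2 * ?m)"
  proof (rule sum_mono)
    fix e assume e: "e \<in> E"
    have "(\<Sum>e'\<in>E. real (card (Z e \<inter> Z e'))) \<le> (\<Sum>e'\<in>E. (if e' = e then ?c\<^sup>2 else 0) +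
      ?a * ?c * ((if fst e' = fst e then 1 else 0) + (if snd e' = snd e then 1 else 0)) + ?a\<^sup>2)"
      by (intro sum_mono c2 e)
    also have "\<dots> = ?c\<^sup>2 + ?a * ?c * ((\<Sum>e'\<in>E. (if fst e' = fst e then 1 else 0)) +
       (\<Sum>e'\<in>E. (if snd e' = snd e then 1 else 0))) + ?a\<^sup>2 * ?m"
      using e E(1) by (simp add: sum.distrib sum_distrib_left[symmetric] mult.commute[of _ ?m])
    also have "\<dots> \<le> ?c\<^sup>2 + ?a * ?c * (?P + ?P) + ?a\<^sup>2 * ?m"
      using d1[of e] d2[of e] pos by (intro add_mono mult_left_mono order_refl) auto
    finally show "(\<Sum>e'\<in>E. real (card (Z e \<inter> Z e'))) \<le> ?c\<^sup>2 + ?a * ?c * (?P + ?P) + ?a\<^sup>2 * ?m" .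
  qed
  also have "\<dots> = 9 * (?P\<^sup>2 * (?m * ?W ^ 4)) + 16 * (?m\<^sup>2 * ?W ^ 4)"
    by (simp add: power2_eq_square power4_eq_xxxx algebra_simps)
  \<comment> \<open>The diagonal and the pairs with a common end are charged to
    \<open>P ^ 2\<close>, which is at most the number of edges.\<close>
  also have "\<dots> \<le> 9 * (?m * (?m * ?W ^ 4)) + 16 * (?m\<^sup>2 * ?W ^ 4)"
    using mP pos m0 by (intro add_mono mult_left_mono mult_right_mono order_refl) auto
  finally have le: "(\<Sum>e\<in>E. \<Sum>e'\<in>E. real (card (Z e \<inter> Z e'))) \<le> 25 * (?m\<^sup>2 * ?W ^ 4)"
    by (simp add: power2_eq_square)
  have "(?m * (?c * ?c))\<^sup>2 = (\<Sum>e\<in>E. real (card (Z e)))\<^sup>2" by (simp add: Z_def card_cartesian_product cu)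
  also have "\<dots> \<le> real (card (\<Union>e\<in>E. Z e)) * (\<Sum>e\<in>E. \<Sum>e'\<in>E. real (card (Z e \<inter> Z e')))"
    by (rule second_moment[OF E(1), of "hashes P W \<times> hashes P W"]) (auto simp: Z_def Zu_def Zv_def finite_hashes)
  also have "\<dots> \<le> real (card ?G) * (25 * (?m\<^sup>2 * ?W ^ 4))" unfolding G by (intro mult_left_mono le) simp
  finally have "(?m\<^sup>2 * ?W ^ 4) * (?P * ?W) ^ 4 \<le> (?m\<^sup>2 * ?W ^ 4) * (25 * real (card ?G))"
    by (simp add: power2_eq_square power4_eq_xxxx mult_ac)
  then have "(?P * ?W) ^ 4 \<le> 25 * real (card ?G)" using pos m0 by (simp add: mult_le_cancel_left)
  then show ?thesis by simp
qed

text \<open>If every fibre of \<open>y\<close> has at most \<open>P\<close> elements, the graph of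
  all collisions works: it has more than \<open>card U ^ 2 / P\<close> edges, and this is at least
  \<open>P ^ 2\<close>. Otherwise \<open>P\<close> elements of one large fibre form a complete graph
  with loops.\<close>

lemma collision_subgraph:
  fixes y :: "'u \<Rightarrow> int" and P :: nat
  assumes U: "finite U" and P: "P ^ 3 \<le> (card U)\<^sup>2"
    and S2: "\<not> real (card {(u, u'). u \<in> U \<and> u' \<in> U \<and> y u = y u'}) * real P \<le> (real (card U))\<^sup>2"
  shows "\<exists>E. E \<subseteq> {(u, u'). u \<in> U \<and> u' \<in> U \<and> y u = y u'} \<and> P ^ 2 \<le> card E \<and>
    (\<forall>u. card {e\<in>E. fst e = u} \<le> P) \<and> (\<forall>v. card {e\<in>E. snd e = v} \<le> P)"
proof (cases "\<forall>u\<in>U. card {u'\<in>U. y u' = y u} \<le> P")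
  case True
  let ?E = "{(u, u'). u \<in> U \<and> u' \<in> U \<and> y u = y u'}"
  have "real ((card U)\<^sup>2) < real (card ?E * P)" using S2 by simp
  then have "(card U)\<^sup>2 < card ?E * P" by (simp only: of_nat_less_iff)
  then have "P ^ 3 < card ?E * P" using P by (rule le_less_trans[rotated])
  then have lt: "P * P ^ 2 < P * card ?E" by (simp only: power3_eq_cube power2_eq_square mult_ac)
  then have "P ^ 2 < card ?E" by (simp only: nat_mult_less_cancel_disj)
  then have "P ^ 2 \<le> card ?E" by simp
  moreover have "card {e\<in>?E. fst e = u} \<le> P" for u
  proof (cases "u \<in> U")
    case T: True
    have "{e\<in>?E. fst e = u} = Pair u ` {u'\<in>U. y u' = y u}" using T by auto
    then show ?thesis using True T card_image_le[of "{u'\<in>U. y u' = y u}" "Pair u"] U by (auto intro: order_trans)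
  next
    case False
    then have "{e\<in>?E. fst e = u} = {}" by auto
    then show ?thesis by (simp only: card.empty)
  qed
  moreover have "card {e\<in>?E. snd e = v} \<le> P" for v
  proof (cases "v \<in> U")
    case T: True
    have "{e\<in>?E. snd e = v} = (\<lambda>u. (u, v)) ` {u'\<in>U. y u' = y v}" using T by auto
    then show ?thesis using True T card_image_le[of "{u'\<in>U. y u' = y v}" "\<lambda>u. (u, v)"] U by (auto intro: order_trans)
  next
    case False
    then have "{e\<in>?E. snd e = v} = {}" by auto
    then show ?thesis by (simp only: card.empty)
  qed
  ultimately show ?thesis by blast
next
  case False
  then obtain u where u: "u \<in> U" "P < card {u'\<in>U. y u' = y u}" by auto
  then obtain A where A: "A \<subseteq> {u'\<in>U. y u' = y u}" "card A = P"
    by (meson less_imp_le obtain_subset_with_card_n)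
  have fA: "finite A" using A(1) U by (auto intro: finite_subset)
  have "card {e\<in>A \<times> A. fst e = u} \<le> P" for u
  proof -
    have "{e\<in>A \<times> A. fst e = u} \<subseteq> Pair u ` A" by auto
    then have "card {e\<in>A \<times> A. fst e = u} \<le> card (Pair u ` A)" using fA by (intro card_mono) simp_all
    also have "\<dots> \<le> P" using card_image_le[OF fA] A(2) by blast
    finally show ?thesis .
  qed
  moreover have "card {e\<in>A \<times> A. snd e = v} \<le> P" for v
  proof -
    have "{e\<in>A \<times> A. snd e = v} \<subseteq> (\<lambda>u. (u, v)) ` A" by auto
    then have "card {e\<in>A \<times> A. snd e = v} \<le> card ((\<lambda>u. (u, v)) ` A)" using fA by (intro card_mono) simp_all
    also have "\<dots> \<le> P" using card_image_le[OF fA] A(2) by blast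
    finally show ?thesis .
  qed
  moreover have "A \<times> A \<subseteq> {(u, u'). u \<in> U \<and> u' \<in> U \<and> y u = y u'}"
  proof -
    have "\<forall>a\<in>A. a \<in> U \<and> y a = y u" using A(1) by blast
    then show ?thesis by auto
  qed
  moreover have "P ^ 2 \<le> card (A \<times> A)" by (simp add: A(2) card_cartesian_product power2_eq_square)
  ultimately show ?thesis by blast
qed

lemma sum_of_bool_card: "finite A \<Longrightarrow> (\<Sum>b\<in>A. of_bool (Q b) :: real) = real (card {b\<in>A. Q b})"
  by (simp add: sum.If_cases of_bool_def Int_def)

text \<open>Markov's inequality for the number of hits. Its mean is the number of pairs divided by
  \<open>P\<close>, because the target is determined by the multiplier while the shift spreads each
  key uniformly over the residues.\<close>

lemma bucket_markov:
  fixes K1 :: "'a \<Rightarrow> int" and tgt :: "int \<Rightarrow> 'b \<Rightarrow> int"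
  assumes PW: "0 < P" "0 < W" and fin: "finite D1" "finite D2"
    and tgt: "\<And>\<alpha> j. 0 \<le> tgt \<alpha> j \<and> tgt \<alpha> j < P"
  shows "real N * real (card {ab\<in>hashes P W.
     N \<le> (\<Sum>j\<in>D2. card {i\<in>D1. ((fst ab * K1 i + snd ab) mod (P * W)) div W = tgt (fst ab) j})}) \<le>
     real (card D1) * real (card D2) * (real_of_int P * (real_of_int W)\<^sup>2)"
proof -
  let ?M = "P * W"
  define hit where "hit ab i j \<longleftrightarrow> ((fst ab * K1 i + snd ab) mod ?M) div W = tgt (fst ab) j" for ab i j
  define Y where "Y ab = (\<Sum>j\<in>D2. card {i\<in>D1. hit ab i j})" for ab
  have Y: "real (Y ab) = (\<Sum>j\<in>D2. \<Sum>i\<in>D1. of_bool (hit ab i j))" for ab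
    using fin by (simp add: Y_def sum.If_cases of_bool_def Int_def)
  have one: "(\<Sum>ab\<in>hashes P W. of_bool (hit ab i j) :: real) = real_of_int P * (real_of_int W)\<^sup>2" for i j
  proof -
    \<comment> \<open>With the multiplier fixed, the target bucket is a fixed block of
      \<open>W\<close> residues, reached by exactly \<open>W\<close> shifts.\<close>
    have b: "card {\<beta>\<in>{0..<?M}. hit (\<alpha>, \<beta>) i j} = nat W" for \<alpha>
    proof -
      let ?t = "tgt \<alpha> j"
      have sub: "{?t * W..<?t * W + W} \<subseteq> {0..<?M}"
      proof -
        have "?t * W + W = (?t + 1) * W" by (simp add: algebra_simps)
        also have "\<dots> \<le> P * W" using tgt[of \<alpha> j] PW by (intro mult_right_mono) auto
        finally show ?thesis using tgt[of \<alpha> j] PW by auto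
      qed
      have dv: "r div W = ?t \<longleftrightarrow> r \<in> {?t * W..<?t * W + W}" for r
      proof
        assume "r div W = ?t"
        then show "r \<in> {?t * W..<?t * W + W}"
          using div_mult_mod_eq[of r W] pos_mod_sign[OF PW(2), of r] pos_mod_bound[OF PW(2), of r] by auto
      next
        assume "r \<in> {?t * W..<?t * W + W}"
        then show "r div W = ?t" using PW by (intro int_div_pos_eq[where r = "r - ?t * W"]) (auto simp: mult.commute)
      qed
      have "{\<beta>\<in>{0..<?M}. hit (\<alpha>, \<beta>) i j} = {\<beta>\<in>{0..<?M}. (\<alpha> * K1 i + \<beta>) mod ?M \<in> {?t * W..<?t * W + W}}"
        by (simp only: hit_def fst_conv snd_conv dv)
      then show ?thesis using card_mod_shift[OF sub, of "\<alpha> * K1 i"] by (simp only:) simp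
    qed
    have "(\<Sum>ab\<in>hashes P W. of_bool (hit ab i j) :: real) = (\<Sum>\<alpha>\<in>{0..<?M}. \<Sum>\<beta>\<in>{0..<?M}. of_bool (hit (\<alpha>, \<beta>) i j))"
      by (simp only: hashes_def sum.cartesian_product) (rule sum.cong[OF refl], clarify)
    also have "\<dots> = (\<Sum>\<alpha>\<in>{0..<?M}. real (card {\<beta>\<in>{0..<?M}. hit (\<alpha>, \<beta>) i j}))"
      by (intro sum.cong refl sum_of_bool_card finite_atLeastLessThan_int)
    also have "\<dots> = (\<Sum>\<alpha>\<in>{0..<?M}. real (nat W))" by (simp only: b)
    also have "\<dots> = real (nat ?M) * real (nat W)" by simp
    also have "\<dots> = real_of_int P * (real_of_int W)\<^sup>2" using PW by (simp add: power2_eq_square)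
    finally show ?thesis .
  qed
  have "real N * real (card {ab\<in>hashes P W. N \<le> Y ab}) = (\<Sum>ab\<in>{ab\<in>hashes P W. N \<le> Y ab}. real N)" by simp
  also have "\<dots> \<le> (\<Sum>ab\<in>{ab\<in>hashes P W. N \<le> Y ab}. real (Y ab))" by (intro sum_mono) auto
  also have "\<dots> \<le> (\<Sum>ab\<in>hashes P W. real (Y ab))" using finite_hashes by (intro sum_mono2) auto
  also have "\<dots> = (\<Sum>j\<in>D2. \<Sum>ab\<in>hashes P W. \<Sum>i\<in>D1. of_bool (hit ab i j))" unfolding Y by (rule sum.swap)
  also have "\<dots> = (\<Sum>j\<in>D2. \<Sum>i\<in>D1. \<Sum>ab\<in>hashes P W. of_bool (hit ab i j))" by (intro sum.cong refl sum.swap)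
  also have "\<dots> = real (card D1) * real (card D2) * (real_of_int P * (real_of_int W)\<^sup>2)" by (simp add: one)
  finally show ?thesis by (simp add: Y_def hit_def)
qed

text \<open>Write both residues as bucket times \<open>W\<close> plus remainder. If the sum falls
  into the window \<open>[0, W)\<close> modulo \<open>P * W\<close>, the bucket numbers add up to 0
  or -1 modulo \<open>P\<close>, the latter if the remainders produce a carry. These are the two
  probes.\<close>

lemma bucket_complete:
  fixes a b \<alpha> \<beta> P W :: int
  assumes PW: "0 < P" "0 < W" and pass: "(\<alpha> * (a + b) + \<beta>) mod (P * W) < W"
  shows "\<exists>q\<in>{0, 1}. ((\<alpha> * a + \<beta>) mod (P * W)) div W = (2 * P - ((\<alpha> * b) mod (P * W)) div W - q) mod P"
proof -
  let ?M = "P * W"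
  have M: "0 < ?M" using PW by simp
  define k1 k2 where "k1 = (\<alpha> * a + \<beta>) mod ?M" and "k2 = (\<alpha> * b) mod ?M"
  define b1 b2 where "b1 = k1 div W" and "b2 = k2 div W"
  define r1 r2 where "r1 = k1 mod W" and "r2 = k2 mod W"
  have k: "k1 = b1 * W + r1" "k2 = b2 * W + r2" by (simp_all add: b1_def b2_def r1_def r2_def)
  have r: "0 \<le> r1" "r1 < W" "0 \<le> r2" "r2 < W" using PW by (simp_all add: r1_def r2_def)
  have kr: "0 \<le> k1" "k1 < ?M" "0 \<le> k2" "k2 < ?M" using M by (simp_all add: k1_def k2_def pos_mod_bound)
  have br: "0 \<le> b1" "b1 < P" "0 \<le> b2" "b2 < P"
    using kr PW div_less_mult_int by (simp_all add: b1_def b2_def pos_imp_zdiv_nonneg_iff)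
  define m where "m = (k1 + k2) mod ?M"
  have "m = (\<alpha> * (a + b) + \<beta>) mod ?M"
    unfolding m_def k1_def k2_def mod_add_eq by (simp add: algebra_simps)
  then have m: "0 \<le> m" "m < W" using pass M by simp_all
  define t where "t = (k1 + k2) div ?M"
  have e: "k1 + k2 = t * ?M + m" unfolding m_def t_def by (rule div_mult_mod_eq[symmetric])
  have e2: "(b1 + b2 - t * P) * W = m - r1 - r2" using e k by (simp add: algebra_simps)
  have l1: "(b1 + b2 - t * P) * W < 1 * W" using e2 m r by simp
  have l2: "(- 2) * W < (b1 + b2 - t * P) * W" using e2 m r by simp
  have "b1 + b2 - t * P < 1" "- 2 < b1 + b2 - t * P"
    using l1 l2 PW by (simp_all only: mult_less_cancel_right_pos)
  then consider "b1 = t * P - b2" | "b1 = t * P - b2 - 1" by linarith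
  then show ?thesis
  proof cases
    case 1
    have "(2 * P - b2 - 0) mod P = (t * P - b2 + (2 - t) * P) mod P" by (simp add: algebra_simps)
    also have "\<dots> = b1" using 1 br by simp
    finally show ?thesis unfolding b1_def b2_def k1_def k2_def by (intro bexI[of _ 0]) auto
  next
    case 2
    have "(2 * P - b2 - 1) mod P = (t * P - b2 - 1 + (2 - t) * P) mod P" by (simp add: algebra_simps)
    also have "\<dots> = b1" using 2 br by simp
    finally show ?thesis unfolding b1_def b2_def k1_def k2_def by (intro bexI[of _ 1]) auto
  qed
qed

section \<open>Vectors\<close>

text \<open>The start \<open>o'\<close> and direction \<open>sg\<close> let the same sum serve whole
  vectors, their second halves, and suffixes read backwards.\<close>

definition dotg :: "(int \<Rightarrow> int) \<Rightarrow> int \<Rightarrow> int \<Rightarrow> int list \<Rightarrow> int" where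
  "dotg F o' sg c = (\<Sum>i<length c. c ! i * F (o' + sg * int i))"

abbreviation "dot F \<equiv> dotg F 0 1"

lemma psum_dotg: "psum F o' sg p = dotg F o' sg (map fst p)"
  by (simp add: psum_def dotg_def)

lemma sum_lessThan_add:
  fixes f :: "nat \<Rightarrow> int"
  shows "(\<Sum>i<m + n. f i) = (\<Sum>i<m. f i) + (\<Sum>i<n. f (m + i))"
  by (induction n) (simp_all add: add.assoc)

lemma dotg_append: "dotg F o' sg (c @ c') = dotg F o' sg c + dotg F (o' + sg * int (length c)) sg c'"
proof -
  have "(\<Sum>i<length c + length c'. (c @ c') ! i * F (o' + sg * int i)) =
    (\<Sum>i<length c. (c @ c') ! i * F (o' + sg * int i)) + (\<Sum>i<length c'. (c @ c') ! (length c + i) * F (o' + sg * int (length c + i)))"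
    by (rule sum_lessThan_add)
  then show ?thesis by (simp add: dotg_def nth_append algebra_simps)
qed

lemma dotg_rev: "dotg F o' 1 (rev c) = dotg F (o' + int (length c) - 1) (- 1) c"
proof -
  have "dotg F o' 1 (rev c) = (\<Sum>i<length c. c ! (length c - Suc i) * F (o' + int i))"
    by (simp add: dotg_def rev_nth)
  also have "\<dots> = (\<Sum>i<length c. c ! i * F (o' + int (length c - Suc i)))"
    by (subst sum.nat_diff_reindex[symmetric]) (intro sum.cong, auto)
  also have "\<dots> = dotg F (o' + int (length c) - 1) (- 1) c"
    by (simp add: dotg_def, intro sum.cong) (auto simp: of_nat_diff algebra_simps)
  finally show ?thesis .
qed

lemma dotg_diff:
  "length c = length c' \<Longrightarrow> dotg F o' sg (map2 (-) c c') = dotg F o' sg c - dotg F o' sg c'"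
  by (simp add: dotg_def left_diff_distrib sum_subtractf)

text \<open>The positions visited are distinct and \<open>F\<close> vanishes outside the input, so
  the bound holds for every start and every length.\<close>

lemma dotg_bound:
  assumes sg: "sg = 1 \<or> sg = - 1" and c: "\<And>v. v \<in> set c \<Longrightarrow> \<bar>v\<bar> \<le> d" "0 \<le> d"
    and F: "\<And>i. i \<notin> {0..<int n} \<Longrightarrow> F i = 0"
  shows "\<bar>dotg F o' sg c\<bar> \<le> d * (\<Sum>i<n. \<bar>F (int i)\<bar>)"
proof -
  have inj: "inj_on (\<lambda>i. o' + sg * int i) {..<length c}" using sg by (auto simp: inj_on_def)
  have "\<bar>dotg F o' sg c\<bar> \<le> (\<Sum>i<length c. \<bar>c ! i * F (o' + sg * int i)\<bar>)" unfolding dotg_def by (rule sum_abs)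
  also have "\<dots> \<le> (\<Sum>i<length c. d * \<bar>F (o' + sg * int i)\<bar>)"
    using c by (intro sum_mono) (auto simp: abs_mult intro!: mult_right_mono)
  also have "\<dots> = d * (\<Sum>i<length c. \<bar>F (o' + sg * int i)\<bar>)" by (simp add: sum_distrib_left)
  also have "(\<Sum>i<length c. \<bar>F (o' + sg * int i)\<bar>) = (\<Sum>j\<in>(\<lambda>i. o' + sg * int i) ` {..<length c}. \<bar>F j\<bar>)"
    by (simp add: sum.reindex[OF inj])
  also have "\<dots> = (\<Sum>j\<in>(\<lambda>i. o' + sg * int i) ` {..<length c} \<inter> {0..<int n}. \<bar>F j\<bar>)"
    using F by (intro sum.mono_neutral_right) auto
  also have "\<dots> \<le> (\<Sum>j\<in>{0..<int n}. \<bar>F j\<bar>)" by (intro sum_mono2) auto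
  also have "\<dots> = (\<Sum>i<n. \<bar>F (int i)\<bar>)"
    by (rule sum.reindex_bij_witness[of _ int nat]) auto
  finally show ?thesis using c(2) by (simp add: mult_left_mono)
qed

lemma digit_sum:
  fixes f :: "nat \<Rightarrow> int"
  assumes "2 \<le> b" "\<And>i. i < n \<Longrightarrow> 0 \<le> f i \<and> f i < b" "i < n"
  shows "((\<Sum>j<n. f j * b ^ j) div b ^ i) mod b = f i"
  using assms(2,3)
proof (induction n arbitrary: f i)
  case (Suc n)
  have e: "(\<Sum>j<Suc n. f j * b ^ j) = f 0 + b * (\<Sum>j<n. f (Suc j) * b ^ j)"
    by (subst sum.lessThan_Suc_shift) (simp add: sum_distrib_left mult_ac)
  show ?case
  proof (cases i)
    case 0
    then show ?thesis using Suc.prems(1)[of 0] by (simp only: e) simp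
  next
    case (Suc i')
    have "(f 0 + b * (\<Sum>j<n. f (Suc j) * b ^ j)) div b = (\<Sum>j<n. f (Suc j) * b ^ j)"
      using Suc.prems(1)[of 0] assms(1) by simp
    then have "(f 0 + b * (\<Sum>j<n. f (Suc j) * b ^ j)) div b ^ Suc i' = (\<Sum>j<n. f (Suc j) * b ^ j) div b ^ i'"
      using assms(1) by (simp add: zdiv_zmult2_eq)
    then show ?thesis using Suc.IH[of "\<lambda>j. f (Suc j)" i'] Suc.prems Suc unfolding e by simp
  qed
qed simp

text \<open>The weights of the code \<open>dot (powf d n) c\<close>, from which \<open>decode\<close> recovers \<open>c\<close>. Codes are additive, so the
  program handles vectors only through them.\<close>

definition powf :: "int \<Rightarrow> nat \<Rightarrow> int \<Rightarrow> int" where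
  "powf d n i = (if 0 \<le> i \<and> i < int n then (2 * d + 1) ^ nat i else 0)"

text \<open>The number \<open>((2 * d + 1) ^ n - 1) div 2\<close> has all digits equal to
  \<open>d\<close> in base \<open>2 * d + 1\<close>. Adding it turns balanced digits into ordinary
  ones.\<close>

lemma decode:
  assumes "1 \<le> d" "length c = n" "\<And>v. v \<in> set c \<Longrightarrow> \<bar>v\<bar> \<le> d" "i < n"
  shows "((dot (powf d n) c + ((2 * d + 1) ^ n - 1) div 2) div (2 * d + 1) ^ i) mod (2 * d + 1) - d = c ! i"
proof -
  let ?b = "2 * d + 1"
  have geo: "(\<Sum>j<m. 2 * d * ?b ^ j) = ?b ^ m - 1" for m
    by (induction m) (auto simp: algebra_simps)
  have "?b ^ n - 1 = 2 * (\<Sum>j<n. d * ?b ^ j)"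
    unfolding geo[symmetric] by (simp add: sum_distrib_left mult.assoc)
  then have "(?b ^ n - 1) div 2 = (\<Sum>j<n. d * ?b ^ j)" by simp
  moreover have "dot (powf d n) c = (\<Sum>j<n. c ! j * ?b ^ j)"
    using assms(2) by (auto simp: dotg_def powf_def intro!: sum.cong)
  ultimately have "dot (powf d n) c + (?b ^ n - 1) div 2 = (\<Sum>j<n. (c ! j + d) * ?b ^ j)"
    by (simp add: sum.distrib distrib_right)
  moreover have "\<bar>c ! j\<bar> \<le> d" if "j < n" for j using assms(2,3) that by simp
  then have "0 \<le> c ! j + d \<and> c ! j + d < ?b" if "j < n" for j using that by fastforce
  ultimately show ?thesis using digit_sum[of ?b n "\<lambda>j. c ! j + d" i] assms(1,4) by simp
qed

lemma code_inj:
  assumes "1 \<le> d" "length c = n" "length c' = n" "\<And>v. v \<in> set c \<union> set c' \<Longrightarrow> \<bar>v\<bar> \<le> d"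
    "dot (powf d n) c = dot (powf d n) c'"
  shows "c = c'"
proof (rule nth_equalityI)
  show "length c = length c'" using assms by simp
  show "c ! i = c' ! i" if "i < length c" for i
    using decode[of d c n i] decode[of d c' n i] assms that by simp
qed

lemma card_lists_nth:
  assumes "\<And>i. i < n \<Longrightarrow> finite (S i)"
  shows "card {u. length u = n \<and> (\<forall>i<n. u ! i \<in> S i)} = (\<Prod>i<n. card (S i)) \<and>
    finite {u. length u = n \<and> (\<forall>i<n. u ! i \<in> S i)}"
  using assms
proof (induction n)
  case 0
  have "{u. length u = 0 \<and> (\<forall>i<0. u ! i \<in> S i)} = {[]}" by auto
  then show ?case by simp
next
  case (Suc n)
  let ?A = "\<lambda>n. {u. length u = n \<and> (\<forall>i<n. u ! i \<in> S i)}"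
  have e: "?A (Suc n) = (\<lambda>(u, v). u @ [v]) ` (?A n \<times> S n)"
  proof
    show "?A (Suc n) \<subseteq> (\<lambda>(u, v). u @ [v]) ` (?A n \<times> S n)"
    proof
      fix u assume u: "u \<in> ?A (Suc n)"
      then have "u \<noteq> []" by auto
      then have l: "u = butlast u @ [last u]" by simp
      have "butlast u \<in> ?A n" using u by (auto simp: nth_butlast)
      moreover have "last u \<in> S n" using u \<open>u \<noteq> []\<close> by (auto simp: last_conv_nth)
      ultimately have m: "(butlast u, last u) \<in> ?A n \<times> S n" by blast
      show "u \<in> (\<lambda>(u, v). u @ [v]) ` (?A n \<times> S n)" by (rule image_eqI[OF _ m]) (simp add: l[symmetric])
    qed
    show "(\<lambda>(u, v). u @ [v]) ` (?A n \<times> S n) \<subseteq> ?A (Suc n)" by (auto simp: nth_append less_Suc_eq)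
  qed
  have inj: "inj_on (\<lambda>(u, v). u @ [v]) (?A n \<times> S n)" by (auto simp: inj_on_def)
  have IH: "card (?A n) = (\<Prod>i<n. card (S i))" "finite (?A n)" using Suc by auto
  have "card (?A (Suc n)) = card (?A n) * card (S n)" unfolding e by (simp add: card_image[OF inj] card_cartesian_product)
  moreover have "finite (?A (Suc n))" unfolding e using IH(2) Suc.prems by simp
  ultimately show ?case using IH(1) by simp
qed

lemma sum_prod_lists:
  fixes f :: "'a \<Rightarrow> int"
  assumes "finite A"
  shows "(\<Sum>p\<in>{p. set p \<subseteq> A \<and> length p = k}. \<Prod>v\<leftarrow>p. f v) = (\<Sum>v\<in>A. f v) ^ k"
proof (induction k)
  case 0
  have "{p. set p \<subseteq> A \<and> length p = 0} = {[]}" by auto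
  then show ?case by simp
next
  case (Suc k)
  let ?L = "{p. set p \<subseteq> A \<and> length p = k}"
  have e: "{p. set p \<subseteq> A \<and> length p = Suc k} = (\<lambda>(v, p). v # p) ` (A \<times> ?L)"
    by (auto simp: length_Suc_conv)
  have inj: "inj_on (\<lambda>(v, p). v # p) (A \<times> ?L)" by (auto simp: inj_on_def)
  have "(\<Sum>p\<in>{p. set p \<subseteq> A \<and> length p = Suc k}. \<Prod>v\<leftarrow>p. f v) = (\<Sum>(v, p)\<in>A \<times> ?L. f v * (\<Prod>v\<leftarrow>p. f v))"
    unfolding e sum.reindex[OF inj] by (simp add: case_prod_beta comp_def)
  also have "\<dots> = (\<Sum>v\<in>A. f v) * (\<Sum>p\<in>?L. \<Prod>v\<leftarrow>p. f v)" by (simp add: sum_product sum.cartesian_product)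
  finally show ?case using Suc by simp
qed

text \<open>Kraft's argument on each level: a path of length \<open>k\<close> has weight at least
  \<open>Q ^ k / N\<close>, while the weights of all lists of length \<open>k\<close> sum to
  \<open>Q ^ k\<close>. The root is counted separately, as its budget is not checked.\<close>

lemma card_paths_weighted:
  assumes fin: "finite vs" and Q: "0 < Q" "(\<Sum>v\<in>vs. snd v) = Q" and w: "\<And>v. v \<in> vs \<Longrightarrow> 0 \<le> snd v" and N: "1 \<le> N"
  shows "int (card (paths vs Q 1 N H)) \<le> int (Suc H) * N"
proof -
  let ?P = "\<lambda>k. {p\<in>paths vs Q 1 N H. length p = k}"
  have level: "int (card (?P k)) \<le> N" for k
  proof (cases "k = 0")
    case True
    have "?P k \<subseteq> {[]}" using True by auto
    then have "card (?P k) \<le> 1" using card_mono[of "{[]}" "?P k"] by simp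
    then show ?thesis using N by simp
  next
    case False
    let ?L = "{p. set p \<subseteq> vs \<and> length p = k}"
    have finL: "finite ?L" by (rule finite_lists_length_eq[OF fin])
    have nn: "0 \<le> (\<Prod>v\<leftarrow>p. snd v)" if "set p \<subseteq> vs" for p
      using that w by (induction p) auto
    have "int (card (?P k)) * Q ^ k = (\<Sum>p\<in>?P k. Q ^ k)" by simp
    also have "\<dots> \<le> (\<Sum>p\<in>?P k. N * (\<Prod>v\<leftarrow>p. snd v))"
    proof (rule sum_mono)
      fix p assume p: "p \<in> ?P k"
      then have "pden 1 Q (take k p) \<le> pnum N (take k p)" using False by (auto simp: paths_def)
      then show "Q ^ k \<le> N * (\<Prod>v\<leftarrow>p. snd v)" using p by (simp add: pden_def pnum_def)
    qed
    also have "\<dots> \<le> (\<Sum>p\<in>?L. N * (\<Prod>v\<leftarrow>p. snd v))"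
      using finL nn N by (intro sum_mono2) (auto simp: paths_def)
    also have "\<dots> = N * Q ^ k" using sum_prod_lists[OF fin, of snd k] Q by (simp add: sum_distrib_left[symmetric])
    finally show ?thesis using Q(1) by simp
  qed
  have "paths vs Q 1 N H \<subseteq> (\<Union>k\<in>{..H}. ?P k)" by (auto simp: paths_def)
  moreover have "finite (\<Union>k\<in>{..H}. ?P k)" using finite_paths[OF fin] by simp
  ultimately have "card (paths vs Q 1 N H) \<le> card (\<Union>k\<in>{..H}. ?P k)" by (intro card_mono)
  also have "\<dots> \<le> (\<Sum>k\<in>{..H}. card (?P k))" by (rule card_UN_le) simp
  finally have "int (card (paths vs Q 1 N H)) \<le> (\<Sum>k\<in>{..H}. int (card (?P k)))" by (simp flip: of_nat_sum)
  also have "\<dots> \<le> (\<Sum>k\<in>{..H}. N)" by (intro sum_mono level)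
  finally show ?thesis by simp
qed

text \<open>With \<open>Q\<close> and \<open>D0\<close> both 0 the denominators vanish and the
  budget test always succeeds. The same enumeration code thus produces full trees.\<close>

lemma paths_complete:
  assumes "\<And>v. v \<in> vs \<Longrightarrow> snd v = 1" "0 \<le> N"
  shows "paths vs 0 0 N H = {p. set p \<subseteq> vs \<and> length p \<le> H}"
proof -
  have "(\<Prod>v\<leftarrow>p. snd v) = 1" if "set p \<subseteq> vs" for p using that assms(1) by (induction p) auto
  then have "0 \<le> pnum N (take k p)" if "set p \<subseteq> vs" for p k
    using that assms(2) set_take_subset[of k p] by (auto simp: pnum_def)
  then show ?thesis unfolding paths_def pden_def by auto
qed

lemma card_paths_complete:
  assumes "\<And>v. v \<in> vs \<Longrightarrow> snd v = 1" "0 \<le> N" "finite vs" "1 \<le> card vs"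
  shows "card (paths vs 0 0 N H) \<le> Suc H * card vs ^ H"
proof -
  have "paths vs 0 0 N H = (\<Union>k\<in>{..H}. {p. set p \<subseteq> vs \<and> length p = k})"
    using paths_complete[of vs N H] assms(1,2) by auto
  then have "card (paths vs 0 0 N H) \<le> (\<Sum>k\<in>{..H}. card {p. set p \<subseteq> vs \<and> length p = k})"
    by (simp only:) (rule card_UN_le, simp)
  also have "\<dots> = (\<Sum>k\<in>{..H}. card vs ^ k)" using card_lists_length_eq[OF assms(3)] by simp
  also have "\<dots> \<le> (\<Sum>k\<in>{..H}. card vs ^ H)" using assms(4) by (intro sum_mono power_increasing) auto
  finally show ?thesis by simp
qed

text \<open>A heavy vector splits where its prefix just fails to be heavy enough for the budget \<open>N\<close>;
  the remaining suffix is then within the budget.\<close>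

lemma heavy_split:
  fixes f :: "nat \<Rightarrow> int" and N Q :: int
  assumes f: "\<And>i. i < n \<Longrightarrow> 1 \<le> f i \<and> f i \<le> Q" and N: "1 \<le> N" and heavy: "Q ^ Suc n \<le> N\<^sup>2 * (\<Prod>i<n. f i)"
  shows "\<exists>h\<le>n. (\<forall>k\<le>h. Q ^ k \<le> N * (\<Prod>i<k. f i)) \<and> (\<forall>k\<le>n - h. Q ^ k \<le> N * (\<Prod>i<k. f (n - Suc i)))"
proof (cases "n = 0")
  case True
  then show ?thesis using N by auto
next
  case n0: False
  have Q: "1 \<le> Q" using f[of 0] n0 by linarith
  let ?ok = "\<lambda>k. Q ^ k \<le> N * (\<Prod>i<k. f i)"
  have fpos: "1 \<le> (\<Prod>i\<in>A. f i)" if "A \<subseteq> {..<n}" for A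
    using prod_mono[of A "\<lambda>_. 1" f] f that by (auto simp: subset_iff)
  have down: "?ok k \<Longrightarrow> j \<le> k \<Longrightarrow> k \<le> n \<Longrightarrow> ?ok j" for j k
  proof (induction k)
    case (Suc k)
    show ?case
    proof (cases "j = Suc k")
      case True then show ?thesis using Suc by simp
    next
      case False
      have fk: "1 \<le> f k" "f k \<le> Q" using f[of k] Suc.prems by auto
      have p0: "0 \<le> N * (\<Prod>i<k. f i)" using fpos[of "{..<k}"] N Suc.prems by simp
      have "Q * Q ^ k \<le> (N * (\<Prod>i<k. f i)) * f k" using Suc.prems(1) by (simp add: mult_ac)
      also have "\<dots> \<le> (N * (\<Prod>i<k. f i)) * Q" using fk p0 by (intro mult_left_mono)
      finally have "?ok k" using Q by (simp add: mult.commute)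
      then show ?thesis using Suc False by simp
    qed
  qed simp
  define h where "h = (GREATEST k. k \<le> n \<and> ?ok k)"
  have ex: "0 \<le> n \<and> ?ok 0" using N by simp
  have h: "h \<le> n" "?ok h" using GreatestI_nat[of "\<lambda>k. k \<le> n \<and> ?ok k" 0 n] ex by (auto simp: h_def)
  have pre: "\<forall>k\<le>h. ?ok k" using down h by blast
  have revprod: "(\<Prod>i<k. f (n - Suc i)) = (\<Prod>i\<in>{n - k..<n}. f i)" if "k \<le> n" for k
    by (rule prod.reindex_bij_witness[of _ "\<lambda>i. n - Suc i" "\<lambda>i. n - Suc i"]) (use that in auto)
  \<comment> \<open>The extra factor \<open>Q\<close> in the hypothesis \<open>heavy\<close> pays
    for the one coordinate at which the prefix exceeds its budget.\<close>
  have full: "Q ^ (n - h) \<le> N * (\<Prod>i\<in>{h..<n}. f i)"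
  proof (cases "h = n")
    case True then show ?thesis using N by simp
  next
    case False
    then have hn: "h < n" using h by simp
    have "\<not> ?ok (Suc h)"
    proof
      assume "?ok (Suc h)"
      then have "Suc h \<le> h" unfolding h_def using hn by (intro Greatest_le_nat[where b = n]) (auto simp: h_def)
      then show False by simp
    qed
    then have a: "N * (\<Prod>i<h. f i) * f h < Q ^ Suc h" by (simp add: mult_ac)
    have Ph: "1 \<le> (\<Prod>i<h. f i)" using fpos[of "{..<h}"] hn by auto
    have Np: "0 < N * (\<Prod>i<h. f i)" using Ph N by simp
    have "N * (\<Prod>i<h. f i) * 1 \<le> N * (\<Prod>i<h. f i) * f h" using Np f[OF hn] by (intro mult_left_mono) auto
    then have a': "N * (\<Prod>i<h. f i) < Q ^ Suc h" using a by simp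
    have "Q ^ (n - h) * (N * (\<Prod>i<h. f i)) \<le> Q ^ (n - h) * Q ^ Suc h" using a' Q by (intro mult_left_mono) auto
    also have "\<dots> = Q ^ Suc n" using h by (simp flip: power_add)
    also have "\<dots> \<le> N\<^sup>2 * (\<Prod>i<n. f i)" by (rule heavy)
    also have "(\<Prod>i<n. f i) = (\<Prod>i<h. f i) * (\<Prod>i\<in>{h..<n}. f i)"
    proof -
      have "{..<h} \<union> {h..<n} = {..<n}" using h by auto
      moreover have "prod f ({..<h} \<union> {h..<n}) = prod f {..<h} * prod f {h..<n}"
        by (rule prod.union_disjoint) auto
      ultimately show ?thesis by (rule subst)
    qed
    finally have "Q ^ (n - h) * (N * (\<Prod>i<h. f i)) \<le> (N * (\<Prod>i\<in>{h..<n}. f i)) * (N * (\<Prod>i<h. f i))"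
      by (simp only: power2_eq_square mult_ac)
    then show ?thesis using Np by (simp only: mult_le_cancel_right_pos)
  qed
  \<comment> \<open>Shortening the suffix divides the left side by \<open>Q\<close> and the right
    side by a weight that is at most \<open>Q\<close>.\<close>
  have suf: "Q ^ k \<le> N * (\<Prod>i\<in>{n - k..<n}. f i)" if "k \<le> n - h" for k
    using that
  proof (induction "n - h - k" arbitrary: k)
    case 0
    then have "k = n - h" "n - k = h" using h by auto
    then show ?case using full by simp
  next
    case (Suc j)
    then have k: "Suc k \<le> n - h" "k < n" by auto
    have IH: "Q ^ Suc k \<le> N * (\<Prod>i\<in>{n - Suc k..<n}. f i)" using Suc k by (intro Suc.hyps) auto
    have e: "{n - Suc k..<n} = insert (n - Suc k) {n - k..<n}" using k by auto
    have fk: "1 \<le> f (n - Suc k)" "f (n - Suc k) \<le> Q" using f[of "n - Suc k"] k by auto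
    have "1 \<le> (\<Prod>i\<in>{n - k..<n}. f i)" by (rule fpos) auto
    then have p0: "0 \<le> N * (\<Prod>i\<in>{n - k..<n}. f i)" using N by simp
    have "Q ^ k * Q \<le> (N * (\<Prod>i\<in>{n - k..<n}. f i)) * f (n - Suc k)" using IH k unfolding e by (simp add: mult_ac)
    also have "\<dots> \<le> (N * (\<Prod>i\<in>{n - k..<n}. f i)) * Q" using fk p0 by (intro mult_left_mono)
    finally show ?case using Q by simp
  qed
  show ?thesis using h pre suf revprod by (intro exI[of _ h]) auto
qed

section \<open>Representations of a solution\<close>

definition setA :: "int \<Rightarrow> int set" where "setA d = {-(d - 1)..-1} \<union> {2..d}"
definition setB :: "int set" where "setB = {0, 1}"
definition setC :: "int \<Rightarrow> int set" where "setC d = {-d..-1} \<union> {1..d}"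

definition xfun :: "int list \<Rightarrow> int \<Rightarrow> int" where
  "xfun x i = (if 0 \<le> i \<and> i < int (length x) then x ! nat i else 0)"

text \<open>Every \<open>c\<close> in \<open>C = A - B\<close> has two representations as a difference, except \<open>\<plusminus>1\<close> and \<open>\<plusminus>d\<close>, which have
  one. The sets are exchanged in the second half, so that each of \<open>u\<close>, \<open>v\<close> runs through about
  \<open>(card A * card B) ^ (n / 2)\<close> vectors, and \<open>u - v\<close> always has its entries in \<open>C\<close>.\<close>

definition inU :: "int \<Rightarrow> nat \<Rightarrow> nat \<Rightarrow> int list \<Rightarrow> bool" where
  "inU d n h u \<longleftrightarrow> length u = n \<and> (\<forall>i<n. u ! i \<in> (if i < h then setA d else uminus ` setB))"

definition inV :: "int \<Rightarrow> nat \<Rightarrow> nat \<Rightarrow> int list \<Rightarrow> bool" where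
  "inV d n h v \<longleftrightarrow> length v = n \<and> (\<forall>i<n. v ! i \<in> (if i < h then setB else uminus ` setA d))"

definition extreme :: "int \<Rightarrow> int \<Rightarrow> bool" where
  "extreme d c \<longleftrightarrow> \<bar>c\<bar> = 1 \<or> \<bar>c\<bar> = d"

lemma setA_setB_diff: "3 \<le> d \<Longrightarrow> a \<in> setA d \<Longrightarrow> b \<in> setB \<Longrightarrow> a - b \<in> setC d"
  by (auto simp: setA_def setB_def setC_def)

lemma inU_bound: "3 \<le> d \<Longrightarrow> inU d n h u \<Longrightarrow> v \<in> set u \<Longrightarrow> \<bar>v\<bar> \<le> d"
  by (fastforce simp: inU_def in_set_conv_nth setA_def setB_def split: if_splits)

lemma inV_bound: "3 \<le> d \<Longrightarrow> inV d n h u \<Longrightarrow> v \<in> set u \<Longrightarrow> \<bar>v\<bar> \<le> d"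
  by (fastforce simp: inV_def in_set_conv_nth setA_def setB_def split: if_splits)

lemma diff_in_C:
  assumes "3 \<le> d" "inU d n h u" "inV d n h v"
  shows "set (map2 (-) u v) \<subseteq> setC d"
proof
  fix c assume "c \<in> set (map2 (-) u v)"
  then obtain i where i: "i < n" "c = u ! i - v ! i"
    using assms by (auto simp: in_set_conv_nth inU_def inV_def)
  show "c \<in> setC d"
  proof (cases "i < h")
    case True
    then have "u ! i \<in> setA d" "v ! i \<in> setB" using assms i(1) by (auto simp: inU_def inV_def)
    then show ?thesis using setA_setB_diff[OF assms(1)] i(2) by blast
  next
    case False
    then have "u ! i \<in> uminus ` setB" "v ! i \<in> uminus ` setA d" using assms i by (auto simp: inU_def inV_def)
    then obtain a b where "a \<in> setA d" "b \<in> setB" "u ! i = - b" "v ! i = - a" by blast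
    then show ?thesis using setA_setB_diff[OF assms(1), of a b] i by simp
  qed
qed

definition reps :: "int \<Rightarrow> nat \<Rightarrow> nat \<Rightarrow> int list \<Rightarrow> int list set" where
  "reps d n h c = {u. inU d n h u \<and> inV d n h (map2 (-) u c)}"

text \<open>The coordinates can be represented independently, so the number of representations is a
  product in which each coefficient that is not extreme contributes at least 2.\<close>

lemma reps_card:
  assumes d: "3 \<le> d" and c: "length c = n" "set c \<subseteq> setC d"
  shows "finite (reps d n h c) \<and> 2 ^ card {i\<in>{..<n}. \<not> extreme d (c ! i)} \<le> card (reps d n h c)"
proof -
  define S where "S i = (if i < h then {a \<in> setA d. a - c ! i \<in> setB} else {a \<in> uminus ` setB. a - c ! i \<in> uminus ` setA d})" for i
  have fin: "finite (S i)" for i by (auto simp: S_def setA_def setB_def)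
  have eq: "reps d n h c = {u. length u = n \<and> (\<forall>i<n. u ! i \<in> S i)}"
    using c(1) by (auto simp: reps_def inU_def inV_def S_def split: if_splits)
  have cC: "c ! i \<in> setC d" if "i < n" for i using c that by (metis nth_mem subsetD)
  have low: "(if extreme d (c ! i) then 1 else 2) \<le> card (S i)" if i: "i < n" for i
  proof -
    let ?c = "c ! i"
    have "\<exists>b\<in>setB. ?c + b \<in> setA d"
      using cC[OF i] d by (auto simp: setA_def setB_def setC_def)
    then obtain b where b: "b \<in> setB" "?c + b \<in> setA d" by blast
    have mem: "(if i < h then ?c + b else - b) \<in> S i" if "b \<in> setB" "?c + b \<in> setA d" for b
    proof (cases "i < h")
      case False
      have "- b - c ! i = - (c ! i + b)" by simp
      then have "- b - c ! i \<in> uminus ` setA d" using that(2) by blast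
      then show ?thesis using False that(1) by (simp add: S_def)
    qed (use that in \<open>simp add: S_def\<close>)
    show ?thesis
    proof (cases "extreme d ?c")
      case True
      have "S i \<noteq> {}" using mem[OF b] by blast
      then show ?thesis using True fin[of i] by (simp add: Suc_le_eq card_gt_0_iff)
    next
      case False
      \<comment> \<open>Away from the extremes, \<open>c\<close> and \<open>c + 1\<close> both lie
        in \<open>A\<close>, giving the choices 0 and 1 for the element of \<open>B\<close>.\<close>
      then have "?c + 0 \<in> setA d" "?c + 1 \<in> setA d" using cC[OF i] d by (auto simp: setA_def setC_def extreme_def)
      then have "{(if i < h then ?c + 0 else - 0), (if i < h then ?c + 1 else - 1)} \<subseteq> S i"
        using mem[of 0] mem[of 1] by (simp add: setB_def)
      then have "card {(if i < h then ?c + 0 else - 0), (if i < h then ?c + 1 else - 1)} \<le> card (S i)"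
        by (rule card_mono[OF fin])
      then show ?thesis using False by (cases "i < h") simp_all
    qed
  qed
  have "(2::nat) ^ card {i\<in>{..<n}. \<not> extreme d (c ! i)} = (\<Prod>i\<in>{i\<in>{..<n}. \<not> extreme d (c ! i)}. 2)" by simp
  also have "\<dots> = (\<Prod>i<n. if extreme d (c ! i) then 1 else 2)"
    by (rule prod.mono_neutral_cong_left) auto
  also have "\<dots> \<le> (\<Prod>i<n. card (S i))" using low by (intro prod_mono) auto
  also have "\<dots> = card (reps d n h c)" using card_lists_nth[of n S] fin eq by simp
  finally show ?thesis using card_lists_nth[of n S] fin eq by simp
qed

text \<open>A width that exceeds the distance of any two sums against \<open>x\<close> and of any two codes.\<close>

definition bigW :: "int \<Rightarrow> int list \<Rightarrow> int" where
  "bigW d x = 1 + (\<Sum>i<length x. 4 * d * (x ! i * x ! i + (2 * d + 1) ^ i))"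

lemma sum_xfun: "(\<Sum>i<length x. \<bar>xfun x (int i)\<bar>) = (\<Sum>i<length x. \<bar>x ! i\<bar>)"
  by (simp add: xfun_def)

lemma sum_powf: "1 \<le> d \<Longrightarrow> (\<Sum>i<n. \<bar>powf d n (int i)\<bar>) = (\<Sum>i<n. (2 * d + 1) ^ i)"
  by (simp add: powf_def)

text \<open>Squares stand in for absolute values in \<open>bigW\<close>, so that the machine obtains
  it by plain arithmetic.\<close>

lemma abs_le_square: "\<bar>a::int\<bar> \<le> a * a"
proof (cases "a = 0")
  case False
  then have "\<bar>a\<bar> * 1 \<le> \<bar>a\<bar> * \<bar>a\<bar>" by (intro mult_left_mono) auto
  then show ?thesis by simp
qed simp

lemma bigW_bounds:
  assumes "1 \<le> d"
  shows "1 \<le> bigW d x" "4 * d * (\<Sum>i<length x. \<bar>xfun x (int i)\<bar>) \<le> bigW d x"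
    "4 * d * (\<Sum>i<length x. \<bar>powf d (length x) (int i)\<bar>) \<le> bigW d x"
proof -
  have p: "0 < (2 * d + 1) ^ i" for i using assms by simp
  have "0 \<le> (\<Sum>i<length x. 4 * d * (x ! i * x ! i + (2 * d + 1) ^ i))"
    by (rule sum_nonneg, rule mult_nonneg_nonneg, use assms in simp, rule add_nonneg_nonneg, rule zero_le_square)
      (use p in \<open>simp add: less_imp_le\<close>)
  then show "1 \<le> bigW d x" by (simp add: bigW_def)
  have "4 * d * (\<Sum>i<length x. \<bar>x ! i\<bar>) \<le> (\<Sum>i<length x. 4 * d * (x ! i * x ! i + (2 * d + 1) ^ i))"
    unfolding sum_distrib_left using assms abs_le_square p
    by (intro sum_mono mult_left_mono) (auto simp: add_increasing2 less_imp_le)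
  then show "4 * d * (\<Sum>i<length x. \<bar>xfun x (int i)\<bar>) \<le> bigW d x" unfolding sum_xfun by (simp add: bigW_def)
  have "4 * d * (\<Sum>i<length x. (2 * d + 1) ^ i) \<le> (\<Sum>i<length x. 4 * d * (x ! i * x ! i + (2 * d + 1) ^ i))"
    unfolding sum_distrib_left using assms
    by (intro sum_mono mult_left_mono) auto
  then show "4 * d * (\<Sum>i<length x. \<bar>powf d (length x) (int i)\<bar>) \<le> bigW d x"
    unfolding sum_powf[OF assms] by (simp add: bigW_def)
qed

text \<open>The factor 4 leaves room for differences: any two values, be they sums or codes, are
  less than the width apart or equal to it, as the hash family demands.\<close>

lemma dotg_le_bigW:
  assumes "1 \<le> d" "sg = 1 \<or> sg = - 1" "\<And>v. v \<in> set c \<Longrightarrow> \<bar>v\<bar> \<le> d"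
  shows "4 * \<bar>dotg (xfun x) o' sg c\<bar> \<le> bigW d x" "4 * \<bar>dotg (powf d (length x)) o' sg c\<bar> \<le> bigW d x"
proof -
  have "\<bar>dotg (xfun x) o' sg c\<bar> \<le> d * (\<Sum>i<length x. \<bar>xfun x (int i)\<bar>)"
    using assms by (intro dotg_bound) (auto simp: xfun_def)
  then show "4 * \<bar>dotg (xfun x) o' sg c\<bar> \<le> bigW d x" using bigW_bounds(2)[OF assms(1), of x] by linarith
  have "\<bar>dotg (powf d (length x)) o' sg c\<bar> \<le> d * (\<Sum>i<length x. \<bar>powf d (length x) (int i)\<bar>)"
    using assms by (intro dotg_bound) (auto simp: powf_def)
  then show "4 * \<bar>dotg (powf d (length x)) o' sg c\<bar> \<le> bigW d x" using bigW_bounds(3)[OF assms(1), of x] by linarith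
qed

text \<open>No solution is mentioned: every pair \<open>u\<close>, \<open>v\<close> with equal sums
  yields one, and it may differ from the solution whose existence was assumed.\<close>

definition goodt :: "int \<Rightarrow> int list \<Rightarrow> int \<Rightarrow> int \<Rightarrow> int \<Rightarrow> int \<times> int \<Rightarrow> int \<times> int \<Rightarrow> bool" where
  "goodt d x P W md ab cd \<longleftrightarrow> (\<exists>u v. inU d (length x) (length x div 2) u \<and> inV d (length x) (length x div 2) v \<and>
     dot (xfun x) u = dot (xfun x) v \<and>
     passes P W ab (lkey md (dot (xfun x) u) (dot (powf d (length x)) u)) \<and>
     passes P W cd (lkey md (dot (xfun x) v) (dot (powf d (length x)) v)))"

text \<open>Let \<open>U\<close> be the set of representations. If few of them have equal sums, the
  common value of \<open>u\<close> and \<open>u - c\<close> is a good key. Otherwise an edge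
  \<open>(u, u')\<close> of the collision graph is used as the pair \<open>u\<close>,
  \<open>u' - c\<close>, whose sums agree since \<open>c\<close> has sum 0. Codes are injective, so
  distinct vertices have distinct keys there.\<close>

lemma light_hashes:
  fixes P :: nat
  assumes d: "3 \<le> d" and c: "length c = length x" "set c \<subseteq> setC d" "dot (xfun x) c = 0"
    and P: "0 < P" "P ^ 3 \<le> (2 ^ card {i\<in>{..<length x}. \<not> extreme d (c ! i)})\<^sup>2"
  defines "W \<equiv> bigW d x"
  shows "real_of_int (int P * W) ^ 2 \<le> 5 * real (card {ab\<in>hashes P W. goodt d x P W 0 ab ab}) \<or>
    real_of_int (int P * W) ^ 4 \<le> 25 * real (card {t\<in>hashes P W \<times> hashes P W. goodt d x P W 1 (fst t) (snd t)})"
proof -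
  let ?n = "length x" and ?h = "length x div 2" and ?X = "xfun x" and ?E = "powf d (length x)"
  define U where "U = reps d ?n ?h c"
  have U: "finite U" "2 ^ card {i\<in>{..<?n}. \<not> extreme d (c ! i)} \<le> card U"
    using reps_card[OF d c(1,2), of ?h] by (auto simp: U_def)
  have PU: "P ^ 3 \<le> (card U)\<^sup>2" using P(2) power_mono[OF U(2), of 2] by linarith
  have "(0::nat) < 2 ^ card {i\<in>{..<?n}. \<not> extreme d (c ! i)}" by simp
  then have "0 < card U" using U(2) by linarith
  then have Une: "U \<noteq> {}" by auto
  have d1: "1 \<le> d" using d by simp
  have W: "0 < W" using bigW_bounds(1)[OF d1, of x] by (simp add: W_def)
  have bU: "4 * \<bar>dot ?X u\<bar> \<le> W" "4 * \<bar>dot ?E u\<bar> \<le> W" if "inU d ?n ?h u" for u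
    unfolding W_def by (rule dotg_le_bigW[OF d1], simp, rule inU_bound[OF d that], assumption)+
  have bV: "4 * \<bar>dot ?E u\<bar> \<le> W" if "inV d ?n ?h u" for u
    unfolding W_def by (rule dotg_le_bigW[OF d1], simp, rule inV_bound[OF d that], assumption)+
  have Up: "inU d ?n ?h u" "inV d ?n ?h (map2 (-) u c)" "dot ?X (map2 (-) u c) = dot ?X u" if "u \<in> U" for u
  proof -
    show u: "inU d ?n ?h u" "inV d ?n ?h (map2 (-) u c)" using that by (auto simp: U_def reps_def)
    then have "length u = length c" using c(1) by (simp add: inU_def)
    then show "dot ?X (map2 (-) u c) = dot ?X u" using c(3) by (simp add: dotg_diff)
  qed
  have inj: "u = u'" if "u \<in> U" "u' \<in> U" "dot ?E u = dot ?E u'" for u u'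
  proof (rule code_inj[OF d1 _ _ _ that(3)])
    show "length u = length x" "length u' = length x" using Up(1)[OF that(1)] Up(1)[OF that(2)] by (auto simp: inU_def)
    show "\<bar>v\<bar> \<le> d" if "v \<in> set u \<union> set u'" for v
      using inU_bound[OF d Up(1)[OF \<open>u \<in> U\<close>]] inU_bound[OF d Up(1)[OF \<open>u' \<in> U\<close>]] that by blast
  qed
  show ?thesis
  proof (cases "real (card {(u, u'). u \<in> U \<and> u' \<in> U \<and> dot ?X u = dot ?X u'}) * real P \<le> (real (card U))\<^sup>2")
    case True
    have "real_of_int (int P * W) ^ 2 \<le> 5 * real (card {ab\<in>hashes P W. \<exists>u\<in>U. passes P W ab (dot ?X u)})"
    proof (rule many_hashes_same[OF U(1) Une])
      show "\<bar>dot ?X u - dot ?X u'\<bar> \<le> W" if "u \<in> U" "u' \<in> U" for u u'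
        using bU(1)[OF Up(1)[OF that(1)]] bU(1)[OF Up(1)[OF that(2)]] by linarith
    qed (use P W True in auto)
    also have "card {ab\<in>hashes P W. \<exists>u\<in>U. passes P W ab (dot ?X u)} \<le> card {ab\<in>hashes P W. goodt d x P W 0 ab ab}"
    proof (rule card_mono)
      show "finite {ab\<in>hashes P W. goodt d x P W 0 ab ab}" using finite_hashes by simp
      show "{ab\<in>hashes P W. \<exists>u\<in>U. passes P W ab (dot ?X u)} \<subseteq> {ab\<in>hashes P W. goodt d x P W 0 ab ab}"
      proof clarify
        fix al be u assume a: "(al, be) \<in> hashes P W" "u \<in> U" "passes P W (al, be) (dot ?X u)"
        show "goodt d x P W 0 (al, be) (al, be)"
          unfolding goodt_def lkey_def using Up[OF a(2)] a(3)
          by - (rule exI[of _ u], rule exI[of _ "map2 (-) u c"], simp)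
      qed
    qed
    finally show ?thesis by simp
  next
    case False
    from collision_subgraph[OF U(1) PU False] obtain E where "E \<subseteq> {(u, u'). u \<in> U \<and> u' \<in> U \<and> dot ?X u = dot ?X u'} \<and>
      P ^ 2 \<le> card E \<and> (\<forall>u. card {e\<in>E. fst e = u} \<le> P) \<and> (\<forall>v. card {e\<in>E. snd e = v} \<le> P)" ..
    then have E: "E \<subseteq> {(u, u'). u \<in> U \<and> u' \<in> U \<and> dot ?X u = dot ?X u'}" "P ^ 2 \<le> card E"
      "\<And>u. card {e\<in>E. fst e = u} \<le> P" "\<And>v. card {e\<in>E. snd e = v} \<le> P" by simp_all
    have Eu: "fst ` E \<subseteq> U" "snd ` E \<subseteq> U" using E(1) by auto
    have fE: "finite E" by (rule finite_subset[of _ "U \<times> U"]) (use E(1) U(1) in auto)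
    have "real_of_int (int P * W) ^ 4 \<le> 25 * real (card {ab\<in>hashes P W \<times> hashes P W.
       \<exists>(u, v)\<in>E. passes P W (fst ab) (dot ?E u) \<and> passes P W (snd ab) (dot ?E (map2 (-) v c))})"
    proof (rule many_hashes_independent[OF fE E(2) P(1) W E(3,4)])
      show "dot ?E u \<noteq> dot ?E u' \<and> \<bar>dot ?E u - dot ?E u'\<bar> \<le> W" if "u \<in> fst ` E" "u' \<in> fst ` E" "u \<noteq> u'" for u u'
      proof -
        have uU: "u \<in> U" "u' \<in> U" using that Eu by auto
        then show ?thesis using inj[OF uU] that(3) bU(2)[OF Up(1)[OF uU(1)]] bU(2)[OF Up(1)[OF uU(2)]] by linarith
      qed
      show "dot ?E (map2 (-) u c) \<noteq> dot ?E (map2 (-) u' c) \<and> \<bar>dot ?E (map2 (-) u c) - dot ?E (map2 (-) u' c)\<bar> \<le> W"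
        if "u \<in> snd ` E" "u' \<in> snd ` E" "u \<noteq> u'" for u u'
      proof -
        have uU: "u \<in> U" "u' \<in> U" using that Eu by auto
        have "length u = length c" "length u' = length c" using Up(1)[OF uU(1)] Up(1)[OF uU(2)] c(1) by (auto simp: inU_def)
        then have "dot ?E (map2 (-) u c) \<noteq> dot ?E (map2 (-) u' c)" using inj[OF uU] that(3) by (auto simp: dotg_diff)
        then show ?thesis using bV[OF Up(2)[OF uU(1)]] bV[OF Up(2)[OF uU(2)]] by linarith
      qed
    qed
    also have "card {ab\<in>hashes P W \<times> hashes P W.
       \<exists>(u, v)\<in>E. passes P W (fst ab) (dot ?E u) \<and> passes P W (snd ab) (dot ?E (map2 (-) v c))} \<le>
       card {t\<in>hashes P W \<times> hashes P W. goodt d x P W 1 (fst t) (snd t)}"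
    proof (rule card_mono)
      show "finite {t\<in>hashes P W \<times> hashes P W. goodt d x P W 1 (fst t) (snd t)}" using finite_hashes by simp
      show "{ab\<in>hashes P W \<times> hashes P W.
       \<exists>(u, v)\<in>E. passes P W (fst ab) (dot ?E u) \<and> passes P W (snd ab) (dot ?E (map2 (-) v c))} \<subseteq>
       {t\<in>hashes P W \<times> hashes P W. goodt d x P W 1 (fst t) (snd t)}"
      proof
        fix t assume t: "t \<in> {ab\<in>hashes P W \<times> hashes P W.
          \<exists>(u, v)\<in>E. passes P W (fst ab) (dot ?E u) \<and> passes P W (snd ab) (dot ?E (map2 (-) v c))}"
        then obtain u v where a: "(u, v) \<in> E" "passes P W (fst t) (dot ?E u)" "passes P W (snd t) (dot ?E (map2 (-) v c))"
          by blast
        then have uv: "u \<in> U" "v \<in> U" "dot ?X u = dot ?X v" using E(1) by auto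
        have "goodt d x P W 1 (fst t) (snd t)"
          unfolding goodt_def lkey_def using Up(1)[OF uv(1)] Up(2,3)[OF uv(2)] uv(3) a(2,3)
          by - (rule exI[of _ u], rule exI[of _ "map2 (-) v c"], simp)
        then show "t \<in> {t\<in>hashes P W \<times> hashes P W. goodt d x P W 1 (fst t) (snd t)}" using t by blast
      qed
    qed
    finally show ?thesis by simp
  qed
qed

section \<open>Counting good seeds\<close>

text \<open>A seed has a mode bit and two hash functions. Mode 0 hashes both sides of \<open>dot x u = dot x v\<close> by
  their common value with the same function; mode 1 hashes the codes of \<open>u\<close> and \<open>v\<close> independently.
  Mode 0 succeeds unless these values collide too often, and then mode 1 does.\<close>

definition dec_md :: "int \<Rightarrow> int" where "dec_md z = z mod 2"
definition dec_ab :: "int \<Rightarrow> int \<Rightarrow> int \<times> int" where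
  "dec_ab M z = (z div 2 mod M, z div 2 div M mod M)"
definition dec_cd :: "int \<Rightarrow> int \<Rightarrow> int \<times> int" where
  "dec_cd M z = (if dec_md z = 0 then dec_ab M z else (z div 2 div M div M mod M, z div 2 div M div M div M mod M))"

text \<open>A mixed radix number with digits below 2, \<open>M\<close>, \<open>M\<close>,
  \<open>M\<close>, \<open>M\<close>. In mode 0 the last two are ignored by
  \<open>dec_cd\<close>.\<close>

definition enc :: "int \<Rightarrow> int \<Rightarrow> (int \<times> int) \<times> (int \<times> int) \<Rightarrow> int" where
  "enc M md t = md + 2 * (fst (fst t) + M * (snd (fst t) + M * (fst (snd t) + M * snd (snd t))))"

lemma enc_dec:
  assumes M: "0 < M" and md: "md \<in> {0, 1}" and t: "t \<in> ({0..<M} \<times> {0..<M}) \<times> ({0..<M} \<times> {0..<M})"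
  shows "dec_md (enc M md t) = md" "dec_ab M (enc M md t) = fst t"
    "dec_cd M (enc M md t) = (if md = 0 then fst t else snd t)" "enc M md t \<in> {0..<2 * (M * M * (M * M))}"
proof -
  obtain a b c e where te: "t = ((a, b), (c, e))" by (metis surj_pair)
  have r: "0 \<le> a" "a < M" "0 \<le> b" "b < M" "0 \<le> c" "c < M" "0 \<le> e" "e < M" using t by (auto simp: te)
  have dm: "(u + M * v) div M = v" "(u + M * v) mod M = u" if "0 \<le> u" "u < M" for u v using that by simp_all
  have d2: "(md + 2 * v) div 2 = v" "(md + 2 * v) mod 2 = md" for v :: int using md by auto
  show "dec_md (enc M md t) = md" by (simp only: dec_md_def enc_def d2)
  show "dec_ab M (enc M md t) = fst t"
    by (simp only: dec_ab_def enc_def d2 te fst_conv snd_conv dm r)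
  then show "dec_cd M (enc M md t) = (if md = 0 then fst t else snd t)"
    using \<open>dec_md (enc M md t) = md\<close> by (simp only: dec_cd_def) (simp only: enc_def d2 te fst_conv snd_conv dm r mod_pos_pos_trivial[OF r(7,8)])
  have s: "0 \<le> u + M * v \<and> u + M * v < M * K" if "0 \<le> u" "u < M" "0 \<le> v" "v < K" for u v K
  proof -
    have "M * (v + 1) \<le> M * K" using that M by (intro mult_left_mono) auto
    then show ?thesis using that M by (simp add: algebra_simps)
  qed
  have 1: "0 \<le> c + M * e \<and> c + M * e < M * M" using s r by blast
  have 2: "0 \<le> b + M * (c + M * e) \<and> b + M * (c + M * e) < M * (M * M)" using s 1 r by blast
  have 3: "0 \<le> a + M * (b + M * (c + M * e)) \<and> a + M * (b + M * (c + M * e)) < M * (M * (M * M))" using s 2 r by blast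
  show "enc M md t \<in> {0..<2 * (M * M * (M * M))}" using 3 md by (auto simp: enc_def te mult.assoc)
qed

lemma enc_inj:
  assumes M: "0 < M" and md: "md \<in> {0, 1}"
  shows "inj_on (enc M md) (({0..<M} \<times> {0..<M}) \<times> ({0..<M} \<times> {0..<M}))"
proof (rule inj_onI)
  fix t t' assume t: "t \<in> ({0..<M} \<times> {0..<M}) \<times> ({0..<M} \<times> {0..<M})"
    "t' \<in> ({0..<M} \<times> {0..<M}) \<times> ({0..<M} \<times> {0..<M})" "enc M md t = enc M md t'"
  obtain a b c e where te: "t = ((a, b), (c, e))" by (metis surj_pair)
  obtain a' b' c' e' where te': "t' = ((a', b'), (c', e'))" by (metis surj_pair)
  have r: "0 \<le> a" "a < M" "0 \<le> b" "b < M" "0 \<le> c" "c < M" "0 \<le> a'" "a' < M" "0 \<le> b'" "b' < M" "0 \<le> c'" "c' < M"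
    using t(1,2) by (auto simp: te te')
  have dm: "u = u' \<and> v = v'" if "0 \<le> u" "u < M" "0 \<le> u'" "u' < M" "u + M * v = u' + M * v'" for u v u' v'
  proof -
    have "u = (u + M * v) mod M" using that(1,2) by simp
    also have "\<dots> = (u' + M * v') mod M" using that(5) by (simp only:)
    also have "\<dots> = u'" using that(3,4) by simp
    finally have "u = u'" .
    then show ?thesis using that M by simp
  qed
  have "a + M * (b + M * (c + M * e)) = a' + M * (b' + M * (c' + M * e'))" using t(3) by (simp add: enc_def te te')
  then have 1: "a = a'" "b + M * (c + M * e) = b' + M * (c' + M * e')" using dm r by blast+
  then have 2: "b = b'" "c + M * e = c' + M * e'" using dm r by blast+
  then have 3: "c = c'" "e = e'" using dm r by blast+
  show "t = t'" using 1 2 3 by (simp add: te te')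
qed

text \<open>The functions \<open>YL\<close> and \<open>YR\<close> count the hits on the two sides;
  below \<open>N\<close> the fuel suffices.\<close>

definition good_seed where
  "good_seed d x P W N YL YR z \<longleftrightarrow> (let md = dec_md z; ab = dec_ab (P * W) z; cd = dec_cd (P * W) z in
     goodt d x P W md ab cd \<and> YL md ab < (N::nat) \<and> YR md cd < N)"

text \<open>At least one seed in 100 is good. A hash function causes too many hits on one side with
  probability at most 1/100, which is small compared with the success probabilities 1/5 and 1/25 of
  the two modes; the mode bit costs another factor 2.\<close>

lemma good_seeds:
  fixes P N :: nat and YL YR :: "int \<Rightarrow> int \<times> int \<Rightarrow> nat"
  assumes d: "3 \<le> d" and c: "length c = length x" "set c \<subseteq> setC d" "dot (xfun x) c = 0"
    and P: "0 < P" "P ^ 3 \<le> (2 ^ card {i\<in>{..<length x}. \<not> extreme d (c ! i)})\<^sup>2" and N: "0 < N"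
  defines "W \<equiv> bigW d x"
  assumes YL: "\<And>md. md \<in> {0, 1} \<Longrightarrow> real N * real (card {ab\<in>hashes P W. N \<le> YL md ab}) \<le> D * (real P * (real_of_int W)\<^sup>2)"
    and YR: "\<And>md. md \<in> {0, 1} \<Longrightarrow> real N * real (card {ab\<in>hashes P W. N \<le> YR md ab}) \<le> D' * (real P * (real_of_int W)\<^sup>2)"
    and D: "100 * D \<le> real N * real P" "100 * D' \<le> real N * real P"
  shows "real_of_int (int P * W) ^ 4 \<le>
    50 * real (card {z\<in>{0..<2 * (int P * W * (int P * W) * (int P * W * (int P * W)))}. good_seed d x P W N YL YR z})"
proof -
  let ?M = "int P * W"
  let ?m = "real_of_int ?M"
  have W: "0 < W" using bigW_bounds(1)[of d x] d by (simp add: W_def)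
  have M: "0 < ?M" using W P by simp
  have m: "0 < ?m" using M by (simp only: of_int_0_less_iff)
  have hs: "hashes P W = {0..<?M} \<times> {0..<?M}" by (simp add: hashes_def)
  have ch: "real (card (hashes P W)) = ?m ^ 2" using card_hashes[of P W] P W by simp
  let ?G = "{z\<in>{0..<2 * (?M * ?M * (?M * ?M))}. good_seed d x P W N YL YR z}"
  have bad: "real (card {ab\<in>hashes P W. N \<le> Y ab}) \<le> ?m ^ 2 / 100"
    if "real N * real (card {ab\<in>hashes P W. N \<le> Y ab}) \<le> D * (real P * (real_of_int W)\<^sup>2)" "100 * D \<le> real N * real P" for Y D
  proof -
    have "100 * (real N * real (card {ab\<in>hashes P W. N \<le> Y ab})) \<le> (100 * D) * (real P * (real_of_int W)\<^sup>2)" using that(1) by simp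
    also have "\<dots> \<le> (real N * real P) * (real P * (real_of_int W)\<^sup>2)" using that(2) by (intro mult_right_mono) auto
    also have "\<dots> = real N * ?m ^ 2" by (simp add: power2_eq_square)
    finally have "real N * (100 * real (card {ab\<in>hashes P W. N \<le> Y ab})) \<le> real N * ?m ^ 2" by simp
    then show ?thesis using N by simp
  qed
  have fin: "finite {ab\<in>hashes P W. Q ab}" "finite {t\<in>hashes P W \<times> hashes P W. Q' t}" for Q Q'
    using finite_hashes by auto
  from light_hashes[OF d c P] consider
    (same) "?m ^ 2 \<le> 5 * real (card {ab\<in>hashes P W. goodt d x P W 0 ab ab})" |
    (indep) "?m ^ 4 \<le> 25 * real (card {t\<in>hashes P W \<times> hashes P W. goodt d x P W 1 (fst t) (snd t)})"
    unfolding W_def by blast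
  then show ?thesis
  proof cases
    case same
    let ?S = "{ab\<in>hashes P W. goodt d x P W 0 ab ab \<and> YL 0 ab < N \<and> YR 0 ab < N}"
    have "{ab\<in>hashes P W. goodt d x P W 0 ab ab} \<subseteq> ?S \<union> {ab\<in>hashes P W. N \<le> YL 0 ab} \<union> {ab\<in>hashes P W. N \<le> YR 0 ab}" by auto
    then have "card {ab\<in>hashes P W. goodt d x P W 0 ab ab} \<le> card (?S \<union> {ab\<in>hashes P W. N \<le> YL 0 ab} \<union> {ab\<in>hashes P W. N \<le> YR 0 ab})"
      by (rule card_mono[rotated]) (use fin in auto)
    also have "\<dots> \<le> card ?S + card {ab\<in>hashes P W. N \<le> YL 0 ab} + card {ab\<in>hashes P W. N \<le> YR 0 ab}"
      by (meson add_le_mono card_Un_le le_refl order_trans)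
    finally have "real (card {ab\<in>hashes P W. goodt d x P W 0 ab ab}) \<le>
        real (card ?S) + real (card {ab\<in>hashes P W. N \<le> YL 0 ab}) + real (card {ab\<in>hashes P W. N \<le> YR 0 ab})"
      by (simp only: of_nat_add[symmetric] of_nat_le_iff)
    \<comment> \<open>Of the fraction 1/5, at most 2/100 is lost to excessive hits on either side,
      leaving more than 1/10.\<close>
    then have S: "?m ^ 2 \<le> 10 * real (card ?S)" using same bad[OF YL[of 0] D(1)] bad[OF YR[of 0] D(2)] by simp
    \<comment> \<open>In mode 0 the second hash function is arbitrary, so every good first one
      accounts for \<open>?m ^ 2\<close> seeds.\<close>
    have "enc ?M 0 ` (?S \<times> hashes P W) \<subseteq> ?G"
    proof clarify
      fix al be cd1 cd2 assume a: "(al, be) \<in> hashes P W" "(cd1, cd2) \<in> hashes P W" "goodt d x P W 0 (al, be) (al, be)"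
        "YL 0 (al, be) < N" "YR 0 (al, be) < N"
      then have t: "((al, be), (cd1, cd2)) \<in> ({0..<?M} \<times> {0..<?M}) \<times> ({0..<?M} \<times> {0..<?M})" by (simp add: hs)
      have 0: "(0::int) \<in> {0, 1}" by simp
      show "enc ?M 0 ((al, be), cd1, cd2) \<in> {0..<2 * (?M * ?M * (?M * ?M))} \<and>
         good_seed d x P W N YL YR (enc ?M 0 ((al, be), cd1, cd2))"
        using a enc_dec[OF M 0 t] by (simp add: good_seed_def)
    qed
    then have "card (enc ?M 0 ` (?S \<times> hashes P W)) \<le> card ?G" by (rule card_mono[rotated]) (rule finite_subset[OF Collect_restrict], rule finite_atLeastLessThan_int)
    moreover have "card (enc ?M 0 ` (?S \<times> hashes P W)) = card ?S * card (hashes P W)"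
    proof -
      have 0: "(0::int) \<in> {0, 1}" by simp
      have "inj_on (enc ?M 0) (?S \<times> hashes P W)" by (rule inj_on_subset[OF enc_inj[OF M 0]]) (auto simp: hs)
      then show ?thesis by (simp add: card_image card_cartesian_product)
    qed
    ultimately have "card ?S * card (hashes P W) \<le> card ?G" by (simp only:)
    then have "real (card ?S * card (hashes P W)) \<le> real (card ?G)" by (simp only: of_nat_le_iff)
    then have "real (card ?S) * ?m ^ 2 \<le> real (card ?G)" by (simp only: of_nat_mult ch)
    moreover have "?m ^ 2 * ?m ^ 2 \<le> 10 * real (card ?S) * ?m ^ 2" using S by (intro mult_right_mono) auto
    moreover have "?m ^ 4 = ?m ^ 2 * ?m ^ 2" by (simp add: power_add[symmetric])
    ultimately show ?thesis by linarith
  next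
    case indep
    let ?HH = "hashes P W \<times> hashes P W"
    let ?T = "{t\<in>?HH. goodt d x P W 1 (fst t) (snd t)}"
    let ?S = "{t\<in>?HH. goodt d x P W 1 (fst t) (snd t) \<and> YL 1 (fst t) < N \<and> YR 1 (snd t) < N}"
    let ?B1 = "{ab\<in>hashes P W. N \<le> YL 1 ab}" and ?B2 = "{ab\<in>hashes P W. N \<le> YR 1 ab}"
    have "?T \<subseteq> ?S \<union> ?B1 \<times> hashes P W \<union> hashes P W \<times> ?B2" by auto
    then have "card ?T \<le> card (?S \<union> ?B1 \<times> hashes P W \<union> hashes P W \<times> ?B2)"
      by (rule card_mono[rotated]) (use fin finite_hashes in auto)
    also have "\<dots> \<le> card ?S + card (?B1 \<times> hashes P W) + card (hashes P W \<times> ?B2)"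
      by (meson add_le_mono card_Un_le le_refl order_trans)
    also have "\<dots> = card ?S + card ?B1 * card (hashes P W) + card (hashes P W) * card ?B2" by (simp only: card_cartesian_product)
    finally have "real (card ?T) \<le> real (card ?S + card ?B1 * card (hashes P W) + card (hashes P W) * card ?B2)"
      by (simp only: of_nat_le_iff)
    then have le: "real (card ?T) \<le> real (card ?S) + real (card ?B1) * ?m ^ 2 + ?m ^ 2 * real (card ?B2)"
      by (simp only: of_nat_add of_nat_mult ch)
    have "real (card ?B1) * ?m ^ 2 \<le> ?m ^ 2 / 100 * ?m ^ 2" "?m ^ 2 * real (card ?B2) \<le> ?m ^ 2 * (?m ^ 2 / 100)"
      by (rule mult_right_mono[OF bad[OF YL[of 1] D(1)]], simp, simp)
        (rule mult_left_mono[OF bad[OF YR[of 1] D(2)]], simp, simp)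
    moreover have m4: "?m ^ 4 = ?m ^ 2 * ?m ^ 2" by (simp add: power_add[symmetric])
    \<comment> \<open>Here the loss is exactly absorbed: 1/25 - 2/100 = 1/50.\<close>
    ultimately have S: "?m ^ 4 \<le> 50 * real (card ?S)" using le indep by simp
    have "enc ?M 1 ` ?S \<subseteq> ?G"
    proof clarify
      fix al be cd1 cd2 assume a: "(al, be) \<in> hashes P W" "(cd1, cd2) \<in> hashes P W"
        "goodt d x P W 1 (fst ((al, be), cd1, cd2)) (snd ((al, be), cd1, cd2))"
        "YL 1 (fst ((al, be), cd1, cd2)) < N" "YR 1 (snd ((al, be), cd1, cd2)) < N"
      then have t: "((al, be), (cd1, cd2)) \<in> ({0..<?M} \<times> {0..<?M}) \<times> ({0..<?M} \<times> {0..<?M})" by (simp add: hs)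
      have 1: "(1::int) \<in> {0, 1}" by simp
      show "enc ?M 1 ((al, be), cd1, cd2) \<in> {0..<2 * (?M * ?M * (?M * ?M))} \<and>
         good_seed d x P W N YL YR (enc ?M 1 ((al, be), cd1, cd2))"
        using a enc_dec[OF M 1 t] by (simp add: good_seed_def)
    qed
    then have "card (enc ?M 1 ` ?S) \<le> card ?G" by (rule card_mono[rotated]) (rule finite_subset[OF Collect_restrict], rule finite_atLeastLessThan_int)
    moreover have "card (enc ?M 1 ` ?S) = card ?S"
    proof -
      have 1: "(1::int) \<in> {0, 1}" by simp
      have "inj_on (enc ?M 1) ?S" by (rule inj_on_subset[OF enc_inj[OF M 1]]) (auto simp: hs)
      then show ?thesis by (rule card_image)
    qed
    ultimately show ?thesis using S by linarith
  qed
qed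

section \<open>The program\<close>

definition unit_weights :: "int list \<Rightarrow> (int \<times> int) list" where
  "unit_weights vs = map (\<lambda>v. (v, 1)) vs"

definition listA :: "int \<Rightarrow> int list" where "listA d = [-(d - 1)..-1] @ [2..d]"
definition listB :: "int list" where "listB = [0, 1]"

definition wt :: "int \<Rightarrow> nat \<Rightarrow> int \<Rightarrow> int" where
  "wt d ss v = (if extreme d v then int ss + 1 else int ss)"

definition listC :: "int \<Rightarrow> nat \<Rightarrow> (int \<times> int) list" where
  "listC d ss = map (\<lambda>v. (v, wt d ss v)) ([-d..-1] @ [1..d])"

text \<open>The sum of \<open>wt d ss v\<close> over \<open>v \<in> C\<close>.\<close>

definition totQ :: "int \<Rightarrow> nat \<Rightarrow> int" where "totQ d ss = 2 * d * int ss + 4"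

definition p_init :: "int \<Rightarrow> com" where
  "p_init d = (''i'' ::= K 0 ;; ''q'' ::= K 1 ;; ''W'' ::= K 1) ;;
     While (Less (V ''i'') (V ''n''))
       (Store ''e'' (V ''i'') (V ''q'') ;;
        ''W'' ::= V ''W'' [+] K (4 * d) [*] (Arr ''x'' (V ''i'') [*] Arr ''x'' (V ''i'') [+] V ''q'') ;;
        ''q'' ::= V ''q'' [*] K (2 * d + 1) ;;
        ''i'' ::= V ''i'' [+] K 1)"

text \<open>\<open>P\<close> and \<open>N\<close> should grow like \<open>exp\<close> of a real
  multiple of \<open>n\<close>. Integer bases are too coarse for single coordinates, so the growth
  is prescribed per block of \<open>bb\<close> coordinates.\<close>

definition p_par :: "nat \<Rightarrow> nat \<Rightarrow> nat \<Rightarrow> com" where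
  "p_par bb pp nu = (''i'' ::= K 0 ;; ''P'' ::= K 1 ;; ''N'' ::= K 1) ;;
     While (Less (V ''i'') (V ''n'' [div] K (int bb)))
       (''P'' ::= V ''P'' [*] K (int pp) ;; ''N'' ::= V ''N'' [*] K (int nu) ;; ''i'' ::= V ''i'' [+] K 1)"

definition p_rnd :: com where
  "p_rnd = (''M'' ::= V ''P'' [*] V ''W'' ;; ''h'' ::= V ''n'' [div] K 2 ;; ''H'' ::= V ''n'' [-] V ''h'' ;;
       ''m'' ::= V ''n'' [-] K 1 ;; ''o'' ::= K 0 ;;
       ''fm'' ::= K 2 [*] (V ''M'' [*] V ''M'' [*] (V ''M'' [*] V ''M'')) ;; ''i'' ::= K 0 ;; ''zm'' ::= K 1) ;;
     While (Less (V ''i'') (V ''n'')) (''zm'' ::= V ''zm'' [*] V ''fm'' ;; ''i'' ::= V ''i'' [+] K 1)"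

text \<open>The trees 1 and 2 provide the halves of \<open>u\<close>, 3 and 4 those of \<open>v\<close>; their zero weights disable
  pruning. Trees 5 and 6 hold the heavy prefixes and, read backwards, suffixes.\<close>

definition p_trees :: "int \<Rightarrow> nat \<Rightarrow> com" where
  "p_trees d ss =
     enum ''1'' (unit_weights (listA d)) 0 0 ''h'' ''o'' 1 ;;
     enum ''2'' (unit_weights (map uminus listB)) 0 0 ''H'' ''h'' 1 ;;
     enum ''3'' (unit_weights listB) 0 0 ''h'' ''o'' 1 ;;
     enum ''4'' (unit_weights (map uminus (listA d))) 0 0 ''H'' ''h'' 1 ;;
     enum ''5'' (listC d ss) (totQ d ss) 1 ''n'' ''o'' 1 ;;
     enum ''6'' (listC d ss) (totQ d ss) 1 ''n'' ''m'' (- 1)"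

text \<open>The key of a prefix is its sum times \<open>n + 1\<close> plus its length, so that equal keys of a prefix and a
  suffix make the lengths add up to \<open>n\<close>.\<close>

definition p_split :: com where
  "p_split =
     look ''5'' ''P'' ''Q'' 1 (Arr ''S5'' (V ''j'') [*] (V ''n'' [+] K 1) [+] Arr ''l5'' (V ''j'')) (Arr ''V5'' (V ''j'')) ;;
     look ''6'' ''Q'' ''P'' (- 1)
       ((K 0 [-] Arr ''S6'' (V ''j'')) [*] (V ''n'' [+] K 1) [+] (V ''n'' [-] Arr ''l6'' (V ''j'')))
       (K 0 [-] Arr ''V6'' (V ''j''))"

lemma enum_writes:
  "wv (enum nm vs Q D0 hv ov sg) = {''r'', ''t'', ''j'', ''g'', ''k'', ''a'', ''b'', CHR ''t'' # nm}"
  "wa (enum nm vs Q D0 hv ov sg) \<subseteq> {CHR ''v'' # nm, CHR ''w'' # nm, CHR ''S'' # nm, CHR ''V'' # nm, CHR ''l'' # nm, CHR ''N'' # nm, CHR ''D'' # nm}"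
proof -
  have t: "wv (tabs nm i vs) = {}" "wa (tabs nm i vs) \<subseteq> {CHR ''v'' # nm, CHR ''w'' # nm}" for i vs
    by (induction vs arbitrary: i) auto
  show "wv (enum nm vs Q D0 hv ov sg) = {''r'', ''t'', ''j'', ''g'', ''k'', ''a'', ''b'', CHR ''t'' # nm}"
    by (auto simp: enum_def enum_init_def enum_loop_def enum_body_def t)
  show "wa (enum nm vs Q D0 hv ov sg) \<subseteq> {CHR ''v'' # nm, CHR ''w'' # nm, CHR ''S'' # nm, CHR ''V'' # nm, CHR ''l'' # nm, CHR ''N'' # nm, CHR ''D'' # nm}"
    using t(2)[of 0 vs] by (auto simp: enum_def enum_init_def enum_loop_def enum_body_def)
qed

lemma enum_frame:
  assumes "exec w (enum nm vs Q D0 hv ov sg) s t s'"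
  shows "v \<notin> {''r'', ''t'', ''j'', ''g'', ''k'', ''a'', ''b'', CHR ''t'' # nm} \<Longrightarrow> vars s' v = vars s v"
    "a \<notin> {CHR ''v'' # nm, CHR ''w'' # nm, CHR ''S'' # nm, CHR ''V'' # nm, CHR ''l'' # nm, CHR ''N'' # nm, CHR ''D'' # nm} \<Longrightarrow> arrs s' a = arrs s a"
proof -
  note ag = exec_agree[OF assms, unfolded agree_def]
  show "vars s' v = vars s v" if "v \<notin> {''r'', ''t'', ''j'', ''g'', ''k'', ''a'', ''b'', CHR ''t'' # nm}"
    by (rule ag[THEN conjunct1, THEN spec, THEN mp]) (unfold enum_writes(1), rule that)
  show "arrs s' a = arrs s a"
    if "a \<notin> {CHR ''v'' # nm, CHR ''w'' # nm, CHR ''S'' # nm, CHR ''V'' # nm, CHR ''l'' # nm, CHR ''N'' # nm, CHR ''D'' # nm}"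
  proof -
    have "a \<notin> wa (enum nm vs Q D0 hv ov sg)" using that enum_writes(2)[of nm vs Q D0 hv ov sg] by (rule contra_subsetD[rotated])
    then show ?thesis by (rule ag[THEN conjunct2, THEN spec, THEN mp])
  qed
qed

text \<open>Weights have done their duty once the pruning is over; from here on a path is just its
  list of coefficients.\<close>

definition tree :: "vname \<Rightarrow> (int \<Rightarrow> int) \<Rightarrow> (int \<Rightarrow> int) \<Rightarrow> int \<Rightarrow> int \<Rightarrow> int list list \<Rightarrow> state \<Rightarrow> bool" where
  "tree nm X E o' sg L s \<longleftrightarrow> distinct L \<and> vars s (CHR ''t'' # nm) = int (length L) \<and> (\<forall>i<length L.
     arrs s (CHR ''l'' # nm) (int i) = int (length (L ! i)) \<and>
     arrs s (CHR ''S'' # nm) (int i) = dotg X o' sg (L ! i) \<and>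
     arrs s (CHR ''V'' # nm) (int i) = dotg E o' sg (L ! i))"

lemma tree_frame:
  assumes "tree nm X E o' sg L s" "vars s' (CHR ''t'' # nm) = vars s (CHR ''t'' # nm)"
    "arrs s' (CHR ''l'' # nm) = arrs s (CHR ''l'' # nm)" "arrs s' (CHR ''S'' # nm) = arrs s (CHR ''S'' # nm)"
    "arrs s' (CHR ''V'' # nm) = arrs s (CHR ''V'' # nm)"
  shows "tree nm X E o' sg L s'"
  using assms by (simp add: tree_def)

text \<open>The weight is a function of the coefficient, so forgetting the weights identifies no
  paths.\<close>

lemma inj_map_fst:
  assumes "\<And>v. v \<in> vs \<Longrightarrow> snd v = f (fst v)" "set p \<subseteq> vs" "set p' \<subseteq> vs" "map fst p = map fst p'"
  shows "p = p'"
proof -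
  have r: "p = map (\<lambda>v. (v, f v)) (map fst p)" if "set p \<subseteq> vs" for p
    using that assms(1) by (induction p) (auto simp: prod_eq_iff)
  show ?thesis using r[OF assms(2)] r[OF assms(3)] assms(4) by simp
qed

lemma tree_of_paths:
  assumes L: "distinct L" "set L = PS" "vars s (CHR ''t'' # nm) = int (length L)" "tree_rep nm X E o' sg L s"
    and PS: "\<And>p. p \<in> PS \<Longrightarrow> set p \<subseteq> vs" "\<And>v. v \<in> vs \<Longrightarrow> snd v = f (fst v)"
  shows "tree nm X E o' sg (map (map fst) L) s \<and> set (map (map fst) L) = map fst ` PS"
proof -
  have "inj_on (map fst) (set L)"
    using inj_map_fst[of vs f, OF PS(2)] PS(1) L(2) by (auto simp: inj_on_def)
  then have "distinct (map (map fst) L)" using L(1) by (simp add: distinct_map)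
  then show ?thesis using L by (auto simp: tree_def tree_rep_def psum_dotg)
qed

section \<open>The program on a fixed input\<close>

text \<open>The assumptions on \<open>B\<close> collect all magnitudes that occur during a run; the
  greatest demand comes from \<open>fm ^ n\<close>, the range of the random number. The queues of
  the four full trees are bounded by \<open>mT\<close>, those of the two pruned trees by
  \<open>mP\<close>.\<close>

locale ctx = machine B w for B :: int and w :: nat +
  fixes d :: int and bb pp nu ss :: nat and x :: "int list"
  assumes d3: "3 \<le> d" and pp1: "1 \<le> pp" and nu1: "1 \<le> nu" and ss1: "1 \<le> ss"
  fixes n h H P N qa mT mP :: nat and W M fm :: int and X E :: "int \<Rightarrow> int"
  defines "n \<equiv> length x" and "h \<equiv> length x div 2" and "H \<equiv> length x - length x div 2"
    and "P \<equiv> pp ^ (length x div bb)" and "N \<equiv> nu ^ (length x div bb)" and "qa \<equiv> nat (2 * d - 2)"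
    and "mT \<equiv> Suc (length x) * nat (2 * d - 2) ^ (length x - length x div 2)"
    and "mP \<equiv> Suc (length x) * nu ^ (length x div bb)"
    and "W \<equiv> bigW d x" and "M \<equiv> int (pp ^ (length x div bb)) * bigW d x"
    and "fm \<equiv> 2 * (int (pp ^ (length x div bb)) * bigW d x * (int (pp ^ (length x div bb)) * bigW d x) *
      (int (pp ^ (length x div bb)) * bigW d x * (int (pp ^ (length x div bb)) * bigW d x)))"
    and "X \<equiv> xfun x" and "E \<equiv> powf d (length x)"
  assumes B: "fm \<le> B" "fm ^ length x \<le> B" "(int (length x) + 2) * W \<le> B" "4 * d \<le> B" "int pp \<le> B" "int nu \<le> B" "int bb \<le> B"
    "totQ d ss \<le> B" "int ss + 1 \<le> B" "(int (length x) + 1) * int P \<le> B" "int N * (int ss + 1) ^ Suc (length x) \<le> B"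
    "totQ d ss ^ Suc (length x) \<le> B" "4 * (int mT * int qa) \<le> B" "4 * (int mP * d) \<le> B"
begin

lemma W1: "1 \<le> W" using bigW_bounds(1)[of d x] d3 by (simp add: W_def)
lemma P1: "1 \<le> P" using pp1 by (simp add: P_def)
lemma N1: "1 \<le> N" using nu1 by (simp add: N_def)
lemma M_eq: "M = int P * W" by (simp add: M_def P_def W_def)
lemma fm_eq: "fm = 2 * (M * M * (M * M))" by (simp add: fm_def M_def)
lemma M1: "1 \<le> M" using W1 P1 mult_mono[of 1 "int P" 1 W] by (simp add: M_eq)
lemma M_fm: "M \<le> fm"
proof -
  have "M * 1 * (1 * 1) \<le> M * M * (M * M)" using M1 by (intro mult_mono) auto
  moreover have "0 \<le> M * M * (M * M)" by simp
  ultimately show ?thesis unfolding fm_eq by linarith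
qed
lemma fm1: "1 \<le> fm" using M1 M_fm by simp
lemma WB: "W \<le> B" "int n + 2 \<le> B" "(int n + 2) * W \<le> B"
proof -
  show b: "(int n + 2) * W \<le> B" using B(3) by (simp add: n_def)
  have "int n + 2 \<le> (int n + 2) * W" using mult_left_mono[of 1 W "int n + 2"] W1 by simp
  then show "int n + 2 \<le> B" using b by (rule order_trans)
  have "1 * W \<le> (int n + 2) * W" using W1 by (intro mult_right_mono) auto
  then show "W \<le> B" using b by simp
qed
lemma PB: "int P \<le> B" "(int n + 1) * int P \<le> B"
proof -
  show b: "(int n + 1) * int P \<le> B" using B by (simp add: n_def)
  have "1 * int P \<le> (int n + 1) * int P" by (intro mult_right_mono) auto
  then show "int P \<le> B" using b by simp
qed
lemma NB: "int N \<le> B"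
proof -
  have "int N * 1 \<le> int N * (int ss + 1) ^ Suc (length x)" by (intro mult_left_mono one_le_power) auto
  then show ?thesis using B(11) by simp
qed
lemma qa2: "2 \<le> qa" "int qa = 2 * d - 2" using d3 by (auto simp: qa_def)
lemma mT_eq: "mT = Suc n * qa ^ H" by (simp add: mT_def n_def qa_def H_def)
lemma mP_eq: "mP = Suc n * N" by (simp add: mP_def n_def N_def)
lemma hH: "h + H = n" "h \<le> H" by (simp_all add: h_def H_def n_def)

text \<open>A power of \<open>2 * d + 1\<close> is 1 plus \<open>2 * d\<close> times the geometric
  sum below it, which \<open>bigW\<close> contains.\<close>

lemma powW: "(2 * d + 1) ^ i \<le> W" if "i \<le> n"
proof -
  have geo: "(2 * d + 1) ^ m = 1 + 2 * d * (\<Sum>j<m. (2 * d + 1) ^ j)" for m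
    by (induction m) (auto simp: algebra_simps)
  have "(2 * d + 1) ^ i \<le> (2 * d + 1) ^ n" using d3 that by (intro power_increasing) auto
  also have "\<dots> = 1 + 2 * d * (\<Sum>j<n. (2 * d + 1) ^ j)" by (rule geo)
  also have "\<dots> = 1 + (\<Sum>j<n. 2 * d * (2 * d + 1) ^ j)" by (simp add: sum_distrib_left)
  also have "\<dots> \<le> 1 + (\<Sum>j<n. 4 * d * (x ! j * x ! j + (2 * d + 1) ^ j))"
  proof (intro add_left_mono sum_mono)
    fix j
    have "0 < (2 * d + 1) ^ j" using d3 by simp
    then have "2 * d * (2 * d + 1) ^ j \<le> 4 * d * (2 * d + 1) ^ j" using d3 by (intro mult_right_mono) auto
    also have "\<dots> \<le> 4 * d * (x ! j * x ! j + (2 * d + 1) ^ j)" using d3 by (intro mult_left_mono) auto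
    finally show "2 * d * (2 * d + 1) ^ j \<le> 4 * d * (x ! j * x ! j + (2 * d + 1) ^ j)" .
  qed
  finally show ?thesis by (simp add: W_def bigW_def n_def)
qed

lemma init_bnd: "bnd B (input_state x)"
proof -
  have "\<bar>x ! i\<bar> \<le> B" if "i < length x" for i
  proof -
    have "\<bar>x ! i\<bar> = \<bar>xfun x (int i)\<bar>" using that by (simp add: xfun_def)
    also have "\<dots> \<le> (\<Sum>i<length x. \<bar>xfun x (int i)\<bar>)" using that by (intro member_le_sum) auto
    also have "\<dots> \<le> 4 * d * (\<Sum>i<length x. \<bar>xfun x (int i)\<bar>)"
    proof -
      have "0 \<le> (\<Sum>i<length x. \<bar>xfun x (int i)\<bar>)" by (intro sum_nonneg) auto
      then have "1 * (\<Sum>i<length x. \<bar>xfun x (int i)\<bar>) \<le> 4 * d * (\<Sum>i<length x. \<bar>xfun x (int i)\<bar>)"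
        using d3 by (intro mult_right_mono) auto
      then show ?thesis by simp
    qed
    also have "\<dots> \<le> W" using bigW_bounds(2)[of d x] d3 by (simp add: W_def)
    finally show ?thesis using WB(1) by simp
  qed
  moreover have "0 \<le> B" using B2 by simp
  ultimately show ?thesis using WB(2) by (auto simp: bnd_def input_state_def n_def)
qed

lemma init_exec:
  assumes s0: "bnd B s0" "vars s0 ''n'' = int n" "arrs s0 ''x'' = X" "arrs s0 ''e'' = (\<lambda>_. 0)"
  shows "\<exists>s'. exec w (p_init d) s0 (n * 20 + 20) s' \<and> bnd B s' \<and> arrs s' ''e'' = E \<and>
    vars s' ''q'' = (2 * d + 1) ^ n \<and> vars s' ''W'' = W"
proof -
  let ?a = "''i'' ::= K 0 ;; ''q'' ::= K 1 ;; ''W'' ::= K 1"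
  let ?b = "Less (V ''i'') (V ''n'')"
  let ?c = "Store ''e'' (V ''i'') (V ''q'') ;;
        ''W'' ::= V ''W'' [+] K (4 * d) [*] (Arr ''x'' (V ''i'') [*] Arr ''x'' (V ''i'') [+] V ''q'') ;;
        ''q'' ::= V ''q'' [*] K (2 * d + 1) ;;
        ''i'' ::= V ''i'' [+] K 1"
  define Wf where "Wf i = 1 + (\<Sum>j<i. 4 * d * (x ! j * x ! j + (2 * d + 1) ^ j))" for i
  have nn: "0 \<le> 4 * d * (x ! j * x ! j + (2 * d + 1) ^ j)" for j
    by (rule mult_nonneg_nonneg, use d3 in simp, rule add_nonneg_nonneg, rule zero_le_square) (use d3 in simp)
  have Wf: "1 \<le> Wf i \<and> Wf i \<le> W" if "i \<le> n" for i
  proof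
    show "1 \<le> Wf i" using sum_nonneg[of "{..<i}" "\<lambda>j. 4 * d * (x ! j * x ! j + (2 * d + 1) ^ j)"] nn by (simp add: Wf_def)
    have "(\<Sum>j<i. 4 * d * (x ! j * x ! j + (2 * d + 1) ^ j)) \<le> (\<Sum>j<n. 4 * d * (x ! j * x ! j + (2 * d + 1) ^ j))"
      using that nn by (intro sum_mono2) auto
    then show "Wf i \<le> W" by (simp add: Wf_def W_def bigW_def n_def)
  qed
  have pw: "1 \<le> (2 * d + 1) ^ i \<and> (2 * d + 1) ^ i \<le> B" if "i \<le> n" for i
    using powW[OF that] WB(1) d3 by (auto intro: one_le_power)
  define s1 where "s1 = sx ?a s0"
  have e1: "exec w ?a s0 (ctime ?a) s1" "bnd B s1" using exec_sx[OF s0(1), of ?a] B2 by (auto simp: s1_def eok_def)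
  define I where "I s \<longleftrightarrow> (\<exists>i\<le>n. vars s ''i'' = int i \<and> vars s ''q'' = (2 * d + 1) ^ i \<and> vars s ''W'' = Wf i \<and>
     arrs s ''e'' = (\<lambda>j. if 0 \<le> j \<and> j < int i then (2 * d + 1) ^ nat j else 0))" for s :: state
  define \<mu> where "\<mu> s = n - nat (vars s ''i'')" for s :: state
  have "\<exists>s'. exec w (While ?b ?c) s1 (n * (ctime ?c + 2) + 1) s' \<and> bnd B s' \<and> I s' \<and> agree ?c s1 s' \<and> \<not> bval ?b s'"
  proof (rule while_sx[where I = I and \<mu> = \<mu>])
    show "bok B ?b" by (simp add: eok_def)
    show "cwf B ?c" using B2 B(4) d3 by (simp add: eok_def)
    show "bnd B s1" by fact
    show "I s1" unfolding I_def using s0 by (intro exI[of _ 0]) (auto simp: s1_def Wf_def)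
    show "\<mu> s1 \<le> n" by (simp add: \<mu>_def)
  next
    fix s assume s: "bnd B s" "I s" "agree ?c s1 s" "bval ?b s"
    then obtain i where i: "i \<le> n" "vars s ''i'' = int i" "vars s ''q'' = (2 * d + 1) ^ i" "vars s ''W'' = Wf i"
      "arrs s ''e'' = (\<lambda>j. if 0 \<le> j \<and> j < int i then (2 * d + 1) ^ nat j else 0)" by (auto simp: I_def)
    have fr: "vars s ''n'' = int n" "arrs s ''x'' = X" using s(3) s0 by (auto simp: agree_def s1_def)
    have il: "i < n" using s(4) fr i by simp
    have Xi: "X (int i) = x ! i" using il by (simp add: X_def xfun_def n_def)
    have WS: "Wf i + 4 * d * (x ! i * x ! i + (2 * d + 1) ^ i) = Wf (Suc i)" by (simp add: Wf_def)
    have b: "\<bar>Wf (Suc i)\<bar> \<le> B" "\<bar>(2 * d + 1) ^ i\<bar> \<le> B" "\<bar>(2 * d + 1) ^ i * (2 * d + 1)\<bar> \<le> B" "int i + 1 \<le> B"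
      using Wf[of "Suc i"] WB il pw[of i] pw[of "Suc i"] by (auto simp: mult.commute)
    have "sok B ?c s" using i fr Xi WS b by simp
    moreover have "I (sx ?c s)"
      unfolding I_def
    proof (intro exI[of _ "Suc i"] conjI)
      show "Suc i \<le> n" using il by simp
      show "vars (sx ?c s) ''i'' = int (Suc i)" using i by simp
      show "vars (sx ?c s) ''q'' = (2 * d + 1) ^ Suc i" using i by simp
      show "vars (sx ?c s) ''W'' = Wf (Suc i)" using i fr Xi WS by simp
      show "arrs (sx ?c s) ''e'' = (\<lambda>j. if 0 \<le> j \<and> j < int (Suc i) then (2 * d + 1) ^ nat j else 0)"
        using i by (auto simp: fun_eq_iff)
    qed
    moreover have "\<mu> (sx ?c s) < \<mu> s" using i il by (simp add: \<mu>_def nat_add_distrib)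
    ultimately show "sok B ?c s \<and> I (sx ?c s) \<and> \<mu> (sx ?c s) < \<mu> s" by blast
  qed
  then obtain s' where s': "exec w (While ?b ?c) s1 (n * (ctime ?c + 2) + 1) s'" "bnd B s'" "I s'"
    "agree ?c s1 s'" "\<not> bval ?b s'" by blast
  from s'(3) obtain i where i: "i \<le> n" "vars s' ''i'' = int i" "vars s' ''q'' = (2 * d + 1) ^ i" "vars s' ''W'' = Wf i"
      "arrs s' ''e'' = (\<lambda>j. if 0 \<le> j \<and> j < int i then (2 * d + 1) ^ nat j else 0)" by (auto simp: I_def)
  have "vars s' ''n'' = int n" using s'(4) s0 by (auto simp: agree_def s1_def)
  then have "i = n" using s'(5) i by simp
  moreover have "Wf n = W" by (simp add: Wf_def W_def bigW_def n_def)
  moreover have "(\<lambda>j. if 0 \<le> j \<and> j < int n then (2 * d + 1) ^ nat j else 0) = E" by (auto simp: E_def powf_def n_def)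
  moreover have "exec w (p_init d) s0 (n * 20 + 20) s'"
    unfolding p_init_def by (rule exec_mono[OF exec_Seq[OF e1(1) s'(1)]]) simp
  ultimately show ?thesis using s'(2) i by blast
qed

lemma par_exec:
  assumes s0: "bnd B s0" "vars s0 ''n'' = int n"
  shows "\<exists>s'. exec w (p_par bb pp nu) s0 (n * 20 + 20) s' \<and> bnd B s' \<and> vars s' ''P'' = int P \<and> vars s' ''N'' = int N"
proof -
  let ?a = "''i'' ::= K 0 ;; ''P'' ::= K 1 ;; ''N'' ::= K 1"
  let ?b = "Less (V ''i'') (V ''n'' [div] K (int bb))"
  let ?c = "''P'' ::= V ''P'' [*] K (int pp) ;; ''N'' ::= V ''N'' [*] K (int nu) ;; ''i'' ::= V ''i'' [+] K 1"
  let ?m = "n div bb"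
  have pw: "\<bar>int pp ^ i\<bar> \<le> B" "\<bar>int nu ^ i\<bar> \<le> B" if "i \<le> ?m" for i
  proof -
    have "int pp ^ i \<le> int pp ^ ?m" "int nu ^ i \<le> int nu ^ ?m" using pp1 nu1 that by (auto intro: power_increasing)
    then show "\<bar>int pp ^ i\<bar> \<le> B" "\<bar>int nu ^ i\<bar> \<le> B" using PB(1) NB by (auto simp: P_def N_def n_def)
  qed
  have mn: "?m \<le> n" by simp
  define s1 where "s1 = sx ?a s0"
  have e1: "exec w ?a s0 (ctime ?a) s1" "bnd B s1" using exec_sx[OF s0(1), of ?a] B2 by (auto simp: s1_def eok_def)
  define I where "I s \<longleftrightarrow> (\<exists>i\<le>?m. vars s ''i'' = int i \<and> vars s ''P'' = int pp ^ i \<and> vars s ''N'' = int nu ^ i)" for s :: state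
  define \<mu> where "\<mu> s = ?m - nat (vars s ''i'')" for s :: state
  have "\<exists>s'. exec w (While ?b ?c) s1 (n * (ctime ?c + 2) + 1) s' \<and> bnd B s' \<and> I s' \<and> agree ?c s1 s' \<and> \<not> bval ?b s'"
  proof (rule while_sx[where I = I and \<mu> = \<mu>])
    show "bok B ?b" using B by (simp add: eok_def)
    show "cwf B ?c" using B B2 by (simp add: eok_def)
    show "bnd B s1" by fact
    show "I s1" unfolding I_def by (intro exI[of _ 0]) (auto simp: s1_def)
    show "\<mu> s1 \<le> n" unfolding \<mu>_def by (rule le_trans[OF diff_le_self mn])
  next
    fix s assume s: "bnd B s" "I s" "agree ?c s1 s" "bval ?b s"
    then obtain i where i: "i \<le> ?m" "vars s ''i'' = int i" "vars s ''P'' = int pp ^ i" "vars s ''N'' = int nu ^ i"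
      by (auto simp: I_def)
    have fr: "vars s ''n'' = int n" using s(3) s0 by (auto simp: agree_def s1_def)
    have il: "i < ?m" using s(4) fr i by (simp flip: zdiv_int)
    have b: "\<bar>int pp ^ i * int pp\<bar> \<le> B" "\<bar>int nu ^ i * int nu\<bar> \<le> B" "int i + 1 \<le> B"
      using pw[of "Suc i"] il less_le_trans[OF il mn] WB(2) by (auto simp: mult.commute)
    have "sok B ?c s" using i b by simp
    moreover have "I (sx ?c s)"
      unfolding I_def using i il by (intro exI[of _ "Suc i"]) simp
    moreover have "\<mu> (sx ?c s) < \<mu> s" using i il by (simp add: \<mu>_def nat_add_distrib)
    ultimately show "sok B ?c s \<and> I (sx ?c s) \<and> \<mu> (sx ?c s) < \<mu> s" by blast
  qed
  then obtain s' where s': "exec w (While ?b ?c) s1 (n * (ctime ?c + 2) + 1) s'" "bnd B s'" "I s'"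
    "agree ?c s1 s'" "\<not> bval ?b s'" by blast
  from s'(3) obtain i where i: "i \<le> ?m" "vars s' ''i'' = int i" "vars s' ''P'' = int pp ^ i" "vars s' ''N'' = int nu ^ i"
    by (auto simp: I_def)
  have "vars s' ''n'' = int n" using s'(4) s0 by (auto simp: agree_def s1_def)
  then have "i = ?m" using s'(5) i by (simp flip: zdiv_int)
  moreover have "exec w (p_par bb pp nu) s0 (n * 20 + 20) s'"
    unfolding p_par_def by (rule exec_mono[OF exec_Seq[OF e1(1) s'(1)]]) simp
  ultimately show ?thesis using s'(2) i by (auto simp: P_def N_def n_def)
qed

lemma rnd_exec:
  assumes s0: "bnd B s0" "vars s0 ''n'' = int n" "vars s0 ''P'' = int P" "vars s0 ''W'' = W"
  shows "\<exists>s'. exec w p_rnd s0 (n * 20 + 40) s' \<and> bnd B s' \<and> vars s' ''M'' = int P * W \<and> vars s' ''h'' = int h \<and>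
    vars s' ''H'' = int H \<and> vars s' ''m'' = int n - 1 \<and> vars s' ''o'' = 0 \<and> vars s' ''fm'' = fm \<and> vars s' ''zm'' = fm ^ n"
proof -
  let ?a = "''M'' ::= V ''P'' [*] V ''W'' ;; ''h'' ::= V ''n'' [div] K 2 ;; ''H'' ::= V ''n'' [-] V ''h'' ;;
       ''m'' ::= V ''n'' [-] K 1 ;; ''o'' ::= K 0 ;;
       ''fm'' ::= K 2 [*] (V ''M'' [*] V ''M'' [*] (V ''M'' [*] V ''M'')) ;; ''i'' ::= K 0 ;; ''zm'' ::= K 1"
  let ?b = "Less (V ''i'') (V ''n'')"
  let ?c = "''zm'' ::= V ''zm'' [*] V ''fm'' ;; ''i'' ::= V ''i'' [+] K 1"
  have pw: "\<bar>fm ^ i\<bar> \<le> B" if "i \<le> n" for i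
  proof -
    have "fm ^ i \<le> fm ^ n" using fm1 that by (intro power_increasing) auto
    moreover have "0 \<le> fm ^ i" using fm1 by simp
    ultimately show ?thesis using B(2) by (simp add: n_def)
  qed
  have hh: "int n div 2 = int h" by (simp add: h_def n_def zdiv_int)
  have hn: "int n - int h = int H" using hH by linarith
  have MB: "\<bar>int P * W\<bar> \<le> B" "\<bar>fm\<bar> \<le> B" using M_fm B(1) M1 fm1 by (auto simp: M_eq)
  have fme: "2 * (int P * W * (int P * W) * (int P * W * (int P * W))) = fm" by (simp add: fm_eq M_eq)
  have mB: "\<bar>int n - 1\<bar> \<le> B" "int h \<le> B" "int H \<le> B" "1 \<le> B" using WB(2) hH B2 by linarith+
  define s1 where "s1 = sx ?a s0"
  have ok: "sok B ?a s0" using MB mB hh hn by (simp only: sok.simps) (simp add: s0 fme)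
  have "cwf B ?a" using B2 by (simp add: eok_def)
  from exec_sx[OF s0(1) this ok] have e1: "exec w ?a s0 (ctime ?a) s1" "bnd B s1" by (auto simp: s1_def)
  have v1: "vars s1 ''M'' = int P * W" "vars s1 ''h'' = int h" "vars s1 ''H'' = int H" "vars s1 ''m'' = int n - 1"
    "vars s1 ''o'' = 0" "vars s1 ''fm'' = fm" "vars s1 ''i'' = 0" "vars s1 ''zm'' = 1" "vars s1 ''n'' = int n"
    using hh hn by (simp_all add: s1_def s0 fme)
  define I where "I s \<longleftrightarrow> (\<exists>i\<le>n. vars s ''i'' = int i \<and> vars s ''zm'' = fm ^ i)" for s :: state
  define \<mu> where "\<mu> s = n - nat (vars s ''i'')" for s :: state
  have "\<exists>s'. exec w (While ?b ?c) s1 (n * (ctime ?c + 2) + 1) s' \<and> bnd B s' \<and> I s' \<and> agree ?c s1 s' \<and> \<not> bval ?b s'"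
  proof (rule while_sx[where I = I and \<mu> = \<mu>])
    show "bok B ?b" by (simp add: eok_def)
    show "cwf B ?c" using B2 by (simp add: eok_def)
    show "bnd B s1" by fact
    show "I s1" unfolding I_def using v1 by (intro exI[of _ 0]) auto
    show "\<mu> s1 \<le> n" by (simp add: \<mu>_def)
  next
    fix s assume s: "bnd B s" "I s" "agree ?c s1 s" "bval ?b s"
    then obtain i where i: "i \<le> n" "vars s ''i'' = int i" "vars s ''zm'' = fm ^ i" by (auto simp: I_def)
    have fr: "vars s ''n'' = int n" "vars s ''fm'' = fm" using s(3) v1 by (auto simp: agree_def)
    have il: "i < n" using s(4) fr i by simp
    have b: "\<bar>fm ^ i * fm\<bar> \<le> B" "int i + 1 \<le> B" using pw[of "Suc i"] il WB(2) by (auto simp: mult.commute)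
    have "sok B ?c s" using i b fr by simp
    moreover have "I (sx ?c s)" unfolding I_def using i il fr by (intro exI[of _ "Suc i"]) simp
    moreover have "\<mu> (sx ?c s) < \<mu> s" using i il by (simp add: \<mu>_def nat_add_distrib)
    ultimately show "sok B ?c s \<and> I (sx ?c s) \<and> \<mu> (sx ?c s) < \<mu> s" by blast
  qed
  then obtain s' where s': "exec w (While ?b ?c) s1 (n * (ctime ?c + 2) + 1) s'" "bnd B s'" "I s'"
    "agree ?c s1 s'" "\<not> bval ?b s'" by blast
  from s'(3) obtain i where i: "i \<le> n" "vars s' ''i'' = int i" "vars s' ''zm'' = fm ^ i" by (auto simp: I_def)
  have fr: "vars s' u = vars s1 u" if "u \<notin> {''zm'', ''i''}" for u using s'(4) that by (auto simp: agree_def)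
  have "i = n" using s'(5) i fr[of "''n''"] v1 by simp
  moreover have "exec w p_rnd s0 (n * 20 + 40) s'"
    unfolding p_rnd_def by (rule exec_mono[OF exec_Seq[OF e1(1) s'(1)]]) simp
  ultimately show ?thesis using s'(2) i fr v1 by (intro exI[of _ s']) simp
qed

end

section \<open>Coefficient lists and the six trees\<close>

lemma set_listA: "set (listA d) = setA d" by (auto simp: listA_def setA_def)
lemma set_listB: "set listB = setB" by (auto simp: listB_def setB_def)
lemma fst_listC: "fst ` set (listC d ss) = setC d" by (auto simp: listC_def setC_def image_Un image_image)
lemma length_listA: "3 \<le> d \<Longrightarrow> length (listA d) = nat (2 * d - 2)"
  by (simp add: listA_def)
lemma length_listC: "3 \<le> d \<Longrightarrow> length (listC d ss) = nat (2 * d)"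
  by (simp add: listC_def)
lemma distinct_listA: "distinct (listA d)" by (auto simp: listA_def)
lemma distinct_listC: "distinct (listC d ss)"
  by (auto simp: listC_def distinct_map inj_on_def)
lemma listC_snd: "v \<in> set (listC d ss) \<Longrightarrow> snd v = wt d ss (fst v)"
  by (auto simp: listC_def)

lemma sum_listC:
  assumes "3 \<le> d"
  shows "(\<Sum>v\<in>set (listC d ss). snd v) = totQ d ss"
proof -
  have "(\<Sum>v\<in>set (listC d ss). snd v) = (\<Sum>v\<in>setC d. wt d ss v)"
  proof -
    have e: "set (listC d ss) = (\<lambda>v. (v, wt d ss v)) ` setC d" by (auto simp: listC_def setC_def)
    show ?thesis unfolding e by (subst sum.reindex) (auto simp: inj_on_def)
  qed
  also have "\<dots> = (\<Sum>v\<in>setC d. int ss + (if v \<in> {1, -1, d, -d} then 1 else 0))"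
    using assms by (intro sum.cong) (auto simp: wt_def extreme_def setC_def)
  also have "\<dots> = int (card (setC d)) * int ss + int (card (setC d \<inter> {1, -1, d, -d}))"
    by (simp add: sum.distrib sum.If_cases setC_def Int_def)
  also have "setC d \<inter> {1, -1, d, -d} = {1, -1, d, -d}" using assms by (auto simp: setC_def)
  \<comment> \<open>The four extreme coefficients are distinct because \<open>d\<close> is at least
    3.\<close>
  also have "card {1, -1, d, -d} = 4" using assms by (simp add: card_insert_if)
  also have "card (setC d) = nat (2 * d)"
  proof -
    have "card (setC d) = card {-d..-1} + card {1..d}" unfolding setC_def by (rule card_Un_disjoint) auto
    then show ?thesis using assms by simp
  qed
  finally show ?thesis using assms by (simp add: totQ_def)
qed

context ctx begin

lemma dot_bounds:
  assumes "sg = 1 \<or> sg = - 1" "\<And>v. v \<in> set c \<Longrightarrow> \<bar>v\<bar> \<le> d"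
  shows "4 * \<bar>dotg X o' sg c\<bar> \<le> W" "4 * \<bar>dotg E o' sg c\<bar> \<le> W"
  using dotg_le_bigW[of d sg c x o'] assms d3 by (auto simp: X_def E_def W_def)

lemma H_le: "H \<le> n" by (simp add: H_def n_def)

lemma enum_unit_exec:
  assumes s0: "bnd B s0" "vars s0 hv = int H'" "vars s0 ov = o'" "vars s0 ''N'' = int N"
      "arrs s0 ''x'' = X" "arrs s0 ''e'' = E"
    and nms: "hv \<notin> {''j'',''g'',''k'',''a'',''b'',''t'',''r''}" "ov \<notin> {''j'',''g'',''k'',''a'',''b'',''t'',''r''}" "nm \<noteq> ''''"
    and ws: "distinct ws" "\<And>v. v \<in> set ws \<Longrightarrow> \<bar>v\<bar> \<le> d" "1 \<le> length ws" "length ws \<le> qa" and H': "H' \<le> H"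
  shows "\<exists>s'. exec w (enum nm (unit_weights ws) 0 0 hv ov 1) s0 (mT * qa * 54 + 30) s' \<and> bnd B s' \<and>
     (\<exists>L. tree nm X E o' 1 L s' \<and> set L = {p. set p \<subseteq> set ws \<and> length p \<le> H'} \<and> length L \<le> mT)"
proof -
  let ?vs = "unit_weights ws"
  let ?PS = "paths (set ?vs) 0 0 (int N) H'"
  have lv: "length ?vs = length ws" by (simp add: unit_weights_def)
  have dv: "distinct ?vs" using ws(1) by (auto simp: unit_weights_def distinct_map inj_on_def)
  have sv: "snd v = 1" if "v \<in> set ?vs" for v using that by (auto simp: unit_weights_def)
  have fv: "\<bar>fst v\<bar> \<le> d" if "v \<in> set ?vs" for v using that ws(2) by (auto simp: unit_weights_def)
  have cs: "card (set ?vs) = length ws" using distinct_card[OF dv] lv by simp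
  have PS: "?PS = {p. set p \<subseteq> set ?vs \<and> length p \<le> H'}" by (rule paths_complete) (auto intro: sv)
  have "card ?PS \<le> Suc H' * card (set ?vs) ^ H'" by (rule card_paths_complete) (use sv cs ws(3) in auto)
  also have "\<dots> \<le> Suc n * qa ^ H'" unfolding cs using H' H_le ws(4) by (intro mult_mono power_mono) auto
  also have "\<dots> \<le> mT" unfolding mT_eq using H' qa2 by (intro mult_le_mono2 power_increasing) auto
  finally have cm: "card ?PS \<le> mT" .
  have mq: "int mT * int (length ws) \<le> int mT * int qa" using ws(4) by (intro mult_left_mono) auto
  have "0 \<le> int mT * int qa" by simp
  then have mB: "int mT * int qa \<le> B" using B(13) by linarith
  have "1 * 1 \<le> Suc n * qa ^ H" using qa2 by (intro mult_le_mono one_le_power) auto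
  then have mT1: "1 \<le> mT" by (simp only: mT_eq mult_1)
  have mTB: "int mT \<le> B"
  proof -
    have "int mT * 1 \<le> int mT * int qa" using qa2 by (intro mult_left_mono) auto
    then show ?thesis using mB by simp
  qed
  have qB: "int qa \<le> B"
  proof -
    have "1 * int qa \<le> int mT * int qa" using mT1 by (intro mult_right_mono) auto
    then show ?thesis using mB by simp
  qed
  have "\<exists>s'. exec w (enum nm ?vs 0 0 hv ov 1) s0 (4 * length ?vs + mT * length ?vs * 50 + 30) s' \<and> bnd B s' \<and>
     (\<exists>L. distinct L \<and> set L = ?PS \<and> vars s' (CHR ''t'' # nm) = int (length L) \<and> tree_rep nm X E o' 1 L s')"
  proof (rule enum_exec[OF s0 nms dv])
    show "\<bar>fst v\<bar> \<le> B \<and> \<bar>snd v\<bar> \<le> B" if "v \<in> set ?vs" for v using fv[OF that] sv[OF that] B(4) d3 B2 by auto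
    show "card ?PS \<le> mT" by (rule cm)
    show "int mT * int (length ?vs) \<le> B" using mq mB lv by simp
    show "int (length ?vs) \<le> B" using lv ws(4) qB by simp
    show "int mT \<le> B" by (rule mTB)
    show "int H' \<le> B" using H' H_le WB(2) by linarith
    show "\<bar>0::int\<bar> \<le> B" "\<bar>0::int\<bar> \<le> B" "\<bar>1::int\<bar> \<le> B" using B2 by auto
    fix p assume p: "set p \<subseteq> set ?vs" "length p \<le> Suc H'"
    have "\<bar>v\<bar> \<le> d" if "v \<in> set (map fst p)" for v using that p(1) fv by auto
    then have "4 * \<bar>psum X o' 1 p\<bar> \<le> W" "4 * \<bar>psum E o' 1 p\<bar> \<le> W"
      unfolding psum_dotg by (auto intro!: dot_bounds)
    moreover have "pnum (int N) p = int N"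
    proof -
      have "(\<Prod>v\<leftarrow>p. snd v) = 1" using p(1) sv by (induction p) auto
      then show ?thesis by (simp add: pnum_def)
    qed
    ultimately show "\<bar>psum X o' 1 p\<bar> \<le> B \<and> \<bar>psum E o' 1 p\<bar> \<le> B \<and> \<bar>pnum (int N) p\<bar> \<le> B \<and> \<bar>pden 0 0 p\<bar> \<le> B"
      using WB(1) NB B2 by (auto simp: pden_def)
  qed
  then obtain s' L where s': "exec w (enum nm ?vs 0 0 hv ov 1) s0 (4 * length ?vs + mT * length ?vs * 50 + 30) s'" "bnd B s'"
    and L: "distinct L" "set L = ?PS" "vars s' (CHR ''t'' # nm) = int (length L)" "tree_rep nm X E o' 1 L s'" by blast
  have "tree nm X E o' 1 (map (map fst) L) s' \<and> set (map (map fst) L) = map fst ` ?PS"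
    by (rule tree_of_paths[OF L, of "set ?vs" "\<lambda>_. 1"]) (auto simp: PS sv)
  moreover have "map fst ` ?PS = {p. set p \<subseteq> set ws \<and> length p \<le> H'}"
  proof
    show "map fst ` ?PS \<subseteq> {p. set p \<subseteq> set ws \<and> length p \<le> H'}"
      unfolding PS by (fastforce simp: unit_weights_def)
    show "{p. set p \<subseteq> set ws \<and> length p \<le> H'} \<subseteq> map fst ` ?PS"
    proof
      fix p assume "p \<in> {p. set p \<subseteq> set ws \<and> length p \<le> H'}"
      then have "unit_weights p \<in> ?PS" unfolding PS by (auto simp: unit_weights_def)
      moreover have "p = map fst (unit_weights p)" by (simp add: unit_weights_def comp_def)
      ultimately show "p \<in> map fst ` ?PS" by blast
    qed
  qed
  moreover have "length (map (map fst) L) \<le> mT" using cm L distinct_card[OF L(1)] by simp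
  moreover have "exec w (enum nm ?vs 0 0 hv ov 1) s0 (mT * qa * 54 + 30) s'"
  proof (rule exec_mono[OF s'(1)])
    have "mT * length ?vs \<le> mT * qa" "length ?vs \<le> mT * qa"
      using ws(4) lv mT1 mult_le_mono[OF mT1 ws(4)] by auto
    then show "4 * length ?vs + mT * length ?vs * 50 + 30 \<le> mT * qa * 54 + 30" by linarith
  qed
  ultimately show ?thesis using s'(2)
    by - (rule exI[of _ s'], intro conjI, assumption+, rule exI[of _ "map (map fst) L"], simp)
qed

definition heavy_paths :: "int list set" where
  "heavy_paths = map fst ` paths (set (listC d ss)) (totQ d ss) 1 (int N) n"

lemma enum_C_exec:
  assumes s0: "bnd B s0" "vars s0 ''n'' = int n" "vars s0 ov = o'" "vars s0 ''N'' = int N"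
      "arrs s0 ''x'' = X" "arrs s0 ''e'' = E"
    and nms: "ov \<notin> {''j'',''g'',''k'',''a'',''b'',''t'',''r''}" "nm \<noteq> ''''" and sg: "sg = 1 \<or> sg = - 1"
  shows "\<exists>s'. exec w (enum nm (listC d ss) (totQ d ss) 1 ''n'' ov sg) s0 (mP * nat d * 108 + 30) s' \<and> bnd B s' \<and>
     (\<exists>L. tree nm X E o' sg L s' \<and> set L = heavy_paths \<and> length L \<le> mP)"
proof -
  let ?vs = "listC d ss"
  let ?PS = "paths (set ?vs) (totQ d ss) 1 (int N) n"
  have fC: "fst v \<in> setC d" if "v \<in> set ?vs" for v using that fst_listC[of d ss] by blast
  have fv: "\<bar>fst v\<bar> \<le> d" if "v \<in> set ?vs" for v using fC[OF that] by (auto simp: setC_def)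
  have sv: "0 \<le> snd v \<and> snd v \<le> int ss + 1" if "v \<in> set ?vs" for v using listC_snd[OF that] by (simp add: wt_def)
  have Q0: "0 < totQ d ss" using d3 by (simp add: totQ_def add_nonneg_pos)
  have "int (card ?PS) \<le> int (Suc n) * int N"
    using sv N1 by (intro card_paths_weighted[OF _ Q0 sum_listC[OF d3]]) auto
  then have "int (card ?PS) \<le> int mP" by (simp only: mP_eq of_nat_mult)
  then have cm: "card ?PS \<le> mP" by simp
  have lv: "int (length ?vs) = 2 * d" "length ?vs = 2 * nat d" using length_listC[OF d3, of ss] d3 by auto
  have mP1: "1 \<le> mP" using N1 by (simp add: mP_eq)
  have mB: "int mP * (2 * d) \<le> B" "int mP \<le> B"
  proof -
    have "0 \<le> int mP * d" using d3 by simp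
    then show "int mP * (2 * d) \<le> B" using B(14) by simp
    have "int mP * 1 \<le> int mP * d" using d3 by (intro mult_left_mono) auto
    then show "int mP \<le> B" using B(14) \<open>0 \<le> int mP * d\<close> by simp
  qed
  have "\<exists>s'. exec w (enum nm ?vs (totQ d ss) 1 ''n'' ov sg) s0 (4 * length ?vs + mP * length ?vs * 50 + 30) s' \<and> bnd B s' \<and>
     (\<exists>L. distinct L \<and> set L = ?PS \<and> vars s' (CHR ''t'' # nm) = int (length L) \<and> tree_rep nm X E o' sg L s')"
  proof (rule enum_exec[OF s0 _ nms distinct_listC])
    show "''n'' \<notin> {''j'',''g'',''k'',''a'',''b'',''t'',''r''}" by simp
    show "\<bar>fst v\<bar> \<le> B \<and> \<bar>snd v\<bar> \<le> B" if "v \<in> set ?vs" for v using fv[OF that] sv[OF that] B(4,9) d3 by auto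
    show "card ?PS \<le> mP" by (rule cm)
    show "int mP * int (length ?vs) \<le> B" using mB lv by simp
    show "int (length ?vs) \<le> B" using lv B(4) d3 by simp
    show "int mP \<le> B" by (rule mB)
    show "int n \<le> B" using WB(2) by linarith
    show "\<bar>totQ d ss\<bar> \<le> B" using B(8) Q0 by simp
    show "\<bar>sg\<bar> \<le> B" "\<bar>1::int\<bar> \<le> B" using B2 sg by auto
    fix p assume p: "set p \<subseteq> set ?vs" "length p \<le> Suc n"
    have "\<bar>v\<bar> \<le> d" if "v \<in> set (map fst p)" for v using that p(1) fv by auto
    then have "4 * \<bar>psum X o' sg p\<bar> \<le> W" "4 * \<bar>psum E o' sg p\<bar> \<le> W"
      unfolding psum_dotg using dot_bounds[OF sg] by blast+
    moreover have "0 \<le> pnum (int N) p \<and> pnum (int N) p \<le> B"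
    proof -
      have "0 \<le> (\<Prod>v\<leftarrow>p. snd v) \<and> (\<Prod>v\<leftarrow>p. snd v) \<le> (int ss + 1) ^ length p" using p(1) sv
      proof (induction p)
        case (Cons a p)
        then have "0 \<le> snd a" "snd a \<le> int ss + 1" "0 \<le> (\<Prod>v\<leftarrow>p. snd v)" "(\<Prod>v\<leftarrow>p. snd v) \<le> (int ss + 1) ^ length p" by auto
        then show ?case by (simp add: mult_mono)
      qed simp
      moreover have "(int ss + 1) ^ length p \<le> (int ss + 1) ^ Suc n" using p(2) by (intro power_increasing) auto
      ultimately have "0 \<le> pnum (int N) p \<and> pnum (int N) p \<le> int N * (int ss + 1) ^ Suc n"
        unfolding pnum_def by (auto intro!: mult_left_mono)
      then show ?thesis using B(11) by (simp add: n_def)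
    qed
    moreover have "0 \<le> pden 1 (totQ d ss) p \<and> pden 1 (totQ d ss) p \<le> B"
    proof -
      have "totQ d ss ^ length p \<le> totQ d ss ^ Suc n" using p(2) Q0 by (intro power_increasing) auto
      then show ?thesis using B(12) Q0 by (simp add: pden_def n_def)
    qed
    ultimately show "\<bar>psum X o' sg p\<bar> \<le> B \<and> \<bar>psum E o' sg p\<bar> \<le> B \<and> \<bar>pnum (int N) p\<bar> \<le> B \<and> \<bar>pden 1 (totQ d ss) p\<bar> \<le> B"
      using WB(1) by auto
  qed
  then obtain s' L where s': "exec w (enum nm ?vs (totQ d ss) 1 ''n'' ov sg) s0 (4 * length ?vs + mP * length ?vs * 50 + 30) s'" "bnd B s'"
    and L: "distinct L" "set L = ?PS" "vars s' (CHR ''t'' # nm) = int (length L)" "tree_rep nm X E o' sg L s'" by blast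
  have "tree nm X E o' sg (map (map fst) L) s' \<and> set (map (map fst) L) = map fst ` ?PS"
    by (rule tree_of_paths[OF L, of "set ?vs" "wt d ss"]) (auto simp: paths_def dest: listC_snd)
  moreover have "length (map (map fst) L) \<le> mP" using cm L distinct_card[OF L(1)] by simp
  moreover have "exec w (enum nm ?vs (totQ d ss) 1 ''n'' ov sg) s0 (mP * nat d * 108 + 30) s'"
  proof (rule exec_mono[OF s'(1)])
    have "2 * nat d \<le> 2 * (mP * nat d)" using mP1 by simp
    then show "4 * length ?vs + mP * length ?vs * 50 + 30 \<le> mP * nat d * 108 + 30" unfolding lv(2) by simp
  qed
  ultimately show ?thesis using s'(2) unfolding heavy_paths_def by blast
qed

definition trees where
  "trees L1 L2 L3 L4 s \<longleftrightarrow>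
     tree ''1'' X E 0 1 L1 s \<and> tree ''2'' X E (int h) 1 L2 s \<and> tree ''3'' X E 0 1 L3 s \<and> tree ''4'' X E (int h) 1 L4 s \<and>
     set L1 = {p. set p \<subseteq> setA d \<and> length p \<le> h} \<and> set L2 = {p. set p \<subseteq> uminus ` setB \<and> length p \<le> H} \<and>
     set L3 = {p. set p \<subseteq> setB \<and> length p \<le> h} \<and> set L4 = {p. set p \<subseteq> uminus ` setA d \<and> length p \<le> H} \<and>
     length L1 \<le> mT \<and> length L2 \<le> mT \<and> length L3 \<le> mT \<and> length L4 \<le> mT"

definition base where
  "base s \<longleftrightarrow> vars s ''n'' = int n \<and> vars s ''h'' = int h \<and> vars s ''H'' = int H \<and> vars s ''N'' = int N \<and> vars s ''P'' = int P \<and>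
     vars s ''M'' = int P * W \<and> vars s ''W'' = W \<and> vars s ''o'' = 0 \<and> vars s ''m'' = int n - 1 \<and> vars s ''q'' = (2 * d + 1) ^ n \<and>
     vars s ''zm'' = fm ^ n \<and> arrs s ''x'' = X \<and> arrs s ''e'' = E"

lemma trees_exec:
  assumes s0: "bnd B s0" "base s0"
  shows "\<exists>s'. exec w (p_trees d ss) s0 (mT * qa * 216 + mP * nat d * 216 + 200) s' \<and> bnd B s' \<and> base s' \<and>
     (\<exists>L1 L2 L3 L4 L5 L6. trees L1 L2 L3 L4 s' \<and> tree ''5'' X E 0 1 L5 s' \<and> tree ''6'' X E (int n - 1) (- 1) L6 s' \<and>
       set L5 = heavy_paths \<and> set L6 = heavy_paths \<and> length L5 \<le> mP \<and> length L6 \<le> mP)"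
proof -
  have A: "distinct (listA d)" "\<And>v. v \<in> set (listA d) \<Longrightarrow> \<bar>v\<bar> \<le> d" "1 \<le> length (listA d)" "length (listA d) \<le> qa"
    using distinct_listA d3 by (auto simp: set_listA setA_def length_listA qa_def)
  have nB: "distinct (map uminus listB)" "\<And>v. v \<in> set (map uminus listB) \<Longrightarrow> \<bar>v\<bar> \<le> d" "1 \<le> length (map uminus listB)" "length (map uminus listB) \<le> qa"
    using d3 qa2 by (auto simp: listB_def)
  have Bb: "distinct listB" "\<And>v. v \<in> set listB \<Longrightarrow> \<bar>v\<bar> \<le> d" "1 \<le> length listB" "length listB \<le> qa"
    using d3 qa2 by (auto simp: listB_def)
  have nA: "distinct (map uminus (listA d))" "\<And>v. v \<in> set (map uminus (listA d)) \<Longrightarrow> \<bar>v\<bar> \<le> d" "1 \<le> length (map uminus (listA d))" "length (map uminus (listA d)) \<le> qa"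
    using A by (auto simp: distinct_map)
  have bf: "base s'" if "base s" "exec w (enum nm vs Q D0 hv ov sg) s t s'"
    "nm \<in> {''1'', ''2'', ''3'', ''4'', ''5'', ''6''}" for s s' nm vs Q D0 hv ov sg t
    using that(1,3) enum_frame[OF that(2)] by (auto simp: base_def)
  \<comment> \<open>Trees with different names use different arrays, so those built earlier survive
    the construction of the later ones.\<close>
  have tf: "tree nm' X E o' sg' L s'" if "tree nm' X E o' sg' L s" "exec w (enum nm vs Q D0 hv ov sg) s t s'"
    "nm \<noteq> nm'" "nm' \<noteq> []" for s s' nm nm' vs Q D0 hv ov sg t o' sg' L
    by (rule tree_frame[OF that(1)]) (use enum_frame[OF that(2)] that(3,4) in auto)
  have b: "vars s ''N'' = int N" "vars s ''h'' = int h" "vars s ''H'' = int H" "vars s ''n'' = int n" "vars s ''o'' = 0"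
     "vars s ''m'' = int n - 1" "arrs s ''x'' = X" "arrs s ''e'' = E" if "base s" for s using that by (auto simp: base_def)
  from enum_unit_exec[OF s0(1) b(2)[OF s0(2)] b(5)[OF s0(2)] b(1,7,8)[OF s0(2)] _ _ _ A hH(2), of "''1''"]
  obtain s1 L1 where 1: "exec w (enum ''1'' (unit_weights (listA d)) 0 0 ''h'' ''o'' 1) s0 (mT * qa * 54 + 30) s1" "bnd B s1"
    "tree ''1'' X E 0 1 L1 s1" "set L1 = {p. set p \<subseteq> set (listA d) \<and> length p \<le> h}" "length L1 \<le> mT" by auto
  note b1 = bf[OF s0(2) 1(1), simplified]
  from enum_unit_exec[OF 1(2) b(3)[OF b1] b(2)[OF b1] b(1,7,8)[OF b1] _ _ _ nB le_refl, of "''2''"]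
  obtain s2 L2 where 2: "exec w (enum ''2'' (unit_weights (map uminus listB)) 0 0 ''H'' ''h'' 1) s1 (mT * qa * 54 + 30) s2" "bnd B s2"
    "tree ''2'' X E (int h) 1 L2 s2" "set L2 = {p. set p \<subseteq> set (map uminus listB) \<and> length p \<le> H}" "length L2 \<le> mT" by auto
  note b2 = bf[OF b1 2(1), simplified]
  from enum_unit_exec[OF 2(2) b(2)[OF b2] b(5)[OF b2] b(1,7,8)[OF b2] _ _ _ Bb hH(2), of "''3''"]
  obtain s3 L3 where 3: "exec w (enum ''3'' (unit_weights listB) 0 0 ''h'' ''o'' 1) s2 (mT * qa * 54 + 30) s3" "bnd B s3"
    "tree ''3'' X E 0 1 L3 s3" "set L3 = {p. set p \<subseteq> set listB \<and> length p \<le> h}" "length L3 \<le> mT" by auto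
  note b3 = bf[OF b2 3(1), simplified]
  from enum_unit_exec[OF 3(2) b(3)[OF b3] b(2)[OF b3] b(1,7,8)[OF b3] _ _ _ nA le_refl, of "''4''"]
  obtain s4 L4 where 4: "exec w (enum ''4'' (unit_weights (map uminus (listA d))) 0 0 ''H'' ''h'' 1) s3 (mT * qa * 54 + 30) s4" "bnd B s4"
    "tree ''4'' X E (int h) 1 L4 s4" "set L4 = {p. set p \<subseteq> set (map uminus (listA d)) \<and> length p \<le> H}" "length L4 \<le> mT" by auto
  note b4 = bf[OF b3 4(1), simplified]
  from enum_C_exec[OF 4(2) b(4)[OF b4] b(5)[OF b4] b(1,7,8)[OF b4] _ _ , of "''5''" 1]
  obtain s5 L5 where 5: "exec w (enum ''5'' (listC d ss) (totQ d ss) 1 ''n'' ''o'' 1) s4 (mP * nat d * 108 + 30) s5" "bnd B s5"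
    "tree ''5'' X E 0 1 L5 s5" "set L5 = heavy_paths" "length L5 \<le> mP" by auto
  note b5 = bf[OF b4 5(1), simplified]
  from enum_C_exec[OF 5(2) b(4)[OF b5] b(6)[OF b5] b(1,7,8)[OF b5] _ _ , of "''6''" "- 1"]
  obtain s6 L6 where 6: "exec w (enum ''6'' (listC d ss) (totQ d ss) 1 ''n'' ''m'' (- 1)) s5 (mP * nat d * 108 + 30) s6" "bnd B s6"
    "tree ''6'' X E (int n - 1) (- 1) L6 s6" "set L6 = heavy_paths" "length L6 \<le> mP" by auto
  note b6 = bf[OF b5 6(1), simplified]
  have t1: "tree ''1'' X E 0 1 L1 s6"
    by (rule tf[OF tf[OF tf[OF tf[OF tf[OF 1(3) 2(1)] 3(1)] 4(1)] 5(1)] 6(1)]; simp)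
  have t2: "tree ''2'' X E (int h) 1 L2 s6"
    by (rule tf[OF tf[OF tf[OF tf[OF 2(3) 3(1)] 4(1)] 5(1)] 6(1)]; simp)
  have t3: "tree ''3'' X E 0 1 L3 s6" by (rule tf[OF tf[OF tf[OF 3(3) 4(1)] 5(1)] 6(1)]; simp)
  have t4: "tree ''4'' X E (int h) 1 L4 s6" by (rule tf[OF tf[OF 4(3) 5(1)] 6(1)]; simp)
  have t5: "tree ''5'' X E 0 1 L5 s6" by (rule tf[OF 5(3) 6(1)]; simp)
  have "exec w (p_trees d ss) s0 (mT * qa * 216 + mP * nat d * 216 + 200) s6"
    unfolding p_trees_def
    by (rule exec_mono[OF exec_Seq[OF 1(1) exec_Seq[OF 2(1) exec_Seq[OF 3(1) exec_Seq[OF 4(1) exec_Seq[OF 5(1) 6(1)]]]]]]) simp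
  moreover have "trees L1 L2 L3 L4 s6"
    using t1 t2 t3 t4 1(4,5) 2(4,5) 3(4,5) 4(4,5) by (simp add: trees_def set_listA set_listB)
  ultimately show ?thesis using 6(2-5) b6 t5 5(4,5)
    by - (rule exI[of _ s6], intro conjI, assumption+, rule exI[of _ L1], rule exI[of _ L2], rule exI[of _ L3],
      rule exI[of _ L4], rule exI[of _ L5], rule exI[of _ L6], intro conjI, assumption+)
qed

section \<open>Solutions with many extreme coefficients\<close>

text \<open>That the solution is nonzero need not be recorded: 0 is not in \<open>C\<close>, and the
  empty vector is ruled out when the result is written.\<close>

definition Zgood :: "int \<Rightarrow> bool" where
  "Zgood z \<longleftrightarrow> (\<exists>c. length c = n \<and> set c \<subseteq> setC d \<and> dot X c = 0 \<and> z = dot E c)"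

lemma setC_bound: "v \<in> setC d \<Longrightarrow> \<bar>v\<bar> \<le> d" by (auto simp: setC_def)

lemma heavy_paths_prop: "p \<in> heavy_paths \<Longrightarrow> set p \<subseteq> setC d \<and> length p \<le> n"
proof -
  assume "p \<in> heavy_paths"
  then obtain q where q: "p = map fst q" "set q \<subseteq> set (listC d ss)" "length q \<le> n"
    by (auto simp: heavy_paths_def paths_def)
  have "set p = fst ` set q" using q(1) by simp
  also have "\<dots> \<subseteq> fst ` set (listC d ss)" using q(2) by (rule image_mono)
  finally show ?thesis using q(1,3) by (simp add: fst_listC)
qed

definition G5 :: "int \<Rightarrow> int \<Rightarrow> bool" where
  "G5 y v \<longleftrightarrow> (\<exists>p\<in>heavy_paths. y = dot X p * (int n + 1) + int (length p) \<and> v = dot E p)"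

text \<open>The signs are reversed so that a prefix sum and a suffix sum adding up to 0 give equal
  keys.\<close>

definition G6 :: "int \<Rightarrow> int \<Rightarrow> bool" where
  "G6 y v \<longleftrightarrow> (\<exists>p\<in>heavy_paths. y = (0 - dotg X (int n - 1) (- 1) p) * (int n + 1) + (int n - int (length p)) \<and>
     v = 0 - dotg E (int n - 1) (- 1) p)"

lemma split_index:
  fixes a b :: int and l l' :: nat
  assumes "a * (int n + 1) + int l = b * (int n + 1) + int l'" "l \<le> n" "l' \<le> n"
  shows "a = b \<and> l = l'"
  using index_inj[of a "Suc n" l b l'] assms by (simp add: add.commute)

lemma compat56: "compat B G5 G6 1 Zgood" "compat B G6 G5 (- 1) Zgood"
proof -
  have main: "Zgood (a - b) \<and> \<bar>a - b\<bar> \<le> B" if "G5 y a" "G6 y b" for y a b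
  proof -
    from that obtain p t where p: "p \<in> heavy_paths" "y = dot X p * (int n + 1) + int (length p)" "a = dot E p"
      and t: "t \<in> heavy_paths" "y = (0 - dotg X (int n - 1) (- 1) t) * (int n + 1) + (int n - int (length t))"
        "b = 0 - dotg E (int n - 1) (- 1) t" by (auto simp: G5_def G6_def)
    note pp = heavy_paths_prop[OF p(1)] and tp = heavy_paths_prop[OF t(1)]
    have nl: "int n - int (length t) = int (n - length t)" using tp by simp
    have e: "dot X p = 0 - dotg X (int n - 1) (- 1) t \<and> length p = n - length t"
    proof (rule split_index)
      show "dot X p * (int n + 1) + int (length p) = (0 - dotg X (int n - 1) (- 1) t) * (int n + 1) + int (n - length t)"
        using trans[OF p(2)[symmetric] t(2)] unfolding nl .
    qed (use pp in auto)
    \<comment> \<open>Tree 6 starts at position \<open>n - 1\<close> and moves down, so its paths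
      are reversed suffixes.\<close>
    define c where "c = p @ rev t"
    have ln: "int (length p) + int (length t) = int n" using e tp by simp
    have dc: "dot F c = dot F p + dotg F (int n - 1) (- 1) t" for F
      by (simp add: c_def dotg_append dotg_rev ln)
    have "length c = n" using e tp by (simp add: c_def)
    moreover have "set c \<subseteq> setC d" using pp tp by (simp add: c_def)
    moreover have "dot X c = 0" using e by (simp add: dc)
    moreover have "a - b = dot E c" using p(3) t(3) by (simp add: dc)
    moreover have "4 * \<bar>dot E c\<bar> \<le> W"
      using \<open>set c \<subseteq> setC d\<close> setC_bound by (intro dot_bounds) auto
    ultimately show ?thesis using WB(1) by (auto simp: Zgood_def)
  qed
  show "compat B G5 G6 1 Zgood" using main by (simp add: compat_def)
  have neg: "- 1 * (b - a) = a - b" for a b :: int by simp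
  show "compat B G6 G5 (- 1) Zgood" unfolding compat_def neg using main by blast
qed

lemma split_exec:
  assumes s0: "bnd B s0" "base s0" and L5: "tree ''5'' X E 0 1 L5 s0" "set L5 = heavy_paths" "length L5 \<le> mP"
    and L6: "tree ''6'' X E (int n - 1) (- 1) L6 s0" "set L6 = heavy_paths" "length L6 \<le> mP"
    and z: "vars s0 ''ok'' = 0" "arrs s0 ''FP'' = (\<lambda>_. 0)" "arrs s0 ''FQ'' = (\<lambda>_. 0)"
  shows "\<exists>s'. exec w p_split s0 (mP * 40 + 30) s' \<and> bnd B s' \<and> okinv Zgood s' \<and>
     ((\<exists>p\<in>heavy_paths. \<exists>t\<in>heavy_paths. dot X p + dotg X (int n - 1) (- 1) t = 0 \<and> length p + length t = n) \<longrightarrow> vars s' ''ok'' = 1)"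
proof -
  let ?f5 = "\<lambda>j. dot X (L5 ! j) * (int n + 1) + int (length (L5 ! j))"
  let ?v5 = "\<lambda>j. dot E (L5 ! j)"
  let ?f6 = "\<lambda>j. (0 - dotg X (int n - 1) (- 1) (L6 ! j)) * (int n + 1) + (int n - int (length (L6 ! j)))"
  let ?v6 = "\<lambda>j. 0 - dotg E (int n - 1) (- 1) (L6 ! j)"
  let ?y5 = "Arr ''S5'' (V ''j'') [*] (V ''n'' [+] K 1) [+] Arr ''l5'' (V ''j'')"
  let ?y6 = "(K 0 [-] Arr ''S6'' (V ''j'')) [*] (V ''n'' [+] K 1) [+] (V ''n'' [-] Arr ''l6'' (V ''j''))"
  let ?e5 = "Arr ''V5'' (V ''j'')"
  let ?e6 = "K 0 [-] Arr ''V6'' (V ''j'')"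
  have yb: "\<bar>a * (int n + 1) + b\<bar> \<le> B" if "4 * \<bar>a\<bar> \<le> W" "0 \<le> b" "b \<le> int n" for a b
  proof -
    have 1: "\<bar>a * (int n + 1) + b\<bar> \<le> \<bar>a\<bar> * (int n + 1) + b" using that by (simp add: abs_mult order_trans[OF abs_triangle_ineq])
    have 2: "2 * (\<bar>a\<bar> * (int n + 1)) \<le> W * (int n + 1)"
    proof -
      have "(2 * \<bar>a\<bar>) * (int n + 1) \<le> W * (int n + 1)" using that by (intro mult_right_mono) auto
      then show ?thesis by simp
    qed
    have 3: "b \<le> int n" using that by simp
    show ?thesis
    proof (cases "a = 0")
      case True then show ?thesis using that WB(2) by simp
    next
      case False
      \<comment> \<open>If the sum is nonzero, the factor 4 in the width leaves room for the length
        that is added to the key.\<close>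
      then have W4: "4 \<le> W" using that by linarith
      have "4 * int n \<le> W * int n" using W4 by (intro mult_right_mono) auto
      then have "2 * b \<le> W * int n" using 3 by linarith
      then have "2 * (\<bar>a\<bar> * (int n + 1) + b) \<le> 2 * ((int n + 2) * W)" using 2 W1 by (simp add: algebra_simps)
      then have "\<bar>a\<bar> * (int n + 1) + b \<le> (int n + 2) * W" by (simp only: mult_le_cancel_left_pos zero_less_numeral)
      from order_trans[OF 1 order_trans[OF this WB(3)]] show ?thesis .
    qed
  qed
  have p5: "L5 ! j \<in> heavy_paths" if "j < length L5" for j using that L5(2) nth_mem by blast
  have p6: "L6 ! j \<in> heavy_paths" if "j < length L6" for j using that L6(2) nth_mem by blast
  have hb: "4 * \<bar>dotg X o' sg p\<bar> \<le> W" "4 * \<bar>dotg E o' sg p\<bar> \<le> W" "length p \<le> n" if "p \<in> heavy_paths" "sg = 1 \<or> sg = -1" for p o' sg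
    using heavy_paths_prop[OF that(1)] dot_bounds[OF that(2), of p o'] setC_bound by auto
  have "\<exists>s'. exec w (look ''5'' ''P'' ''Q'' 1 ?y5 ?e5) s0 (length L5 * 20 + 10) s' \<and> bnd B s' \<and>
     tabinv ''P'' G5 s' \<and> tabinv ''Q'' G6 s' \<and> okinv Zgood s' \<and> (vars s0 ''ok'' = 1 \<longrightarrow> vars s' ''ok'' = 1) \<and>
     (\<forall>j<length L5. arrs s' (CHR ''F'' # ''P'') (?f5 j) = 1 \<and> (arrs s0 (CHR ''F'' # ''Q'') (?f5 j) = 1 \<longrightarrow> vars s' ''ok'' = 1))"
  proof (rule look_exec[where fv = ?v5])
    show "vars s0 (CHR ''t'' # ''5'') = int (length L5)" using L5 by (simp add: tree_def)
    show "eok B ?y5" "eok B ?e5" "\<bar>1::int\<bar> \<le> B" using B2 by (auto simp: eok_def)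
    fix s j assume s: "agree (look_body ''P'' ''Q'' 1 ?y5 ?e5) s0 s" "vars s ''j'' = int j" "j < length L5"
    have fr: "vars s ''n'' = int n" "arrs s ''S5'' = arrs s0 ''S5''" "arrs s ''l5'' = arrs s0 ''l5''" "arrs s ''V5'' = arrs s0 ''V5''"
      using s(1) s0(2) by (auto simp: agree_def look_body_def proc_agree base_def)
    show "aval ?y5 s = ?f5 j" using fr s L5(1) by (simp add: tree_def)
    show "aval ?e5 (s\<lparr>vars := (vars s)(''y'' := ?f5 j)\<rparr>) = ?v5 j" using fr s L5(1) by (simp add: tree_def)
  next
    fix j assume j: "j < length L5"
    note hj = hb[OF p5[OF j]]
    show "G5 (?f5 j) (?v5 j) \<and> \<bar>?f5 j\<bar> \<le> B \<and> \<bar>?v5 j\<bar> \<le> B"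
      using p5[OF j] yb[OF hj(1)[of 1 0]] hj(2)[of 1 0] hj(3)[of 1] WB(1) by (auto simp: G5_def)
  qed (use z s0 compat56 in \<open>auto simp: tabinv_def okinv_def\<close>)
  then obtain s1 where e1: "exec w (look ''5'' ''P'' ''Q'' 1 ?y5 ?e5) s0 (length L5 * 20 + 10) s1" and
     s1: "bnd B s1" "tabinv ''P'' G5 s1" "tabinv ''Q'' G6 s1" "okinv Zgood s1"
     "\<And>j. j < length L5 \<Longrightarrow> arrs s1 (CHR ''F'' # ''P'') (?f5 j) = 1" by blast
  have fr1: "vars s1 ''n'' = int n" "arrs s1 ''S6'' = arrs s0 ''S6''" "arrs s1 ''l6'' = arrs s0 ''l6''"
    "arrs s1 ''V6'' = arrs s0 ''V6''" "vars s1 ''t6'' = vars s0 ''t6''"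
    using exec_agree[OF e1] s0(2) by (auto simp: agree_def look_def look_body_def proc_agree base_def)
  have "\<exists>s'. exec w (look ''6'' ''Q'' ''P'' (- 1) ?y6 ?e6) s1 (length L6 * 20 + 10) s' \<and> bnd B s' \<and>
     tabinv ''Q'' G6 s' \<and> tabinv ''P'' G5 s' \<and> okinv Zgood s' \<and> (vars s1 ''ok'' = 1 \<longrightarrow> vars s' ''ok'' = 1) \<and>
     (\<forall>j<length L6. arrs s' (CHR ''F'' # ''Q'') (?f6 j) = 1 \<and> (arrs s1 (CHR ''F'' # ''P'') (?f6 j) = 1 \<longrightarrow> vars s' ''ok'' = 1))"
  proof (rule look_exec[where fv = ?v6])
    show "vars s1 (CHR ''t'' # ''6'') = int (length L6)" using L6 fr1 by (simp add: tree_def)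
    show "eok B ?y6" "eok B ?e6" "\<bar>- 1::int\<bar> \<le> B" using B2 by (auto simp: eok_def)
    fix s j assume s: "agree (look_body ''Q'' ''P'' (- 1) ?y6 ?e6) s1 s" "vars s ''j'' = int j" "j < length L6"
    have fr: "vars s ''n'' = int n" "arrs s ''S6'' = arrs s0 ''S6''" "arrs s ''l6'' = arrs s0 ''l6''" "arrs s ''V6'' = arrs s0 ''V6''"
      using s(1) fr1 by (auto simp: agree_def look_body_def proc_agree)
    show "aval ?y6 s = ?f6 j" using fr s L6(1) by (simp add: tree_def)
    show "aval ?e6 (s\<lparr>vars := (vars s)(''y'' := ?f6 j)\<rparr>) = ?v6 j" using fr s L6(1) by (simp add: tree_def)
  next
    fix j assume j: "j < length L6"
    note hj = hb[OF p6[OF j]]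
    have "4 * \<bar>0 - dotg X (int n - 1) (- 1) (L6 ! j)\<bar> \<le> W" using hj(1)[of "- 1" "int n - 1"] by simp
    then have "\<bar>?f6 j\<bar> \<le> B" using hj(3)[of 1] by (intro yb) auto
    then show "G6 (?f6 j) (?v6 j) \<and> \<bar>?f6 j\<bar> \<le> B \<and> \<bar>?v6 j\<bar> \<le> B"
      using p6[OF j] hj(2)[of "- 1" "int n - 1"] WB(1) by (auto simp: G6_def)
  qed (use s1 compat56 in auto)
  then obtain s2 where e2: "exec w (look ''6'' ''Q'' ''P'' (- 1) ?y6 ?e6) s1 (length L6 * 20 + 10) s2" and
     s2: "bnd B s2" "okinv Zgood s2"
     "\<And>j. j < length L6 \<Longrightarrow> arrs s1 (CHR ''F'' # ''P'') (?f6 j) = 1 \<Longrightarrow> vars s2 ''ok'' = 1" by blast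
  have "exec w p_split s0 (mP * 40 + 30) s2"
    unfolding p_split_def by (rule exec_mono[OF exec_Seq[OF e1 e2]]) (use L5(3) L6(3) in simp)
  moreover have "vars s2 ''ok'' = 1" if pt: "p \<in> heavy_paths" "t \<in> heavy_paths"
    "dot X p + dotg X (int n - 1) (- 1) t = 0" "length p + length t = n" for p t
  proof -
    obtain i where i: "i < length L5" "L5 ! i = p" using pt(1) L5(2) by (metis in_set_conv_nth)
    obtain j where j: "j < length L6" "L6 ! j = t" using pt(2) L6(2) by (metis in_set_conv_nth)
    \<comment> \<open>All prefixes are in the table before the first suffix is looked up, so it is
      the second sweep that reports the match.\<close>
    have "?f5 i = ?f6 j"
    proof -
      have "dot X p = 0 - dotg X (int n - 1) (- 1) t" "int (length p) = int n - int (length t)" using pt by linarith+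
      then show ?thesis using i j by simp
    qed
    then show ?thesis using s1(5)[OF i(1)] s2(3)[OF j(1)] by simp
  qed
  ultimately show ?thesis using s2 by blast
qed

text \<open>The split of the weights is read as a split of the vector: the prefix and the reversed
  suffix respect the budget on all their own prefixes and are therefore in the pruned trees.\<close>

lemma heavy_split_paths:
  assumes c: "length c = n" "set c \<subseteq> setC d" "dot X c = 0"
    and heavy: "totQ d ss ^ Suc n \<le> (int N)\<^sup>2 * (\<Prod>i<n. wt d ss (c ! i))"
  shows "\<exists>p\<in>heavy_paths. \<exists>t\<in>heavy_paths. dot X p + dotg X (int n - 1) (- 1) t = 0 \<and> length p + length t = n"
proof -
  let ?Q = "totQ d ss"
  have "1 \<le> wt d ss v \<and> wt d ss v \<le> ?Q" for v
  proof -
    have "1 * int ss \<le> 2 * d * int ss" using d3 by (intro mult_right_mono) auto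
    then have h: "int ss + 1 \<le> ?Q" "int ss \<le> ?Q" unfolding totQ_def by linarith+
    have "1 \<le> int ss" using ss1 by simp
    then show ?thesis using h by (simp add: wt_def)
  qed
  then obtain k where k: "k \<le> n" "\<And>j. j \<le> k \<Longrightarrow> ?Q ^ j \<le> int N * (\<Prod>i<j. wt d ss (c ! i))"
    "\<And>j. j \<le> n - k \<Longrightarrow> ?Q ^ j \<le> int N * (\<Prod>i<j. wt d ss (c ! (n - Suc i)))"
    using heavy_split[of n "\<lambda>i. wt d ss (c ! i)" ?Q "int N"] heavy N1 by auto
  define pr where "pr v = (v, wt d ss v)" for v
  have pin: "pr v \<in> set (listC d ss)" if "v \<in> setC d" for v using that by (auto simp: pr_def listC_def setC_def)
  have prod: "(\<Prod>v\<leftarrow>map pr l. snd v) = (\<Prod>i<length l. wt d ss (l ! i))" for l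
  proof (induction l rule: rev_induct)
    case (snoc a l)
    have "(\<Prod>i<length l. wt d ss ((l @ [a]) ! i)) = (\<Prod>i<length l. wt d ss (l ! i))" by (intro prod.cong) (auto simp: nth_append)
    then show ?case using snoc by (simp add: pr_def)
  qed simp
  have inP: "l \<in> heavy_paths" if l: "set l \<subseteq> setC d" "length l \<le> n"
    "\<And>j. j \<le> length l \<Longrightarrow> ?Q ^ j \<le> int N * (\<Prod>i<j. wt d ss (l ! i))" for l
  proof -
    have "map pr l \<in> paths (set (listC d ss)) ?Q 1 (int N) n"
      unfolding paths_def
    proof (intro CollectI conjI allI impI)
      show "set (map pr l) \<subseteq> set (listC d ss)" using l(1) pin by auto
      show "length (map pr l) \<le> n" using l(2) by simp
      fix j assume j: "j \<le> length (map pr l)" "0 < j"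
      have "(\<Prod>v\<leftarrow>map pr (take j l). snd v) = (\<Prod>i<j. wt d ss (l ! i))" unfolding prod using j by simp
      then show "pden 1 ?Q (take j (map pr l)) \<le> pnum (int N) (take j (map pr l))"
        using l(3)[of j] j by (simp add: pden_def pnum_def take_map)
    qed
    moreover have "l = map fst (map pr l)" by (simp add: pr_def comp_def)
    ultimately show ?thesis unfolding heavy_paths_def by blast
  qed
  define p t where "p = take k c" and "t = rev (drop k c)"
  have "p \<in> heavy_paths"
  proof (rule inP)
    show "set p \<subseteq> setC d" using c(2) set_take_subset[of k c] by (auto simp: p_def)
    show "length p \<le> n" using c(1) by (simp add: p_def)
    fix j assume "j \<le> length p"
    then have j: "j \<le> k" by (simp add: p_def)
    have "(\<Prod>i<j. wt d ss (p ! i)) = (\<Prod>i<j. wt d ss (c ! i))" using j by (intro prod.cong) (auto simp: p_def)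
    then show "?Q ^ j \<le> int N * (\<Prod>i<j. wt d ss (p ! i))" using k(2)[OF j] by simp
  qed
  moreover have "t \<in> heavy_paths"
  proof (rule inP)
    show "set t \<subseteq> setC d" using c(2) set_drop_subset[of k c] by (auto simp: t_def)
    show "length t \<le> n" using c(1) by (simp add: t_def)
    fix j assume "j \<le> length t"
    then have j: "j \<le> n - k" by (simp add: t_def c(1))
    have "(\<Prod>i<j. wt d ss (t ! i)) = (\<Prod>i<j. wt d ss (c ! (n - Suc i)))"
    proof (intro prod.cong refl)
      fix i assume "i \<in> {..<j}"
      then have "i < n - k" using j by simp
      then have "t ! i = c ! (n - Suc i)" by (simp add: t_def rev_nth c(1))
      then show "wt d ss (t ! i) = wt d ss (c ! (n - Suc i))" by simp
    qed
    then show "?Q ^ j \<le> int N * (\<Prod>i<j. wt d ss (t ! i))" using k(3)[OF j] by simp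
  qed
  moreover have lpt: "length p + length t = n" using k(1) c(1) by (simp add: p_def t_def)
  moreover have "dot X p + dotg X (int n - 1) (- 1) t = 0"
  proof -
    have "c = p @ rev t" by (simp add: p_def t_def)
    then have "dot X c = dot X p + dotg X (int (length p) + int (length t) - 1) (- 1) t" by (simp add: dotg_append dotg_rev)
    moreover have "int (length p) + int (length t) = int n" using lpt by (simp flip: of_nat_add)
    ultimately show ?thesis using c(3) by simp
  qed
  ultimately show ?thesis by blast
qed

end

section \<open>One round of sampling\<close>

lemma exec_frame:
  assumes "exec w c s t s'"
  shows "v \<notin> wv c \<Longrightarrow> vars s' v = vars s v" "a \<notin> wa c \<Longrightarrow> arrs s' a = arrs s a"
  using exec_agree[OF assms] by (simp_all add: agree_def)

text \<open>Peels one seed off \<open>z\<close> digit by digit and leaves the seeds of the later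
  rounds in it. For \<open>md = 0\<close> the second hash function is overwritten by a copy of the
  first.\<close>

definition p_dec :: com where
  "p_dec = (''md'' ::= V ''z'' [mod] K 2 ;; ''z'' ::= V ''z'' [div] K 2 ;;
     ''al'' ::= V ''z'' [mod] V ''M'' ;; ''z'' ::= V ''z'' [div] V ''M'' ;;
     ''be'' ::= V ''z'' [mod] V ''M'' ;; ''z'' ::= V ''z'' [div] V ''M'' ;;
     ''ar'' ::= V ''z'' [mod] V ''M'' ;; ''z'' ::= V ''z'' [div] V ''M'' ;;
     ''br'' ::= V ''z'' [mod] V ''M'' ;; ''z'' ::= V ''z'' [div] V ''M'' ;;
     ''ar'' ::= V ''md'' [*] V ''ar'' [+] (K 1 [-] V ''md'') [*] V ''al'' ;;
     ''br'' ::= V ''md'' [*] V ''br'' [+] (K 1 [-] V ''md'') [*] V ''be'' ;;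
     ''rb'' ::= V ''ro'' [*] V ''P'')"

definition p_half :: "vname \<Rightarrow> vname \<Rightarrow> vname \<Rightarrow> vname \<Rightarrow> vname \<Rightarrow> vname \<Rightarrow> int \<Rightarrow> com" where
  "p_half nm1 nm2 av bv own oth sg =
     bkt nm1 ''h'' av bv own ;; match nm1 nm2 ''H'' av own own oth sg"

text \<open>The tables \<open>L\<close> and \<open>R\<close> are never cleared: entries of earlier rounds are still sums of vectors \<open>u\<close>
  and \<open>v\<close>. Only the buckets must be fresh, hence the offset \<open>rb = ro * P\<close>.\<close>

definition p_round :: com where
  "p_round = p_dec ;; p_half ''1'' ''2'' ''al'' ''be'' ''L'' ''R'' 1 ;;
     p_half ''3'' ''4'' ''ar'' ''br'' ''R'' ''L'' (- 1) ;; ''ro'' ::= V ''ro'' [+] K 1"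

definition p_rounds :: com where
  "p_rounds = ''ro'' ::= K 0 ;; While (Less (V ''ro'') (V ''n'')) p_round"

lemma bkt_writes: "wv (bkt nm hv av bv bn) = {''j'', ''k'', ''b''}"
  "wa (bkt nm hv av bv bn) = {CHR ''B'' # bn, CHR ''C'' # bn}"
  by (auto simp: bkt_def bkt_body_def)

lemma match_writes:
  "wv (match nm1 nm2 hv av bn own oth sg) = {''p'', ''i'', ''f'', ''j'', ''k'', ''b'', ''g'', ''y'', ''v'', ''ok'', ''Z''}"
  "wa (match nm1 nm2 hv av bn own oth sg) = {CHR ''F'' # own, CHR ''T'' # own}"
  by (auto simp: match_def match_body_def match_pre_def match_hit_def proc_agree)

lemma p_half_writes:
  "wv (p_half nm1 nm2 av bv own oth sg) = {''p'', ''i'', ''f'', ''j'', ''k'', ''b'', ''g'', ''y'', ''v'', ''ok'', ''Z''}"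
  "wa (p_half nm1 nm2 av bv own oth sg) = {CHR ''B'' # own, CHR ''C'' # own, CHR ''F'' # own, CHR ''T'' # own}"
  unfolding p_half_def wv.simps wa.simps bkt_writes match_writes by auto

lemma bfilter_cong:
  "(\<And>j. j < n \<Longrightarrow> leaf j = leaf' j \<and> bk j = bk' j) \<Longrightarrow> bfilter leaf bk n b = bfilter leaf' bk' n b"
  unfolding bfilter_def by (rule filter_cong) auto

lemma set_bfilter: "x \<in> set (bfilter leaf bk n b) \<longleftrightarrow> x < n \<and> leaf x \<and> bk x = b"
  by (auto simp: bfilter_def)

lemma length_bfilter: "length (bfilter leaf bk n b) = card {i\<in>{i. i < n \<and> leaf i}. bk i = b}"
proof -
  have "length (bfilter leaf bk n b) = card (set (bfilter leaf bk n b))"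
    by (rule distinct_card[symmetric]) (simp add: bfilter_def)
  also have "set (bfilter leaf bk n b) = {i\<in>{i. i < n \<and> leaf i}. bk i = b}" by (auto simp: set_bfilter)
  finally show ?thesis .
qed

lemma lkey_add: "lkey md (a + b) (c + e) = lkey md a c + lkey md b e"
  by (simp add: lkey_def algebra_simps)

context ctx begin

definition bkf :: "int list list \<Rightarrow> int \<Rightarrow> int \<times> int \<Rightarrow> nat \<Rightarrow> int" where
  "bkf La md ab j = ((fst ab * lkey md (dot X (La ! j)) (dot E (La ! j)) + snd ab) mod (int P * W)) div W"

definition tgt :: "int list list \<Rightarrow> int \<Rightarrow> int \<Rightarrow> nat \<Rightarrow> int" where
  "tgt Lb md al p = (2 * int P - ((al * lkey md (dotg X (int h) 1 (Lb ! (p div 2))) (dotg E (int h) 1 (Lb ! (p div 2)))) mod (int P * W)) div W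
     - int (p mod 2)) mod int P"

definition items :: "int list list \<Rightarrow> int list list \<Rightarrow> int \<Rightarrow> int \<times> int \<Rightarrow> nat \<Rightarrow> nat list" where
  "items La Lb md ab p = (if length (Lb ! (p div 2)) = H then
     bfilter (\<lambda>j. length (La ! j) = h) (bkf La md ab) (length La) (tgt Lb md (fst ab) p) else [])"

text \<open>The number of hits in one half round, to be compared with the fuel. The bound 2 on the
  probes per entry appears as the range of \<open>p\<close>.\<close>

definition YY :: "int list list \<Rightarrow> int list list \<Rightarrow> int \<Rightarrow> int \<times> int \<Rightarrow> nat" where
  "YY La Lb md ab = (\<Sum>p<2 * length Lb. length (items La Lb md ab p))"

lemma tgt_range: "0 \<le> tgt Lb md al p \<and> tgt Lb md al p < int P"
  using P1 by (simp add: tgt_def)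

text \<open>Passing the filter ensures that one of the two probes of the second half reaches the
  bucket of the first half. A bucket may also contain vectors that do not pass; they are tabulated
  as well, since they too satisfy \<open>Gown\<close>.\<close>

lemma half_exec:
  assumes s0: "bnd B s0" "base s0" "tree nm1 X E 0 1 La s0" "tree nm2 X E (int h) 1 Lb s0"
      "length La \<le> mT" "length Lb \<le> mT" "vars s0 av = fst ab" "vars s0 bv = snd ab" "vars s0 ''md'' = md" "vars s0 ''rb'' = int k * int P" "k < n"
      "\<And>b. int k * int P \<le> b \<Longrightarrow> arrs s0 (CHR ''C'' # own) b = 0"
    and La: "\<And>a v. a \<in> set La \<Longrightarrow> v \<in> set a \<Longrightarrow> \<bar>v\<bar> \<le> d" "\<And>a v. a \<in> set Lb \<Longrightarrow> v \<in> set a \<Longrightarrow> \<bar>v\<bar> \<le> d"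
    and nms: "nm1 \<noteq> ''''" "nm2 \<noteq> ''''" "own \<noteq> ''''" "own \<noteq> oth"
      "av \<notin> {''j'', ''k'', ''b'', ''g'', ''y'', ''v'', ''i'', ''f'', ''p'', ''ok'', ''Z''}" "bv \<notin> {''j'', ''k'', ''b''}"
    and sg: "sg = 1 \<or> sg = - 1"
    and G: "\<And>a b. a \<in> set La \<Longrightarrow> b \<in> set Lb \<Longrightarrow> length a = h \<Longrightarrow> length b = H \<Longrightarrow> Gown (dot X (a @ b)) (dot E (a @ b))"
    and inv: "tabinv own Gown s0" "tabinv oth Goth s0" "okinv Zgood s0" "compat B Gown Goth sg Zgood"
  shows "\<exists>s'. exec w (p_half nm1 nm2 av bv own oth sg) s0 (mT * 100 + N * 40 + 30) s' \<and> bnd B s' \<and>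
     tabinv own Gown s' \<and> tabinv oth Goth s' \<and> okinv Zgood s' \<and> (vars s0 ''ok'' = 1 \<longrightarrow> vars s' ''ok'' = 1) \<and>
     (\<forall>b. int (Suc k) * int P \<le> b \<longrightarrow> arrs s' (CHR ''C'' # own) b = 0) \<and>
     (YY La Lb md ab < N \<longrightarrow> (\<forall>a\<in>set La. \<forall>b\<in>set Lb. length a = h \<longrightarrow> length b = H \<longrightarrow>
        passes P W ab (lkey md (dot X (a @ b)) (dot E (a @ b))) \<longrightarrow>
        arrs s' (CHR ''F'' # own) (dot X (a @ b)) = 1 \<and>
        (arrs s0 (CHR ''F'' # oth) (dot X (a @ b)) = 1 \<longrightarrow> vars s' ''ok'' = 1)))"
proof -
  let ?T1 = "length La" and ?T2 = "length Lb" and ?rb = "int k * int P"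
  have Pp: "0 < int P" "0 < W" using P1 W1 by auto
  have b0: "vars s0 ''h'' = int h" "vars s0 ''H'' = int H" "vars s0 ''N'' = int N" "vars s0 ''P'' = int P" "vars s0 ''M'' = int P * W" "vars s0 ''W'' = W"
    using s0(2) by (auto simp: base_def)
  have rbB: "?rb + int P \<le> B"
  proof -
    have "?rb + int P = (int k + 1) * int P" by (simp add: algebra_simps)
    also have "\<dots> \<le> (int n + 1) * int P" using s0(11) by (intro mult_right_mono) auto
    finally show ?thesis using PB(2) by simp
  qed
  let ?leaf = "\<lambda>j. arrs s0 (CHR ''l'' # nm1) (int j) = int h"
  let ?bk = "\<lambda>j. ((fst ab * lkey md (arrs s0 (CHR ''S'' # nm1) (int j)) (arrs s0 (CHR ''V'' # nm1) (int j)) + snd ab) mod (int P * W)) div W"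
  define xs where "xs = bfilter ?leaf ?bk ?T1"
  have "\<exists>s'. exec w (bkt nm1 ''h'' av bv own) s0 (?T1 * 20 + 10) s' \<and> bnd B s' \<and>
     buckets own ?rb ?T1 (int P) (bfilter ?leaf ?bk ?T1) s' \<and>
     (\<forall>b. b \<notin> {?rb..<?rb + int P} \<longrightarrow> arrs s' (CHR ''C'' # own) b = arrs s0 (CHR ''C'' # own) b)"
  proof (rule bkt_exec)
    show "vars s0 (CHR ''t'' # nm1) = int ?T1" using s0(3) by (simp add: tree_def)
  qed (use s0 b0 Pp rbB nms in auto)
  then obtain s1 where s1: "exec w (bkt nm1 ''h'' av bv own) s0 (?T1 * 20 + 10) s1" "bnd B s1"
     "buckets own ?rb ?T1 (int P) xs s1"
     "\<And>b. b \<notin> {?rb..<?rb + int P} \<Longrightarrow> arrs s1 (CHR ''C'' # own) b = arrs s0 (CHR ''C'' # own) b"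
    unfolding xs_def by blast
  have f1: "vars s1 v = vars s0 v" if "v \<notin> {''j'', ''k'', ''b''}" for v
    by (rule exec_frame(1)[OF s1(1)]) (unfold bkt_writes, rule that)
  have f1a: "arrs s1 a = arrs s0 a" if "a \<notin> {CHR ''B'' # own, CHR ''C'' # own}" for a
    by (rule exec_frame(2)[OF s1(1)]) (unfold bkt_writes, rule that)
  have xs_eq: "xs b = bfilter (\<lambda>j. length (La ! j) = h) (bkf La md ab) ?T1 b" for b
    unfolding xs_def by (rule bfilter_cong) (use s0(3) in \<open>auto simp: tree_def bkf_def\<close>)
  let ?S1 = "\<lambda>j. arrs s1 (CHR ''S'' # nm1) (int j)" and ?V1 = "\<lambda>j. arrs s1 (CHR ''V'' # nm1) (int j)"
  let ?S2 = "\<lambda>j. arrs s1 (CHR ''S'' # nm2) (int j)" and ?V2 = "\<lambda>j. arrs s1 (CHR ''V'' # nm2) (int j)"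
  define its where "its p = (if arrs s1 (CHR ''l'' # nm2) (int (p div 2)) = int H then
      xs ((2 * int P - ((fst ab * lkey md (?S2 (p div 2)) (?V2 (p div 2))) mod (int P * W)) div W - int (p mod 2)) mod int P) else [])" for p
  have t1: "?S1 j = dot X (La ! j)" "?V1 j = dot E (La ! j)" if "j < ?T1" for j
    using s0(3) that f1a by (auto simp: tree_def)
  have t2: "?S2 j = dotg X (int h) 1 (Lb ! j)" "?V2 j = dotg E (int h) 1 (Lb ! j)" "arrs s1 (CHR ''l'' # nm2) (int j) = int (length (Lb ! j))" if "j < ?T2" for j
    using s0(4) that f1a by (auto simp: tree_def)
  have its_eq: "its p = items La Lb md ab p" if "p < 2 * ?T2" for p
  proof -
    have "p div 2 < ?T2" using that by auto
    then show ?thesis by (simp add: its_def items_def t2 xs_eq tgt_def)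
  qed
  have item: "x < ?T1 \<and> length (La ! x) = h \<and> length (Lb ! (p div 2)) = H \<and> p div 2 < ?T2" if "p < 2 * ?T2" "x \<in> set (its p)" for p x
    using that by (auto simp: its_eq items_def set_bfilter split: if_splits)
  have dapp: "dot F (a @ b) = dot F a + dotg F (int h) 1 b" if "length a = h" for F a b
    using that by (simp add: dotg_append)
  have val: "?S1 x + ?S2 (p div 2) = dot X (La ! x @ Lb ! (p div 2))" "?V1 x + ?V2 (p div 2) = dot E (La ! x @ Lb ! (p div 2))"
    if "p < 2 * ?T2" "x \<in> set (its p)" for p x
    using item[OF that] t1[of x] t2[of "p div 2"] dapp by auto
  have T2B: "2 * int ?T2 \<le> B"
  proof -
    have "int mT * 1 \<le> int mT * int qa" using qa2 by (intro mult_left_mono) auto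
    then show ?thesis using B(13) s0(6) by linarith
  qed
  have bd: "\<bar>dot X (La ! x @ Lb ! j)\<bar> \<le> B" "\<bar>dot E (La ! x @ Lb ! j)\<bar> \<le> B" if "x < ?T1" "j < ?T2" for x j
  proof -
    have "\<bar>v\<bar> \<le> d" if "v \<in> set (La ! x @ Lb ! j)" for v
      using La(1)[OF nth_mem[OF \<open>x < ?T1\<close>], of v] La(2)[OF nth_mem[OF \<open>j < ?T2\<close>], of v] that by auto
    then have "4 * \<bar>dot X (La ! x @ Lb ! j)\<bar> \<le> W" "4 * \<bar>dot E (La ! x @ Lb ! j)\<bar> \<le> W" by (auto intro: dot_bounds)
    then show "\<bar>dot X (La ! x @ Lb ! j)\<bar> \<le> B" "\<bar>dot E (La ! x @ Lb ! j)\<bar> \<le> B" using WB(1) by auto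
  qed
  have "\<exists>s'. exec w (match nm1 nm2 ''H'' av own own oth sg) s1 ((2 * ?T2 + N) * 40 + 10) s' \<and> bnd B s' \<and>
     tabinv own Gown s' \<and> tabinv oth Goth s' \<and> okinv Zgood s' \<and> (vars s1 ''ok'' = 1 \<longrightarrow> vars s' ''ok'' = 1) \<and>
     ((\<Sum>p<2 * ?T2. length (its p)) < N \<longrightarrow>
       (\<forall>p<2 * ?T2. \<forall>x\<in>set (its p). arrs s' (CHR ''F'' # own) (?S1 x + ?S2 (p div 2)) = 1 \<and>
          (arrs s1 (CHR ''F'' # oth) (?S1 x + ?S2 (p div 2)) = 1 \<longrightarrow> vars s' ''ok'' = 1)))"
  proof (rule match_exec[where al = "fst ab" and md = md and P = "int P" and W = W and rb = ?rb and xs = xs and H = "int H" and ?T1.0 = ?T1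
      and Gown = Gown and Goth = Goth])
    show "bnd B s1" by fact
    show "vars s1 (CHR ''t'' # nm1) = int ?T1" "vars s1 (CHR ''t'' # nm2) = int ?T2"
      using s0(3,4) nms f1 by (auto simp: tree_def)
    show "buckets own ?rb ?T1 (int P) xs s1" by fact
    show "length (xs b) \<le> ?T1" for b unfolding xs_def by (rule bfilter_length)
    show "its p = (if arrs s1 (CHR ''l'' # nm2) (int (p div 2)) = int H then
      xs ((2 * int P - ((fst ab * lkey md (?S2 (p div 2)) (?V2 (p div 2))) mod (int P * W)) div W - int (p mod 2)) mod int P) else [])" for p
      by (rule its_def)
    show "Gown (?S1 x + ?S2 (p div 2)) (?V1 x + ?V2 (p div 2)) \<and>
       \<bar>?S1 x + ?S2 (p div 2)\<bar> \<le> B \<and> \<bar>?V1 x + ?V2 (p div 2)\<bar> \<le> B" if "p < 2 * ?T2" "x \<in> set (its p)" for p x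
      unfolding val[OF that] using item[OF that] G[of "La ! x" "Lb ! (p div 2)"] bd[of x "p div 2"] by simp
    show "tabinv own Gown s1" "tabinv oth Goth s1" "okinv Zgood s1"
      using inv f1 f1a by (auto simp: tabinv_def okinv_def)
    show "\<bar>sg\<bar> \<le> B" using sg B2 by auto
    show "av \<notin> {''j'', ''k'', ''b'', ''g'', ''y'', ''v'', ''i'', ''f'', ''p'', ''ok'', ''Z''}" by fact
    show "vars s1 av = fst ab" using f1[of av] nms(5) s0(7) by auto
  qed (use inv(4) b0 s0 f1 Pp rbB T2B nms in auto)
  then obtain s2 where s2: "exec w (match nm1 nm2 ''H'' av own own oth sg) s1 ((2 * ?T2 + N) * 40 + 10) s2" "bnd B s2"
     "tabinv own Gown s2" "tabinv oth Goth s2" "okinv Zgood s2" "vars s1 ''ok'' = 1 \<longrightarrow> vars s2 ''ok'' = 1"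
     and all: "(\<Sum>p<2 * ?T2. length (its p)) < N \<Longrightarrow>
       (\<forall>p<2 * ?T2. \<forall>x\<in>set (its p). arrs s2 (CHR ''F'' # own) (?S1 x + ?S2 (p div 2)) = 1 \<and>
          (arrs s1 (CHR ''F'' # oth) (?S1 x + ?S2 (p div 2)) = 1 \<longrightarrow> vars s2 ''ok'' = 1))" by blast
  have ex: "exec w (p_half nm1 nm2 av bv own oth sg) s0 (mT * 100 + N * 40 + 30) s2"
    unfolding p_half_def by (rule exec_mono[OF exec_Seq[OF s1(1) s2(1)]]) (use s0(5,6) in simp)
  have C: "arrs s2 (CHR ''C'' # own) b = 0" if b: "int (Suc k) * int P \<le> b" for b
  proof -
    have "arrs s2 (CHR ''C'' # own) = arrs s1 (CHR ''C'' # own)"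
      using exec_agree[OF s2(1)] unfolding agree_def match_writes by auto
    \<comment> \<open>Round \<open>k\<close> touches only the counters of its own block of
      \<open>P\<close> buckets, so those of the next round are still zero.\<close>
    moreover have ge: "?rb + int P \<le> b" using b by (simp add: algebra_simps)
    then have "arrs s1 (CHR ''C'' # own) b = arrs s0 (CHR ''C'' # own) b" by (intro s1(4)) auto
    moreover have "arrs s0 (CHR ''C'' # own) b = 0" using ge Pp by (intro s0(12)) simp
    ultimately show ?thesis by simp
  qed
  have fin: "arrs s2 (CHR ''F'' # own) (dot X (a @ b)) = 1 \<and>
        (arrs s0 (CHR ''F'' # oth) (dot X (a @ b)) = 1 \<longrightarrow> vars s2 ''ok'' = 1)"
    if Y: "YY La Lb md ab < N" and ab: "a \<in> set La" "b \<in> set Lb" "length a = h" "length b = H"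
      and pass: "passes P W ab (lkey md (dot X (a @ b)) (dot E (a @ b)))" for a b
  proof -
    obtain i where i: "i < ?T1" "La ! i = a" using ab(1) by (metis in_set_conv_nth)
    obtain j where j: "j < ?T2" "Lb ! j = b" using ab(2) by (metis in_set_conv_nth)
    have key: "lkey md (dot X (a @ b)) (dot E (a @ b)) = lkey md (dot X a) (dot E a) + lkey md (dotg X (int h) 1 b) (dotg E (int h) 1 b)"
      using dapp[OF ab(3)] by (simp add: lkey_add)
    have "(fst ab * (lkey md (dot X a) (dot E a) + lkey md (dotg X (int h) 1 b) (dotg E (int h) 1 b)) + snd ab) mod (int P * W) < W"
      using pass unfolding passes_def key .
    from bucket_complete[OF Pp this] obtain q where q: "q = 0 \<or> q = (1::int)"
      "bkf La md ab i = (2 * int P - ((fst ab * lkey md (dotg X (int h) 1 b) (dotg E (int h) 1 b)) mod (int P * W)) div W - q) mod int P"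
      unfolding bkf_def i(2) by blast
    \<comment> \<open>The probe at which this pair is met: entry \<open>j\<close> with the carry
      \<open>q\<close>.\<close>
    define p where "p = 2 * j + nat q"
    have p: "p div 2 = j" "int (p mod 2) = q" "p < 2 * ?T2" using q(1) j(1) by (auto simp: p_def)
    have "i \<in> set (items La Lb md ab p)"
      unfolding items_def set_bfilter tgt_def p(1,2) j(2) using ab(3,4) i q(2) by (simp add: set_bfilter)
    then have ii: "i \<in> set (its p)" using its_eq[OF p(3)] by simp
    have "(\<Sum>p<2 * ?T2. length (its p)) = YY La Lb md ab"
      unfolding YY_def by (intro sum.cong refl) (simp add: its_eq)
    then have "(\<Sum>p<2 * ?T2. length (its p)) < N" using Y by simp
    from all[OF this] p(3) ii have "arrs s2 (CHR ''F'' # own) (?S1 i + ?S2 (p div 2)) = 1 \<and>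
          (arrs s1 (CHR ''F'' # oth) (?S1 i + ?S2 (p div 2)) = 1 \<longrightarrow> vars s2 ''ok'' = 1)" by blast
    then show ?thesis unfolding val(1)[OF p(3) ii] using f1a[of "CHR ''F'' # oth"] by (simp add: p(1) i j)
  qed
  have okm: "vars s0 ''ok'' = 1 \<longrightarrow> vars s2 ''ok'' = 1" using s2(6) f1[of "''ok''"] by simp
  show ?thesis
    by (rule exI[of _ s2]) (use ex s2 C fin okm in blast)
qed

definition GU :: "int \<Rightarrow> int \<Rightarrow> bool" where "GU y v \<longleftrightarrow> (\<exists>u. inU d n h u \<and> y = dot X u \<and> v = dot E u)"
definition GV :: "int \<Rightarrow> int \<Rightarrow> bool" where "GV y v \<longleftrightarrow> (\<exists>u. inV d n h u \<and> y = dot X u \<and> v = dot E u)"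

text \<open>The table keys are the true sums; hash values only select what is entered. A match is
  therefore valid even if its two vectors come from different rounds or modes.\<close>

lemma compatUV: "compat B GU GV 1 Zgood" "compat B GV GU (- 1) Zgood"
proof -
  have main: "Zgood (a - b) \<and> \<bar>a - b\<bar> \<le> B" if "GU y a" "GV y b" for y a b
  proof -
    from that obtain u v where u: "inU d n h u" "y = dot X u" "a = dot E u" and v: "inV d n h v" "y = dot X v" "b = dot E v"
      by (auto simp: GU_def GV_def)
    define c where "c = map2 (-) u v"
    have l: "length u = n" "length v = n" using u v by (auto simp: inU_def inV_def)
    have C: "set c \<subseteq> setC d" unfolding c_def by (rule diff_in_C[OF d3 u(1) v(1)])
    have "dot X c = 0" "dot E c = a - b" using l u v by (simp_all add: c_def dotg_diff)
    moreover have "length c = n" using l by (simp add: c_def)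
    moreover have "4 * \<bar>dot E c\<bar> \<le> W" using C setC_bound by (intro dot_bounds) auto
    ultimately have "Zgood (a - b)" "4 * \<bar>a - b\<bar> \<le> W" using C unfolding Zgood_def by auto
    moreover have "\<bar>a - b\<bar> \<le> 4 * \<bar>a - b\<bar>" by simp
    ultimately show ?thesis using WB(1) by (blast intro: order_trans)
  qed
  show "compat B GU GV 1 Zgood" using main by (simp add: compat_def)
  have neg: "- 1 * (b - a) = a - b" for a b :: int by simp
  show "compat B GV GU (- 1) Zgood" unfolding compat_def neg using main by blast
qed

definition rinv where
  "rinv L1 L2 L3 L4 k s \<longleftrightarrow> base s \<and> trees L1 L2 L3 L4 s \<and> vars s ''ro'' = int k \<and>
     tabinv ''L'' GU s \<and> tabinv ''R'' GV s \<and> okinv Zgood s \<and>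
     (\<forall>b. int k * int P \<le> b \<longrightarrow> arrs s ''CL'' b = 0 \<and> arrs s ''CR'' b = 0)"

lemma round_exec:
  assumes s0: "bnd B s0" "rinv L1 L2 L3 L4 k s0" "vars s0 ''z'' = z" "0 \<le> z" "k < n"
  shows "\<exists>s'. exec w p_round s0 (mT * 200 + N * 80 + 120) s' \<and> bnd B s' \<and> rinv L1 L2 L3 L4 (Suc k) s' \<and> vars s' ''z'' = z div fm \<and>
    (vars s0 ''ok'' = 1 \<or> good_seed d x P W N (YY L1 L2) (YY L3 L4) (z mod fm) \<longrightarrow> vars s' ''ok'' = 1)"
proof -
  have b0: "base s0" "trees L1 L2 L3 L4 s0" "vars s0 ''ro'' = int k" "tabinv ''L'' GU s0" "tabinv ''R'' GV s0" "okinv Zgood s0"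
     "\<And>b. int k * int P \<le> b \<Longrightarrow> arrs s0 ''CL'' b = 0 \<and> arrs s0 ''CR'' b = 0"
    using s0(2) by (auto simp: rinv_def)
  have Mv: "vars s0 ''M'' = M" "vars s0 ''P'' = int P" using b0(1) by (auto simp: base_def M_eq)
  have MB: "M \<le> B" using M_fm B(1) by simp
  have M0: "0 < M" using M1 by simp
  have "\<bar>vars s0 ''z''\<bar> \<le> B" using s0(1) unfolding bnd_def by blast
  then have zB: "z \<le> B" using s0(3) by linarith
  have fmM: "fm = 2 * (M * (M * (M * M)))" by (simp add: fm_eq mult.assoc)
  define md al be ar br where "md = z mod 2" and "al = z div 2 mod M" and "be = z div 2 div M mod M"
    and "ar = z div 2 div M div M mod M" and "br = z div 2 div M div M div M mod M"
  define ar' br' where "ar' = md * ar + (1 - md) * al" and "br' = md * br + (1 - md) * be"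
  have md01: "md = 0 \<or> md = 1" by (auto simp: md_def)
  have rng: "0 \<le> al" "al < M" "0 \<le> be" "be < M" "0 \<le> ar" "ar < M" "0 \<le> br" "br < M"
    using M0 by (auto simp: al_def be_def ar_def br_def)
  have rng': "0 \<le> ar'" "ar' < M" "0 \<le> br'" "br' < M" using rng md01 by (auto simp: ar'_def br'_def)
  have zd: "0 \<le> z div 2" "z div 2 \<le> B" "0 \<le> z div 2 div M" "z div 2 div M \<le> B" "0 \<le> z div 2 div M div M" "z div 2 div M div M \<le> B"
    "0 \<le> z div 2 div M div M div M" "z div 2 div M div M div M \<le> B" "0 \<le> z div 2 div M div M div M div M" "z div 2 div M div M div M div M \<le> B"
  proof -
    have *: "0 \<le> y div m \<and> y div m \<le> B" if "0 \<le> y" "y \<le> B" "0 < m" for y m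
      using abs_div_le[of y m] that by (auto simp: pos_imp_zdiv_nonneg_iff)
    have 1: "0 \<le> z div 2 \<and> z div 2 \<le> B" by (rule *) (use s0(4) zB in auto)
    have 2: "0 \<le> z div 2 div M \<and> z div 2 div M \<le> B" by (rule *) (use 1 M0 in auto)
    have 3: "0 \<le> z div 2 div M div M \<and> z div 2 div M div M \<le> B" by (rule *) (use 2 M0 in auto)
    have 4: "0 \<le> z div 2 div M div M div M \<and> z div 2 div M div M div M \<le> B" by (rule *) (use 3 M0 in auto)
    have 5: "0 \<le> z div 2 div M div M div M div M \<and> z div 2 div M div M div M div M \<le> B" by (rule *) (use 4 M0 in auto)
    show "0 \<le> z div 2" "z div 2 \<le> B" "0 \<le> z div 2 div M" "z div 2 div M \<le> B" "0 \<le> z div 2 div M div M" "z div 2 div M div M \<le> B"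
    "0 \<le> z div 2 div M div M div M" "z div 2 div M div M div M \<le> B" "0 \<le> z div 2 div M div M div M div M" "z div 2 div M div M div M div M \<le> B"
      using 1 2 3 4 5 by auto
  qed
  have rbB: "int k * int P \<le> B" "0 \<le> int k * int P"
  proof -
    have "int k * int P \<le> (int n + 1) * int P" using s0(5) by (intro mult_right_mono) auto
    then show "int k * int P \<le> B" using PB(2) by simp
  qed simp
  define s1 where "s1 = sx p_dec s0"
  define z1 z2 z3 z4 z5 where "z1 = z div 2" and "z2 = z div 2 div M" and "z3 = z div 2 div M div M"
    and "z4 = z div 2 div M div M div M" and "z5 = z div 2 div M div M div M div M"
  have ops: "opval Mod z 2 = md" "opval Div z 2 = z1" "opval Mod z1 M = al" "opval Div z1 M = z2" "opval Mod z2 M = be" "opval Div z2 M = z3"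
    "opval Mod z3 M = ar" "opval Div z3 M = z4" "opval Mod z4 M = br" "opval Div z4 M = z5"
    "opval Add (opval Mul md ar) (opval Mul (opval Sub 1 md) al) = ar'" "opval Add (opval Mul md br) (opval Mul (opval Sub 1 md) be) = br'"
    "opval Mul (int k) (int P) = int k * int P"
    by (simp_all only: opval.simps md_def al_def be_def ar_def br_def z1_def z2_def z3_def z4_def z5_def ar'_def br'_def)
  have v1: "vars s1 ''md'' = md" "vars s1 ''al'' = al" "vars s1 ''be'' = be" "vars s1 ''ar'' = ar'" "vars s1 ''br'' = br'"
    "vars s1 ''z'' = z5" "vars s1 ''rb'' = int k * int P"
    unfolding s1_def p_dec_def by (simp_all del: opval.simps add: Mv b0(3) s0(3) ops)
  have a1: "arrs s1 = arrs s0" by (simp add: s1_def p_dec_def del: opval.simps)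
  have B1: "1 \<le> B" using B2 by simp
  have q: "\<bar>md\<bar> \<le> B" "\<bar>z1\<bar> \<le> B" "\<bar>al\<bar> \<le> B" "\<bar>z2\<bar> \<le> B" "\<bar>be\<bar> \<le> B"
    "\<bar>z3\<bar> \<le> B" "\<bar>ar\<bar> \<le> B" "\<bar>z4\<bar> \<le> B" "\<bar>br\<bar> \<le> B" "\<bar>z5\<bar> \<le> B" "\<bar>ar'\<bar> \<le> B" "\<bar>br'\<bar> \<le> B"
    using rng rng' zd[folded z1_def z2_def z3_def z4_def z5_def] MB md01 B1 by auto
  have q': "\<bar>int k * int P\<bar> \<le> B" using rbB by linarith
  have "sok B p_dec s0"
    by (simp add: p_dec_def Mv b0(3) s0(3) ops q q' rbB(1) del: opval.simps)
  moreover have "cwf B p_dec" using B2 by (simp add: p_dec_def eok_def)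
  ultimately have e1: "exec w p_dec s0 (ctime p_dec) s1" "bnd B s1" using exec_sx[OF s0(1)] by (auto simp: s1_def)
  have f1: "vars s1 v = vars s0 v" if "v \<notin> {''md'', ''z'', ''al'', ''be'', ''ar'', ''br'', ''rb''}" for v
    using exec_agree[OF e1(1)] that unfolding agree_def by (simp add: p_dec_def)
  have base1: "base s1" using b0(1) by (simp add: base_def f1 a1)
  have trees1: "trees L1 L2 L3 L4 s1" using b0(2) by (simp add: trees_def tree_def f1 a1)
  note tr = trees1[unfolded trees_def]
  have setB_A: "\<bar>v\<bar> \<le> d" if "v \<in> setA d \<or> v \<in> uminus ` setA d \<or> v \<in> setB \<or> v \<in> uminus ` setB" for v
    using that d3 by (auto simp: setA_def setB_def)
  have memU: "inU d n h (a @ b)" if "a \<in> set L1" "b \<in> set L2" "length a = h" "length b = H" for a b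
  proof -
    have "set a \<subseteq> setA d" "set b \<subseteq> uminus ` setB" using that tr by auto
    then show ?thesis using that(3,4) hH(1) by (auto simp: inU_def nth_append subset_iff)
  qed
  have memV: "inV d n h (a @ b)" if "a \<in> set L3" "b \<in> set L4" "length a = h" "length b = H" for a b
  proof -
    have "set a \<subseteq> setB" "set b \<subseteq> uminus ` setA d" using that tr by auto
    then show ?thesis using that(3,4) hH(1) by (auto simp: inV_def nth_append subset_iff)
  qed
  have b12: "\<bar>v\<bar> \<le> d" if "v \<in> set a" "a \<in> set L1 \<or> a \<in> set L2 \<or> a \<in> set L3 \<or> a \<in> set L4" for a v
    using that tr by (intro setB_A) auto
  have "\<exists>s'. exec w (p_half ''1'' ''2'' ''al'' ''be'' ''L'' ''R'' 1) s1 (mT * 100 + N * 40 + 30) s' \<and> bnd B s' \<and>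
     tabinv ''L'' GU s' \<and> tabinv ''R'' GV s' \<and> okinv Zgood s' \<and> (vars s1 ''ok'' = 1 \<longrightarrow> vars s' ''ok'' = 1) \<and>
     (\<forall>b. int (Suc k) * int P \<le> b \<longrightarrow> arrs s' (CHR ''C'' # ''L'') b = 0) \<and>
     (YY L1 L2 md (al, be) < N \<longrightarrow> (\<forall>a\<in>set L1. \<forall>b\<in>set L2. length a = h \<longrightarrow> length b = H \<longrightarrow>
        passes P W (al, be) (lkey md (dot X (a @ b)) (dot E (a @ b))) \<longrightarrow>
        arrs s' (CHR ''F'' # ''L'') (dot X (a @ b)) = 1 \<and>
        (arrs s1 (CHR ''F'' # ''R'') (dot X (a @ b)) = 1 \<longrightarrow> vars s' ''ok'' = 1)))" (is "\<exists>s'. ?QL s'")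
  proof (rule half_exec[OF e1(2) base1, where k = k])
    show "tree ''1'' X E 0 1 L1 s1" "tree ''2'' X E (int h) 1 L2 s1" "length L1 \<le> mT" "length L2 \<le> mT" using tr by auto
    show "GU (dot X (a @ b)) (dot E (a @ b))" if "a \<in> set L1" "b \<in> set L2" "length a = h" "length b = H" for a b
      using memU[OF that] unfolding GU_def by blast
    show "tabinv ''L'' GU s1" "tabinv ''R'' GV s1" "okinv Zgood s1" using b0 by (auto simp: tabinv_def okinv_def f1 a1)
    show "\<bar>v\<bar> \<le> d" if "a \<in> set L1" "v \<in> set a" for a v using b12 that by blast
    show "\<bar>v\<bar> \<le> d" if "a \<in> set L2" "v \<in> set a" for a v using b12 that by blast
    show "compat B GU GV 1 Zgood" by (rule compatUV)
  qed (use b0(7) s0(5) in \<open>simp_all add: v1 f1 a1\<close>)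
  then obtain s2 where Q: "?QL s2" ..
  note e2 = Q[THEN conjunct1] and full = Q[THEN conjunct2, THEN conjunct2, THEN conjunct2, THEN conjunct2, THEN conjunct2, THEN conjunct2, THEN conjunct2]
  have s2: "bnd B s2" "tabinv ''L'' GU s2" "tabinv ''R'' GV s2" "okinv Zgood s2" "vars s1 ''ok'' = 1 \<longrightarrow> vars s2 ''ok'' = 1"
    "\<forall>b. int (Suc k) * int P \<le> b \<longrightarrow> arrs s2 ''CL'' b = 0"
    using Q by - (elim conjE, assumption)+
  note full2 = full[rule_format, THEN conjunct1]
  have f2: "vars s2 v = vars s1 v" if "v \<notin> {''p'', ''i'', ''f'', ''j'', ''k'', ''b'', ''g'', ''y'', ''v'', ''ok'', ''Z''}" for v
    by (rule exec_frame(1)[OF e2]) (unfold p_half_writes, rule that)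
  have f2a: "arrs s2 a = arrs s1 a" if "a \<notin> {''BL'', ''CL'', ''FL'', ''TL''}" for a
    by (rule exec_frame(2)[OF e2]) (unfold p_half_writes, rule that)
  have base2: "base s2" using base1 by (simp add: base_def f2 f2a)
  have trees2: "trees L1 L2 L3 L4 s2" using trees1 by (simp add: trees_def tree_def f2 f2a)
  have "\<exists>s'. exec w (p_half ''3'' ''4'' ''ar'' ''br'' ''R'' ''L'' (- 1)) s2 (mT * 100 + N * 40 + 30) s' \<and> bnd B s' \<and>
     tabinv ''R'' GV s' \<and> tabinv ''L'' GU s' \<and> okinv Zgood s' \<and> (vars s2 ''ok'' = 1 \<longrightarrow> vars s' ''ok'' = 1) \<and>
     (\<forall>b. int (Suc k) * int P \<le> b \<longrightarrow> arrs s' (CHR ''C'' # ''R'') b = 0) \<and>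
     (YY L3 L4 md (ar', br') < N \<longrightarrow> (\<forall>a\<in>set L3. \<forall>b\<in>set L4. length a = h \<longrightarrow> length b = H \<longrightarrow>
        passes P W (ar', br') (lkey md (dot X (a @ b)) (dot E (a @ b))) \<longrightarrow>
        arrs s' (CHR ''F'' # ''R'') (dot X (a @ b)) = 1 \<and>
        (arrs s2 (CHR ''F'' # ''L'') (dot X (a @ b)) = 1 \<longrightarrow> vars s' ''ok'' = 1)))" (is "\<exists>s'. ?QR s'")
  proof (rule half_exec[OF s2(1) base2, where k = k])
    show "tree ''3'' X E 0 1 L3 s2" "tree ''4'' X E (int h) 1 L4 s2" "length L3 \<le> mT" "length L4 \<le> mT" using trees2 by (auto simp: trees_def)
    show "GV (dot X (a @ b)) (dot E (a @ b))" if "a \<in> set L3" "b \<in> set L4" "length a = h" "length b = H" for a b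
      using memV[OF that] unfolding GV_def by blast
    show "tabinv ''R'' GV s2" "tabinv ''L'' GU s2" "okinv Zgood s2" by fact+
    show "\<bar>v\<bar> \<le> d" if "a \<in> set L3" "v \<in> set a" for a v using b12 that by blast
    show "\<bar>v\<bar> \<le> d" if "a \<in> set L4" "v \<in> set a" for a v using b12 that by blast
    show "compat B GV GU (- 1) Zgood" by (rule compatUV)
  qed (use b0(7) s0(5) in \<open>simp_all add: f2 f2a v1 f1 a1\<close>)
  then obtain s3 where Q': "?QR s3" ..
  note e3 = Q'[THEN conjunct1] and full' = Q'[THEN conjunct2, THEN conjunct2, THEN conjunct2, THEN conjunct2, THEN conjunct2, THEN conjunct2, THEN conjunct2]
  have s3: "bnd B s3" "tabinv ''R'' GV s3" "tabinv ''L'' GU s3" "okinv Zgood s3" "vars s2 ''ok'' = 1 \<longrightarrow> vars s3 ''ok'' = 1"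
    "\<forall>b. int (Suc k) * int P \<le> b \<longrightarrow> arrs s3 ''CR'' b = 0"
    using Q' by - (elim conjE, assumption)+
  note full3 = full'[rule_format, THEN conjunct2, rule_format]
  have f3: "vars s3 v = vars s2 v" if "v \<notin> {''p'', ''i'', ''f'', ''j'', ''k'', ''b'', ''g'', ''y'', ''v'', ''ok'', ''Z''}" for v
    by (rule exec_frame(1)[OF e3]) (unfold p_half_writes, rule that)
  have f3a: "arrs s3 a = arrs s2 a" if "a \<notin> {''BR'', ''CR'', ''FR'', ''TR''}" for a
    by (rule exec_frame(2)[OF e3]) (unfold p_half_writes, rule that)
  let ?c = "''ro'' ::= V ''ro'' [+] K 1"
  have ro3: "vars s3 ''ro'' = int k" by (simp add: f3 f2 f1 b0(3))
  have "sok B ?c s3" using ro3 s0(5) WB(2) by simp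
  moreover have "cwf B ?c" using B2 by (simp add: eok_def)
  ultimately have e4: "exec w ?c s3 1 (sx ?c s3)" "bnd B (sx ?c s3)" using exec_sx[OF s3(1), of ?c] by auto
  let ?s = "sx ?c s3"
  have base3: "base s3" using base2 by (simp add: base_def f3 f3a)
  have trees3: "trees L1 L2 L3 L4 s3" using trees2 by (simp add: trees_def tree_def f3 f3a)
  have ex: "exec w p_round s0 (mT * 200 + N * 80 + 120) ?s"
    unfolding p_round_def
    by (rule exec_mono[OF exec_Seq[OF e1(1) exec_Seq[OF e2 exec_Seq[OF e3 e4(1)]]]]) (simp add: p_dec_def)
  have "rinv L1 L2 L3 L4 (Suc k) ?s"
  proof -
    have "base ?s" using base3 by (simp add: base_def)
    moreover have "trees L1 L2 L3 L4 ?s" using trees3 by (simp add: trees_def tree_def)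
    moreover have "tabinv ''L'' GU ?s" "tabinv ''R'' GV ?s" "okinv Zgood ?s" using s3 by (auto simp: tabinv_def okinv_def)
    moreover have "arrs ?s ''CL'' b = 0 \<and> arrs ?s ''CR'' b = 0" if "int (Suc k) * int P \<le> b" for b
      using s2(6)[rule_format, OF that] s3(6)[rule_format, OF that] f3a[of "''CL''"] by simp
    ultimately show ?thesis using ro3 unfolding rinv_def by simp
  qed
  moreover have "vars ?s ''z'' = z div fm"
  proof -
    \<comment> \<open>Removing the five digits of a seed amounts to one division by
      \<open>fm\<close>.\<close>
    have "z div 2 div M div M div M div M = z div (2 * (M * (M * (M * M))))"
      using M0 by (simp add: zdiv_zmult2_eq)
    then show ?thesis by (simp add: f3 f2 v1 fmM z5_def)
  qed
  moreover have "vars ?s ''ok'' = 1" if "vars s0 ''ok'' = 1"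
    using that s2(5) s3(5) by (simp add: f1)
  moreover have "vars ?s ''ok'' = 1" if good: "good_seed d x P W N (YY L1 L2) (YY L3 L4) (z mod fm)"
  proof -
    \<comment> \<open>The later seeds enter \<open>z\<close> as a multiple of
      \<open>fm = 2 * M ^ 4\<close>, which does not affect any of the digits decoded in this
      round.\<close>
    define z0 where "z0 = z mod fm"
    have zz: "z = z0 + fm * (z div fm)" by (simp add: z0_def)
    have z0: "0 \<le> z0" using fm1 by (simp add: z0_def)
    have step: "(y0 + m * q * t) div m = y0 div m + q * t \<and> (y0 + m * q * t) mod m = y0 mod m" if "0 < m" for y0 m q t :: int
      using that by (simp add: mult.assoc)
    let ?t = "z div fm"
    have d1: "z div 2 = z0 div 2 + M * (M * (M * M)) * ?t" "z mod 2 = z0 mod 2"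
      using step[of 2 z0 "M * (M * (M * M))" ?t] zz by (simp_all add: fmM)
    have d2: "z div 2 div M = z0 div 2 div M + M * (M * M) * ?t" "z div 2 mod M = z0 div 2 mod M"
      using step[OF M0, of "z0 div 2" "M * (M * M)" ?t] by (simp_all only: d1 mult.assoc)
    have d3: "z div 2 div M div M = z0 div 2 div M div M + M * M * ?t" "z div 2 div M mod M = z0 div 2 div M mod M"
      using step[OF M0, of "z0 div 2 div M" "M * M" ?t] by (simp_all only: d2 mult.assoc)
    have d4: "z div 2 div M div M div M = z0 div 2 div M div M div M + M * ?t" "z div 2 div M div M mod M = z0 div 2 div M div M mod M"
      using step[OF M0, of "z0 div 2 div M div M" "M" ?t] by (simp_all only: d3 mult.assoc)
    have d5: "z div 2 div M div M div M mod M = z0 div 2 div M div M div M mod M"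
      using step[OF M0, of "z0 div 2 div M div M div M" 1 ?t] by (simp only: d4 mult_1_right)
    have dmd: "dec_md z0 = md" by (simp add: dec_md_def md_def d1(2))
    have dab: "dec_ab (int P * W) z0 = (al, be)" by (simp add: dec_ab_def al_def be_def d2(2) d3(2) M_eq[symmetric])
    have dcd: "dec_cd (int P * W) z0 = (ar', br')"
      using md01 dmd dab by (auto simp: dec_cd_def ar'_def br'_def ar_def br_def d4(2) d5 M_eq[symmetric])
    have g: "goodt d x P W md (al, be) (ar', br')" "YY L1 L2 md (al, be) < N" "YY L3 L4 md (ar', br') < N"
      using good unfolding good_seed_def z0_def[symmetric] Let_def dmd dab dcd by auto
    from g(1) obtain u v where uv: "inU d n h u" "inV d n h v" "dot X u = dot X v"
      "passes P W (al, be) (lkey md (dot X u) (dot E u))" "passes P W (ar', br') (lkey md (dot X v) (dot E v))"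
      unfolding goodt_def by (auto simp: n_def h_def X_def E_def)
    have lu: "length u = n" "length v = n" using uv by (auto simp: inU_def inV_def)
    have sp: "length (take h u) = h" "length (drop h u) = H" "length (take h v) = h" "length (drop h v) = H"
      using lu hH by auto
    have tk: "take h u \<in> set L1" "take h v \<in> set L3"
    proof -
      have "set (take h u) \<subseteq> setA d"
      proof
        fix a assume "a \<in> set (take h u)"
        then obtain i where i: "i < h" "a = u ! i" using sp by (auto simp: in_set_conv_nth)
        then have "i < n" using hH(1) by simp
        then have "u ! i \<in> (if i < h then setA d else uminus ` setB)" using uv(1) unfolding inU_def by blast
        then show "a \<in> setA d" using i by simp
      qed
      then show "take h u \<in> set L1" using tr sp by simp
      have "set (take h v) \<subseteq> setB"
      proof
        fix a assume "a \<in> set (take h v)"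
        then obtain i where i: "i < h" "a = v ! i" using sp by (auto simp: in_set_conv_nth)
        then have "i < n" using hH(1) by simp
        then have "v ! i \<in> (if i < h then setB else uminus ` setA d)" using uv(2) unfolding inV_def by blast
        then show "a \<in> setB" using i by simp
      qed
      then show "take h v \<in> set L3" using tr sp by simp
    qed
    have dr: "drop h u \<in> set L2" "drop h v \<in> set L4"
    proof -
      have "set (drop h u) \<subseteq> uminus ` setB"
      proof
        fix a assume "a \<in> set (drop h u)"
        then obtain i where "i < H" "a = u ! (h + i)" using sp(2) by (auto simp: in_set_conv_nth)
        then have "h + i < n" "\<not> h + i < h" "a = u ! (h + i)" using hH(1) by auto
        moreover from this(1) have "u ! (h + i) \<in> (if h + i < h then setA d else uminus ` setB)" using uv(1) unfolding inU_def by blast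
        ultimately show "a \<in> uminus ` setB" by simp
      qed
      then show "drop h u \<in> set L2" using tr sp by simp
      have "set (drop h v) \<subseteq> uminus ` setA d"
      proof
        fix a assume "a \<in> set (drop h v)"
        then obtain i where "i < H" "a = v ! (h + i)" using sp(4) by (auto simp: in_set_conv_nth)
        then have "h + i < n" "\<not> h + i < h" "a = v ! (h + i)" using hH(1) by auto
        moreover from this(1) have "v ! (h + i) \<in> (if h + i < h then setB else uminus ` setA d)" using uv(2) unfolding inV_def by blast
        ultimately show "a \<in> uminus ` setA d" by simp
      qed
      then show "drop h v \<in> set L4" using tr sp by simp
    qed
    \<comment> \<open>The first half has entered the sum of \<open>u\<close>; when the second half
      comes to \<open>v\<close>, it finds the same key.\<close>
    have "arrs s2 ''FL'' (dot X u) = 1"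
      using full2[OF g(2) tk(1) dr(1) sp(1,2)] uv(4) by simp
    then have "vars s3 ''ok'' = 1" using full3[OF g(3) tk(2) dr(2) sp(3,4)] uv(3,5) by simp
    then show ?thesis by simp
  qed
  ultimately show ?thesis using ex e4(2) by blast
qed

end

section \<open>The whole program\<close>

text \<open>Recovers the coefficients from the code in \<open>Z\<close> by \<open>decode\<close>.
  The guard on \<open>n\<close> rejects the empty vector, which is not a nonzero solution.\<close>

definition p_final :: "int \<Rightarrow> com" where
  "p_final d = Cond (And (Eq (V ''ok'') (K 1)) (Less (K 0) (V ''n'')))
     ((''i'' ::= K 0 ;; ''a'' ::= V ''Z'' [+] (V ''q'' [-] K 1) [div] K 2) ;;
      While (Less (V ''i'') (V ''n''))
        (Store ''c'' (V ''i'') ((V ''a'' [div] Arr ''e'' (V ''i'')) [mod] K (2 * d + 1) [-] K d) ;;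
         ''i'' ::= V ''i'' [+] K 1) ;;
      ''found'' ::= K 1)
     Skip"

definition p_pre :: "int \<Rightarrow> nat \<Rightarrow> nat \<Rightarrow> nat \<Rightarrow> nat \<Rightarrow> com" where
  "p_pre d bb pp nu ss = p_init d ;; p_par bb pp nu ;; p_rnd ;; p_trees d ss ;; p_split"

text \<open>The digits of a single random number below \<open>fm ^ n\<close> are the seeds of the rounds, so that everything
  after \<open>Rand\<close> is deterministic.\<close>

definition prog :: "int \<Rightarrow> nat \<Rightarrow> nat \<Rightarrow> nat \<Rightarrow> nat \<Rightarrow> com" where
  "prog d bb pp nu ss = p_pre d bb pp nu ss ;; Rand ''z'' (V ''zm'') ;; (p_rounds ;; p_final d)"

text \<open>The digits of a uniform number below \<open>m ^ n\<close> are independent and uniform;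
  this makes the rounds independent although there is a single random draw.\<close>

lemma card_digits:
  fixes m :: int and Q :: "int \<Rightarrow> bool"
  assumes m: "0 < m"
  shows "card {z\<in>{0..<m ^ n}. \<forall>k<n. Q (z div m ^ k mod m)} = card {y\<in>{0..<m}. Q y} ^ n"
proof (induction n)
  case 0
  have "{z\<in>{0..<m ^ 0}. \<forall>k<0. Q (z div m ^ k mod m)} = {0}" by auto
  then show ?case by simp
next
  case (Suc n)
  let ?S = "\<lambda>n. {z\<in>{0..<m ^ n}. \<forall>k<n. Q (z div m ^ k mod m)}" and ?Y = "{y\<in>{0..<m}. Q y}"
  have dm: "(y + m * z) div m = z" "(y + m * z) mod m = y" if "y \<in> ?Y" for y z using that by auto
  have e: "?S (Suc n) = (\<lambda>(y, z). y + m * z) ` (?Y \<times> ?S n)"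
  proof
    show "?S (Suc n) \<subseteq> (\<lambda>(y, z). y + m * z) ` (?Y \<times> ?S n)"
    proof
      fix z assume z: "z \<in> ?S (Suc n)"
      have "z div m < m ^ n" using div_less_mult_int[OF m, of z "m ^ n"] z by (simp add: mult.commute)
      moreover have "0 \<le> z div m" using z m by (simp add: pos_imp_zdiv_nonneg_iff)
      moreover have "Q (z div m div m ^ k mod m)" if "k < n" for k
      proof -
        have "Q (z div m ^ Suc k mod m)" using z that by blast
        moreover have "z div m ^ Suc k = z div m div m ^ k" using m by (simp add: zdiv_zmult2_eq)
        ultimately show ?thesis by simp
      qed
      moreover have "Q (z div m ^ 0 mod m)" using z by blast
      then have "z mod m \<in> ?Y" using m by simp
      ultimately have "(z mod m, z div m) \<in> ?Y \<times> ?S n" by simp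
      then show "z \<in> (\<lambda>(y, z). y + m * z) ` (?Y \<times> ?S n)" by (rule rev_image_eqI) simp
    qed
    show "(\<lambda>(y, z). y + m * z) ` (?Y \<times> ?S n) \<subseteq> ?S (Suc n)"
    proof
      fix z' assume "z' \<in> (\<lambda>(y, z). y + m * z) ` (?Y \<times> ?S n)"
      then obtain y z where yz: "y \<in> ?Y" "z \<in> ?S n" "z' = y + m * z" by auto
      have y: "0 \<le> y" "y < m" "Q y" and z: "0 \<le> z" "z < m ^ n" "\<And>k. k < n \<Longrightarrow> Q (z div m ^ k mod m)" using yz by auto
      have "m * (z + 1) \<le> m * m ^ n" using z m by (intro mult_left_mono) auto
      then have "z' < m ^ Suc n" using y yz(3) by (simp add: algebra_simps)
      moreover have "0 \<le> z'" using y z m yz(3) by simp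
      moreover have "Q (z' div m ^ k mod m)" if "k < Suc n" for k
      proof (cases k)
        case 0 then show ?thesis using dm[OF yz(1)] y yz(3) by simp
      next
        case (Suc j)
        have "z' div m ^ k = z div m ^ j" using m dm[OF yz(1)] Suc yz(3) by (simp add: zdiv_zmult2_eq)
        then show ?thesis using z(3)[of j] that Suc by simp
      qed
      ultimately show "z' \<in> ?S (Suc n)" by simp
    qed
  qed
  have inj: "inj_on (\<lambda>(y, z). y + m * z) (?Y \<times> ?S n)"
  proof (rule inj_onI)
    fix t t' assume t: "t \<in> ?Y \<times> ?S n" "t' \<in> ?Y \<times> ?S n" "(case t of (y, z) \<Rightarrow> y + m * z) = (case t' of (y, z) \<Rightarrow> y + m * z)"
    obtain y z y' z' where e: "t = (y, z)" "t' = (y', z')" by (metis surj_pair)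
    have yy: "y \<in> ?Y" "y' \<in> ?Y" "y + m * z = y' + m * z'" using t by (auto simp: e)
    have "y = y'" using dm(2)[OF yy(1), of z] dm(2)[OF yy(2), of z'] yy(3) by (simp only:)
    moreover have "z = z'" using dm(1)[OF yy(1), of z] dm(1)[OF yy(2), of z'] yy(3) by (simp only:)
    ultimately show "t = t'" by (simp add: e)
  qed
  have "card (?S (Suc n)) = card (?Y \<times> ?S n)" unfolding e by (rule card_image[OF inj])
  then show ?case using Suc by (simp only: card_cartesian_product power_Suc)
qed

lemma init_writes: "wv (p_init d) = {''i'', ''q'', ''W''}" "wa (p_init d) = {''e''}"
  "wv (p_par bb pp nu) = {''i'', ''P'', ''N''}" "wa (p_par bb pp nu) = {}"
  "wv p_rnd = {''M'', ''h'', ''H'', ''m'', ''o'', ''fm'', ''i'', ''zm''}" "wa p_rnd = {}"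
  by (auto simp: p_init_def p_par_def p_rnd_def)

lemma split_writes: "wv p_split = {''j'', ''y'', ''v'', ''ok'', ''Z''}" "wa p_split = {''FP'', ''TP'', ''FQ'', ''TQ''}"
  by (auto simp: p_split_def look_def look_body_def proc_agree)

lemma rounds_writes:
  "''found'' \<notin> wv p_rounds" "''c'' \<notin> wa p_rounds"
  unfolding p_rounds_def p_round_def wv.simps wa.simps p_half_writes by (auto simp: p_dec_def)

context ctx begin

lemma pre_exec:
  shows "\<exists>s' L1 L2 L3 L4. exec w (p_pre d bb pp nu ss) (input_state x) (mT * qa * 216 + mP * nat d * 216 + mP * 40 + n * 60 + 400) s' \<and>
     bnd B s' \<and> base s' \<and> trees L1 L2 L3 L4 s' \<and> okinv Zgood s' \<and> vars s' ''found'' = 0 \<and>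
     arrs s' ''FL'' = (\<lambda>_. 0) \<and> arrs s' ''FR'' = (\<lambda>_. 0) \<and> arrs s' ''CL'' = (\<lambda>_. 0) \<and> arrs s' ''CR'' = (\<lambda>_. 0) \<and>
     (\<forall>c. length c = n \<longrightarrow> set c \<subseteq> setC d \<longrightarrow> dot X c = 0 \<longrightarrow>
        totQ d ss ^ Suc n \<le> (int N)\<^sup>2 * (\<Prod>i<n. wt d ss (c ! i)) \<longrightarrow> vars s' ''ok'' = 1)"
proof -
  let ?s0 = "input_state x"
  have i0: "vars ?s0 ''n'' = int n" "arrs ?s0 ''x'' = X" "\<And>v. v \<noteq> ''n'' \<Longrightarrow> vars ?s0 v = 0" "\<And>a. a \<noteq> ''x'' \<Longrightarrow> arrs ?s0 a = (\<lambda>_. 0)"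
    by (auto simp: input_state_def n_def X_def xfun_def fun_eq_iff)
  from init_exec[OF init_bnd i0(1,2)] i0(4)[of "''e''"]
  obtain s1 where e1: "exec w (p_init d) ?s0 (n * 20 + 20) s1" "bnd B s1" "arrs s1 ''e'' = E" "vars s1 ''q'' = (2 * d + 1) ^ n" "vars s1 ''W'' = W"
    by auto
  have f1: "v \<notin> {''i'', ''q'', ''W''} \<Longrightarrow> vars s1 v = vars ?s0 v" "a \<noteq> ''e'' \<Longrightarrow> arrs s1 a = arrs ?s0 a" for v a
    by (rule exec_frame[OF e1(1)]; simp add: init_writes)+
  from par_exec[OF e1(2)] f1(1)[of "''n''"] i0(1)
  obtain s2 where e2: "exec w (p_par bb pp nu) s1 (n * 20 + 20) s2" "bnd B s2" "vars s2 ''P'' = int P" "vars s2 ''N'' = int N" by auto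
  have f2: "v \<notin> {''i'', ''P'', ''N''} \<Longrightarrow> vars s2 v = vars s1 v" "arrs s2 a = arrs s1 a" for v a
    by (rule exec_frame[OF e2(1)]; simp add: init_writes)+
  have "vars s2 ''n'' = int n" "vars s2 ''W'' = W" using f2(1)[of "''n''"] f1(1)[of "''n''"] i0(1) f2(1)[of "''W''"] e1(5) by auto
  from rnd_exec[OF e2(2) this(1) e2(3) this(2)]
  obtain s3 where e3: "exec w p_rnd s2 (n * 20 + 40) s3" "bnd B s3" and v3: "vars s3 ''M'' = int P * W" "vars s3 ''h'' = int h"
    "vars s3 ''H'' = int H" "vars s3 ''m'' = int n - 1" "vars s3 ''o'' = 0" "vars s3 ''zm'' = fm ^ n" by auto
  have f3: "v \<notin> {''M'', ''h'', ''H'', ''m'', ''o'', ''fm'', ''i'', ''zm''} \<Longrightarrow> vars s3 v = vars s2 v" "arrs s3 a = arrs s2 a" for v a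
    by (rule exec_frame[OF e3(1)]; simp add: init_writes)+
  have base3: "base s3"
    unfolding base_def using v3 e2(3,4) e1(3,4,5) i0(1,2) by (simp add: f3 f2 f1)
  from trees_exec[OF e3(2) base3] obtain s4 L1 L2 L3 L4 L5 L6 where
    e4: "exec w (p_trees d ss) s3 (mT * qa * 216 + mP * nat d * 216 + 200) s4" "bnd B s4" "base s4" "trees L1 L2 L3 L4 s4"
     and L5: "tree ''5'' X E 0 1 L5 s4" "set L5 = heavy_paths" "length L5 \<le> mP"
     and L6: "tree ''6'' X E (int n - 1) (- 1) L6 s4" "set L6 = heavy_paths" "length L6 \<le> mP" by blast
  have f4: "vars s4 v = vars s3 v" if "v \<in> {''ok'', ''found''}" for v
  proof -
    have "v \<notin> wv (p_trees d ss)"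
      using that unfolding p_trees_def wv.simps enum_writes(1) by (elim insertE emptyE) simp_all
    then show ?thesis using exec_agree[OF e4(1)] unfolding agree_def by blast
  qed
  have f4a: "arrs s4 a = arrs s3 a" if "a \<in> {''FP'', ''FQ'', ''FL'', ''FR'', ''CL'', ''CR''}" for a
  proof -
    have "a \<notin> wa (p_trees d ss)"
      using that enum_writes(2) unfolding p_trees_def wa.simps by (fastforce dest!: subsetD)
    then show ?thesis using exec_agree[OF e4(1)] unfolding agree_def by blast
  qed
  have z4: "vars s4 ''ok'' = 0" "vars s4 ''found'' = 0" "arrs s4 ''FP'' = (\<lambda>_. 0)" "arrs s4 ''FQ'' = (\<lambda>_. 0)"
    "arrs s4 ''FL'' = (\<lambda>_. 0)" "arrs s4 ''FR'' = (\<lambda>_. 0)" "arrs s4 ''CL'' = (\<lambda>_. 0)" "arrs s4 ''CR'' = (\<lambda>_. 0)"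
    by (simp_all add: f4 f4a f3 f2 f1 i0)
  from split_exec[OF e4(2,3) L5 L6 z4(1,3,4)] obtain s5 where e5: "exec w p_split s4 (mP * 40 + 30) s5" "bnd B s5" "okinv Zgood s5"
     "(\<exists>p\<in>heavy_paths. \<exists>t\<in>heavy_paths. dot X p + dotg X (int n - 1) (- 1) t = 0 \<and> length p + length t = n) \<Longrightarrow> vars s5 ''ok'' = 1"
    by blast
  have f5: "v \<notin> {''j'', ''y'', ''v'', ''ok'', ''Z''} \<Longrightarrow> vars s5 v = vars s4 v" "a \<notin> {''FP'', ''TP'', ''FQ'', ''TQ''} \<Longrightarrow> arrs s5 a = arrs s4 a" for v a
    by (rule exec_frame[OF e5(1)]; simp add: split_writes)+
  have "base s5" using e4(3) by (simp add: base_def f5)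
  moreover have "trees L1 L2 L3 L4 s5" using e4(4) by (simp add: trees_def tree_def f5)
  moreover have "vars s5 ''found'' = 0" "arrs s5 ''FL'' = (\<lambda>_. 0)" "arrs s5 ''FR'' = (\<lambda>_. 0)" "arrs s5 ''CL'' = (\<lambda>_. 0)" "arrs s5 ''CR'' = (\<lambda>_. 0)"
    using z4 by (simp_all add: f5)
  moreover have "vars s5 ''ok'' = 1" if "length c = n" "set c \<subseteq> setC d" "dot X c = 0"
     "totQ d ss ^ Suc n \<le> (int N)\<^sup>2 * (\<Prod>i<n. wt d ss (c ! i))" for c
    using e5(4) heavy_split_paths[OF that] by blast
  moreover have "exec w (p_pre d bb pp nu ss) ?s0 (mT * qa * 216 + mP * nat d * 216 + mP * 40 + n * 60 + 400) s5"
    unfolding p_pre_def by (rule exec_mono[OF exec_Seq[OF e1(1) exec_Seq[OF e2(1) exec_Seq[OF e3(1) exec_Seq[OF e4(1) e5(1)]]]]]) simp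
  ultimately show ?thesis using e5(2,3)
    by - (rule exI[of _ s5], rule exI[of _ L1], rule exI[of _ L2], rule exI[of _ L3], rule exI[of _ L4], blast)
qed

lemma rounds_exec:
  assumes s0: "bnd B s0" "base s0" "trees L1 L2 L3 L4 s0" "okinv Zgood s0" "vars s0 ''z'' = z" "0 \<le> z"
    "arrs s0 ''FL'' = (\<lambda>_. 0)" "arrs s0 ''FR'' = (\<lambda>_. 0)" "arrs s0 ''CL'' = (\<lambda>_. 0)" "arrs s0 ''CR'' = (\<lambda>_. 0)"
  shows "\<exists>s'. exec w p_rounds s0 (n * (mT * 200 + N * 80 + 122) + 10) s' \<and> bnd B s' \<and> base s' \<and> okinv Zgood s' \<and>
    (vars s0 ''ok'' = 1 \<or> (\<exists>k<n. good_seed d x P W N (YY L1 L2) (YY L3 L4) (z div fm ^ k mod fm)) \<longrightarrow> vars s' ''ok'' = 1)"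
proof -
  let ?a = "''ro'' ::= K 0" and ?b = "Less (V ''ro'') (V ''n'')"
  let ?g = "\<lambda>y. good_seed d x P W N (YY L1 L2) (YY L3 L4) y"
  define s1 where "s1 = sx ?a s0"
  have e1: "exec w ?a s0 1 s1" "bnd B s1" using exec_sx[OF s0(1), of ?a] B2 by (auto simp: s1_def eok_def)
  define I where "I s \<longleftrightarrow> (\<exists>k\<le>n. rinv L1 L2 L3 L4 k s \<and> vars s ''z'' = z div fm ^ k \<and>
     (vars s0 ''ok'' = 1 \<or> (\<exists>j<k. ?g (z div fm ^ j mod fm)) \<longrightarrow> vars s ''ok'' = 1))" for s :: state
  define \<mu> where "\<mu> s = n - nat (vars s ''ro'')" for s :: state
  have nv: "vars s ''n'' = int n" "vars s ''ro'' = int k" if "rinv L1 L2 L3 L4 k s" for s k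
    using that by (auto simp: rinv_def base_def)
  have "\<exists>s'. exec w (While ?b p_round) s1 (n * (mT * 200 + N * 80 + 120 + 2) + 1) s' \<and> bnd B s' \<and> I s' \<and> agree p_round s1 s' \<and> \<not> bval ?b s'"
  proof (rule while_rule[where I = I and \<mu> = \<mu>])
    show "bok B ?b" by (simp add: eok_def)
    show "bnd B s1" by fact
    have "rinv L1 L2 L3 L4 0 s1" using s0 by (auto simp: rinv_def base_def trees_def tree_def tabinv_def okinv_def s1_def)
    then show "I s1" unfolding I_def using s0(5) by (intro exI[of _ 0]) (simp add: s1_def)
    show "\<mu> s1 \<le> n" by (simp add: \<mu>_def)
  next
    fix s assume s: "bnd B s" "I s" "bval ?b s"
    then obtain k where k: "k \<le> n" "rinv L1 L2 L3 L4 k s" "vars s ''z'' = z div fm ^ k"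
     "vars s0 ''ok'' = 1 \<or> (\<exists>j<k. ?g (z div fm ^ j mod fm)) \<longrightarrow> vars s ''ok'' = 1" unfolding I_def by blast
    have kn: "k < n" using s(3) nv[OF k(2)] by simp
    have z0: "0 \<le> z div fm ^ k" using s0(6) fm1 by (simp add: pos_imp_zdiv_nonneg_iff)
    from round_exec[OF s(1) k(2,3) z0 kn] obtain s' where s': "exec w p_round s (mT * 200 + N * 80 + 120) s'" "bnd B s'"
      "rinv L1 L2 L3 L4 (Suc k) s'" "vars s' ''z'' = z div fm ^ k div fm"
      "vars s ''ok'' = 1 \<or> ?g (z div fm ^ k mod fm) \<longrightarrow> vars s' ''ok'' = 1" by blast
    have zz: "z div fm ^ k div fm = z div fm ^ Suc k" using fm1 by (simp add: zdiv_zmult2_eq[symmetric] mult.commute)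
    have "I s'" unfolding I_def
    proof (intro exI[of _ "Suc k"] conjI impI)
      show "Suc k \<le> n" using kn by simp
      assume "vars s0 ''ok'' = 1 \<or> (\<exists>j<Suc k. ?g (z div fm ^ j mod fm))"
      then show "vars s' ''ok'' = 1" using k(4) s'(5) less_Suc_eq by blast
    qed (use s' zz in auto)
    moreover have "\<mu> s' < \<mu> s" using nv[OF k(2)] nv[OF s'(3)] kn by (simp add: \<mu>_def)
    ultimately show "\<exists>s'. exec w p_round s (mT * 200 + N * 80 + 120) s' \<and> bnd B s' \<and> I s' \<and> \<mu> s' < \<mu> s" using s' by blast
  qed
  then obtain s' where s': "exec w (While ?b p_round) s1 (n * (mT * 200 + N * 80 + 120 + 2) + 1) s'" "bnd B s'" "I s'" "\<not> bval ?b s'" by blast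
  from s'(3) obtain k where k: "k \<le> n" "rinv L1 L2 L3 L4 k s'"
     "vars s0 ''ok'' = 1 \<or> (\<exists>j<k. ?g (z div fm ^ j mod fm)) \<longrightarrow> vars s' ''ok'' = 1" unfolding I_def by blast
  have "k = n" using s'(4) nv[OF k(2)] k(1) by simp
  moreover have "exec w p_rounds s0 (n * (mT * 200 + N * 80 + 122) + 10) s'"
    unfolding p_rounds_def by (rule exec_mono[OF exec_Seq[OF e1(1) s'(1)]]) (simp add: algebra_simps)
  ultimately show ?thesis using s'(2) k by (auto simp: rinv_def)
qed

lemma final_exec:
  assumes s0: "bnd B s0" "base s0" "okinv Zgood s0" "vars s0 ''found'' = 0"
  shows "\<exists>s'. exec w (p_final d) s0 (n * 10 + 30) s' \<and>
    (\<forall>v. result n s' = Some v \<longrightarrow> balancing_solution (setC d) x v) \<and>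
    (vars s0 ''ok'' = 1 \<longrightarrow> 0 < n \<longrightarrow> (\<exists>v. result n s' = Some v))"
proof -
  have b0: "vars s0 ''n'' = int n" "vars s0 ''q'' = (2 * d + 1) ^ n" "arrs s0 ''e'' = E" using s0(2) by (auto simp: base_def)
  let ?g = "And (Eq (V ''ok'') (K 1)) (Less (K 0) (V ''n''))"
  have gok: "bok B ?g" using B2 by (simp add: eok_def)
  show ?thesis
  proof (cases "vars s0 ''ok'' = 1 \<and> 0 < n")
    case False
    have ng: "\<not> bval ?g s0" using False b0 by auto
    have ex: "exec w (p_final d) s0 (0 + 1) s0"
      unfolding p_final_def by (rule exec_Cond[OF bok_bsafe[OF s0(1) gok]]) (simp only: ng if_False exec_Skip)
    have "exec w (p_final d) s0 (n * 10 + 30) s0" by (rule exec_mono[OF ex]) simp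
    moreover have "result n s0 = None" using s0(4) by (simp add: result_def)
    ultimately show ?thesis using False by auto
  next
    case True
    then have "Zgood (vars s0 ''Z'')" using s0(3) by (simp add: okinv_def)
    then obtain c where c: "length c = n" "set c \<subseteq> setC d" "dot X c = 0" "vars s0 ''Z'' = dot E c" by (auto simp: Zgood_def)
    have cb: "\<bar>v\<bar> \<le> d" if "v \<in> set c" for v using c(2) that setC_bound by blast
    let ?a = "''i'' ::= K 0 ;; ''a'' ::= V ''Z'' [+] (V ''q'' [-] K 1) [div] K 2"
    let ?b = "Less (V ''i'') (V ''n'')"
    let ?c = "Store ''c'' (V ''i'') ((V ''a'' [div] Arr ''e'' (V ''i'')) [mod] K (2 * d + 1) [-] K d) ;; ''i'' ::= V ''i'' [+] K 1"
    define A where "A = dot E c + ((2 * d + 1) ^ n - 1) div 2"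
    have AB: "\<bar>A\<bar> \<le> B"
    proof -
      have "4 * \<bar>dot E c\<bar> \<le> W" using cb by (intro dot_bounds) auto
      moreover have "(2 * d + 1) ^ n \<le> W" by (rule powW) simp
      moreover have "1 \<le> (2 * d + 1) ^ n" using d3 by (intro one_le_power) auto
      moreover have "0 \<le> ((2 * d + 1) ^ n - 1) div 2" "((2 * d + 1) ^ n - 1) div 2 * 2 \<le> (2 * d + 1) ^ n - 1"
        using \<open>1 \<le> (2 * d + 1) ^ n\<close> by simp_all
      ultimately show ?thesis using WB(1) unfolding A_def by arith
    qed
    define s1 where "s1 = sx ?a s0"
    have "sok B ?a s0" using AB B2 by (simp add: b0 c(4) A_def)
    moreover have "cwf B ?a" using B2 by (simp add: eok_def)
    ultimately have e1: "exec w ?a s0 (ctime ?a) s1" "bnd B s1" using exec_sx[OF s0(1), of ?a] by (auto simp: s1_def)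
    have v1: "vars s1 ''i'' = 0" "vars s1 ''a'' = A" "vars s1 ''n'' = int n" "arrs s1 = arrs s0" by (simp_all add: s1_def b0 c(4) A_def)
    define I where "I s \<longleftrightarrow> (\<exists>i\<le>n. vars s ''i'' = int i \<and> (\<forall>j<i. arrs s ''c'' (int j) = c ! j))" for s :: state
    define \<mu> where "\<mu> s = n - nat (vars s ''i'')" for s :: state
    have "\<exists>s'. exec w (While ?b ?c) s1 (n * (ctime ?c + 2) + 1) s' \<and> bnd B s' \<and> I s' \<and> agree ?c s1 s' \<and> \<not> bval ?b s'"
    proof (rule while_sx[where I = I and \<mu> = \<mu>])
      show "bok B ?b" by (simp add: eok_def)
      show "cwf B ?c" using B2 B(4) d3 by (simp add: eok_def)
      show "bnd B s1" by fact
      show "I s1" unfolding I_def using v1 by (intro exI[of _ 0]) simp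
      show "\<mu> s1 \<le> n" by (simp add: \<mu>_def)
    next
      fix s assume s: "bnd B s" "I s" "agree ?c s1 s" "bval ?b s"
      then obtain i where i: "i \<le> n" "vars s ''i'' = int i" "\<And>j. j < i \<Longrightarrow> arrs s ''c'' (int j) = c ! j" by (auto simp: I_def)
      have fr: "vars s ''n'' = int n" "vars s ''a'' = A" "arrs s ''e'' = E" using s(3) v1 b0 by (auto simp: agree_def)
      have il: "i < n" using s(4) fr i by simp
      have Ei: "E (int i) = (2 * d + 1) ^ i" using il by (simp add: E_def powf_def n_def)
      have dec: "A div (2 * d + 1) ^ i mod (2 * d + 1) - d = c ! i"
        using decode[of d c n i] d3 c(1) cb il by (simp add: A_def E_def n_def)
      have "\<bar>c ! i\<bar> \<le> B" using cb[of "c ! i"] il c(1) B(4) d3 by simp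
      then have "sok B ?c s" using i fr Ei dec il WB(2) by simp
      moreover have "I (sx ?c s)"
        unfolding I_def using i fr Ei dec il by (intro exI[of _ "Suc i"]) (auto simp: less_Suc_eq)
      moreover have "\<mu> (sx ?c s) < \<mu> s" using i il by (simp add: \<mu>_def nat_add_distrib)
      ultimately show "sok B ?c s \<and> I (sx ?c s) \<and> \<mu> (sx ?c s) < \<mu> s" by blast
    qed
    then obtain s2 where s2: "exec w (While ?b ?c) s1 (n * (ctime ?c + 2) + 1) s2" "bnd B s2" "I s2"
      "agree ?c s1 s2" "\<not> bval ?b s2" by blast
    from s2(3) obtain i where i: "i \<le> n" "vars s2 ''i'' = int i" "\<And>j. j < i \<Longrightarrow> arrs s2 ''c'' (int j) = c ! j" by (auto simp: I_def)
    have "vars s2 ''n'' = int n" using s2(4) v1 by (auto simp: agree_def)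
    then have inn: "i = n" using s2(5) i by simp
    let ?f = "''found'' ::= K 1"
    have "cwf B ?f" "sok B ?f s2" using B2 by (auto simp: eok_def)
    then have e3: "exec w ?f s2 1 (sx ?f s2)" using exec_sx[OF s2(2), of ?f] by simp
    have g: "bval ?g s0" using True b0 by simp
    have ex0: "exec w (?a ;; While ?b ?c ;; ?f) s0 (ctime ?a + (n * (ctime ?c + 2) + 1 + 1 + 1) + 1) (sx ?f s2)"
      by (rule exec_Seq[OF e1(1) exec_Seq[OF s2(1) e3]])
    have ex: "exec w (p_final d) s0 (ctime ?a + (n * (ctime ?c + 2) + 1 + 1 + 1) + 1 + 1) (sx ?f s2)"
      unfolding p_final_def by (rule exec_Cond[OF bok_bsafe[OF s0(1) gok]]) (simp only: g if_True ex0)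
    have "exec w (p_final d) s0 (n * 10 + 30) (sx ?f s2)" by (rule exec_mono[OF ex]) simp
    moreover have "result n (sx ?f s2) = Some c"
      using i inn c(1) by (auto simp: result_def intro!: nth_equalityI)
    moreover have "balancing_solution (setC d) x c"
    proof -
      have "c ! 0 \<in> setC d" using True c(1,2) nth_mem[of 0 c] by blast
      then have "c ! 0 \<noteq> 0" by (auto simp: setC_def)
      moreover have "(\<Sum>i<length x. c ! i * x ! i) = dot X c" using c(1) by (simp add: dotg_def X_def xfun_def n_def)
      ultimately show ?thesis using c True unfolding balancing_solution_def by (auto simp: n_def)
    qed
    ultimately show ?thesis by (intro exI[of _ "sx ?f s2"]) auto
  qed
qed

section \<open>Success probability of the rounds\<close>

lemma leaf_card:
  assumes "distinct L" "set L = {p. set p \<subseteq> S \<and> length p \<le> m}" "finite S"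
  shows "card {i. i < length L \<and> length (L ! i) = m} = card S ^ m"
proof -
  have "bij_betw ((!) L) {i. i < length L \<and> length (L ! i) = m} {p. set p \<subseteq> S \<and> length p = m}"
  proof (rule bij_betwI')
    show "(L ! i = L ! j) = (i = j)" if "i \<in> {i. i < length L \<and> length (L ! i) = m}" "j \<in> {i. i < length L \<and> length (L ! i) = m}" for i j
      using that assms(1) by (simp add: nth_eq_iff_index_eq)
    show "L ! i \<in> {p. set p \<subseteq> S \<and> length p = m}" if "i \<in> {i. i < length L \<and> length (L ! i) = m}" for i
    proof -
      have "L ! i \<in> set L" using that by simp
      then show ?thesis using that assms(2) by auto
    qed
    show "\<exists>i\<in>{i. i < length L \<and> length (L ! i) = m}. p = L ! i" if "p \<in> {p. set p \<subseteq> S \<and> length p = m}" for p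
    proof -
      have "p \<in> set L" using that assms(2) by auto
      then obtain i where "i < length L" "L ! i = p" by (metis in_set_conv_nth)
      then show ?thesis using that by auto
    qed
  qed
  from bij_betw_same_card[OF this] show ?thesis by (simp only: card_lists_length_eq[OF assms(3), of m])
qed

text \<open>The factor 2 accounts for the two probes of each entry of the second tree.\<close>

lemma YY_markov:
  assumes La: "distinct La" "set La = {p. set p \<subseteq> SA \<and> length p \<le> h}" "finite SA"
    and Lb: "distinct Lb" "set Lb = {p. set p \<subseteq> SB \<and> length p \<le> H}" "finite SB"
  shows "real N * real (card {ab\<in>hashes P W. N \<le> YY La Lb md ab}) \<le> real (card SA ^ h * (2 * card SB ^ H)) * (real P * (real_of_int W)\<^sup>2)"
proof -
  let ?D1 = "{i. i < length La \<and> length (La ! i) = h}" and ?D2 = "{p. p < 2 * length Lb \<and> length (Lb ! (p div 2)) = H}"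
  define K1 where "K1 i = lkey md (dot X (La ! i)) (dot E (La ! i))" for i
  have Y: "YY La Lb md ab = (\<Sum>p\<in>?D2. card {i\<in>?D1. ((fst ab * K1 i + snd ab) mod (int P * W)) div W = tgt Lb md (fst ab) p})" for ab
  proof -
    have "YY La Lb md ab = (\<Sum>p\<in>?D2. length (items La Lb md ab p))"
      unfolding YY_def by (rule sum.mono_neutral_right) (auto simp: items_def)
    also have "\<dots> = (\<Sum>p\<in>?D2. card {i\<in>?D1. ((fst ab * K1 i + snd ab) mod (int P * W)) div W = tgt Lb md (fst ab) p})"
      by (intro sum.cong refl) (simp add: items_def length_bfilter bkf_def K1_def)
    finally show ?thesis .
  qed
  have Pp: "0 < int P" "0 < W" using P1 W1 by auto
  have "real N * real (card {ab\<in>hashes P W. N \<le> YY La Lb md ab}) \<le> real (card ?D1) * real (card ?D2) * (real_of_int (int P) * (real_of_int W)\<^sup>2)"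
    unfolding Y by (rule bucket_markov[OF Pp]) (auto simp: tgt_range)
  also have "card ?D1 = card SA ^ h" by (rule leaf_card[OF La])
  also have "card ?D2 = 2 * card SB ^ H"
  proof -
    let ?D = "{j. j < length Lb \<and> length (Lb ! j) = H}"
    have "?D2 = (\<lambda>j. 2 * j) ` ?D \<union> (\<lambda>j. 2 * j + 1) ` ?D"
    proof
      show "?D2 \<subseteq> (\<lambda>j. 2 * j) ` ?D \<union> (\<lambda>j. 2 * j + 1) ` ?D"
      proof
        fix p assume p: "p \<in> ?D2"
        then have j: "p div 2 \<in> ?D" by auto
        have "p = 2 * (p div 2) \<or> p = 2 * (p div 2) + 1" by presburger
        then show "p \<in> (\<lambda>j. 2 * j) ` ?D \<union> (\<lambda>j. 2 * j + 1) ` ?D" using j by blast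
      qed
    qed auto
    moreover have "card ((\<lambda>j. 2 * j) ` ?D \<union> (\<lambda>j. 2 * j + 1) ` ?D) = card ?D + card ?D"
    proof (subst card_Un_disjoint)
      show "(\<lambda>j. 2 * j) ` ?D \<inter> (\<lambda>j. 2 * j + 1) ` ?D = {}" by (auto, presburger)
      show "card ((\<lambda>j. 2 * j) ` ?D) + card ((\<lambda>j. 2 * j + 1) ` ?D) = card ?D + card ?D"
        by (simp add: card_image inj_on_def)
    qed auto
    ultimately show ?thesis using leaf_card[OF Lb] by simp
  qed
  finally show ?thesis by simp
qed

text \<open>The first condition keeps a representation alive. The second bounds the work: a half
  round has at most \<open>2 * (2 * qa) ^ H / P\<close> hits on average, hence at most
  \<open>N / 100\<close>.\<close>

definition light :: "int list \<Rightarrow> bool" where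
  "light c \<longleftrightarrow> P ^ 3 \<le> (2 ^ card {i\<in>{..<n}. \<not> extreme d (c ! i)})\<^sup>2 \<and> 200 * (2 * qa) ^ H \<le> N * P"

definition heavy :: "int list \<Rightarrow> bool" where
  "heavy c \<longleftrightarrow> totQ d ss ^ Suc n \<le> (int N)\<^sup>2 * (\<Prod>i<n. wt d ss (c ! i))"

lemma card_setA: "card (setA d) = qa"
proof -
  have "card (setA d) = card {-(d - 1)..-1} + card {2..d}" unfolding setA_def by (rule card_Un_disjoint) auto
  then show ?thesis using d3 by (simp add: qa_def)
qed

lemma card_setB: "card setB = 2" by (simp add: setB_def)

text \<open>There are \<open>fm = 2 * M ^ 4\<close> seeds, of which at least
  \<open>M ^ 4 / 50\<close> are good.\<close>

lemma few_bad_seeds: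
  assumes c: "length c = n" "set c \<subseteq> setC d" "dot X c = 0" "light c" and tr: "trees L1 L2 L3 L4 s"
  shows "real (card {y\<in>{0..<fm}. \<not> good_seed d x P W N (YY L1 L2) (YY L3 L4) y}) \<le> 99 / 100 * real_of_int fm"
proof -
  let ?g = "\<lambda>y. good_seed d x P W N (YY L1 L2) (YY L3 L4) y"
  have L: "distinct L1" "distinct L2" "distinct L3" "distinct L4" "set L1 = {p. set p \<subseteq> setA d \<and> length p \<le> h}"
    "set L2 = {p. set p \<subseteq> uminus ` setB \<and> length p \<le> H}" "set L3 = {p. set p \<subseteq> setB \<and> length p \<le> h}"
    "set L4 = {p. set p \<subseteq> uminus ` setA d \<and> length p \<le> H}" using tr by (auto simp: trees_def tree_def)
  have fin: "finite (setA d)" "finite setB" by (auto simp: setA_def setB_def)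
  have cim: "card (uminus ` setB) = 2" "card (uminus ` setA d) = qa" by (simp_all add: card_image card_setA card_setB)
  have "1 \<le> 2 * qa" using qa2 by simp
  have DL: "qa ^ h * (2 * 2 ^ H) \<le> 2 * (2 * qa) ^ H"
  proof -
    have "qa ^ h \<le> qa ^ H" using qa2 hH(2) by (intro power_increasing) auto
    then have "qa ^ h * (2 * 2 ^ H) \<le> qa ^ H * (2 * 2 ^ H)" by (rule mult_le_mono1)
    then show ?thesis by (simp add: power_mult_distrib mult_ac)
  qed
  have DR: "2 ^ h * (2 * qa ^ H) \<le> 2 * (2 * qa) ^ H"
  proof -
    have "(2::nat) ^ h \<le> 2 ^ H" using hH(2) by (intro power_increasing) auto
    then have "2 ^ h * (2 * qa ^ H) \<le> 2 ^ H * (2 * qa ^ H)" by (rule mult_le_mono1)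
    then show ?thesis by (simp add: power_mult_distrib mult_ac)
  qed
  have lt: "200 * (2 * qa) ^ H \<le> N * P" "P ^ 3 \<le> (2 ^ card {i\<in>{..<n}. \<not> extreme d (c ! i)})\<^sup>2" using c(4) by (auto simp: light_def)
  have bL: "100 * real (qa ^ h * (2 * 2 ^ H)) \<le> real N * real P"
  proof -
    have "100 * (qa ^ h * (2 * 2 ^ H)) \<le> N * P" using DL lt(1) by linarith
    then have "real (100 * (qa ^ h * (2 * 2 ^ H))) \<le> real (N * P)" by (simp only: of_nat_le_iff)
    then show ?thesis by simp
  qed
  have bR: "100 * real (2 ^ h * (2 * qa ^ H)) \<le> real N * real P"
  proof -
    have "100 * (2 ^ h * (2 * qa ^ H)) \<le> N * P" using DR lt(1) by linarith
    then have "real (100 * (2 ^ h * (2 * qa ^ H))) \<le> real (N * P)" by (simp only: of_nat_le_iff)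
    then show ?thesis by simp
  qed
  have "real_of_int (int P * bigW d x) ^ 4 \<le> 50 * real (card {z\<in>{0..<2 * (int P * bigW d x * (int P * bigW d x) * (int P * bigW d x * (int P * bigW d x)))}.
     good_seed d x P (bigW d x) N (YY L1 L2) (YY L3 L4) z})"
  proof (rule good_seeds[OF d3 _ c(2)])
    show "length c = length x" using c(1) by (simp add: n_def)
    show "dot (xfun x) c = 0" using c(3) by (simp add: X_def)
    show "0 < P" "0 < N" using P1 N1 by auto
    show "P ^ 3 \<le> (2 ^ card {i\<in>{..<length x}. \<not> extreme d (c ! i)})\<^sup>2" using lt(2) by (simp add: n_def)
    show "real N * real (card {ab\<in>hashes P (bigW d x). N \<le> YY L1 L2 md ab}) \<le> real (qa ^ h * (2 * 2 ^ H)) * (real P * (real_of_int (bigW d x))\<^sup>2)" for md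
      using YY_markov[OF L(1,5) fin(1) L(2,6), of md] fin(2) by (simp only: finite_imageI cim card_setA W_def)
    show "real N * real (card {ab\<in>hashes P (bigW d x). N \<le> YY L3 L4 md ab}) \<le> real (2 ^ h * (2 * qa ^ H)) * (real P * (real_of_int (bigW d x))\<^sup>2)" for md
      using YY_markov[OF L(3,7) fin(2) L(4,8), of md] fin(1) by (simp only: finite_imageI cim card_setB W_def)
  qed (use bL bR in auto)
  then have g: "real_of_int M ^ 4 \<le> 50 * real (card {z\<in>{0..<fm}. ?g z})"
    by (simp only: W_def[symmetric] M_eq[symmetric] fm_eq[symmetric])
  have "card {y\<in>{0..<fm}. ?g y} + card {y\<in>{0..<fm}. \<not> ?g y} = card {0..<fm}"
  proof -
    have e: "{y\<in>{0..<fm}. ?g y} \<union> {y\<in>{0..<fm}. \<not> ?g y} = {0..<fm}" by auto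
    have "card ({y\<in>{0..<fm}. ?g y} \<union> {y\<in>{0..<fm}. \<not> ?g y}) = card {y\<in>{0..<fm}. ?g y} + card {y\<in>{0..<fm}. \<not> ?g y}"
      by (rule card_Un_disjoint) (auto intro: finite_subset[of _ "{0..<fm}"])
    then show ?thesis unfolding e by simp
  qed
  then have "real (card {y\<in>{0..<fm}. ?g y}) + real (card {y\<in>{0..<fm}. \<not> ?g y}) = real_of_int fm"
    using fm1 by (simp flip: of_nat_add)
  moreover have "real_of_int fm = 2 * real_of_int M ^ 4" by (simp add: fm_eq power4_eq_xxxx mult_ac)
  ultimately show ?thesis using g by linarith
qed

text \<open>A heavy solution is found before the random draw. A light one is missed only if all
  \<open>n\<close> seeds are bad, each of which has probability at most 99/100.\<close>

lemma prog_correct: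
  assumes T: "mT * qa * 216 + mP * nat d * 256 + n * (mT * 200 + N * 80 + 200) + 1000 \<le> T"
  defines "D \<equiv> run w T (prog d bb pp nu ss, input_state x)"
  shows "\<forall>(c, s)\<in>set_pmf D. c = Skip \<and> (\<forall>v. result n s = Some v \<longrightarrow> balancing_solution (setC d) x v)"
    and "balancing_solution (setC d) x c \<Longrightarrow> heavy c \<or> light c \<Longrightarrow>
      measure_pmf.prob D {(c, s). \<exists>v. result n s = Some v \<and> balancing_solution (setC d) x v} \<ge> 1 - (99 / 100) ^ n"
proof -
  from pre_exec obtain s1 L1 L2 L3 L4 where
    e1: "exec w (p_pre d bb pp nu ss) (input_state x) (mT * qa * 216 + mP * nat d * 216 + mP * 40 + n * 60 + 400) s1" and
    s1: "bnd B s1" "base s1" "trees L1 L2 L3 L4 s1" "okinv Zgood s1" "vars s1 ''found'' = 0"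
     "arrs s1 ''FL'' = (\<lambda>_. 0)" "arrs s1 ''FR'' = (\<lambda>_. 0)" "arrs s1 ''CL'' = (\<lambda>_. 0)" "arrs s1 ''CR'' = (\<lambda>_. 0)"
     and hv: "\<And>c. length c = n \<Longrightarrow> set c \<subseteq> setC d \<Longrightarrow> dot X c = 0 \<Longrightarrow> heavy c \<Longrightarrow> vars s1 ''ok'' = 1" unfolding heavy_def by blast
  let ?g = "\<lambda>y. good_seed d x P W N (YY L1 L2) (YY L3 L4) y"
  let ?c3 = "p_rounds ;; p_final d"
  define t3 where "t3 = (n * (mT * 200 + N * 80 + 122) + 10) + (n * 10 + 30) + 1"
  define Z0 where "Z0 = {0..<fm ^ n}"
  have zpos: "0 < fm ^ n" using fm1 by simp
  have Z0: "finite Z0" "Z0 \<noteq> {}" using zpos by (auto simp: Z0_def)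
  define sz where "sz z = s1\<lparr>vars := (vars s1)(''z'' := z)\<rparr>" for z
  have "\<exists>s'. exec w ?c3 (sz z) t3 s' \<and> (\<forall>v. result n s' = Some v \<longrightarrow> balancing_solution (setC d) x v) \<and>
     (vars s1 ''ok'' = 1 \<or> (\<exists>k<n. ?g (z div fm ^ k mod fm)) \<longrightarrow> 0 < n \<longrightarrow> (\<exists>v. result n s' = Some v))" if z: "z \<in> Z0" for z
  proof -
    have zb: "0 \<le> z" "\<bar>z\<bar> \<le> B" using z B(2) by (auto simp: Z0_def n_def)
    have "bnd B (sz z)" using s1(1) zb by (auto simp: bnd_def sz_def)
    moreover have "base (sz z)" using s1(2) by (simp add: base_def sz_def)
    moreover have "trees L1 L2 L3 L4 (sz z)" using s1(3) by (simp add: trees_def tree_def sz_def)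
    moreover have "okinv Zgood (sz z)" using s1(4) by (simp add: okinv_def sz_def)
    ultimately obtain s2 where s2: "exec w p_rounds (sz z) (n * (mT * 200 + N * 80 + 122) + 10) s2" "bnd B s2" "base s2" "okinv Zgood s2"
      "vars (sz z) ''ok'' = 1 \<or> (\<exists>k<n. ?g (z div fm ^ k mod fm)) \<longrightarrow> vars s2 ''ok'' = 1"
      using rounds_exec[of "sz z" L1 L2 L3 L4 z] s1 zb by (auto simp: sz_def)
    have "vars s2 ''found'' = 0" using exec_agree[OF s2(1)] rounds_writes(1) s1(5) by (auto simp: agree_def sz_def)
    from final_exec[OF s2(2-4) this] obtain s3 where s3: "exec w (p_final d) s2 (n * 10 + 30) s3"
      "\<forall>v. result n s3 = Some v \<longrightarrow> balancing_solution (setC d) x v"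
      "vars s2 ''ok'' = 1 \<longrightarrow> 0 < n \<longrightarrow> (\<exists>v. result n s3 = Some v)" by blast
    have "exec w ?c3 (sz z) t3 s3" unfolding t3_def by (rule exec_Seq[OF s2(1) s3(1)])
    moreover have "vars (sz z) ''ok'' = vars s1 ''ok''" by (simp add: sz_def)
    ultimately show ?thesis using s3 s2(5) by (intro exI[of _ s3]) simp
  qed
  \<comment> \<open>Everything after the draw is deterministic, so the final state is a function of
    the random number.\<close>
  then obtain fin where fin: "\<And>z. z \<in> Z0 \<Longrightarrow> exec w ?c3 (sz z) t3 (fin z) \<and>
     (\<forall>v. result n (fin z) = Some v \<longrightarrow> balancing_solution (setC d) x v) \<and>
     (vars s1 ''ok'' = 1 \<or> (\<exists>k<n. ?g (z div fm ^ k mod fm)) \<longrightarrow> 0 < n \<longrightarrow> (\<exists>v. result n (fin z) = Some v))" by metis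
  let ?U = "pmf_of_set Z0"
  let ?c2 = "Rand ''z'' (V ''zm'') ;; ?c3"
  have zm: "vars s1 ''zm'' = fm ^ n" using s1(2) by (simp add: base_def)
  have sf: "asafe w (V ''zm'') s1" by (rule eok_asafe[OF s1(1)]) (simp add: eok_def)
  have st: "step w ?c2 s1 = map_pmf (\<lambda>z. (Seq Skip ?c3, sz z)) ?U"
    using sf zm zpos by (simp add: map_pmf_comp sz_def Z0_def)
  \<comment> \<open>The two extra steps are the draw and the removal of the \<open>Skip\<close> that
    it leaves.\<close>
  have r2: "run w (t3 + 2) (?c2, s1) = map_pmf (\<lambda>z. (Skip, fin z)) ?U"
  proof -
    have "run w (t3 + 2) (?c2, s1) = bind_pmf (step w ?c2 s1) (run w (t3 + 1))"
      by (simp only: add_2_eq_Suc' run.simps fst_conv snd_conv) simp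
    also have "\<dots> = bind_pmf ?U (\<lambda>z. run w (t3 + 1) (Seq Skip ?c3, sz z))"
      unfolding st by (simp add: bind_map_pmf del: run.simps)
    also have "\<dots> = bind_pmf ?U (\<lambda>z. return_pmf (Skip, fin z))"
    proof (rule bind_pmf_cong[OF refl])
      fix z assume "z \<in> set_pmf ?U"
      then have z: "z \<in> Z0" using Z0 by simp
      have "run w (t3 + 1) (Seq Skip ?c3, sz z) = run w t3 (?c3, sz z)" by (simp add: bind_return_pmf)
      then show "run w (t3 + 1) (Seq Skip ?c3, sz z) = return_pmf (Skip, fin z)" using fin[OF z] by (simp add: exec_def)
    qed
    finally show ?thesis by (simp add: map_pmf_def)
  qed
  have h2: "halted w (t3 + 2) (?c2, s1)" unfolding halted_def r2 by auto
  let ?t = "(mT * qa * 216 + mP * nat d * 216 + mP * 40 + n * 60 + 400) + (t3 + 2) + 1"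
  have r: "run w ?t (prog d bb pp nu ss, input_state x) = map_pmf (\<lambda>z. (Skip, fin z)) ?U"
    unfolding prog_def using run_Seq[OF e1 h2] r2 by simp
  have hh: "halted w ?t (prog d bb pp nu ss, input_state x)" unfolding halted_def r by auto
  have tT: "?t \<le> T"
  proof -
    have "mP * 1 \<le> mP * nat d" using d3 by (intro mult_le_mono2) auto
    then have "mP * 40 \<le> mP * nat d * 40" unfolding mult_1_right by (rule mult_le_mono1)
    then show ?thesis using T d3 unfolding t3_def by (simp only: algebra_simps)
  qed
  have D: "D = map_pmf (\<lambda>z. (Skip, fin z)) ?U"
    using halted_run_add[OF hh, of "T - ?t"] tT r by (simp add: D_def)
  show "\<forall>(c, s)\<in>set_pmf D. c = Skip \<and> (\<forall>v. result n s = Some v \<longrightarrow> balancing_solution (setC d) x v)"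
    unfolding D using Z0 fin by auto
  show "measure_pmf.prob D {(c, s). \<exists>v. result n s = Some v \<and> balancing_solution (setC d) x v} \<ge> 1 - (99 / 100) ^ n"
    if sol: "balancing_solution (setC d) x c" and hl: "heavy c \<or> light c"
  proof -
    have c: "length c = n" "set c \<subseteq> setC d" using sol by (auto simp: balancing_solution_def n_def)
    have n0: "0 < n" using sol by (auto simp: balancing_solution_def n_def)
    have dc: "dot X c = 0" using sol by (simp add: balancing_solution_def dotg_def X_def xfun_def)
    let ?G = "{z\<in>Z0. \<exists>v. result n (fin z) = Some v}"
    have "measure_pmf.prob D {(c, s). \<exists>v. result n s = Some v \<and> balancing_solution (setC d) x v} =
       measure_pmf.prob ?U {z. \<exists>v. result n (fin z) = Some v \<and> balancing_solution (setC d) x v}"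
      unfolding D measure_map_pmf by (rule arg_cong[where f = "measure_pmf.prob ?U"]) auto
    also have "\<dots> = real (card (Z0 \<inter> {z. \<exists>v. result n (fin z) = Some v \<and> balancing_solution (setC d) x v})) / real (card Z0)"
      by (rule measure_pmf_of_set[OF Z0(2,1)])
    also have "Z0 \<inter> {z. \<exists>v. result n (fin z) = Some v \<and> balancing_solution (setC d) x v} = ?G" using fin by blast
    finally have pr: "measure_pmf.prob D {(c, s). \<exists>v. result n s = Some v \<and> balancing_solution (setC d) x v} = real (card ?G) / real (card Z0)" .
    have cZ: "real (card Z0) = real_of_int fm ^ n" using zpos by (simp add: Z0_def)
    have cZp: "0 < real (card Z0)" using Z0 by (simp add: card_gt_0_iff)
    have "real (card Z0) * (1 - (99 / 100) ^ n) \<le> real (card ?G)"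
    proof (cases "heavy c")
      case True
      then have "vars s1 ''ok'' = 1" using hv c dc by blast
      then have "?G = Z0" using fin n0 by blast
      then have "real (card ?G) = real (card Z0) * 1" by simp
      also have "real (card Z0) * (1 - (99 / 100) ^ n) \<le> real (card Z0) * 1" by (intro mult_left_mono) auto
      finally show ?thesis .
    next
      case False
      then have lc: "light c" using hl by blast
      let ?Bd = "{z\<in>Z0. \<forall>k<n. \<not> ?g (z div fm ^ k mod fm)}"
      \<comment> \<open>One good digit is enough for success.\<close>
      have "Z0 \<subseteq> ?G \<union> ?Bd" using fin n0 by blast
      then have "card Z0 \<le> card (?G \<union> ?Bd)" using Z0(1) by (intro card_mono) auto
      also have "\<dots> \<le> card ?G + card ?Bd" by (rule card_Un_le)
      finally have "real (card Z0) \<le> real (card ?G) + real (card ?Bd)" by (simp only: of_nat_add[symmetric] of_nat_le_iff)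
      moreover have "card ?Bd = card {y\<in>{0..<fm}. \<not> ?g y} ^ n"
        unfolding Z0_def by (rule card_digits) (use fm1 in simp)
      then have "real (card ?Bd) = real (card {y\<in>{0..<fm}. \<not> ?g y}) ^ n" by simp
      then have "real (card ?Bd) \<le> (99 / 100 * real_of_int fm) ^ n"
        using few_bad_seeds[OF c dc lc s1(3)] by (simp add: power_mono)
      then have "real (card ?Bd) \<le> (99 / 100) ^ n * real (card Z0)" by (simp only: power_mult_distrib cZ)
      ultimately show ?thesis by (simp add: algebra_simps)
    qed
    then have "1 - (99 / 100) ^ n \<le> real (card ?G) / real (card Z0)" using cZp by (simp add: pos_le_divide_eq mult.commute)
    then show ?thesis using pr by simp
  qed
qed

end

section \<open>Choice of parameters\<close>

text \<open>For \<open>m\<close> large enough, \<open>exp (b * m)\<close> exceeds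
  \<open>exp (a * m)\<close> by at least 1, so there is an integer between them. This realizes real
  growth rates by integer bases.\<close>

lemma nat_ln_between:
  fixes a b :: real
  assumes ab: "0 \<le> a" "a < b" and m: "1 / (b - a) \<le> real m"
  shows "\<exists>p\<ge>1. a * real m \<le> ln (real p) \<and> ln (real p) \<le> b * real m"
proof -
  define p where "p = nat \<lfloor>exp (b * real m)\<rfloor>"
  have bm: "1 \<le> (b - a) * real m" using ab m by (simp add: divide_le_eq mult.commute)
  have "exp (a * real m) + 1 \<le> exp (a * real m) * (1 + (b - a) * real m)"
  proof -
    have "1 * 1 \<le> exp (a * real m) * ((b - a) * real m)" using bm ab(1) by (intro mult_mono) auto
    then show ?thesis by (simp add: distrib_left)
  qed
  also have "\<dots> \<le> exp (a * real m) * exp ((b - a) * real m)" by (intro mult_left_mono exp_ge_add_one_self) simp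
  also have "\<dots> = exp (b * real m)" by (simp add: exp_add[symmetric] algebra_simps)
  finally have e: "exp (a * real m) + 1 \<le> exp (b * real m)" .
  have pr: "real p = of_int \<lfloor>exp (b * real m)\<rfloor>" unfolding p_def by simp
  have lo: "exp (a * real m) \<le> real p" unfolding pr using e by linarith
  have hi: "real p \<le> exp (b * real m)" unfolding pr by simp
  have pos: "0 < real p" by (rule less_le_trans[OF _ lo]) simp
  have "a * real m \<le> ln (real p)" using lo pos by (simp add: ln_ge_iff)
  moreover have "ln (real p) \<le> b * real m" using hi pos by (metis ln_exp ln_mono)
  ultimately show ?thesis using pos by (intro exI[of _ p]) simp
qed

lemma linear_dominates:
  fixes a b c :: real
  assumes "a < b"
  shows "\<exists>n0. \<forall>n\<ge>n0. a * real n + c \<le> b * real n"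
proof -
  obtain n0 where n0: "c / (b - a) \<le> real n0" using real_arch_simple by blast
  have "a * real n + c \<le> b * real n" if "n0 \<le> n" for n
  proof -
    have "c / (b - a) \<le> real n" using n0 that by linarith
    then have "c \<le> (b - a) * real n" using assms by (simp add: divide_le_eq mult.commute)
    then show ?thesis by (simp add: algebra_simps)
  qed
  then show ?thesis by blast
qed

text \<open>Here \<open>\<theta>\<close> is the fraction of coefficients \<open>\<plusminus>1, \<plusminus>d\<close> that separates the two searches. The
  first inequality makes path enumeration cheaper than \<open>(2 * d) ^ (n / 2)\<close> above \<open>\<theta>\<close>, the last one
  makes sampling cheaper below. At \<open>d = 3\<close> the two barely meet: \<open>2 ^ 7 < (3 / 2) ^ 12\<close>.\<close>

lemma threshold_exists:
  fixes d :: real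
  assumes d: "d = 3 \<or> 4 \<le> d"
  shows "\<exists>\<theta>. 2 / d < \<theta> \<and> 0 < \<theta> \<and> \<theta> < 1 \<and> ln (2 * (d - 1) / d) < 4 / 3 * (1 - \<theta>) * ln 2"
  using d
proof
  assume d: "d = 3"
  have "(12::real) * ln 2 + 7 * ln 2 < 12 * ln 3"
  proof -
    have "ln ((2::real) ^ 19) < ln (3 ^ 12)" by simp
    then show ?thesis by (simp only: ln_realpow)
  qed
  moreover have "ln (2 * (d - 1) / d) = 2 * ln 2 - ln 3"
    unfolding d using ln_div[of 4 3] ln_realpow[of 2 2] by simp
  \<comment> \<open>At \<open>d = 3\<close> the fraction must exceed 2/3, and with 11/16 the last
    inequality becomes \<open>19 * ln 2 < 12 * ln 3\<close>.\<close>
  ultimately show ?thesis unfolding d by (intro exI[of _ "11 / 16"]) simp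
next
  assume d: "4 \<le> d"
  have "ln (2 * (d - 1) / d) = ln 2 + ln (1 - 1 / d)"
  proof -
    have "2 * (d - 1) / d = 2 * (1 - 1 / d)" "0 < 1 - 1 / d" using d by (simp_all add: field_simps)
    then show ?thesis using ln_mult_pos[of 2 "1 - 1 / d"] by simp
  qed
  also have "ln (1 - 1 / d) \<le> - (1 / d)" using d ln_le_minus_one[of "1 - 1 / d"] by simp
  \<comment> \<open>The part 1/4 of the fraction makes the leading terms \<open>ln 2\<close> agree,
    as \<open>4 / 3 * (3 / 4) = 1\<close>. The correction 21/20 leaves
    \<open>7 / 5 * ln 2 < 1\<close>, and it satisfies the lower bound \<open>2 / d\<close> for
    \<open>d\<close> above 3.8, which is why 3 is treated separately.\<close>
  also have "ln 2 + - (1 / d) < 4 / 3 * (1 - (1 / 4 + 21 / (20 * d))) * ln 2"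
  proof -
    have "ln (2::real) < 5 / 7" using ln2_le_25_over_36 by simp
    then have "7 / 5 * ln 2 / d < 1 / d" using d by (intro divide_strict_right_mono) auto
    then show ?thesis by (simp add: field_simps)
  qed
  finally have "ln (2 * (d - 1) / d) < 4 / 3 * (1 - (1 / 4 + 21 / (20 * d))) * ln 2" by simp
  moreover have "2 / d < 1 / 4 + 21 / (20 * d)" "0 < 1 / 4 + 21 / (20 * d)" "1 / 4 + 21 / (20 * d) < 1"
    using d by (auto simp: field_simps)
  ultimately show ?thesis by blast
qed

text \<open>A uniformly random coefficient is extreme with probability \<open>2 / d\<close>. Tilting
  the weights from \<open>s\<close> to \<open>s + 1\<close> raises the logarithm of the total weight
  by about \<open>2 / (d * s)\<close>, but gains about \<open>\<theta> / s\<close> per coordinate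
  for a vector with a fraction \<open>\<theta>\<close> of extremes. For a gentle tilt, that is large
  \<open>s\<close>, the gain prevails.\<close>

lemma weight_exists:
  fixes d \<theta> :: real
  assumes d: "3 \<le> d" and t: "2 / d < \<theta>"
  shows "\<exists>s\<ge>1::nat. ln (2 * d * real s + 4) - ln (real s) - \<theta> * (ln (real s + 1) - ln (real s)) < ln (2 * d)"
proof -
  \<comment> \<open>Equivalent to \<open>2 / d * (s + 1) < \<theta> * s\<close>, which compares the
    bounds \<open>2 / (d * s)\<close> and \<open>\<theta> / (s + 1)\<close> derived below.\<close>
  obtain s0 :: nat where s0: "2 / d / (\<theta> - 2 / d) < real s0" using reals_Archimedean2 by blast
  define s where "s = Suc s0"
  have s: "2 / d / (\<theta> - 2 / d) < real s" "1 \<le> real s" using s0 by (auto simp: s_def)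
  then have "2 / d < real s * (\<theta> - 2 / d)" using t by (simp only: pos_divide_less_eq diff_gt_0_iff_gt)
  then have k: "2 / d * (real s + 1) < \<theta> * real s" by (simp add: algebra_simps add_divide_distrib)
  have tp: "0 < \<theta>" by (rule less_trans[OF _ t]) (use d in simp)
  have "ln (2 * d * real s + 4) - ln (real s) - ln (2 * d) = ln (1 + 2 / (d * real s))"
  proof -
    have "2 * d * real s + 4 = (2 * d) * (real s) * (1 + 2 / (d * real s))" using d s by (simp add: field_simps)
    moreover have "0 < 2 * d" "0 < real s" "0 < 1 + 2 / (d * real s)" using d s by (simp_all add: add_pos_pos)
    ultimately show ?thesis by (simp only: ln_mult_pos mult_pos_pos)
  qed
  also have "\<dots> \<le> 2 / (d * real s)" using d s by (intro ln_add_one_self_le_self) simp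
  also have "\<dots> < \<theta> / (real s + 1)" using k d s by (simp add: field_simps)
  also have "\<dots> = \<theta> * (1 / (real s + 1))" by simp
  also have "\<dots> \<le> \<theta> * (ln (real s + 1) - ln (real s))"
  proof (rule mult_left_mono)
    have "ln (real s / (real s + 1)) \<le> real s / (real s + 1) - 1" using s by (intro ln_le_minus_one) simp
    also have "\<dots> = - (1 / (real s + 1))" using s by (simp add: field_simps)
    finally show "1 / (real s + 1) \<le> ln (real s + 1) - ln (real s)" using s by (simp add: ln_div)
  qed (use tp in simp)
  finally show ?thesis by (intro exI[of _ s]) (simp add: s_def)
qed

lemma le_via_ln:
  fixes a b :: real
  assumes "0 < a" "0 < b" "ln a \<le> ln b"
  shows "a \<le> b"
  using assms by simp

text \<open>Here \<open>\<kappa>\<close> and \<open>\<mu>\<close> are the numbers of extreme and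
  other coefficients; the disjunction says that each vector is heavy or light. Finitely many
  \<open>n\<close> are exempt, since rounding and constant factors must be absorbed.\<close>

lemma parameters_exist:
  fixes d :: int
  assumes d: "3 \<le> d"
  shows "\<exists>bb pp nu ss n0 \<gamma>. 1 \<le> (pp::nat) \<and> 1 \<le> (nu::nat) \<and> 1 \<le> (ss::nat) \<and> \<gamma> < ln (2 * real_of_int d) / 2 \<and>
    ln (2 * real_of_int d - 2) / 2 \<le> \<gamma> \<and> (\<forall>n. real (nu ^ (n div bb)) \<le> exp (\<gamma> * real n)) \<and>
    (\<forall>n\<ge>n0. \<forall>\<kappa> \<mu>. \<kappa> + \<mu> = n \<longrightarrow>
       totQ d ss ^ Suc n \<le> (int (nu ^ (n div bb)))\<^sup>2 * ((int ss + 1) ^ \<kappa> * int ss ^ \<mu>) \<or>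
       (pp ^ (n div bb)) ^ 3 \<le> (2 ^ \<mu>)\<^sup>2 \<and>
       200 * (2 * nat (2 * d - 2)) ^ (n - n div 2) \<le> nu ^ (n div bb) * pp ^ (n div bb))"
proof -
  define D where "D = real_of_int d"
  have D: "D = 3 \<or> 4 \<le> D" "3 \<le> D" using d by (auto simp: D_def)
  obtain \<theta> where th: "2 / D < \<theta>" "0 < \<theta>" "\<theta> < 1" "ln (2 * (D - 1) / D) < 4 / 3 * (1 - \<theta>) * ln 2"
    using threshold_exists[OF D(1)] by blast
  obtain ss :: nat where ss: "1 \<le> ss" "ln (2 * D * real ss + 4) - ln (real ss) - \<theta> * (ln (real ss + 1) - ln (real ss)) < ln (2 * D)"
    using weight_exists[OF D(2) th(1)] by blast
  define q where "q = 2 * D * real ss + 4"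
  have q: "real_of_int (totQ d ss) = q" "0 < q" using D ss(1) by (simp_all add: totQ_def q_def D_def add_pos_pos)
  define l where "l = ln (real ss + 1) - ln (real ss)"
  have l0: "0 < l" using ss(1) by (simp add: l_def)
  \<comment> \<open>Growth rates per coordinate: \<open>G / 2\<close> is needed for \<open>N\<close>
    to catch heavy vectors, \<open>A\<close> is that of the square root of \<open>card C\<close> to
    the \<open>n\<close>, \<open>Bt\<close> is the largest that
    \<open>P ^ 3 <= (2 ^ \<mu>)\<^sup>2\<close> permits below the threshold, and \<open>R\<close> is
    that of the vectors to be filtered.\<close>
  define G where "G = ln q - ln (real ss) - \<theta> * l"
  define A where "A = ln (2 * D) / 2"
  define Bt where "Bt = 2 / 3 * (1 - \<theta>) * ln 2"
  define R where "R = ln (4 * (D - 1)) / 2"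
  have GA: "G / 2 < A" using ss(2) by (simp add: G_def A_def l_def q_def)
  have A0: "0 < A" using D by (simp add: A_def)
  have B0: "0 < Bt" using th by (simp add: Bt_def)
  have RAB: "R < A + Bt"
  proof -
    have "4 * (D - 1) = 2 * D * (2 * (D - 1) / D)" using D by (simp add: field_simps)
    then have "ln (4 * (D - 1)) = ln (2 * D) + ln (2 * (D - 1) / D)" using D by (simp add: ln_mult del: times_divide_eq_right)
    then show ?thesis using th(4) by (simp add: R_def A_def Bt_def field_simps)
  qed
  \<comment> \<open>Two units of slack are given up for \<open>N\<close> and one for
    \<open>P\<close>; a quarter of the least gap covers all three.\<close>
  define \<epsilon> where "\<epsilon> = Min {A - G / 2, A, Bt, A + Bt - R} / 4"
  have "0 < \<epsilon>" using GA A0 B0 RAB by (simp add: \<epsilon>_def)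
  moreover have "4 * \<epsilon> \<le> A - G / 2" "4 * \<epsilon> \<le> A" "4 * \<epsilon> \<le> Bt" "4 * \<epsilon> \<le> A + Bt - R" by (simp_all add: \<epsilon>_def)
  ultimately have eps: "0 < \<epsilon>" "G / 2 < A - 2 * \<epsilon>" "0 \<le> A - 2 * \<epsilon>" "0 \<le> Bt - \<epsilon>" "R < (A - 2 * \<epsilon>) + (Bt - \<epsilon>)" by linarith+
  define a b where "a = A - 2 * \<epsilon>" and "b = Bt - \<epsilon>"
  have ab: "0 \<le> a" "a < A - \<epsilon>" "0 \<le> b" "b < Bt" "G < 2 * a" "R < a + b" using eps by (auto simp: a_def b_def)
  obtain bb0 :: nat where "1 / \<epsilon> \<le> real bb0" using real_arch_simple by blast
  then obtain bb :: nat where bb: "1 / \<epsilon> \<le> real bb" "1 \<le> bb" by (metis le_SucI le_trans nat_le_linear of_nat_le_iff order_trans)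
  obtain nu where nu: "1 \<le> nu" "a * real bb \<le> ln (real nu)" "ln (real nu) \<le> (A - \<epsilon>) * real bb"
    using nat_ln_between[OF ab(1,2), of bb] bb by (auto simp: a_def)
  obtain pp where pp: "1 \<le> pp" "b * real bb \<le> ln (real pp)" "ln (real pp) \<le> Bt * real bb"
    using nat_ln_between[OF ab(3,4), of bb] bb by (auto simp: b_def)
  have dv: "real bb * real (n div bb) \<le> real n" "real n - real bb \<le> real bb * real (n div bb)" for n
  proof -
    have "bb * (n div bb) + n mod bb = n" by simp
    then have e: "real bb * real (n div bb) + real (n mod bb) = real n" by (metis of_nat_add of_nat_mult)
    have "n mod bb < bb" using bb by simp
    then show "real bb * real (n div bb) \<le> real n" "real n - real bb \<le> real bb * real (n div bb)" using e by linarith+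
  qed
  define LN LP where "LN n = real (n div bb) * ln (real nu)" and "LP n = real (n div bb) * ln (real pp)" for n
  have bds: "r * (real n - real bb) \<le> real (n div bb) * y \<and> real (n div bb) * y \<le> r' * real n"
    if "0 \<le> r" "0 \<le> r'" "r * real bb \<le> y" "y \<le> r' * real bb" for r r' y n
  proof
    have "r * (real n - real bb) \<le> r * (real bb * real (n div bb))" using dv(2) that(1) by (rule mult_left_mono)
    also have "\<dots> = real (n div bb) * (r * real bb)" by simp
    also have "\<dots> \<le> real (n div bb) * y" using that by (intro mult_left_mono) auto
    finally show "r * (real n - real bb) \<le> real (n div bb) * y" .
    have "real (n div bb) * y \<le> real (n div bb) * (r' * real bb)" using that by (intro mult_left_mono) auto
    also have "\<dots> = r' * (real bb * real (n div bb))" by simp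
    also have "\<dots> \<le> r' * real n" using dv(1) that(2) by (rule mult_left_mono)
    finally show "real (n div bb) * y \<le> r' * real n" .
  qed
  have LN: "a * (real n - real bb) \<le> LN n" "LN n \<le> (A - \<epsilon>) * real n" for n
    using bds[of a "A - \<epsilon>" "ln (real nu)" n] ab nu by (auto simp: LN_def)
  have LP: "b * (real n - real bb) \<le> LP n" "LP n \<le> Bt * real n" for n
    using bds[of b Bt "ln (real pp)" n] ab pp B0 by (auto simp: LP_def)
  have lnN: "ln (real nu ^ (n div bb)) = LN n" and lnP: "ln (real pp ^ (n div bb)) = LP n" for n
    using nu(1) pp(1) by (simp_all add: LN_def LP_def ln_realpow)
  obtain n1 where n1: "\<And>n. n1 \<le> n \<Longrightarrow> G * real n + (ln q + 2 * a * real bb) \<le> 2 * a * real n"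
    using linear_dominates[OF ab(5)] by blast
  obtain n2 where n2: "\<And>n. n2 \<le> n \<Longrightarrow> R * real n + (ln 200 + R + (a + b) * real bb) \<le> (a + b) * real n"
    using linear_dominates[OF ab(6)] by blast
  \<comment> \<open>Besides \<open>N\<close>, the time is governed by the full trees, whose size
    grows like \<open>(2 * d - 2) ^ (n / 2)\<close>; this too is below
    \<open>card C ^ (n / 2)\<close>.\<close>
  define \<gamma> where "\<gamma> = max (A - \<epsilon>) (ln (2 * D - 2) / 2)"
  have "A - \<epsilon> < A" "ln (2 * D - 2) / 2 < A" using eps(1) D by (simp_all add: A_def)
  then have gA: "\<gamma> < A" by (simp add: \<gamma>_def)
  have gN: "real (nu ^ (n div bb)) \<le> exp (\<gamma> * real n)" for n
  proof -
    have "LN n \<le> \<gamma> * real n" by (rule order_trans[OF LN(2)]) (auto simp: \<gamma>_def intro!: mult_right_mono)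
    then have "ln (real nu ^ (n div bb)) \<le> ln (exp (\<gamma> * real n))" by (simp only: lnN ln_exp)
    moreover have "0 < real nu ^ (n div bb)" using nu(1) by simp
    ultimately have "real nu ^ (n div bb) \<le> exp (\<gamma> * real n)" by - (rule le_via_ln[OF _ exp_gt_zero])
    then show ?thesis by (simp only: of_nat_power)
  qed
  have main: "totQ d ss ^ Suc n \<le> (int (nu ^ (n div bb)))\<^sup>2 * ((int ss + 1) ^ \<kappa> * int ss ^ \<mu>) \<or>
       (pp ^ (n div bb)) ^ 3 \<le> (2 ^ \<mu>)\<^sup>2 \<and>
       200 * (2 * nat (2 * d - 2)) ^ (n - n div 2) \<le> nu ^ (n div bb) * pp ^ (n div bb)"
    if n: "max n1 n2 \<le> n" and km: "\<kappa> + \<mu> = n" for n \<kappa> \<mu>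
  proof (cases "\<theta> * real n \<le> real \<kappa>")
    case True
    have rn: "real n = real \<kappa> + real \<mu>" using km by simp
    have "ln (q ^ Suc n) = real n * ln q + ln q" using q(2) by (simp only: ln_realpow) (simp add: algebra_simps)
    also have "\<dots> \<le> 2 * (a * (real n - real bb)) + real n * ln (real ss) + \<theta> * real n * l"
    proof -
      have "real n * G = real n * ln q - real n * ln (real ss) - \<theta> * real n * l" by (simp add: G_def algebra_simps)
      then show ?thesis using n1[of n] n by (simp add: algebra_simps)
    qed
    also have "\<dots> \<le> 2 * LN n + real n * ln (real ss) + real \<kappa> * l"
      using LN(1)[of n] True l0 by (intro add_mono mult_left_mono mult_right_mono) auto
    also have "\<dots> = ln ((real nu ^ (n div bb))\<^sup>2 * ((real ss + 1) ^ \<kappa> * real ss ^ \<mu>))"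
    proof -
      have "ln ((real nu ^ (n div bb))\<^sup>2 * ((real ss + 1) ^ \<kappa> * real ss ^ \<mu>)) =
        ln ((real nu ^ (n div bb))\<^sup>2) + (ln ((real ss + 1) ^ \<kappa>) + ln (real ss ^ \<mu>))"
        using nu(1) ss(1) by (simp add: ln_mult)
      also have "\<dots> = 2 * LN n + (real \<kappa> * ln (real ss + 1) + real \<mu> * ln (real ss))"
        using nu(1) ss(1) lnN[of n] by (simp add: ln_realpow)
      finally show ?thesis by (simp add: rn l_def algebra_simps)
    qed
    finally have "q ^ Suc n \<le> (real nu ^ (n div bb))\<^sup>2 * ((real ss + 1) ^ \<kappa> * real ss ^ \<mu>)"
      using q(2) nu(1) ss(1) by - (rule le_via_ln; (assumption | simp (no_asm_simp)))
    then have "real_of_int (totQ d ss ^ Suc n) \<le> real_of_int ((int (nu ^ (n div bb)))\<^sup>2 * ((int ss + 1) ^ \<kappa> * int ss ^ \<mu>))"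
      by (simp add: q(1))
    then have "totQ d ss ^ Suc n \<le> (int (nu ^ (n div bb)))\<^sup>2 * ((int ss + 1) ^ \<kappa> * int ss ^ \<mu>)" by (simp only: of_int_le_iff)
    then show ?thesis by (rule disjI1)
  next
    case False
    have "(pp ^ (n div bb)) ^ 3 \<le> (2 ^ \<mu>)\<^sup>2"
    proof -
      have "real \<kappa> + real \<mu> = real n" using km by simp
      then have "(1 - \<theta>) * real n \<le> real \<mu>" using False by (simp add: algebra_simps)
      then have "2 * ln 2 * ((1 - \<theta>) * real n) \<le> 2 * ln 2 * real \<mu>" by (intro mult_left_mono) auto
      then have "3 * LP n \<le> 2 * ln 2 * real \<mu>" using LP(2)[of n] by (simp add: Bt_def algebra_simps)
      moreover have "ln ((real pp ^ (n div bb)) ^ 3) = 3 * LP n"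
        using pp(1) lnP[of n] ln_realpow[of "real pp ^ (n div bb)" 3] by simp
      moreover have "ln (((2::real) ^ \<mu>)\<^sup>2) = 2 * ln 2 * real \<mu>"
        using ln_realpow[of "(2::real) ^ \<mu>" 2] ln_realpow[of "2::real" \<mu>] by simp
      ultimately have "(real pp ^ (n div bb)) ^ 3 \<le> (2 ^ \<mu>)\<^sup>2" using pp(1) by - (rule le_via_ln; (assumption | simp (no_asm_simp)))
      then have "real ((pp ^ (n div bb)) ^ 3) \<le> real ((2 ^ \<mu>)\<^sup>2)" by simp
      then show ?thesis by (simp only: of_nat_le_iff)
    qed
    moreover have "200 * (2 * nat (2 * d - 2)) ^ (n - n div 2) \<le> nu ^ (n div bb) * pp ^ (n div bb)"
    proof -
      define Y where "Y = 4 * (D - 1)"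
      have Y: "real (2 * nat (2 * d - 2)) = Y" "1 < Y" using d by (auto simp: Y_def D_def)
      have "2 * (n - n div 2) \<le> n + 1" by presburger
      then have "real (2 * (n - n div 2)) \<le> real (n + 1)" by (simp only: of_nat_le_iff)
      then have "2 * real (n - n div 2) \<le> real n + 1" by (simp only: of_nat_mult of_nat_add of_nat_numeral of_nat_1)
      then have "real (n - n div 2) * ln Y \<le> (real n + 1) / 2 * ln Y" using Y by (intro mult_right_mono) auto
      also have "\<dots> = R * real n + R" by (simp add: R_def Y_def algebra_simps)
      finally have "ln 200 + real (n - n div 2) * ln Y \<le> a * (real n - real bb) + b * (real n - real bb)"
        using n2[of n] n by (simp add: algebra_simps)
      also have "\<dots> \<le> LN n + LP n" by (intro add_mono LN LP)
      finally have "ln (200 * Y ^ (n - n div 2)) \<le> ln (real nu ^ (n div bb) * real pp ^ (n div bb))"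
        using Y nu(1) pp(1) lnN[of n] lnP[of n] by (simp add: ln_mult ln_realpow)
      then have "200 * Y ^ (n - n div 2) \<le> real nu ^ (n div bb) * real pp ^ (n div bb)"
        using Y nu(1) pp(1) by - (rule le_via_ln; (assumption | simp (no_asm_simp)))
      then have "real (200 * (2 * nat (2 * d - 2)) ^ (n - n div 2)) \<le> real (nu ^ (n div bb) * pp ^ (n div bb))"
        using Y(1) by (simp only: of_nat_mult of_nat_power of_nat_numeral)
      then show ?thesis by (simp only: of_nat_le_iff)
    qed
    ultimately show ?thesis by blast
  qed
  have "\<gamma> < ln (2 * real_of_int d) / 2" "ln (2 * real_of_int d - 2) / 2 \<le> \<gamma>" using gA by (auto simp: A_def D_def \<gamma>_def)
  with pp(1) nu(1) ss(1) gN main show ?thesis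
    by - (rule exI[of _ bb], rule exI[of _ pp], rule exI[of _ nu], rule exI[of _ ss], rule exI[of _ "max n1 n2"], rule exI[of _ \<gamma>], blast)
qed

section \<open>Word length and running time\<close>

lemma mult_le_two_power:
  fixes a b :: int
  assumes "a \<le> 2 ^ i" "b \<le> 2 ^ j" "0 \<le> b"
  shows "a * b \<le> 2 ^ (i + j)"
  unfolding power_add using assms by (intro mult_mono) auto

lemma power_le_two_power:
  fixes a :: int
  assumes "a \<le> 2 ^ i" "0 \<le> a"
  shows "a ^ m \<le> 2 ^ (i * m)"
  unfolding power_mult using assms by (rule power_mono)

lemma add_le_two_power:
  fixes a b :: int
  assumes "a \<le> 2 ^ i" "b \<le> 2 ^ j"
  shows "a + b \<le> 2 ^ (i + j + 1)"
proof -
  have "(2::int) ^ i \<le> 2 ^ (i + j)" "(2::int) ^ j \<le> 2 ^ (i + j)" by (intro power_increasing; simp)+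
  then have "a + b \<le> 2 * 2 ^ (i + j)" using assms by linarith
  then show ?thesis by simp
qed

lemma Suc_le_two_power: "int n + 1 \<le> 2 ^ n"
proof -
  have "Suc n \<le> 2 ^ n" by (simp add: Suc_le_eq less_exp)
  then have "int (Suc n) \<le> int (2 ^ n)" by (simp only: of_nat_le_iff)
  then show ?thesis by simp
qed

text \<open>The inner bracket after \<open>4 *\<close> bounds the length of \<open>M\<close>, so
  \<open>fm\<close> has at most one bit more than four times that, and \<open>fm ^ n\<close> about
  \<open>n\<close> times as many. The parameter \<open>l\<close> bounds the constants of the
  program.\<close>

definition word_bits :: "nat \<Rightarrow> nat \<Rightarrow> nat \<Rightarrow> nat" where
  "word_bits l k n = (n + 1) * (4 * (l * n + (n + l + 2 * n ^ k + l * n + 1)) + 4 * l + 4)"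

lemma bigW_le_two_power:
  assumes d: "1 \<le> d" and x: "bounded_input k x" and l: "4 * d \<le> 2 ^ l"
  shows "bigW d x \<le> 2 ^ (length x + l + 2 * length x ^ k + l * length x + 1)"
proof -
  let ?n = "length x" and ?t = "l + (2 * length x ^ k + l * length x + 1)"
  have "4 * d * (x ! i * x ! i + (2 * d + 1) ^ i) \<le> 2 ^ ?t" if i: "i < ?n" for i
  proof (rule mult_le_two_power[OF l])
    have "\<bar>x ! i\<bar> \<le> 2 ^ (?n ^ k)" using x i by (simp add: bounded_input_def)
    then have "\<bar>x ! i\<bar> * \<bar>x ! i\<bar> \<le> 2 ^ (?n ^ k + ?n ^ k)" by (intro mult_le_two_power) auto
    then have a: "x ! i * x ! i \<le> 2 ^ (2 * ?n ^ k)" by (simp add: mult_2)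
    have "(2 * d + 1) ^ i \<le> 2 ^ (l * i)" using l d by (intro power_le_two_power) auto
    also have "\<dots> \<le> 2 ^ (l * ?n)" using i by (intro power_increasing) auto
    finally show "x ! i * x ! i + (2 * d + 1) ^ i \<le> 2 ^ (2 * ?n ^ k + l * ?n + 1)" using a by (intro add_le_two_power)
    show "0 \<le> x ! i * x ! i + (2 * d + 1) ^ i" using d by simp
  qed
  then have "(\<Sum>i<?n. 4 * d * (x ! i * x ! i + (2 * d + 1) ^ i)) \<le> (\<Sum>i<?n. 2 ^ ?t)" by (intro sum_mono) simp
  also have "\<dots> = int ?n * 2 ^ ?t" by simp
  finally have "bigW d x \<le> 1 + int ?n * 2 ^ ?t" by (simp add: bigW_def)
  also have "\<dots> \<le> (int ?n + 1) * 2 ^ ?t" using one_le_power[of "2::int" ?t] unfolding distrib_right by linarith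
  also have "\<dots> \<le> 2 ^ (?n + ?t)" by (rule mult_le_two_power[OF Suc_le_two_power]) auto
  finally show ?thesis by (simp add: add_ac)
qed

text \<open>Each magnitude is estimated by a power of two whose exponent is at most
  \<open>word_bits\<close>. The factor 12 in the word length is that of \<open>eok\<close>.\<close>

lemma ctx_word_bits:
  assumes d: "3 \<le> d" and p: "1 \<le> pp" "1 \<le> nu" "1 \<le> ss" and x: "bounded_input k x"
    and l: "4 * d \<le> 2 ^ l" "int pp \<le> 2 ^ l" "int nu \<le> 2 ^ l" "int bb \<le> 2 ^ l" "totQ d ss \<le> 2 ^ l" "int ss + 1 \<le> 2 ^ l"
  shows "ctx (2 ^ word_bits l k (length x)) (12 * word_bits l k (length x)) d bb pp nu ss x"
proof -
  let ?n = "length x"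
  define V where "V = ?n + l + 2 * ?n ^ k + l * ?n + 1"
  define r where "r = l * ?n + V"
  define b where "b = word_bits l k ?n"
  have b: "b = (?n + 1) * (4 * r + 4 * l + 4)" by (simp add: b_def word_bits_def r_def V_def)
  have b1: "4 * r + 4 * l + 4 \<le> b" and b2: "(1 + 4 * r) * ?n \<le> b" unfolding b by (simp_all add: algebra_simps)
  have up: "a \<le> 2 ^ b" if "a \<le> 2 ^ j" "j \<le> b" for a :: int and j
    by (rule order_trans[OF that(1)]) (use that(2) in \<open>intro power_increasing; simp\<close>)
  have KB: "l \<le> b" using b1 by simp
  have W: "bigW d x \<le> 2 ^ V" "0 \<le> bigW d x" using bigW_le_two_power[OF _ x l(1)] d bigW_bounds(1)[of d x] by (auto simp: V_def)
  have dv: "l * (?n div bb) \<le> l * ?n" by (intro mult_le_mono2 div_le_dividend)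
  have P: "int (pp ^ (?n div bb)) \<le> 2 ^ (l * ?n)"
  proof -
    have "int pp ^ (?n div bb) \<le> 2 ^ (l * (?n div bb))" using l(2) by (intro power_le_two_power) auto
    also have "\<dots> \<le> 2 ^ (l * ?n)" using dv by (intro power_increasing) auto
    finally show ?thesis by simp
  qed
  have N: "int (nu ^ (?n div bb)) \<le> 2 ^ (l * ?n)"
  proof -
    have "int nu ^ (?n div bb) \<le> 2 ^ (l * (?n div bb))" using l(3) by (intro power_le_two_power) auto
    also have "\<dots> \<le> 2 ^ (l * ?n)" using dv by (intro power_increasing) auto
    finally show ?thesis by simp
  qed
  have q: "int (nat (2 * d - 2)) \<le> 2 ^ l" using l(1) d by simp
  have qH: "int (nat (2 * d - 2) ^ (?n - ?n div 2)) \<le> 2 ^ (l * ?n)"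
  proof -
    have "int (nat (2 * d - 2)) ^ (?n - ?n div 2) \<le> 2 ^ (l * (?n - ?n div 2))" using q by (intro power_le_two_power) auto
    also have "\<dots> \<le> 2 ^ (l * ?n)" by (intro power_increasing) auto
    finally show ?thesis by simp
  qed
  have S: "int (Suc ?n) \<le> 2 ^ ?n" using Suc_le_two_power[of ?n] by simp
  have M: "int (pp ^ (?n div bb)) * bigW d x \<le> 2 ^ r" "0 \<le> int (pp ^ (?n div bb)) * bigW d x"
    unfolding r_def using P W by (auto intro!: mult_le_two_power mult_nonneg_nonneg)
  let ?M = "int (pp ^ (?n div bb)) * bigW d x"
  have fm: "2 * (?M * ?M * (?M * ?M)) \<le> 2 ^ (1 + 4 * r)" "0 \<le> 2 * (?M * ?M * (?M * ?M))"
  proof -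
    have "?M * ?M \<le> 2 ^ (r + r)" by (rule mult_le_two_power[OF M(1) M])
    then have "?M * ?M * (?M * ?M) \<le> 2 ^ (r + r + (r + r))" by (rule mult_le_two_power) (use \<open>?M * ?M \<le> 2 ^ (r + r)\<close> M(2) in \<open>simp_all only: mult_nonneg_nonneg\<close>)
    moreover have "r + r + (r + r) = 4 * r" by simp
    ultimately show "2 * (?M * ?M * (?M * ?M)) \<le> 2 ^ (1 + 4 * r)" by (simp only: power_add power_one_right mult_left_mono)
    show "0 \<le> 2 * (?M * ?M * (?M * ?M))" by simp
  qed
  have m4: "4 * (a * c) \<le> 2 ^ (2 + (i + j))" if "a \<le> 2 ^ i" "c \<le> 2 ^ j" "0 \<le> c" for a c :: int and i j
    using mult_le_two_power[OF that] by (simp add: power_add)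
  have rn: "l * ?n \<le> r" "?n \<le> r" "V \<le> r" "l * ?n + ?n \<le> r" "?n + V \<le> 2 * r" by (simp_all add: r_def V_def)
  show ?thesis
    unfolding b_def[symmetric]
  proof (unfold_locales)
    show "2 \<le> (2::int) ^ b" using power_increasing[of 1 b "2::int"] b1 by simp
    show "((2::int) ^ b) ^ 12 \<le> 2 ^ (12 * b)" by (simp add: power_mult[symmetric] mult.commute)
    show "3 \<le> d" "1 \<le> pp" "1 \<le> nu" "1 \<le> ss" by fact+
    show "2 * (?M * ?M * (?M * ?M)) \<le> 2 ^ b" by (rule up[OF fm(1)]) (use b1 in linarith)
    show "(2 * (?M * ?M * (?M * ?M))) ^ ?n \<le> 2 ^ b" by (rule up[OF power_le_two_power[OF fm]]) (rule b2)
    have "int ?n + 2 \<le> 2 ^ (?n + 1)" using Suc_le_two_power[of ?n] by simp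
    then have "(int ?n + 2) * bigW d x \<le> 2 ^ (?n + 1 + V)" using W by (intro mult_le_two_power)
    then show "(int ?n + 2) * bigW d x \<le> 2 ^ b" by (rule up) (use b1 rn in linarith)
    show "4 * d \<le> 2 ^ b" "int pp \<le> 2 ^ b" "int nu \<le> 2 ^ b" "int bb \<le> 2 ^ b" "totQ d ss \<le> 2 ^ b" "int ss + 1 \<le> 2 ^ b"
      by (rule up[OF l(1) KB] up[OF l(2) KB] up[OF l(3) KB] up[OF l(4) KB] up[OF l(5) KB] up[OF l(6) KB])+
    have "(int ?n + 1) * int (pp ^ (?n div bb)) \<le> 2 ^ (?n + l * ?n)" using P Suc_le_two_power by (intro mult_le_two_power) auto
    then show "(int ?n + 1) * int (pp ^ (?n div bb)) \<le> 2 ^ b" by (rule up) (use b1 rn in linarith)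
    have "(int ss + 1) ^ Suc ?n \<le> 2 ^ (l * Suc ?n)" using l(6) by (intro power_le_two_power) auto
    with N have "int (nu ^ (?n div bb)) * (int ss + 1) ^ Suc ?n \<le> 2 ^ (l * ?n + l * Suc ?n)" by (intro mult_le_two_power) auto
    then show "int (nu ^ (?n div bb)) * (int ss + 1) ^ Suc ?n \<le> 2 ^ b"
      by (rule up) (use b1 rn in \<open>unfold mult_Suc_right, linarith\<close>)
    have "totQ d ss ^ Suc ?n \<le> 2 ^ (l * Suc ?n)" using l(5) d by (intro power_le_two_power) (auto simp: totQ_def)
    then show "totQ d ss ^ Suc ?n \<le> 2 ^ b"
      by (rule up) (use b1 rn in \<open>unfold mult_Suc_right, linarith\<close>)
    have "int (Suc ?n * nat (2 * d - 2) ^ (?n - ?n div 2)) \<le> 2 ^ (?n + l * ?n)"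
      unfolding of_nat_mult[of "Suc ?n"] using qH S by (intro mult_le_two_power) auto
    from m4[OF this q] have "4 * (int (Suc ?n * nat (2 * d - 2) ^ (?n - ?n div 2)) * int (nat (2 * d - 2))) \<le> 2 ^ (2 + (?n + l * ?n + l))" by simp
    then show "4 * (int (Suc ?n * nat (2 * d - 2) ^ (?n - ?n div 2)) * int (nat (2 * d - 2))) \<le> 2 ^ b"
      by (rule up) (use b1 rn in linarith)
    have "int (Suc ?n * nu ^ (?n div bb)) \<le> 2 ^ (?n + l * ?n)"
      unfolding of_nat_mult[of "Suc ?n"] using N S by (intro mult_le_two_power) auto
    moreover have "d \<le> 2 ^ l" using l(1) d by simp
    ultimately have "4 * (int (Suc ?n * nu ^ (?n div bb)) * d) \<le> 2 ^ (2 + (?n + l * ?n + l))" using m4 d by simp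
    then show "4 * (int (Suc ?n * nu ^ (?n div bb)) * d) \<le> 2 ^ b"
      by (rule up) (use b1 rn in linarith)
  qed
qed

lemma word_bits_bigo: "(\<lambda>n. real (12 * word_bits l k n)) \<in> bigo_star (\<lambda>_. 1)"
proof -
  have "\<forall>\<^sub>F n in sequentially. norm (real (12 * word_bits l k n)) \<le> real (24 * (16 * l + 20)) * norm (real n ^ (k + 2) * 1)"
    using eventually_ge_at_top[of 1]
  proof eventually_elim
    fix n :: nat assume n: "1 \<le> n"
    define q where "q = n ^ (k + 1)"
    have q: "n ^ k \<le> q" "n \<le> q" "1 \<le> q" using n by (auto simp: q_def)
    have ln: "l * n \<le> l * q" "l \<le> l * q" using q by auto
    have "4 * (l * n + (n + l + 2 * n ^ k + l * n + 1)) + 4 * l + 4 \<le> 16 * (l * q) + 20 * q"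
    proof -
      have "4 * (u + (n + l + 2 * v + u + 1)) + 4 * l + 4 \<le> 16 * z + 20 * q"
        if "u \<le> z" "l \<le> z" "v \<le> q" for u v z :: nat
      proof -
        have "4 * (u + (n + l + 2 * v + u + 1)) + 4 * l + 4 = 8 * u + 8 * l + 4 * n + 8 * v + 8 * 1" by simp
        also have "\<dots> \<le> 8 * z + 8 * z + 4 * q + 8 * q + 8 * q"
          using that q(2,3) by (intro add_mono mult_le_mono2)
        finally show ?thesis by simp
      qed
      then show ?thesis using ln q(1) by blast
    qed
    then have "word_bits l k n \<le> (2 * n) * (16 * (l * q) + 20 * q)" unfolding word_bits_def using n by (intro mult_le_mono) auto
    then have "12 * word_bits l k n \<le> (24 * (16 * l + 20)) * (n * q)" by (simp add: algebra_simps)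
    then have "real (12 * word_bits l k n) \<le> real ((24 * (16 * l + 20)) * (n * q))" by (simp only: of_nat_le_iff)
    moreover have "n * q = n ^ (k + 2)" by (simp add: q_def)
    ultimately have "real (12 * word_bits l k n) \<le> real (24 * (16 * l + 20)) * real n ^ (k + 2)"
      by (simp only: of_nat_mult of_nat_power)
    then show "norm (real (12 * word_bits l k n)) \<le> real (24 * (16 * l + 20)) * norm (real n ^ (k + 2) * 1)" by simp
  qed
  then have "(\<lambda>n. real (12 * word_bits l k n)) \<in> O(\<lambda>n. real n ^ (k + 2) * 1)" by (rule bigoI)
  then show ?thesis unfolding bigo_star_def by blast
qed

text \<open>Rounding \<open>n / 2\<close> up costs at most a factor \<open>exp \<gamma>\<close>,
  which joins the constant; the remaining factors are at most quadratic in \<open>n\<close>.\<close>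

lemma time_bigo:
  fixes \<gamma> :: real and N :: "nat \<Rightarrow> nat" and qa :: nat
  assumes N: "\<And>n. real (N n) \<le> exp (\<gamma> * real n)" and qa: "1 \<le> qa" "ln (real qa) / 2 \<le> \<gamma>"
  shows "(\<lambda>n. real (Suc n * qa ^ (n - n div 2) * qa * 216 + Suc n * N n * nd * 256 +
     n * (Suc n * qa ^ (n - n div 2) * 200 + N n * 80 + 200) + 1000)) \<in> bigo_star (\<lambda>n. exp (\<gamma> * real n))"
    (is "(\<lambda>n. real (?T n)) \<in> _")
proof -
  have g0: "0 \<le> \<gamma>" by (rule order_trans[OF _ qa(2)]) (use qa(1) in simp)
  define c where "c = (432 * real qa + 512 * real nd + 1680) * exp \<gamma>"
  have "\<forall>\<^sub>F n in sequentially. norm (real (?T n)) \<le> c * norm (real n ^ 2 * exp (\<gamma> * real n))"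
    using eventually_ge_at_top[of 1]
  proof eventually_elim
    fix n :: nat assume n: "1 \<le> n"
    define a where "a = real (qa ^ (n - n div 2))"
    define b where "b = real (N n)"
    define Z where "Z = exp \<gamma> * exp (\<gamma> * real n)"
    define U where "U = real n ^ 2 * Z"
    have Z1: "1 \<le> Z" using g0 by (simp add: Z_def exp_add[symmetric])
    have bZ: "b \<le> Z"
    proof -
      have "1 * exp (\<gamma> * real n) \<le> Z" unfolding Z_def using g0 by (intro mult_right_mono) auto
      then show ?thesis using N[of n] by (simp add: b_def)
    qed
    have aZ: "a \<le> Z"
    proof -
      have "2 * (n - n div 2) \<le> n + 1" by presburger
      then have "real (2 * (n - n div 2)) \<le> real (n + 1)" by (simp only: of_nat_le_iff)
      then have "2 * real (n - n div 2) \<le> real n + 1" by (simp only: of_nat_mult of_nat_add of_nat_numeral of_nat_1)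
      then have "real (n - n div 2) * ln (real qa) \<le> (real n + 1) / 2 * ln (real qa)" using qa by (intro mult_right_mono) auto
      also have "\<dots> = (real n + 1) * (ln (real qa) / 2)" by simp
      also have "\<dots> \<le> (real n + 1) * \<gamma>" using qa by (intro mult_left_mono) auto
      also have "\<dots> = ln Z" by (simp add: Z_def exp_add[symmetric] algebra_simps)
      finally have "ln a \<le> ln Z" using qa by (simp add: a_def ln_realpow)
      then show ?thesis using qa Z1 by - (rule le_via_ln, simp_all add: a_def)
    qed
    have n1: "1 \<le> real n" using n by simp
    have nn: "real n \<le> real n ^ 2" using n1 by (intro self_le_power) auto
    have UZ: "r * y \<le> s * U" if "0 \<le> r" "r \<le> s * real n ^ 2" "y \<le> Z" for r s y
    proof -
      have "r * y \<le> r * Z" using that by (intro mult_left_mono)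
      also have "\<dots> \<le> s * real n ^ 2 * Z" using that Z1 by (intro mult_right_mono) auto
      finally show ?thesis by (simp add: U_def mult.assoc)
    qed
    have "real n * (real n + 1) = real n ^ 2 + real n" by (simp add: power2_eq_square distrib_left)
    then have n2: "real n * (real n + 1) \<le> 2 * real n ^ 2" using nn by linarith
    have n3: "real n + 1 \<le> 2 * real n ^ 2" "real n \<le> 1 * real n ^ 2" "1 \<le> 1 * real n ^ 2" using nn n1 by linarith+
    have u: "(real n + 1) * a \<le> 2 * U" "(real n + 1) * b \<le> 2 * U" "(real n * (real n + 1)) * a \<le> 2 * U"
       "real n * b \<le> 1 * U" "real n * 1 \<le> 1 * U" "1 * 1 \<le> 1 * U"
      by (rule UZ[OF _ n3(1) aZ] UZ[OF _ n3(1) bZ] UZ[OF _ n2 aZ] UZ[OF _ n3(2) bZ] UZ[OF _ n3(2) Z1] UZ[OF _ n3(3) Z1]; simp)+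
    have u1: "(real n + 1) * a * real qa \<le> 2 * U * real qa" "(real n + 1) * b * real nd \<le> 2 * U * real nd"
      using u by (intro mult_right_mono; simp)+
    have "real (?T n) = (real n + 1) * a * real qa * 216 + (real n + 1) * b * real nd * 256 +
       ((real n * (real n + 1)) * a * 200 + real n * b * 80 + real n * 1 * 200) + 1 * 1 * 1000"
      by (simp add: a_def b_def algebra_simps)
    also have "\<dots> \<le> 2 * U * real qa * 216 + 2 * U * real nd * 256 + (2 * U * 200 + 1 * U * 80 + 1 * U * 200) + 1 * U * 1000"
      using u u1 by linarith
    also have "\<dots> = c * (real n ^ 2 * exp (\<gamma> * real n))" by (simp add: c_def U_def Z_def algebra_simps)
    finally show "norm (real (?T n)) \<le> c * norm (real n ^ 2 * exp (\<gamma> * real n))" by simp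
  qed
  then have "(\<lambda>n. real (?T n)) \<in> O(\<lambda>n. real n ^ 2 * exp (\<gamma> * real n))" by (rule bigoI)
  then show ?thesis unfolding bigo_star_def by blast
qed

lemma prod_wt:
  "(\<Prod>i<n. wt d ss (c ! i)) =
     (int ss + 1) ^ card {i\<in>{..<n}. extreme d (c ! i)} * int ss ^ card {i\<in>{..<n}. \<not> extreme d (c ! i)}"
proof -
  have "{..<n} \<inter> {i. extreme d (c ! i)} = {i\<in>{..<n}. extreme d (c ! i)}"
    "{..<n} \<inter> - {i. extreme d (c ! i)} = {i\<in>{..<n}. \<not> extreme d (c ! i)}" by auto
  then show ?thesis unfolding wt_def by (subst prod.If_cases) simp_all
qed

lemma card_extreme: "card {i\<in>{..<n}. extreme d (c ! i)} + card {i\<in>{..<n}. \<not> extreme d (c ! i)} = n"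
proof -
  have "{i\<in>{..<n}. extreme d (c ! i)} \<union> {i\<in>{..<n}. \<not> extreme d (c ! i)} = {..<n}" by auto
  then have "card ({i\<in>{..<n}. extreme d (c ! i)} \<union> {i\<in>{..<n}. \<not> extreme d (c ! i)}) = n" by simp
  then show ?thesis by (subst (asm) card_Un_disjoint) auto
qed

lemma two_powr_minus_log: "2 powr (- (real n * log 2 (100 / 99))) = (99 / 100) ^ n"
proof -
  have "2 powr (- (real n * log 2 (100 / 99))) = (2 powr log 2 (100 / 99)) powr (- real n)"
    unfolding powr_powr by (simp add: mult.commute)
  also have "\<dots> = (100 / 99) powr (- real n)" by simp
  also have "\<dots> = (99 / 100) ^ n" by (simp add: powr_minus powr_realpow power_divide)
  finally show ?thesis .
qed

theorem theorem6p7: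
  fixes d :: int and C :: "int set"
  assumes "d > 2"
    and "C = {-d..-1} \<union> {1..d}"
  shows "\<exists>\<delta>::real. \<delta> > 0 \<and>
           (\<exists>P. solves_balancing_whp C P (\<lambda>n. real (card C) powr ((1 / 2 - \<delta>) * real n)))"
proof -
  have d: "3 \<le> d" using assms(1) by simp
  have C: "C = setC d" using assms(2) by (simp add: setC_def)
  have "card C = card {-d..-1} + card {1..d}" unfolding assms(2) by (rule card_Un_disjoint) auto
  then have cC: "real (card C) = 2 * real_of_int d" using d by simp
  from parameters_exist[OF d] obtain bb pp nu ss n0 and \<gamma> :: real where
    split: "\<forall>n\<ge>n0. \<forall>\<kappa> \<mu>. \<kappa> + \<mu> = n \<longrightarrow>
       totQ d ss ^ Suc n \<le> (int (nu ^ (n div bb)))\<^sup>2 * ((int ss + 1) ^ \<kappa> * int ss ^ \<mu>) \<or>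
       (pp ^ (n div bb)) ^ 3 \<le> (2 ^ \<mu>)\<^sup>2 \<and>
       200 * (2 * nat (2 * d - 2)) ^ (n - n div 2) \<le> nu ^ (n div bb) * pp ^ (n div bb)"
    and N: "\<forall>n. real (nu ^ (n div bb)) \<le> exp (\<gamma> * real n)"
    and pos: "1 \<le> pp" "1 \<le> nu" "1 \<le> ss" and g: "\<gamma> < ln (2 * real_of_int d) / 2" "ln (2 * real_of_int d - 2) / 2 \<le> \<gamma>"
    by (elim exE conjE) (rule that, assumption+)
  \<comment> \<open>Chosen such that \<open>card C\<close> to the power
    \<open>(1 / 2 - \<delta>) * n\<close> equals \<open>exp (\<gamma> * n)\<close>.\<close>
  define \<delta> where "\<delta> = 1 / 2 - \<gamma> / ln (2 * real_of_int d)"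
  have l: "0 < ln (2 * real_of_int d)" using d by simp
  have "0 < \<delta>" using g(1) l by (simp add: \<delta>_def field_simps)
  have f: "real (card C) powr ((1 / 2 - \<delta>) * real n) = exp (\<gamma> * real n)" for n
    using l d by (simp add: cC powr_def \<delta>_def)
  define T where "T n = Suc n * nat (2 * d - 2) ^ (n - n div 2) * nat (2 * d - 2) * 216 + Suc n * nu ^ (n div bb) * nat d * 256 +
     n * (Suc n * nat (2 * d - 2) ^ (n - n div 2) * 200 + nu ^ (n div bb) * 80 + 200) + 1000" for n
  have T: "(\<lambda>n. real (T n)) \<in> bigo_star (\<lambda>n. exp (\<gamma> * real n))"
    unfolding T_def by (rule time_bigo[OF N[rule_format]]) (use d g in auto)
  \<comment> \<open>Any number up to the sum of all program constants plus 1 is at most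
    \<open>l + 1\<close>, hence at most \<open>2 ^ l\<close>.\<close>
  define l where "l = nat (4 * d + int pp + int nu + int bb + totQ d ss + int ss + 1)"
  have l: "v \<le> 2 ^ l" if "v \<le> 4 * d + int pp + int nu + int bb + totQ d ss + int ss + 1" for v
  proof -
    have "v \<le> int l + 1" using that by (simp add: l_def)
    then show ?thesis using Suc_le_two_power[of l] by linarith
  qed
  have q0: "0 \<le> totQ d ss" using d by (simp add: totQ_def)
  have lb: "4 * d \<le> 2 ^ l" "int pp \<le> 2 ^ l" "int nu \<le> 2 ^ l" "int bb \<le> 2 ^ l" "totQ d ss \<le> 2 ^ l" "int ss + 1 \<le> 2 ^ l"
    by (rule l; use q0 d in simp)+
  define r where "r = log 2 (100 / 99 :: real)"
  have r: "0 < r" by (simp add: r_def)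
  \<comment> \<open>For \<open>n\<close> below \<open>n0\<close> the required probability is
    \<open>1 - 2 powr 0\<close>, which is 0. Beyond it, the failure probability
    \<open>(99 / 100) ^ n\<close> is the stated power of two.\<close>
  define g where "g n = (if n < n0 then 0 else real n * r)" for n
  have g\<Omega>: "g \<in> \<Omega>(\<lambda>n. real n)"
  proof (rule landau_omega.bigI[OF r])
    show "\<forall>\<^sub>F n in sequentially. norm (g n) \<ge> r * norm (real n)"
      using eventually_ge_at_top[of n0] by eventually_elim (use r in \<open>simp add: g_def mult.commute\<close>)
  qed
  have "solves_balancing_whp C (prog d bb pp nu ss) (\<lambda>n. real (card C) powr ((1 / 2 - \<delta>) * real n))"
    unfolding solves_balancing_whp_def f Let_def
  proof (intro allI, rule exI[of _ T], rule exI[of _ "\<lambda>n. 12 * word_bits l k n" for k], rule exI[of _ g], intro conjI allI impI)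
    fix k
    show "(\<lambda>n. real (T n)) \<in> bigo_star (\<lambda>n. exp (\<gamma> * real n))" by (rule T)
    show "(\<lambda>n. real (12 * word_bits l k n)) \<in> bigo_star (\<lambda>_. 1)" by (rule word_bits_bigo)
    show "g \<in> \<Omega>(\<lambda>n. real n)" by (rule g\<Omega>)
    show "\<forall>\<^sub>F n in sequentially. 0 \<le> g n" using r by (simp add: g_def)
    fix x assume "bounded_input k x"
    then have ctx: "ctx (2 ^ word_bits l k (length x)) (12 * word_bits l k (length x)) d bb pp nu ss x"
      using ctx_word_bits[OF d pos] lb by blast
    note pc = ctx.prog_correct[OF ctx, of "T (length x)", folded C]
    show "\<forall>(c, s)\<in>set_pmf (run (12 * word_bits l k (length x)) (T (length x)) (prog d bb pp nu ss, input_state x)).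
      c = Skip \<and> (\<forall>v. result (length x) s = Some v \<longrightarrow> balancing_solution C x v)"
      by (rule pc(1)) (simp only: T_def order_refl)
    assume "\<exists>v. balancing_solution C x v"
    then obtain c where c: "balancing_solution C x c" by blast
    let ?p = "measure_pmf.prob (run (12 * word_bits l k (length x)) (T (length x)) (prog d bb pp nu ss, input_state x))
        {(c, s). \<exists>v. result (length x) s = Some v \<and> balancing_solution C x v}"
    show "1 - 2 powr - g (length x) \<le> ?p"
    proof (cases "length x < n0")
      case True
      then show ?thesis by (simp add: g_def)
    next
      case False
      have "ctx.heavy d bb nu ss x c \<or> ctx.light d bb pp nu x c"
        unfolding ctx.heavy_def[OF ctx] ctx.light_def[OF ctx] prod_wt using False by (intro split[rule_format] card_extreme) simp
      then have "1 - (99 / 100) ^ length x \<le> ?p" by (intro pc(2)[OF _ c]) (simp only: T_def order_refl)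
      then show ?thesis using False two_powr_minus_log[of "length x"] by (simp add: g_def r_def)
    qed
  qed
  then show ?thesis using \<open>0 < \<delta>\<close> by blast
qed

end
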